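(* Let $G=(V,E)$ be a decomposable graph with cliques $C_1,\dots,C_k$ in a perfect order, and consider the multinomial model with $N\ge1$ trials and strictly positive cell-probability vector $p$, Markov with respect to $G$. Consider the reference prior for each of the following parameters (in each case the order of the groups does not matter): (a) $\theta^{cond}$, relative to the grouping with groups $\big(\theta^{C_1}(i_D):\emptyset\neq D\subseteq C_1,\ i_D\in\mathcal I_D^*\big)$ and $\big(\theta^{R_l|i_{S_l}}(i_D):\emptyset\ne D\subseteq R_l,\ i_D\in\mathcal I_D^*\big)$, one for each $l=2,\dots,k$ and $i_{S_l}\in\mathcal I_{S_l}$; (b) $\theta^{cliq}$, relative to the grouping with $k$ groups $\big(\theta^{C_1}(i_D):\emptyset\neq D\subseteq C_1,\ i_D\in\mathcal I_D^*\big)$ and, for $l=2,\dots,k$, $\big(\theta^{C_l}(i_F,i_D): F\subseteq S_l \text{ possibly empty},\ i_F\in\mathcal I_F^*,\ \emptyset\ne D\subseteq R_l,\ i_D\in\mathcal I_D^*\big)$; (c) $\theta^{mod}$, relative to the grouping with $k$ groups $\tilde\theta^{C_1}=\big(\theta(i_D):\emptyset\neq D\subseteq C_1,\ i_D\in\mathcal I_D^*\big)$ and $\tilde\theta^{C_l}=\big(\theta(i_D): D\subseteq C_l,\ D\cap R_l\neq\emptyset,\ i_D\in\mathcal I_D^*\big)$, $l=2,\dots,k$. In each case the reference prior density (with respect to Lebesgue measure on the parameter) is proportional to $$\Big(\prod_{i_{C_1}\in\mathcal I_{C_1}}p^{C_1}(i_{C_1})\Big)^{1/2}\ \prod_{l=2}^k\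 \prod_{i_{S_l}\in\mathcal I_{S_l}}\Big(\prod_{i_{R_l}\in\mathcal I_{R_l}}p^{R_l|i_{S_l}}(i_{R_l})\Big)^{1/2},$$ where the probabilities are expressed as functions of the respective parameter $\theta^{cond}$, $\theta^{cliq}$ or $\theta^{mod}$. More explicitly, up to proportionality: • the reference prior for $\theta^{cond}$ is $$\exp\Big\{\sum_{\emptyset\ne D\subseteq C_1}\sum_{i_D\in\mathcal I_D^*}\theta^{C_1}(i_D)\tfrac{|\mathcal I_{C_1\setminus D}|}{2}-\tfrac{|\mathcal I_{C_1}|}{2}k_1\Big\}\prod_{l=2}^k\prod_{i_{S_l}\in\mathcal I_{S_l}}\exp\Big\{\sum_{\emptyset\neq D\subseteq R_l}\sum_{i_D\in\mathcal I_D^*}\theta^{R_l|i_{S_l}}(i_D)\tfrac{|\mathcal I_{R_l\setminus D}|}{2}-\tfrac{|\mathcal I_{R_l}|}{2}k(i_{S_l})\Big\},$$ with $k_1=\log\big(1+\sum_{\emptyset\ne D\subseteq C_1}\sum_{i_D\in\mathcal I_D^*}\exp\sum_{\emptyset\neq F\subseteq D}\theta^{C_1}(i_F)\big)$ and $k(i_{S_l})=\log\big(1+\sum_{\emptyset\neq D\subseteq R_l}\sum_{i_D\in\mathcal I_D^*}\exp\sum_{\emptyset\neq F\subseteq D}\theta^{R_l|i_{S_l}}(i_F)\big)$; • the reference prior for $\theta^{cliq}$ is $$\exp\Big\{\sum_{\emptyset\ne D\subseteq C_1}\sum_{i_D\in\mathcal I_D^*}\theta^{C_1}(i_D)\tfrac{|\mathcal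 I_{C_1\setminus D}|}{2}-\tfrac{|\mathcal I_{C_1}|}{2}k_1\Big\}\prod_{l=2}^k\exp\Big\{\sum_{F\subseteq S_l}\sum_{i_F\in\mathcal I_F^*}\sum_{\emptyset\neq D\subseteq R_l}\sum_{i_D\in\mathcal I_D^*}\theta^{C_l}(i_F,i_D)\tfrac{|\mathcal I_{S_l\setminus F}||\mathcal I_{R_l\setminus D}|}{2}-\sum_{F\subseteq S_l}\sum_{j_F\in\mathcal I_F^*}\tfrac{|\mathcal I_{S_l\setminus F}||\mathcal I_{R_l}|}{2}\sum_{H\subseteq F}(-1)^{|F\setminus H|}k_l(j_H)\Big\},$$ with $k_l(j_H)=\log\big(1+\sum_{\emptyset\neq L\subseteq R_l}\sum_{i_L\in\mathcal I_L^*}\exp\sum_{K\subseteq H,\,\emptyset\neq M\subseteq L}\theta^{C_l}(j_K,i_M)\big)$, where $F\subseteq S_l$, $H\subseteq F$, $K\subseteq H$ may be empty; • the reference prior for $\theta^{mod}$ is obtained from that of $\theta^{cliq}$ by expressing $\theta^{cliq}$ in it as a function of $\theta^{mod}$.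
   Context: $V$ is a finite nonempty set. For each $\gamma\in V$, $\mathcal I_\gamma$ is a finite set of levels containing a distinguished level $0=i^*_\gamma$. $\mathcal I=\prod_{\gamma\in V}\mathcal I_\gamma$, $\mathcal I_D=\prod_{\gamma\in D}\mathcal I_\gamma$ ($|\mathcal I_\emptyset|=1$), $i^*=(i^*_\gamma)_{\gamma\in V}$; $i_D$ denotes restriction to $D$; $\mathcal I_D^*=\{i_D\in\mathcal I_D: i_\gamma\neq i_\gamma^*\ \forall\gamma\in D\}$. For disjoint $A,B$, $(i_A,i_B)$ is the combined cell in $\mathcal I_{A\cup B}$; $\theta(i_\emptyset,i_D)=\theta(i_D)$ and similarly for $\theta^{C_l}$. The data are counts $n=(n(i))_{i\in\mathcal I}$ with $\sum_in(i)=N$, with likelihood $\prod_ip(i)^{n(i)}$ (up to the multinomial coefficient). For an ordering $C_1,\dots,C_k$ of the cliques (maximal complete subsets), $H_l=\bigcup_{j\le l}C_j$, and for $l\ge2$, $S_l=H_{l-1}\cap C_l$, $R_l=C_l\setminus S_l$. The order is perfect if for each $l>1$ there is $i<l$ with $S_l\subseteq C_i$. $p$ is Markov with respect to $G$ if $X_\gamma, X_\delta$ are conditionally independent given the remaining variables whenever $\gamma\neq\delta$ and $\{\gamma,\delta\}\notin E$. $p^D(i_D)=\sum_{j\in\mathcal I:j_D=i_D}p(j)$ and $p^{A|i_B}(i_A)=p^{A\cup B}(i_A,i_B)/p^B(i_B)$. For $D\ne\emptyset$, $i_D\in\mathcal I_D^*$ (products including $F=\emptyset$): - $\theta(i_D)=\log\prod_{F\subseteq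 D}p(i_F,i^*_{V\setminus F})^{(-1)^{|D\setminus F|}}$ for $D\subseteq V$; - $\theta^{C_l}(i_D)=\log\prod_{F\subseteq D}\big(p^{C_l}(i_F,i^*_{C_l\setminus F})\big)^{(-1)^{|D\setminus F|}}$ for $D\subseteq C_l$; - $\theta^{R_l|i_{S_l}}(i_D)=\log\prod_{F\subseteq D}\big(p^{R_l|i_{S_l}}(i_F,i^*_{R_l\setminus F})\big)^{(-1)^{|D\setminus F|}}$ for $D\subseteq R_l$, $i_{S_l}\in\mathcal I_{S_l}$. $\theta^{mod}=(\theta(i_D): D \text{ nonempty complete},\ i_D\in\mathcal I_D^* )$ (for $p$ Markov, $\theta(i_D)=0$ for non-complete $D$); $\theta^{cond}$ and $\theta^{cliq}$ are the collections of all the parameters in the groups listed in (a) and (b). Each of $\theta^{cond},\theta^{cliq},\theta^{mod}$ is a bijective parametrization of the set of strictly positive Markov $p$ by a Euclidean space of the same dimension. Reference prior (Berger–Bernardo) relative to ordered groups: for a parameter $\lambda=(\lambda_1,\dots,\lambda_m)$ divided into ordered groups, let $I(\lambda)$ be the Fisher information matrix (of one observation of the data $n$), $\Sigma=I^{-1}$, $\Sigma_j$ the upper-left block of $\Sigma$ for $(\lambda_1,\dots,\lambda_j)$, and $h_j(\lambda)$ the lower-right block of $\Sigma_j^{-1}$ corresponding to $\lambda_j$. Define conditional densities recursively for $j=m,m-1,\dots,1$: $$\pi(\lambda_j\mid\lambda_1,\dots,\lambda_{j-1})\propto\exp\Big\{\tfrac12\,E\big[\log\det h_j(\lambda)\mid\lambda_1,\dots,\lambda_j\big]\Big\},$$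 normalized in $\lambda_j$, where the expectation is over $(\lambda_{j+1},\dots,\lambda_m)$ under the already constructed $\prod_{r>j}\pi(\lambda_r|\lambda_1,\dots,\lambda_{r-1})$. The reference prior is $\pi^R(\lambda)=\prod_j\pi(\lambda_j|\lambda_1,\dots,\lambda_{j-1})$ (if a normalizing constant or expectation is not finite, one uses the usual limit along an increasing sequence of compact sets).
   Formalization: In (c) the order of the groups does matter: the claim is false for the path with cliques {a,b},{b,c}, binary, order C_1,C_2. It is proved for every order listing the group of C_{l'} before that of C_l whenever l<l' and S_{l'} meets R_l (for example C_k,...,C_1). *)

theory Defs
  imports
    "HOL-Analysis.Analysis"
    "Jordan_Normal_Form.Gauss_Jordan_Elimination"
    "Jordan_Normal_Form.Determinant"
begin

section \<open>Decomposable graphs\<close>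

definition simple_graph :: "'v set \<Rightarrow> 'v set set \<Rightarrow> bool" where
  "simple_graph V E \<longleftrightarrow> (\<forall>e\<in>E. e \<subseteq> V \<and> card e = 2)"

definition complete_in :: "'v set set \<Rightarrow> 'v set \<Rightarrow> bool" where
  "complete_in E D \<longleftrightarrow> (\<forall>\<gamma>\<in>D. \<forall>\<delta>\<in>D. \<gamma> \<noteq> \<delta> \<longrightarrow> {\<gamma>, \<delta>} \<in> E)"

definition cliques :: "'v set \<Rightarrow> 'v set set \<Rightarrow> 'v set set" where
  "cliques V E = {C. C \<subseteq> V \<and> complete_in E C \<and>
     (\<forall>D. D \<subseteq> V \<longrightarrow> complete_in E D \<longrightarrow> C \<subseteq> D \<longrightarrow> D = C)}"

text \<open>Decomposable means chordal: every cycle of length at least 4 has a chord.\<close>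

definition decomposable :: "'v set \<Rightarrow> 'v set set \<Rightarrow> bool" where
  "decomposable V E \<longleftrightarrow>
     (\<forall>c. set c \<subseteq> V \<and> distinct c \<and> length c \<ge> 4 \<and>
          (\<forall>i<length c. {c ! i, c ! (Suc i mod length c)} \<in> E) \<longrightarrow>
        (\<exists>i<length c. \<exists>j<length c. i \<noteq> j \<and> j \<noteq> Suc i mod length c \<and> i \<noteq> Suc j mod length c \<and>
           {c ! i, c ! j} \<in> E))"

text \<open>
  Cliques are numbered from 0, so \<open>Cs ! 0\<close> is $C_1$. For the first clique the
  definitions give separator \<open>{}\<close> and residual \<open>Cs ! 0\<close>.
\<close>

definition separator :: "'v set list \<Rightarrow> nat \<Rightarrow> 'v set" where
  "separator Cs l = (\<Union>j<l. Cs ! j) \<inter> Cs ! l"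

definition residual :: "'v set list \<Rightarrow> nat \<Rightarrow> 'v set" where
  "residual Cs l = Cs ! l - separator Cs l"

definition perfect_clique_order :: "'v set \<Rightarrow> 'v set set \<Rightarrow> 'v set list \<Rightarrow> bool" where
  "perfect_clique_order V E Cs \<longleftrightarrow> distinct Cs \<and> set Cs = cliques V E \<and>
     (\<forall>l. 0 < l \<and> l < length Cs \<longrightarrow> (\<exists>i<l. separator Cs l \<subseteq> Cs ! i))"


section \<open>Contingency tables\<close>

text \<open>
  A marginal cell $i_D$ is a partial map with domain $D$: restriction is \<open>i |` F\<close>,
  the combined cell $(i_A, i_B)$ is \<open>i\<^sub>A ++ i\<^sub>B\<close>, and the only cell of
  $\mathcal I_\emptyset$ is \<open>Map.empty\<close>. Throughout, \<open>I \<gamma>\<close> is the set of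
  levels of \<open>\<gamma>\<close> and \<open>z \<gamma>\<close> its distinguished level.
\<close>

type_synonym ('v, 'a) cell = "'v \<rightharpoonup> 'a"

definition cells :: "('v \<Rightarrow> 'a set) \<Rightarrow> 'v set \<Rightarrow> ('v, 'a) cell set" where
  "cells I D = {i. dom i = D \<and> (\<forall>\<gamma>\<in>D. the (i \<gamma>) \<in> I \<gamma>)}"

definition cells_star :: "('v \<Rightarrow> 'a set) \<Rightarrow> ('v \<Rightarrow> 'a) \<Rightarrow> 'v set \<Rightarrow> ('v, 'a) cell set" where
  "cells_star I z D = {i \<in> cells I D. \<forall>\<gamma>\<in>D. the (i \<gamma>) \<noteq> z \<gamma>}"

definition base_cell :: "('v \<Rightarrow> 'a) \<Rightarrow> 'v set \<Rightarrow> ('v, 'a) cell" where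
  "base_cell z D = (\<lambda>\<gamma>. Some (z \<gamma>)) |` D"

definition marginal ::
  "'v set \<Rightarrow> ('v \<Rightarrow> 'a set) \<Rightarrow> (('v, 'a) cell \<Rightarrow> real) \<Rightarrow> ('v, 'a) cell \<Rightarrow> real" where
  "marginal V I p i = (\<Sum>j | j \<in> cells I V \<and> j |` dom i = i. p j)"

definition conditional ::
  "'v set \<Rightarrow> ('v \<Rightarrow> 'a set) \<Rightarrow> (('v, 'a) cell \<Rightarrow> real) \<Rightarrow> ('v, 'a) cell \<Rightarrow> ('v, 'a) cell \<Rightarrow> real" where
  "conditional V I p iB iA = marginal V I p (iA ++ iB) / marginal V I p iB"

definition markov ::
  "'v set \<Rightarrow> 'v set set \<Rightarrow> ('v \<Rightarrow> 'a set) \<Rightarrow> (('v, 'a) cell \<Rightarrow> real) \<Rightarrow> bool" where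
  "markov V E I p \<longleftrightarrow>
     (\<forall>\<gamma>\<in>V. \<forall>\<delta>\<in>V. \<gamma> \<noteq> \<delta> \<and> {\<gamma>, \<delta>} \<notin> E \<longrightarrow>
        (\<forall>i\<in>cells I V. let r = i |` (V - {\<gamma>, \<delta>}) in
           conditional V I p r (i |` {\<gamma>, \<delta>}) =
           conditional V I p r (i |` {\<gamma>}) * conditional V I p r (i |` {\<delta>})))"

definition positive_markov ::
  "'v set \<Rightarrow> 'v set set \<Rightarrow> ('v \<Rightarrow> 'a set) \<Rightarrow> (('v, 'a) cell \<Rightarrow> real) set" where
  "positive_markov V E I = {p \<in> extensional (cells I V).
     (\<forall>i\<in>cells I V. p i > 0) \<and> (\<Sum>i\<in>cells I V. p i) = 1 \<and> markov V E I p}"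


section \<open>Log-linear parameters\<close>

text \<open>
  The log-linear parameter at \<open>i\<close> of a table \<open>q\<close> on the cells with domain \<open>A \<supseteq> dom i\<close>.
\<close>

definition log_linear ::
  "('v \<Rightarrow> 'a) \<Rightarrow> 'v set \<Rightarrow> (('v, 'a) cell \<Rightarrow> real) \<Rightarrow> ('v, 'a) cell \<Rightarrow> real" where
  "log_linear z A q i =
     ln (\<Prod>F\<in>Pow (dom i). q ((i |` F) ++ base_cell z (A - F)) powi ((-1) ^ card (dom i - F)))"

text \<open>
  Coordinates of a parameter are labelled as follows. For \<open>\<theta>\<^sup>c\<^sup>o\<^sup>n\<^sup>d\<close> a label is
  \<open>((l, s), i)\<close>, standing for $\theta^{R_l|s}(i)$, with \<open>((0, Map.empty), i)\<close> standing for
  $\theta^{C_1}(i)$; for \<open>\<theta>\<^sup>c\<^sup>l\<^sup>i\<^sup>q\<close> a label is \<open>(l, i)\<close>, standing for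
  $\theta^{C_l}(i)$; for \<open>\<theta>\<^sup>m\<^sup>o\<^sup>d\<close> it is the marginal cell \<open>i\<close> itself.
  Groups are indexed by \<open>(l, s)\<close> in the first case and by \<open>l\<close> in the other two.
\<close>

type_synonym ('v, 'a) cond_group = "nat \<times> ('v, 'a) cell"
type_synonym ('v, 'a) cond_label = "('v, 'a) cond_group \<times> ('v, 'a) cell"
type_synonym ('v, 'a) cliq_label = "nat \<times> ('v, 'a) cell"

definition cond_groups :: "('v \<Rightarrow> 'a set) \<Rightarrow> 'v set list \<Rightarrow> ('v, 'a) cond_group set" where
  "cond_groups I Cs =
     insert (0, Map.empty) {(l, s). 0 < l \<and> l < length Cs \<and> s \<in> cells I (separator Cs l)}"

definition cond_group ::
  "('v \<Rightarrow> 'a set) \<Rightarrow> ('v \<Rightarrow> 'a) \<Rightarrow> 'v set list \<Rightarrow> ('v, 'a) cond_group \<Rightarrow> ('v, 'a) cond_label set" where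
  "cond_group I z Cs = (\<lambda>(l, s).
     if l = 0 then {((0, Map.empty), i) |D i. D \<noteq> {} \<and> D \<subseteq> Cs ! 0 \<and> i \<in> cells_star I z D}
     else {((l, s), i) |D i. D \<noteq> {} \<and> D \<subseteq> residual Cs l \<and> i \<in> cells_star I z D})"

definition theta_cond ::
  "'v set \<Rightarrow> ('v \<Rightarrow> 'a set) \<Rightarrow> ('v \<Rightarrow> 'a) \<Rightarrow> 'v set list \<Rightarrow>
     (('v, 'a) cell \<Rightarrow> real) \<Rightarrow> ('v, 'a) cond_label \<Rightarrow> real" where
  "theta_cond V I z Cs p =
     restrict (\<lambda>((l, s), i).
         if l = 0 then log_linear z (Cs ! 0) (marginal V I p) i
         else log_linear z (residual Cs l) (conditional V I p s) i)
       (\<Union>g\<in>cond_groups I Cs. cond_group I z Cs g)"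

definition cliq_group ::
  "('v \<Rightarrow> 'a set) \<Rightarrow> ('v \<Rightarrow> 'a) \<Rightarrow> 'v set list \<Rightarrow> nat \<Rightarrow> ('v, 'a) cliq_label set" where
  "cliq_group I z Cs l =
     (if l = 0 then {(0, i) |D i. D \<noteq> {} \<and> D \<subseteq> Cs ! 0 \<and> i \<in> cells_star I z D}
      else {(l, iF ++ iD) |F iF D iD. F \<subseteq> separator Cs l \<and> iF \<in> cells_star I z F \<and>
              D \<noteq> {} \<and> D \<subseteq> residual Cs l \<and> iD \<in> cells_star I z D})"

definition theta_cliq ::
  "'v set \<Rightarrow> ('v \<Rightarrow> 'a set) \<Rightarrow> ('v \<Rightarrow> 'a) \<Rightarrow> 'v set list \<Rightarrow>
     (('v, 'a) cell \<Rightarrow> real) \<Rightarrow> ('v, 'a) cliq_label \<Rightarrow> real" where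
  "theta_cliq V I z Cs p =
     restrict (\<lambda>(l, i). log_linear z (Cs ! l) (marginal V I p) i)
       (\<Union>l<length Cs. cliq_group I z Cs l)"

definition mod_group ::
  "('v \<Rightarrow> 'a set) \<Rightarrow> ('v \<Rightarrow> 'a) \<Rightarrow> 'v set list \<Rightarrow> nat \<Rightarrow> ('v, 'a) cell set" where
  "mod_group I z Cs l =
     (if l = 0 then {i |D i. D \<noteq> {} \<and> D \<subseteq> Cs ! 0 \<and> i \<in> cells_star I z D}
      else {i |D i. D \<subseteq> Cs ! l \<and> D \<inter> residual Cs l \<noteq> {} \<and> i \<in> cells_star I z D})"

definition theta_mod ::
  "'v set \<Rightarrow> 'v set set \<Rightarrow> ('v \<Rightarrow> 'a set) \<Rightarrow> ('v \<Rightarrow> 'a) \<Rightarrow>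
     (('v, 'a) cell \<Rightarrow> real) \<Rightarrow> ('v, 'a) cell \<Rightarrow> real" where
  "theta_mod V E I z p =
     restrict (log_linear z V p)
       {i |D i. D \<noteq> {} \<and> D \<subseteq> V \<and> complete_in E D \<and> i \<in> cells_star I z D}"

definition prob_of ::
  "'v set \<Rightarrow> 'v set set \<Rightarrow> ('v \<Rightarrow> 'a set) \<Rightarrow> ((('v, 'a) cell \<Rightarrow> real) \<Rightarrow> 'k \<Rightarrow> real) \<Rightarrow>
     ('k \<Rightarrow> real) \<Rightarrow> ('v, 'a) cell \<Rightarrow> real" where
  "prob_of V E I \<Theta> = the_inv_into (positive_markov V E I) \<Theta>"


section \<open>Multinomial model\<close>

definition counts :: "'c set \<Rightarrow> nat \<Rightarrow> ('c \<Rightarrow> nat) set" where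
  "counts X N = {n \<in> X \<rightarrow>\<^sub>E UNIV. (\<Sum>i\<in>X. n i) = N}"

definition multinomial_prob :: "'c set \<Rightarrow> nat \<Rightarrow> ('c \<Rightarrow> real) \<Rightarrow> ('c \<Rightarrow> nat) \<Rightarrow> real" where
  "multinomial_prob X N p n = fact N / (\<Prod>i\<in>X. fact (n i)) * (\<Prod>i\<in>X. p i ^ n i)"


definition multinomial_model ::
  "'v set \<Rightarrow> 'v set set \<Rightarrow> ('v \<Rightarrow> 'a set) \<Rightarrow> nat \<Rightarrow> ((('v, 'a) cell \<Rightarrow> real) \<Rightarrow> 'k \<Rightarrow> real) \<Rightarrow>
     ('k \<Rightarrow> real) \<Rightarrow> (('v, 'a) cell \<Rightarrow> nat) \<Rightarrow> real" where
  "multinomial_model V E I N \<Theta> \<theta> = multinomial_prob (cells I V) N (prob_of V E I \<Theta> \<theta>)"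


section \<open>Reference priors\<close>

text \<open>
  A statistical model is given by a finite sample space \<open>X\<close> and probabilities \<open>f u x\<close>, where
  the parameter \<open>u\<close> is a real vector indexed by a finite set of labels. The ordered groups are
  a list \<open>gs\<close> of lists of labels.
\<close>

definition score :: "(('k \<Rightarrow> real) \<Rightarrow> 'x \<Rightarrow> real) \<Rightarrow> ('k \<Rightarrow> real) \<Rightarrow> 'x \<Rightarrow> 'k \<Rightarrow> real" where
  "score f u x a = deriv (\<lambda>t. ln (f (u(a := t)) x)) (u a)"

definition fisher_mat ::
  "'x set \<Rightarrow> (('k \<Rightarrow> real) \<Rightarrow> 'x \<Rightarrow> real) \<Rightarrow> 'k list \<Rightarrow> ('k \<Rightarrow> real) \<Rightarrow> real Matrix.mat" where
  "fisher_mat X f as u = Matrix.mat (length as) (length as)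
     (\<lambda>(r, s). \<Sum>x\<in>X. f u x * (score f u x (as ! r) * score f u x (as ! s)))"

text \<open>
  Groups are numbered from 0: \<open>\<Sigma>\<^sub>j\<close> is the block of \<open>\<Sigma>\<close> for groups \<open>0, \<dots>, j\<close>.
\<close>

definition sigma_block ::
  "'x set \<Rightarrow> (('k \<Rightarrow> real) \<Rightarrow> 'x \<Rightarrow> real) \<Rightarrow> 'k list list \<Rightarrow> nat \<Rightarrow> ('k \<Rightarrow> real) \<Rightarrow> real Matrix.mat" where
  "sigma_block X f gs j u =
     (let Sig = the (mat_inverse (fisher_mat X f (concat gs) u));
          d = length (concat (take (Suc j) gs))
      in Matrix.mat d d (\<lambda>(r, s). Sig $$ (r, s)))"

definition h_block ::
  "'x set \<Rightarrow> (('k \<Rightarrow> real) \<Rightarrow> 'x \<Rightarrow> real) \<Rightarrow> 'k list list \<Rightarrow> nat \<Rightarrow> ('k \<Rightarrow> real) \<Rightarrow> real Matrix.mat" where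
  "h_block X f gs j u =
     (let S = the (mat_inverse (sigma_block X f gs j u));
          o' = length (concat (take j gs));
          d = length (gs ! j)
      in Matrix.mat d d (\<lambda>(r, s). S $$ (o' + r, o' + s)))"

abbreviation lborel_on :: "'k set \<Rightarrow> ('k \<Rightarrow> real) measure" where
  "lborel_on J \<equiv> PiM J (\<lambda>_. lborel)"

definition later_labels :: "'k list list \<Rightarrow> nat \<Rightarrow> 'k set" where
  "later_labels gs j = set (concat (drop (Suc j) gs))"

text \<open>
  The construction is carried out on a region \<open>K\<close> of the parameter space; \<open>K = UNIV\<close> is the
  untruncated construction. The value of group \<open>j\<close> is confined to the section, given the
  preceding groups, of the projection of \<open>K\<close>.

  In \<open>ref_expectation\<close> and \<open>ref_kernel\<close> the function \<open>T\<close> is the joint conditional density of the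
  groups after \<open>j\<close>; \<open>ref_tail d\<close> is the joint conditional density of the last \<open>d\<close> groups
  given the preceding ones.
\<close>

definition in_projection :: "('k \<Rightarrow> real) set \<Rightarrow> 'k list list \<Rightarrow> nat \<Rightarrow> ('k \<Rightarrow> real) \<Rightarrow> bool" where
  "in_projection K gs j u \<longleftrightarrow> (\<exists>y. override_on u y (later_labels gs j) \<in> K)"

definition ref_integrand ::
  "'x set \<Rightarrow> (('k \<Rightarrow> real) \<Rightarrow> 'x \<Rightarrow> real) \<Rightarrow> 'k list list \<Rightarrow> (('k \<Rightarrow> real) \<Rightarrow> real) \<Rightarrow>
     nat \<Rightarrow> ('k \<Rightarrow> real) \<Rightarrow> ('k \<Rightarrow> real) \<Rightarrow> real" where
  "ref_integrand X f gs T j u y =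
     (let \<mu> = override_on u y (later_labels gs j)
      in ln (Determinant.det (h_block X f gs j \<mu>)) * T \<mu>)"

definition ref_expectation ::
  "'x set \<Rightarrow> (('k \<Rightarrow> real) \<Rightarrow> 'x \<Rightarrow> real) \<Rightarrow> 'k list list \<Rightarrow> (('k \<Rightarrow> real) \<Rightarrow> real) \<Rightarrow>
     nat \<Rightarrow> ('k \<Rightarrow> real) \<Rightarrow> real" where
  "ref_expectation X f gs T j u =
     (\<integral>y. ref_integrand X f gs T j u y \<partial>lborel_on (later_labels gs j))"

definition ref_kernel ::
  "'x set \<Rightarrow> (('k \<Rightarrow> real) \<Rightarrow> 'x \<Rightarrow> real) \<Rightarrow> 'k list list \<Rightarrow> ('k \<Rightarrow> real) set \<Rightarrow>
     (('k \<Rightarrow> real) \<Rightarrow> real) \<Rightarrow> nat \<Rightarrow> ('k \<Rightarrow> real) \<Rightarrow> real" where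
  "ref_kernel X f gs K T j u =
     (if in_projection K gs j u then exp (1 / 2 * ref_expectation X f gs T j u) else 0)"

definition ref_conditional ::
  "'x set \<Rightarrow> (('k \<Rightarrow> real) \<Rightarrow> 'x \<Rightarrow> real) \<Rightarrow> 'k list list \<Rightarrow> ('k \<Rightarrow> real) set \<Rightarrow>
     (('k \<Rightarrow> real) \<Rightarrow> real) \<Rightarrow> nat \<Rightarrow> ('k \<Rightarrow> real) \<Rightarrow> real" where
  "ref_conditional X f gs K T j u =
     ref_kernel X f gs K T j u /
     (\<integral>y. ref_kernel X f gs K T j (override_on u y (set (gs ! j))) \<partial>lborel_on (set (gs ! j)))"

primrec ref_tail ::
  "'x set \<Rightarrow> (('k \<Rightarrow> real) \<Rightarrow> 'x \<Rightarrow> real) \<Rightarrow> 'k list list \<Rightarrow> ('k \<Rightarrow> real) set \<Rightarrow>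
     nat \<Rightarrow> ('k \<Rightarrow> real) \<Rightarrow> real" where
  "ref_tail X f gs K 0 = (\<lambda>u. 1)"
| "ref_tail X f gs K (Suc d) =
     (\<lambda>u. ref_conditional X f gs K (ref_tail X f gs K d) (length gs - Suc d) u *
          ref_tail X f gs K d u)"

abbreviation ref_density ::
  "'x set \<Rightarrow> (('k \<Rightarrow> real) \<Rightarrow> 'x \<Rightarrow> real) \<Rightarrow> 'k list list \<Rightarrow> ('k \<Rightarrow> real) set \<Rightarrow>
     ('k \<Rightarrow> real) \<Rightarrow> real" where
  "ref_density X f gs K \<equiv> ref_tail X f gs K (length gs)"

definition parameter_space :: "'k list list \<Rightarrow> ('k \<Rightarrow> real) set" where
  "parameter_space gs = set (concat gs) \<rightarrow>\<^sub>E UNIV"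

text \<open>All expectations and all normalizing constants of the construction on \<open>K\<close> are finite.\<close>

definition ref_finite ::
  "'x set \<Rightarrow> (('k \<Rightarrow> real) \<Rightarrow> 'x \<Rightarrow> real) \<Rightarrow> 'k list list \<Rightarrow> ('k \<Rightarrow> real) set \<Rightarrow> bool" where
  "ref_finite X f gs K \<longleftrightarrow>
     (\<forall>j<length gs. \<forall>u\<in>parameter_space gs.
        let T = ref_tail X f gs K (length gs - Suc j) in
          (in_projection K gs j u \<longrightarrow>
             integrable (lborel_on (later_labels gs j)) (ref_integrand X f gs T j u)) \<and>
          integrable (lborel_on (set (gs ! j)))
            (\<lambda>y. ref_kernel X f gs K T j (override_on u y (set (gs ! j)))))"

text \<open>
  If the construction is not finite, the reference prior is the pointwise limit of
  \<open>\<pi>\<^sub>n(u) / \<pi>\<^sub>n(u\<^sub>0)\<close>, where \<open>\<pi>\<^sub>n\<close> is constructed on the \<open>n\<close>-th of an increasing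
  sequence of compact sets exhausting the parameter space and \<open>u\<^sub>0\<close> is a fixed point.
\<close>

definition is_reference_prior ::
  "'x set \<Rightarrow> (('k \<Rightarrow> real) \<Rightarrow> 'x \<Rightarrow> real) \<Rightarrow> 'k list list \<Rightarrow> (('k \<Rightarrow> real) \<Rightarrow> real) \<Rightarrow> bool" where
  "is_reference_prior X f gs \<pi> \<longleftrightarrow>
     (if ref_finite X f gs UNIV
      then \<forall>u\<in>parameter_space gs. \<pi> u = ref_density X f gs UNIV u
      else \<exists>K u\<^sub>0. incseq K \<and> (\<forall>n. compact (K n)) \<and> (\<Union>n. K n) = parameter_space gs \<and>
             (\<forall>n. ref_finite X f gs (K n)) \<and> u\<^sub>0 \<in> parameter_space gs \<and>
             (\<forall>u\<in>parameter_space gs.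
                (\<lambda>n. ref_density X f gs (K n) u / ref_density X f gs (K n) u\<^sub>0)
                  \<longlonglongrightarrow> \<pi> u))"

definition reference_prior_proportional_to ::
  "'x set \<Rightarrow> (('k \<Rightarrow> real) \<Rightarrow> 'x \<Rightarrow> real) \<Rightarrow> 'k list list \<Rightarrow> (('k \<Rightarrow> real) \<Rightarrow> real) \<Rightarrow> bool" where
  "reference_prior_proportional_to X f gs g \<longleftrightarrow>
     (\<exists>c>0. is_reference_prior X f gs (\<lambda>u. c * g u))"

text \<open>
  \<open>gs\<close> lists the groups \<open>grp b\<close>, \<open>b \<in> B\<close>, in the order \<open>bs\<close>; the order of the labels inside a
  group is arbitrary.
\<close>

definition ordered_grouping ::
  "'b set \<Rightarrow> ('b \<Rightarrow> 'k set) \<Rightarrow> 'b list \<Rightarrow> 'k list list \<Rightarrow> bool" where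
  "ordered_grouping B grp bs gs \<longleftrightarrow> distinct bs \<and> set bs = B \<and>
     list_all2 (\<lambda>b g. distinct g \<and> set g = grp b) bs gs"

text \<open>
  For $l < l'$ the parameters $\theta(i_D)$ with $D \subseteq C_l \cap C_{l'}$ and
  $D \cap R_l \neq \emptyset$ involve, besides $\theta^{C_l}(i_D)$, the group of
  $\theta^{cliq}$ belonging to $C_{l'}$. The order of the groups of $\theta^{mod}$ has to list
  the group of $C_{l'}$ before that of $C_l$ whenever such $D$ exist, that is, whenever
  $S_{l'} \cap R_l \neq \emptyset$. Already for the path with cliques $\{a,b\}$, $\{b,c\}$ and
  binary variables, the opposite order leads to a different prior. The order
  $C_k, \dots, C_1$ always qualifies, and every order does if all separators are empty.
\<close>

definition compatible_order :: "'v set list \<Rightarrow> nat list \<Rightarrow> bool" where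
  "compatible_order Cs =
     sorted_wrt (\<lambda>l l'. l < l' \<longrightarrow> separator Cs l' \<inter> residual Cs l = {})"


section \<open>The densities\<close>

definition prior_prob ::
  "'v set \<Rightarrow> ('v \<Rightarrow> 'a set) \<Rightarrow> 'v set list \<Rightarrow> (('v, 'a) cell \<Rightarrow> real) \<Rightarrow> real" where
  "prior_prob V I Cs p =
     sqrt (\<Prod>i\<in>cells I (Cs ! 0). marginal V I p i) *
     (\<Prod>l\<in>{0<..<length Cs}. \<Prod>s\<in>cells I (separator Cs l).
        sqrt (\<Prod>r\<in>cells I (residual Cs l). conditional V I p s r))"

definition log_norm ::
  "('v \<Rightarrow> 'a set) \<Rightarrow> ('v \<Rightarrow> 'a) \<Rightarrow> 'v set \<Rightarrow> (('v, 'a) cell \<Rightarrow> real) \<Rightarrow> real" where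
  "log_norm I z A t =
     ln (1 + (\<Sum>D\<in>Pow A - {{}}. \<Sum>i\<in>cells_star I z D. exp (\<Sum>F\<in>Pow D - {{}}. t (i |` F))))"

definition block_prior ::
  "('v \<Rightarrow> 'a set) \<Rightarrow> ('v \<Rightarrow> 'a) \<Rightarrow> 'v set \<Rightarrow> (('v, 'a) cell \<Rightarrow> real) \<Rightarrow> real" where
  "block_prior I z A t =
     exp ((\<Sum>D\<in>Pow A - {{}}. \<Sum>i\<in>cells_star I z D. t i * (real (card (cells I (A - D))) / 2))
          - real (card (cells I A)) / 2 * log_norm I z A t)"

definition prior_cond ::
  "('v \<Rightarrow> 'a set) \<Rightarrow> ('v \<Rightarrow> 'a) \<Rightarrow> 'v set list \<Rightarrow> (('v, 'a) cond_label \<Rightarrow> real) \<Rightarrow> real" where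
  "prior_cond I z Cs \<theta> =
     block_prior I z (Cs ! 0) (\<lambda>i. \<theta> ((0, Map.empty), i)) *
     (\<Prod>l\<in>{0<..<length Cs}. \<Prod>s\<in>cells I (separator Cs l).
        block_prior I z (residual Cs l) (\<lambda>i. \<theta> ((l, s), i)))"

definition log_norm_cliq ::
  "('v \<Rightarrow> 'a set) \<Rightarrow> ('v \<Rightarrow> 'a) \<Rightarrow> 'v set \<Rightarrow> (('v, 'a) cell \<Rightarrow> real) \<Rightarrow> ('v, 'a) cell \<Rightarrow> real" where
  "log_norm_cliq I z R t j =
     ln (1 + (\<Sum>L\<in>Pow R - {{}}. \<Sum>i\<in>cells_star I z L.
       exp (\<Sum>K\<in>Pow (dom j). \<Sum>M\<in>Pow L - {{}}. t ((j |` K) ++ (i |` M)))))"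

definition prior_cliq ::
  "('v \<Rightarrow> 'a set) \<Rightarrow> ('v \<Rightarrow> 'a) \<Rightarrow> 'v set list \<Rightarrow> (('v, 'a) cliq_label \<Rightarrow> real) \<Rightarrow> real" where
  "prior_cliq I z Cs \<theta> =
     block_prior I z (Cs ! 0) (\<lambda>i. \<theta> (0, i)) *
     (\<Prod>l\<in>{0<..<length Cs}. let S = separator Cs l; R = residual Cs l in
        exp ((\<Sum>F\<in>Pow S. \<Sum>iF\<in>cells_star I z F. \<Sum>D\<in>Pow R - {{}}. \<Sum>iD\<in>cells_star I z D.
                \<theta> (l, iF ++ iD) *
                (real (card (cells I (S - F))) * real (card (cells I (R - D))) / 2))
             - (\<Sum>F\<in>Pow S. \<Sum>jF\<in>cells_star I z F.
                  real (card (cells I (S - F))) * real (card (cells I R)) / 2 *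
                  (\<Sum>H\<in>Pow F. (-1) ^ card (F - H) *
                     log_norm_cliq I z R (\<lambda>i. \<theta> (l, i)) (jF |` H)))))"

end

theory Submission
  imports Defs
begin

text \<open>
  For each parametrization the table is a product of conditional tables
  $p^{R_l \mid i_{S_l}}$, and after a change of variables \<open>\<phi>\<close> each group of parameters consists of
  the logits of some of these tables. In the coordinates \<open>\<phi>\<close> the Fisher information is block
  diagonal, since scores of different conditional tables are uncorrelated, and the determinant of
  the block of group \<open>j\<close> is a product \<open>G\<^sub>j g\<^sub>j\<close>: here \<open>g\<^sub>j\<close> is the product of the cell
  probabilities of the conditional tables of the group, a function of the group alone, while \<open>G\<^sub>j\<close>
  comes from the separator marginals and does not depend on the group. Hence the conditional
  density of group \<open>j\<close> is proportional to \<open>g\<^sub>j\<close> to the power $1/2$.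

  For \<open>\<theta>\<^sup>c\<^sup>o\<^sup>n\<^sup>d\<close> and \<open>\<theta>\<^sup>c\<^sup>l\<^sup>i\<^sup>q\<close> the map \<open>\<phi>\<close> is the identity. For \<open>\<theta>\<^sup>m\<^sup>o\<^sup>d\<close> it is the passage to
  \<open>\<theta>\<^sup>c\<^sup>l\<^sup>i\<^sup>q\<close>, which in a compatible order of the groups adds to each coordinate a function of the
  preceding groups. Such a triangular change of variables preserves Lebesgue measure and, as the
  inverse information matrix is transformed by block triangular matrices with identity diagonal
  blocks, it preserves the determinants of the blocks \<open>h\<^sub>j\<close>.
\<close>

section \<open>Matrices indexed by lists of labels\<close>

text \<open>The conditional density of group \<open>j\<close> comes out as \<open>g_j\<close> to the
  power 1/2 because the expectation over the later groups splits into E[ln G_j] + ln g_j: the term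
  ln g_j is constant in the later groups, whose density has mass one, and E[ln G_j] does not involve
  group \<open>j\<close>, so the normalization absorbs it. The obstacle is analytic. The definition
  branches on whether the untruncated construction is finite, and the truncated one normalizes on
  sections of a region. One argument serves both branches, for regions that are boxes in the
  coordinates \<phi>: their sections do not vary with the preceding groups. G_j is free of group
  \<open>j\<close> because the separator marginal of C_l is a sum of products of conditional tables
  of cliques before C_l, while the tables of one group belong to one clique. For theta^mod the
  passage to theta^cliq adds, for a label with domain D, interactions of the log normalizers of the
  later cliques whose separator contains D. The values of these normalizers must be fixed by
  preceding groups; this is where compatibility of the order enters.\<close>

definition mat_of :: "'k list \<Rightarrow> ('k \<Rightarrow> 'k \<Rightarrow> real) \<Rightarrow> real Matrix.mat" where
  "mat_of xs f = Matrix.mat (length xs) (length xs) (\<lambda>(r, s). f (xs ! r) (xs ! s))"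

lemma mat_of_carrier [simp]: "mat_of xs f \<in> carrier_mat (length xs) (length xs)"
  by (simp add: mat_of_def)

lemma dim_mat_of [simp]: "dim_row (mat_of xs f) = length xs" "dim_col (mat_of xs f) = length xs"
  by (simp_all add: mat_of_def)

lemma index_mat_of [simp]:
  "r < length xs \<Longrightarrow> s < length xs \<Longrightarrow> mat_of xs f $$ (r, s) = f (xs ! r) (xs ! s)"
  by (simp add: mat_of_def)

lemma mat_of_cong:
  "(\<And>a b. a \<in> set xs \<Longrightarrow> b \<in> set xs \<Longrightarrow> f a b = g a b) \<Longrightarrow> mat_of xs f = mat_of xs g"
  by (rule eq_matI) auto

lemma sum_nth_distinct: "distinct xs \<Longrightarrow> (\<Sum>i = 0..<length xs. f (xs ! i)) = sum f (set xs)"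
  using sum.distinct_set_conv_list[of xs f] sum_list_sum_nth[of "map f xs"] by simp

text \<open>Indexing rows and columns by labels turns matrix identities into sums over label sets,
  in which the order of the labels in the list no longer appears.\<close>

lemma mat_of_mult:
  assumes "distinct xs"
  shows "mat_of xs f * mat_of xs g = mat_of xs (\<lambda>a b. \<Sum>c\<in>set xs. f a c * g c b)"
proof (rule eq_matI)
  fix r s assume "r < dim_row (mat_of xs (\<lambda>a b. \<Sum>c\<in>set xs. f a c * g c b))"
    and "s < dim_col (mat_of xs (\<lambda>a b. \<Sum>c\<in>set xs. f a c * g c b))"
  then show "(mat_of xs f * mat_of xs g) $$ (r, s) =
      mat_of xs (\<lambda>a b. \<Sum>c\<in>set xs. f a c * g c b) $$ (r, s)"
    by (simp add: times_mat_def scalar_prod_def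
        sum_nth_distinct[OF assms, of "\<lambda>c. f (xs ! r) c * g c (xs ! s)", symmetric])
qed auto

lemma mat_of_transpose: "transpose_mat (mat_of xs f) = mat_of xs (\<lambda>a b. f b a)"
  by (rule eq_matI) auto

lemma mat_of_one: "distinct xs \<Longrightarrow> 1\<^sub>m (length xs) = mat_of xs (\<lambda>a b. if a = b then 1 else 0)"
  by (rule eq_matI) (auto simp: nth_eq_iff_index_eq)

lemma mat_of_inj:
  assumes "mat_of xs f = mat_of xs g" "a \<in> set xs" "b \<in> set xs"
  shows "f a b = g a b"
proof -
  obtain r s where "r < length xs" "s < length xs" "xs ! r = a" "xs ! s = b"
    using assms by (auto simp: in_set_conv_nth)
  then show ?thesis using assms(1) index_mat_of[of r xs s f] index_mat_of[of r xs s g] by simp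
qed

text \<open>An inverse is first obtained as an abstract matrix. Since the labels are distinct,
  positions can be recovered from labels and its entries become a function of two labels.\<close>

lemma mat_of_ex:
  assumes "distinct xs" "B \<in> carrier_mat (length xs) (length xs)"
  obtains g where "B = mat_of xs g"
proof -
  define ix where "ix = inv_into {..<length xs} ((!) xs)"
  have "ix (xs ! r) = r" if "r < length xs" for r
    unfolding ix_def using assms(1) that by (intro inv_into_f_f) (auto simp: inj_on_def nth_eq_iff_index_eq)
  then have "B = mat_of xs (\<lambda>a b. B $$ (ix a, ix b))"
    using assms by (intro eq_matI) auto
  then show ?thesis by (rule that)
qed

lemma det_mat_of_mult:
  assumes "distinct xs"
  shows "Determinant.det (mat_of xs (\<lambda>a b. \<Sum>c\<in>set xs. f a c * g c b)) =
    Determinant.det (mat_of xs f) * Determinant.det (mat_of xs g)"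
  using det_mult[OF mat_of_carrier mat_of_carrier, of xs f g] mat_of_mult[OF assms, of f g] by simp

lemma det_mat_of_transpose:
  "Determinant.det (mat_of xs (\<lambda>a b. f b a)) = Determinant.det (mat_of xs f)"
  using Determinant.det_transpose[OF mat_of_carrier[of xs f]] by (simp add: mat_of_transpose)

text \<open>This is how an information matrix transforms under a change of coordinates; the change
  contributes only the square of its determinant.\<close>

lemma det_mat_of_congruence:
  assumes "distinct xs"
  shows "Determinant.det (mat_of xs (\<lambda>a b. \<Sum>c\<in>set xs. \<Sum>d\<in>set xs. L c a * D c d * L d b)) =
    (Determinant.det (mat_of xs L))\<^sup>2 * Determinant.det (mat_of xs D)"
proof -
  have "(\<lambda>a b. \<Sum>c\<in>set xs. \<Sum>d\<in>set xs. L c a * D c d * L d b) =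
      (\<lambda>a b. \<Sum>c\<in>set xs. L c a * (\<Sum>d\<in>set xs. D c d * L d b))"
    by (simp add: sum_distrib_left mult.assoc)
  then show ?thesis
    by (simp add: det_mat_of_mult[OF assms] det_mat_of_transpose[of xs L] power2_eq_square)
qed

lemma mat_of_append:
  "mat_of (xs @ ys) f = four_block_mat (mat_of xs f)
     (Matrix.mat (length xs) (length ys) (\<lambda>(r, s). f (xs ! r) (ys ! s)))
     (Matrix.mat (length ys) (length xs) (\<lambda>(r, s). f (ys ! r) (xs ! s))) (mat_of ys f)"
  by (rule eq_matI) (auto simp: nth_append)

lemma det_mat_of_append_upper:
  assumes "\<And>a b. a \<in> set ys \<Longrightarrow> b \<in> set xs \<Longrightarrow> f a b = 0"
  shows "Determinant.det (mat_of (xs @ ys) f) = Determinant.det (mat_of xs f) * Determinant.det (mat_of ys f)"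
  unfolding mat_of_append
  by (rule det_four_block_mat_lower_left_zero[of _ "length xs" _ "length ys"])
     (use assms in \<open>auto intro!: eq_matI\<close>)

lemma det_mat_of_append_lower:
  assumes "\<And>a b. a \<in> set xs \<Longrightarrow> b \<in> set ys \<Longrightarrow> f a b = 0"
  shows "Determinant.det (mat_of (xs @ ys) f) = Determinant.det (mat_of xs f) * Determinant.det (mat_of ys f)"
  unfolding mat_of_append
  by (rule det_four_block_mat_upper_right_zero[of _ "length xs" _ "length ys"])
     (use assms in \<open>auto intro!: eq_matI\<close>)

lemma det_mat_of_Nil [simp]: "Determinant.det (mat_of [] f) = 1"
  by (rule det_dim_zero) (use mat_of_carrier[of "[]" f] in simp)

lemma det_mat_of_single [simp]: "Determinant.det (mat_of [a] f) = f a a"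
  by (subst det_single) (auto simp: mat_of_def)

section \<open>Triangular and block diagonal determinants\<close>

lemma det_mat_of_lower_triangular:
  assumes "\<And>r s. r < s \<Longrightarrow> s < length xs \<Longrightarrow> f (xs ! r) (xs ! s) = 0"
  shows "Determinant.det (mat_of xs f) = (\<Prod>a\<leftarrow>xs. f a a)"
  using assms
proof (induction xs rule: rev_induct)
  case (snoc x xs)
  have "f a x = 0" if "a \<in> set xs" for a
    using snoc.prems[of _ "length xs"] that by (auto simp: in_set_conv_nth nth_append)
  moreover have "f (xs ! r) (xs ! s) = 0" if "r < s" "s < length xs" for r s
    using snoc.prems[of r s] that by (auto simp: nth_append)
  ultimately show ?case
    using snoc.IH by (subst det_mat_of_append_lower) auto
qed simp

lemma det_mat_of_diag:
  assumes "distinct xs"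
  shows "Determinant.det (mat_of xs (\<lambda>a b. if a = b then d a else 0)) = prod d (set xs)"
  by (subst det_mat_of_lower_triangular)
     (use assms in \<open>auto simp: nth_eq_iff_index_eq prod.distinct_set_conv_list\<close>)

lemma in_set_concat_nth: "a \<in> set (concat gs) \<longleftrightarrow> (\<exists>i<length gs. a \<in> set (gs ! i))"
proof -
  have "a \<in> set (concat gs) \<longleftrightarrow> (\<exists>g\<in>set gs. a \<in> set g)" by auto
  also have "\<dots> \<longleftrightarrow> (\<exists>i<length gs. a \<in> set (gs ! i))" by (simp add: set_conv_nth) blast
  finally show ?thesis .
qed

lemma det_mat_of_concat:
  assumes "\<And>i j a b. i < length gs \<Longrightarrow> j < length gs \<Longrightarrow> i \<noteq> j \<Longrightarrow> a \<in> set (gs ! i) \<Longrightarrow>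
      b \<in> set (gs ! j) \<Longrightarrow> D a b = 0"
  shows "Determinant.det (mat_of (concat gs) D) = (\<Prod>g\<leftarrow>gs. Determinant.det (mat_of g D))"
  using assms
proof (induction gs rule: rev_induct)
  case Nil
  show ?case by simp
next
  case (snoc g gs)
  have "D a b = 0" if ab: "a \<in> set (concat gs)" "b \<in> set g" for a b
  proof -
    obtain i where "i < length gs" "a \<in> set (gs ! i)"
      using ab(1) in_set_concat_nth[of a gs] by blast
    then show ?thesis
      by (intro snoc.prems[of i "length gs"]) (use ab(2) in \<open>simp_all add: nth_append\<close>)
  qed
  then have "Determinant.det (mat_of (concat gs @ g) D) =
      Determinant.det (mat_of (concat gs) D) * Determinant.det (mat_of g D)"
    by (rule det_mat_of_append_lower)
  moreover have "Determinant.det (mat_of (concat gs) D) = (\<Prod>g\<leftarrow>gs. Determinant.det (mat_of g D))"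
  proof (rule snoc.IH)
    show "D a b = 0" if "i < length gs" "j < length gs" "i \<noteq> j" "a \<in> set (gs ! i)"
      "b \<in> set (gs ! j)" for i j a b
      by (rule snoc.prems[of i j]) (use that in \<open>simp_all add: nth_append\<close>)
  qed
  ultimately show ?case by simp
qed

section \<open>Inverse matrices and their leading blocks\<close>

lemma mat_of_right_inverse:
  assumes "distinct xs" "Determinant.det (mat_of xs f) \<noteq> 0"
  shows "\<exists>g. \<forall>a\<in>set xs. \<forall>b\<in>set xs. (\<Sum>c\<in>set xs. f a c * g c b) = (if a = b then 1 else 0)"
proof -
  from det_non_zero_imp_unit[OF mat_of_carrier assms(2), of "()"]
  obtain B where B: "B \<in> carrier_mat (length xs) (length xs)" "mat_of xs f * B = 1\<^sub>m (length xs)"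
    by (auto simp: Units_def ring_mat_def)
  obtain g where g: "B = mat_of xs g" using mat_of_ex[OF assms(1) B(1)] .
  have "mat_of xs (\<lambda>a b. \<Sum>c\<in>set xs. f a c * g c b) = mat_of xs (\<lambda>a b. if a = b then 1 else 0)"
    using B(2) g assms(1) by (simp add: mat_of_mult mat_of_one)
  from mat_of_inj[OF this] show ?thesis by (intro exI[of _ g] ballI)
qed

text \<open>A right inverse of a square matrix over a field is also a left inverse, and inverses are
  unique, so the result of \<open>mat_inverse\<close> can be identified from one of the two products
  alone.\<close>

lemma mat_inverse_mat_of:
  assumes "distinct xs"
    and "\<And>a b. a \<in> set xs \<Longrightarrow> b \<in> set xs \<Longrightarrow> (\<Sum>c\<in>set xs. f a c * g c b) = (if a = b then 1 else 0)"
  shows "mat_inverse (mat_of xs f) = Some (mat_of xs g)"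
proof -
  let ?n = "length xs"
  have fg: "mat_of xs f * mat_of xs g = 1\<^sub>m ?n"
    using assms by (simp add: mat_of_mult mat_of_one cong: mat_of_cong)
  have gf: "mat_of xs g * mat_of xs f = 1\<^sub>m ?n"
    by (rule mat_mult_left_right_inverse[OF mat_of_carrier mat_of_carrier fg])
  have unit: "mat_of xs f \<in> Units (ring_mat TYPE(real) ?n ())"
    using fg gf by (auto simp: Units_def ring_mat_def intro!: bexI[of _ "mat_of xs g"])
  show ?thesis
  proof (cases "mat_inverse (mat_of xs f)")
    case None
    then show ?thesis using mat_inverse(1)[OF mat_of_carrier None, of "()"] unit by blast
  next
    case (Some B)
    from mat_inverse(2)[OF mat_of_carrier Some]
    have B: "B * mat_of xs f = 1\<^sub>m ?n" "B \<in> carrier_mat ?n ?n" by auto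
    have "B = B * (mat_of xs f * mat_of xs g)" using B(2) fg by simp
    also have "\<dots> = (B * mat_of xs f) * mat_of xs g"
      using B(2) by (intro assoc_mult_mat[symmetric]) auto
    finally show ?thesis using Some B(1) by simp
  qed
qed

text \<open>
  The upper left block of the inverse of \<open>L\<^sup>T D L\<close> is the inverse of the corresponding product
  of upper left blocks, because \<open>L\<close> is block lower triangular.
\<close>

lemma leading_block_inverse:
  fixes F D L G R :: "'k \<Rightarrow> 'k \<Rightarrow> real"
  assumes fin: "finite X" "finite Y" "X \<inter> Y = {}"
    and F: "\<And>a b. a \<in> X \<union> Y \<Longrightarrow> b \<in> X \<union> Y \<Longrightarrow> F a b = (\<Sum>c\<in>X \<union> Y. \<Sum>d\<in>X \<union> Y. L c a * D c d * L d b)"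
    and G: "\<And>a b. a \<in> X \<union> Y \<Longrightarrow> b \<in> X \<union> Y \<Longrightarrow> (\<Sum>c\<in>X \<union> Y. G a c * F c b) = (if a = b then 1 else 0)"
    and L0: "\<And>a b. a \<in> X \<Longrightarrow> b \<in> Y \<Longrightarrow> L a b = 0"
    and D0: "\<And>a b. a \<in> X \<Longrightarrow> b \<in> Y \<Longrightarrow> D a b = 0" "\<And>a b. a \<in> X \<Longrightarrow> b \<in> Y \<Longrightarrow> D b a = 0"
    and R: "\<And>a b. a \<in> Y \<Longrightarrow> b \<in> Y \<Longrightarrow> (\<Sum>c\<in>Y. L a c * R c b) = (if a = b then 1 else 0)"
    and ab: "a \<in> X" "b \<in> X"
  shows "(\<Sum>c\<in>X. G a c * (\<Sum>d\<in>X. \<Sum>e\<in>X. L d c * D d e * L e b)) = (if a = b then 1 else 0)"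
proof -
  define H where "H = (\<lambda>c b. \<Sum>d\<in>X. \<Sum>e\<in>X. L d c * D d e * L e b)"
  define K where "K = (\<lambda>d b. \<Sum>e\<in>Y. D d e * L e b)"
  define P where "P = (\<lambda>d. \<Sum>c\<in>X \<union> Y. G a c * L d c)"
  have split: "sum f (X \<union> Y) = sum f X + sum f Y" for f :: "'k \<Rightarrow> real"
    using fin by (rule sum.union_disjoint)
  have FK: "F c b = H c b + (\<Sum>d\<in>Y. L d c * K d b)" if "c \<in> X \<union> Y" "b \<in> X \<union> Y" for c b
    using that D0 by (simp add: F split H_def K_def sum.distrib sum_distrib_left mult.assoc)
  have H0: "H c b = 0" if "c \<in> Y" for c b
    using that L0 by (simp add: H_def)
  have H0': "H c b = 0" if "b \<in> Y" for c b
    using that L0 by (simp add: H_def)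
  have expand: "(if a = b then 1 else 0) = (\<Sum>c\<in>X. G a c * H c b) + (\<Sum>d\<in>Y. P d * K d b)"
    if b: "b \<in> X \<union> Y" for b
  proof -
    have "(\<Sum>c\<in>X \<union> Y. G a c * F c b) = (\<Sum>c\<in>X \<union> Y. G a c * (H c b + (\<Sum>d\<in>Y. L d c * K d b)))"
      by (intro sum.cong refl arg_cong2[where f = times] FK b)
    then have "(if a = b then 1 else 0) = (\<Sum>c\<in>X \<union> Y. G a c * (H c b + (\<Sum>d\<in>Y. L d c * K d b)))"
      using G[of a b] ab b by simp
    also have "\<dots> = (\<Sum>c\<in>X \<union> Y. G a c * H c b) + (\<Sum>c\<in>X \<union> Y. \<Sum>d\<in>Y. G a c * (L d c * K d b))"
      by (simp add: distrib_left sum.distrib sum_distrib_left)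
    also have "(\<Sum>c\<in>X \<union> Y. G a c * H c b) = (\<Sum>c\<in>X. G a c * H c b)"
      by (simp add: split H0)
    also have "(\<Sum>c\<in>X \<union> Y. \<Sum>d\<in>Y. G a c * (L d c * K d b)) = (\<Sum>d\<in>Y. P d * K d b)"
      unfolding P_def by (subst sum.swap) (simp add: sum_distrib_right mult.assoc)
    finally show ?thesis .
  qed
  \<comment> \<open>For a column in \<open>Y\<close> the left side of \<open>expand\<close> is 0,
    since the row index \<open>a\<close> lies in \<open>X\<close>, and the \<open>H\<close> term is
    0 as well; only the second sum is left.\<close>
  have PK: "(\<Sum>d\<in>Y. P d * K d b) = 0" if "b \<in> Y" for b
  proof -
    have "a \<noteq> b" using that ab fin by blast
    then show ?thesis using expand[of b] that H0' by simp
  qed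
  \<comment> \<open>\<open>PK\<close> says that P D L = 0 on \<open>Y\<close>. Multiplying by the
    right inverse \<open>R\<close> of the block of \<open>L\<close> on \<open>Y\<close> cancels
    \<open>L\<close>. With P D = 0 the second sum of \<open>expand\<close> also vanishes for columns
    in \<open>X\<close>.\<close>
  have PD: "(\<Sum>d\<in>Y. P d * D d e) = 0" if e: "e \<in> Y" for e
  proof -
    have "0 = (\<Sum>b\<in>Y. (\<Sum>d\<in>Y. P d * K d b) * R b e)"
      using PK by simp
    also have "\<dots> = (\<Sum>b\<in>Y. \<Sum>d\<in>Y. \<Sum>e'\<in>Y. P d * (D d e' * L e' b) * R b e)"
      by (simp add: K_def sum_distrib_left sum_distrib_right)
    also have "\<dots> = (\<Sum>d\<in>Y. \<Sum>b\<in>Y. \<Sum>e'\<in>Y. P d * (D d e' * L e' b) * R b e)"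
      by (rule sum.swap)
    also have "\<dots> = (\<Sum>d\<in>Y. \<Sum>e'\<in>Y. \<Sum>b\<in>Y. P d * (D d e' * L e' b) * R b e)"
      by (intro sum.cong refl sum.swap)
    also have "\<dots> = (\<Sum>d\<in>Y. \<Sum>e'\<in>Y. P d * D d e' * (\<Sum>b\<in>Y. L e' b * R b e))"
      by (simp add: sum_distrib_left mult_ac)
    also have "\<dots> = (\<Sum>d\<in>Y. \<Sum>e'\<in>Y. P d * D d e' * (if e' = e then 1 else 0))"
      using R e by (intro sum.cong refl) auto
    also have "\<dots> = (\<Sum>d\<in>Y. P d * D d e)"
      using e fin(2) by (simp add: if_distrib cong: if_cong)
    finally show ?thesis by simp
  qed
  have "(\<Sum>d\<in>Y. P d * K d b) = (\<Sum>d\<in>Y. \<Sum>e\<in>Y. P d * D d e * L e b)"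
    by (simp add: K_def sum_distrib_left mult.assoc)
  also have "\<dots> = (\<Sum>e\<in>Y. (\<Sum>d\<in>Y. P d * D d e) * L e b)"
    by (subst sum.swap) (simp add: sum_distrib_right)
  also have "\<dots> = 0" using PD by simp
  finally show ?thesis
    using expand[of b] ab by (simp add: H_def)
qed

text \<open>
  A block diagonal matrix whose blocks are \<open>w \<cdot> (diag q - q q\<^sup>T)\<close>; the two
  factorizations of the bordered matrix give its determinant.
\<close>

lemma det_multinomial_blocks:
  fixes q :: "'k \<Rightarrow> real" and w :: "'b \<Rightarrow> real" and \<beta> :: "'k \<Rightarrow> 'b"
  assumes "distinct xs" "distinct bs" "\<beta> ` set xs \<subseteq> set bs"
  shows "Determinant.det (mat_of xs (\<lambda>a b. if \<beta> a = \<beta> b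
            then w (\<beta> a) * ((if a = b then q a else 0) - q a * q b) else 0)) =
         (\<Prod>s\<in>set bs. 1 - (\<Sum>a | a \<in> set xs \<and> \<beta> a = s. q a)) * (\<Prod>a\<in>set xs. w (\<beta> a) * q a)"
    (is "Determinant.det (mat_of xs ?W) = ?B * ?P")
proof -
  define zs where "zs = map Inl bs @ map Inr xs"
  \<comment> \<open>\<open>M\<close> is diag(w q) bordered by one row and one column per block. Row
    operations by \<open>L\<close> clear the lower left part and leave the wanted matrix as Schur
    complement; column operations by \<open>U\<close> clear it too and leave the numbers 1 - sum of
    q as the other Schur complement. Both \<open>L\<close> and \<open>U\<close> have determinant
    1.\<close>
  define M where "M = (\<lambda>u v. case u of
      Inl s \<Rightarrow> (case v of Inl t \<Rightarrow> if s = t then 1 else 0 | Inr a \<Rightarrow> if \<beta> a = s then q a else 0)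
    | Inr b \<Rightarrow> (case v of Inl s \<Rightarrow> if \<beta> b = s then w s * q b else 0
                 | Inr a \<Rightarrow> if a = b then w (\<beta> a) * q a else (0::real)))"
  define L where "L = (\<lambda>u v. case u of
      Inl s \<Rightarrow> (case v of Inl t \<Rightarrow> if s = t then 1 else 0 | Inr a \<Rightarrow> 0)
    | Inr b \<Rightarrow> (case v of Inl s \<Rightarrow> if \<beta> b = s then - w s * q b else 0
                 | Inr a \<Rightarrow> if a = b then 1 else (0::real)))"
  define U where "U = (\<lambda>u v. case u of
      Inl s \<Rightarrow> (case v of Inl t \<Rightarrow> if s = t then 1 else 0 | Inr a \<Rightarrow> 0)
    | Inr b \<Rightarrow> (case v of Inl s \<Rightarrow> if \<beta> b = s then - 1 else 0
                 | Inr a \<Rightarrow> if a = b then 1 else (0::real)))"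
  have dist: "distinct zs" using assms by (auto simp: zs_def distinct_map)
  have setz: "set zs = Inl ` set bs \<union> Inr ` set xs" by (auto simp: zs_def)
  have sum_zs: "sum f (set zs) = (\<Sum>s\<in>set bs. f (Inl s)) + (\<Sum>a\<in>set xs. f (Inr a))" for f :: "_ \<Rightarrow> real"
    unfolding setz by (subst sum.union_disjoint) (auto simp: sum.reindex)
  have det_Inl: "Determinant.det (mat_of (map Inl bs) f) = Determinant.det (mat_of bs (\<lambda>s t. f (Inl s) (Inl t)))"
    and det_Inr: "Determinant.det (mat_of (map Inr xs) f) = Determinant.det (mat_of xs (\<lambda>s t. f (Inr s) (Inr t)))"
    for f :: "'b + 'k \<Rightarrow> 'b + 'k \<Rightarrow> real"
    by (auto intro!: arg_cong[where f = Determinant.det] eq_matI)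
  have one_bs: "Determinant.det (mat_of bs (\<lambda>s t. if s = t then 1 else 0)) = 1"
    using det_mat_of_diag[OF assms(2), of "\<lambda>_. 1"] by simp
  have one_xs: "Determinant.det (mat_of xs (\<lambda>s t. if s = t then 1 else 0)) = 1"
    "Determinant.det (mat_of xs (\<lambda>s t. if t = s then 1 else 0)) = 1"
  proof -
    show 1: "Determinant.det (mat_of xs (\<lambda>s t. if s = t then 1 else 0)) = 1"
      using det_mat_of_diag[OF assms(1), of "\<lambda>_. 1"] by simp
    have "(\<lambda>s t. if t = s then 1 else (0::real)) = (\<lambda>s t :: 'k. if s = t then 1 else 0)"
      by (intro ext) auto
    then show "Determinant.det (mat_of xs (\<lambda>s t. if t = s then 1 else 0)) = 1"
      using 1 by simp
  qed
  have detL: "Determinant.det (mat_of zs L) = 1" "Determinant.det (mat_of zs U) = 1"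
    unfolding zs_def
    by (subst det_mat_of_append_lower, auto simp: L_def U_def det_Inl det_Inr one_bs one_xs)+
  have LM: "Determinant.det (mat_of zs (\<lambda>u v. \<Sum>x\<in>set zs. L u x * M x v)) = Determinant.det (mat_of xs ?W)"
  proof -
    have "Determinant.det (mat_of zs (\<lambda>u v. \<Sum>x\<in>set zs. L u x * M x v)) =
      Determinant.det (mat_of bs (\<lambda>s t. if s = t then 1 else 0)) *  Determinant.det (mat_of xs ?W)"
      unfolding zs_def
    proof (subst det_mat_of_append_upper)
      fix u v :: "'b + 'k" assume "u \<in> set (map Inr xs)" "v \<in> set (map Inl bs)"
      then obtain a s where as: "u = Inr a" "v = Inl s" "a \<in> set xs" "s \<in> set bs" by auto
      have "(\<Sum>x\<in>set bs. L (Inr a) (Inl x) * M (Inl x) (Inl s)) =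
          (\<Sum>x\<in>set bs. if x = s then (if \<beta> a = s then - w s * q a else 0) else 0)"
        by (intro sum.cong) (auto simp: L_def M_def)
      moreover have "(\<Sum>x\<in>set xs. L (Inr a) (Inr x) * M (Inr x) (Inl s)) =
          (\<Sum>x\<in>set xs. if x = a then (if \<beta> a = s then w s * q a else 0) else 0)"
        by (intro sum.cong) (auto simp: L_def M_def)
      ultimately show "(\<Sum>x\<in>set (map Inl bs @ map Inr xs). L u x * M x v) = 0"
        unfolding zs_def[symmetric] sum_zs using as by simp
    next
      have 1: "mat_of bs (\<lambda>s t. \<Sum>x\<in>set zs. L (Inl s) x * M x (Inl t)) = mat_of bs (\<lambda>s t. if s = t then 1 else 0)"
        unfolding sum_zs
      proof (intro mat_of_cong)
        fix s t assume st: "s \<in> set bs" "t \<in> set bs"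
        have "(\<Sum>x\<in>set bs. L (Inl s) (Inl x) * M (Inl x) (Inl t)) =
          (\<Sum>x\<in>set bs. if x = s then (if s = t then 1 else 0) else 0)"
          by (intro sum.cong) (auto simp: L_def M_def)
        moreover have "(\<Sum>x\<in>set xs. L (Inl s) (Inr x) * M (Inr x) (Inl t)) = 0"
          by (intro sum.neutral) (auto simp: L_def M_def)
        ultimately show "(\<Sum>x\<in>set bs. L (Inl s) (Inl x) * M (Inl x) (Inl t)) +
          (\<Sum>x\<in>set xs. L (Inl s) (Inr x) * M (Inr x) (Inl t)) = (if s = t then 1 else 0)"
          using st by simp
      qed
      have 2: "mat_of xs (\<lambda>s t. \<Sum>x\<in>set zs. L (Inr s) x * M x (Inr t)) = mat_of xs ?W"
        unfolding sum_zs
      proof (intro mat_of_cong)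
        fix a b assume ab: "a \<in> set xs" "b \<in> set xs"
        have "(\<Sum>s\<in>set bs. L (Inr a) (Inl s) * M (Inl s) (Inr b)) =
          (\<Sum>s\<in>set bs. if s = \<beta> a then (if \<beta> b = s then - w s * q a * q b else 0) else 0)"
          by (intro sum.cong) (auto simp: L_def M_def)
        moreover have "(\<Sum>x\<in>set xs. L (Inr a) (Inr x) * M (Inr x) (Inr b)) =
          (\<Sum>x\<in>set xs. if x = a then (if x = b then w (\<beta> b) * q b else 0) else 0)"
          by (intro sum.cong) (auto simp: L_def M_def)
        ultimately show "(\<Sum>s\<in>set bs. L (Inr a) (Inl s) * M (Inl s) (Inr b)) +
          (\<Sum>x\<in>set xs. L (Inr a) (Inr x) * M (Inr x) (Inr b)) = ?W a b"
          using ab assms by (auto simp: algebra_simps)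
      qed
      show "Determinant.det (mat_of (map Inl bs) (\<lambda>u v. \<Sum>x\<in>set (map Inl bs @ map Inr xs). L u x * M x v)) *
        Determinant.det (mat_of (map Inr xs) (\<lambda>u v. \<Sum>x\<in>set (map Inl bs @ map Inr xs). L u x * M x v)) =
        Determinant.det (mat_of bs (\<lambda>s t. if s = t then 1 else 0)) * Determinant.det (mat_of xs ?W)"
        unfolding zs_def[symmetric] det_Inl det_Inr 1 2 ..
    qed
    then show ?thesis by (simp add: one_bs)
  qed
  have MU: "Determinant.det (mat_of zs (\<lambda>u v. \<Sum>x\<in>set zs. M u x * U x v)) = ?B * ?P"
  proof -
    have "Determinant.det (mat_of zs (\<lambda>u v. \<Sum>x\<in>set zs. M u x * U x v)) =
      Determinant.det (mat_of bs (\<lambda>s t. if s = t then 1 - (\<Sum>a | a \<in> set xs \<and> \<beta> a = s. q a) else 0)) *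
      Determinant.det (mat_of xs (\<lambda>a b. if a = b then w (\<beta> a) * q a else 0))"
      unfolding zs_def
    proof (subst det_mat_of_append_upper)
      fix u v :: "'b + 'k" assume "u \<in> set (map Inr xs)" "v \<in> set (map Inl bs)"
      then obtain a s where as: "u = Inr a" "v = Inl s" "a \<in> set xs" "s \<in> set bs" by auto
      have "(\<Sum>x\<in>set bs. M (Inr a) (Inl x) * U (Inl x) (Inl s)) =
          (\<Sum>x\<in>set bs. if x = s then (if \<beta> a = s then w s * q a else 0) else 0)"
        by (intro sum.cong) (auto simp: U_def M_def)
      moreover have "(\<Sum>x\<in>set xs. M (Inr a) (Inr x) * U (Inr x) (Inl s)) =
          (\<Sum>x\<in>set xs. if x = a then (if \<beta> a = s then - w s * q a else 0) else 0)"
        by (intro sum.cong) (auto simp: U_def M_def)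
      ultimately show "(\<Sum>x\<in>set (map Inl bs @ map Inr xs). M u x * U x v) = 0"
        unfolding zs_def[symmetric] sum_zs using as by simp
    next
      have 1: "mat_of bs (\<lambda>s t. \<Sum>x\<in>set zs. M (Inl s) x * U x (Inl t)) =
        mat_of bs (\<lambda>s t. if s = t then 1 - (\<Sum>a | a \<in> set xs \<and> \<beta> a = s. q a) else 0)"
        unfolding sum_zs
      proof (intro mat_of_cong)
        fix s t assume st: "s \<in> set bs" "t \<in> set bs"
        have "(\<Sum>x\<in>set bs. M (Inl s) (Inl x) * U (Inl x) (Inl t)) =
          (\<Sum>x\<in>set bs. if x = s then (if s = t then 1 else 0) else 0)"
          by (intro sum.cong) (auto simp: U_def M_def)
        moreover have "(\<Sum>x\<in>set xs. M (Inl s) (Inr x) * U (Inr x) (Inl t)) =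
          (\<Sum>x\<in>set xs. if \<beta> x = s then (if s = t then - q x else 0) else 0)"
          by (intro sum.cong) (auto simp: U_def M_def)
        moreover have "(\<Sum>x\<in>set xs. if \<beta> x = s then - q x else 0) = - (\<Sum>a | a \<in> set xs \<and> \<beta> a = s. q a)"
          by (simp add: sum.If_cases Int_def sum_negf)
        ultimately show "(\<Sum>x\<in>set bs. M (Inl s) (Inl x) * U (Inl x) (Inl t)) +
          (\<Sum>x\<in>set xs. M (Inl s) (Inr x) * U (Inr x) (Inl t)) =
          (if s = t then 1 - (\<Sum>a | a \<in> set xs \<and> \<beta> a = s. q a) else 0)"
          using st by (cases "s = t") (simp_all only: if_True if_False refl sum.delta sum.neutral_const List.finite_set, simp_all)
      qed
      have 2: "mat_of xs (\<lambda>s t. \<Sum>x\<in>set zs. M (Inr s) x * U x (Inr t)) =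
        mat_of xs (\<lambda>a b. if a = b then w (\<beta> a) * q a else 0)"
        unfolding sum_zs
      proof (intro mat_of_cong)
        fix a b assume ab: "a \<in> set xs" "b \<in> set xs"
        have "(\<Sum>x\<in>set bs. M (Inr a) (Inl x) * U (Inl x) (Inr b)) = 0"
          by (intro sum.neutral) (auto simp: U_def M_def)
        moreover have "(\<Sum>x\<in>set xs. M (Inr a) (Inr x) * U (Inr x) (Inr b)) =
          (\<Sum>x\<in>set xs. if x = a then (if a = b then w (\<beta> a) * q a else 0) else 0)"
          by (intro sum.cong) (auto simp: U_def M_def)
        ultimately show "(\<Sum>x\<in>set bs. M (Inr a) (Inl x) * U (Inl x) (Inr b)) +
          (\<Sum>x\<in>set xs. M (Inr a) (Inr x) * U (Inr x) (Inr b)) = (if a = b then w (\<beta> a) * q a else 0)"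
          using ab by simp
      qed
      show "Determinant.det (mat_of (map Inl bs) (\<lambda>u v. \<Sum>x\<in>set (map Inl bs @ map Inr xs). M u x * U x v)) *
        Determinant.det (mat_of (map Inr xs) (\<lambda>u v. \<Sum>x\<in>set (map Inl bs @ map Inr xs). M u x * U x v)) =
        Determinant.det (mat_of bs (\<lambda>s t. if s = t then 1 - (\<Sum>a | a \<in> set xs \<and> \<beta> a = s. q a) else 0)) *
        Determinant.det (mat_of xs (\<lambda>a b. if a = b then w (\<beta> a) * q a else 0))"
        unfolding zs_def[symmetric] det_Inl det_Inr 1 2 ..
    qed
    then show ?thesis by (simp add: det_mat_of_diag assms)
  qed
  have "Determinant.det (mat_of xs ?W) = Determinant.det (mat_of zs L) * Determinant.det (mat_of zs M)"
    using LM det_mat_of_mult[OF dist, of L M] by simp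
  also have "\<dots> = Determinant.det (mat_of zs M) * Determinant.det (mat_of zs U)"
    by (simp add: detL)
  also have "\<dots> = ?B * ?P"
    using MU det_mat_of_mult[OF dist, of M U] by simp
  finally show ?thesis .
qed

section \<open>The blocks h_j under a block triangular change of coordinates\<close>

lemma concat_split:
  assumes "j < length gs"
  shows "concat gs = concat (take (Suc j) gs) @ concat (drop (Suc j) gs)"
    and "concat (take (Suc j) gs) = concat (take j gs) @ gs ! j"
  by (metis append_take_drop_id concat_append)
     (simp add: take_Suc_conv_app_nth assms)

lemma in_set_concat_take:
  "a \<in> set (concat (take j gs)) \<longleftrightarrow> (\<exists>i<min j (length gs). a \<in> set (gs ! i))"
  unfolding in_set_concat_nth by (auto simp: conj_ac)

lemma in_set_concat_drop:
  assumes "j \<le> length gs"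
  shows "a \<in> set (concat (drop j gs)) \<longleftrightarrow> (\<exists>i<length gs. j \<le> i \<and> a \<in> set (gs ! i))"
proof -
  have "a \<in> set (concat (drop j gs)) \<longleftrightarrow> (\<exists>k<length gs - j. a \<in> set (gs ! (j + k)))"
    unfolding in_set_concat_nth using assms by (intro arg_cong[where f = Ex] ext) auto
  also have "\<dots> \<longleftrightarrow> (\<exists>i<length gs. j \<le> i \<and> a \<in> set (gs ! i))"
    by (metis add.commute le_add_diff_inverse less_diff_conv le_add1)
  finally show ?thesis .
qed

text \<open>The shape of the Jacobian of a map that adds to each group functions of the preceding
  groups: block lower triangular with identity blocks on the diagonal. Peeling off the last group
  gives determinant 1.\<close>

lemma det_group_triangular:
  assumes "distinct (concat gs)"
    and L: "\<And>i j a c. i \<le> j \<Longrightarrow> j < length gs \<Longrightarrow> c \<in> set (gs ! i) \<Longrightarrow> a \<in> set (gs ! j) \<Longrightarrow>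
        L c a = (if c = a then 1 else 0)"
  shows "Determinant.det (mat_of (concat gs) L) = 1"
  using assms
proof (induction gs rule: rev_induct)
  case Nil
  show ?case by simp
next
  case (snoc g gs)
  have L0: "L c a = 0" if ca: "c \<in> set (concat gs)" "a \<in> set g" for a c
  proof -
    obtain i where i: "i < length gs" "c \<in> set (gs ! i)"
      using ca(1) unfolding in_set_concat_nth by blast
    have "c \<noteq> a" using snoc.prems(1) ca by auto
    then show ?thesis using snoc.prems(2)[of i "length gs" c a] i ca by (auto simp: nth_append)
  qed
  have "Determinant.det (mat_of (concat gs) L) = 1"
  proof (rule snoc.IH)
    show "distinct (concat gs)" using snoc.prems(1) by simp
    show "L c a = (if c = a then 1 else 0)" if "i \<le> j" "j < length gs" "c \<in> set (gs ! i)" "a \<in> set (gs ! j)" for i j a c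
      using snoc.prems(2)[of i j c a] that by (simp add: nth_append)
  qed
  moreover have "Determinant.det (mat_of (concat gs @ g) L) =
      Determinant.det (mat_of (concat gs) L) * Determinant.det (mat_of g L)"
    by (rule det_mat_of_append_lower[OF L0])
  moreover have "mat_of g L = mat_of g (\<lambda>a b. if a = b then 1 else 0)"
    using snoc.prems(2)[of "length gs" "length gs"] by (intro mat_of_cong) auto
  ultimately show ?case
    using snoc.prems(1) by (simp add: det_mat_of_diag)
qed

text \<open>By \<open>leading_block_inverse\<close>, inverting the leading block of Sigma gives the
  product of L^T, D and L restricted to the groups up to \<open>j\<close>. On these groups the
  columns of \<open>L\<close> that belong to group \<open>j\<close> are unit vectors, so the lower
  right block of that product is the block of \<open>D\<close> itself.\<close>

lemma h_block_triangular:
  assumes dist: "distinct (concat gs)"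
    and F: "fisher_mat X f (concat gs) u = mat_of (concat gs)
      (\<lambda>a b. \<Sum>c\<in>set (concat gs). \<Sum>d\<in>set (concat gs). L c a * D c d * L d b)"
    and L: "\<And>i j a c. i \<le> j \<Longrightarrow> j < length gs \<Longrightarrow> c \<in> set (gs ! i) \<Longrightarrow> a \<in> set (gs ! j) \<Longrightarrow>
        L c a = (if c = a then 1 else 0)"
    and D0: "\<And>i j a b. i < length gs \<Longrightarrow> j < length gs \<Longrightarrow> i \<noteq> j \<Longrightarrow> a \<in> set (gs ! i) \<Longrightarrow>
        b \<in> set (gs ! j) \<Longrightarrow> D a b = 0"
    and Ddet: "\<And>j. j < length gs \<Longrightarrow> Determinant.det (mat_of (gs ! j) D) \<noteq> 0"
    and j: "j < length gs"
  shows "h_block X f gs j u = mat_of (gs ! j) D"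
proof -
  define as where "as = concat gs"
  define xs where "xs = concat (take (Suc j) gs)"
  define ys where "ys = concat (drop (Suc j) gs)"
  define Fm where "Fm = (\<lambda>a b. \<Sum>c\<in>set as. \<Sum>d\<in>set as. L c a * D c d * L d b)"
  have as: "as = xs @ ys" and xs: "xs = concat (take j gs) @ gs ! j"
    using concat_split[OF j] by (simp_all add: as_def xs_def ys_def)
  have dx: "distinct as" "distinct xs" "distinct ys" "set xs \<inter> set ys = {}"
    using dist as unfolding as_def[symmetric] by auto
  have inx: "a \<in> set xs \<longleftrightarrow> (\<exists>i\<le>j. a \<in> set (gs ! i))" for a
    unfolding xs_def in_set_concat_take using j by (auto simp: less_Suc_eq_le)
  have iny: "a \<in> set ys \<longleftrightarrow> (\<exists>i<length gs. j < i \<and> a \<in> set (gs ! i))" for a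
    unfolding ys_def using in_set_concat_drop[of "Suc j" gs a] j by (auto simp: Suc_le_eq)
  have LDxy: "L a b = 0 \<and> D a b = 0 \<and> D b a = 0" if ab: "a \<in> set xs" "b \<in> set ys" for a b
  proof -
    obtain i k where ik: "i \<le> j" "a \<in> set (gs ! i)" "k < length gs" "j < k" "b \<in> set (gs ! k)"
      using ab inx iny by blast
    have "a \<noteq> b" using ab dx(4) by auto
    then show ?thesis using L[of i k a b] D0[of i k a b] D0[of k i b a] ik j by simp
  qed
  have "Determinant.det (mat_of as D) \<noteq> 0"
  proof -
    have "Determinant.det (mat_of as D) = (\<Prod>g\<leftarrow>gs. Determinant.det (mat_of g D))"
      unfolding as_def by (rule det_mat_of_concat[OF D0])
    moreover have "Determinant.det (mat_of g D) \<noteq> 0" if "g \<in> set gs" for g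
      using that Ddet by (metis in_set_conv_nth)
    ultimately show ?thesis by (metis (mono_tags, lifting) imageE list.set_map prod_list_zero_iff)
  qed
  moreover have "Determinant.det (mat_of as L) = 1"
    unfolding as_def by (rule det_group_triangular[OF dist L])
  ultimately have "Determinant.det (mat_of as Fm) \<noteq> 0"
    unfolding Fm_def by (subst det_mat_of_congruence) (use dx in auto)
  from mat_of_right_inverse[OF dx(1) this]
  obtain G where "\<forall>a\<in>set as. \<forall>b\<in>set as. (\<Sum>c\<in>set as. Fm a c * G c b) = (if a = b then 1 else 0)" ..
  then have FG: "(\<Sum>c\<in>set as. Fm a c * G c b) = (if a = b then 1 else 0)"
    if "a \<in> set as" "b \<in> set as" for a b using that by blast
  have inv: "mat_inverse (fisher_mat X f (concat gs) u) = Some (mat_of as G)"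
    using mat_inverse_mat_of[OF dx(1) FG] F by (simp add: Fm_def as_def)
  have GF: "(\<Sum>c\<in>set as. G a c * Fm c b) = (if a = b then 1 else 0)" if "a \<in> set as" "b \<in> set as" for a b
  proof -
    have "mat_of as Fm * mat_of as G = 1\<^sub>m (length as)"
      using FG dx(1) by (simp add: mat_of_mult mat_of_one cong: mat_of_cong)
    then have "mat_of as G * mat_of as Fm = 1\<^sub>m (length as)"
      by (rule mat_mult_left_right_inverse[OF mat_of_carrier mat_of_carrier])
    then show ?thesis
      using mat_of_inj[of as "\<lambda>a b. \<Sum>c\<in>set as. G a c * Fm c b" "\<lambda>a b. if a = b then 1 else 0" a b] that dx(1)
      by (simp add: mat_of_mult mat_of_one)
  qed
  \<comment> \<open>The later groups form a block triangular matrix by themselves; its right inverse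
    is the \<open>R\<close> required by \<open>leading_block_inverse\<close>.\<close>
  have "Determinant.det (mat_of ys L) = 1"
    unfolding ys_def
  proof (rule det_group_triangular)
    show "distinct (concat (drop (Suc j) gs))" using dx by (simp add: ys_def)
  next
    fix i k a c assume "i \<le> k" "k < length (drop (Suc j) gs)" "c \<in> set (drop (Suc j) gs ! i)" "a \<in> set (drop (Suc j) gs ! k)"
    then show "L c a = (if c = a then 1 else 0)"
      using L[of "Suc j + i" "Suc j + k" c a] by auto
  qed
  then have "Determinant.det (mat_of ys L) \<noteq> 0" by simp
  from mat_of_right_inverse[OF dx(3) this]
  obtain R where "\<forall>a\<in>set ys. \<forall>b\<in>set ys. (\<Sum>c\<in>set ys. L a c * R c b) = (if a = b then 1 else 0)" ..
  then have R: "(\<Sum>c\<in>set ys. L a c * R c b) = (if a = b then 1 else 0)"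
    if "a \<in> set ys" "b \<in> set ys" for a b using that by blast
  have setas: "set as = set xs \<union> set ys" by (simp add: as)
  define H where "H = (\<lambda>a b. \<Sum>c\<in>set xs. \<Sum>d\<in>set xs. L c a * D c d * L d b)"
  have GH: "(\<Sum>c\<in>set xs. G a c * H c b) = (if a = b then 1 else 0)" if abx: "a \<in> set xs" "b \<in> set xs" for a b
    unfolding H_def
  proof (rule leading_block_inverse[where F = Fm and Y = "set ys" and R = R and G = G])
    show "Fm a b = (\<Sum>c\<in>set xs \<union> set ys. \<Sum>d\<in>set xs \<union> set ys. L c a * D c d * L d b)" for a b
      unfolding Fm_def setas ..
    show "(\<Sum>c\<in>set xs \<union> set ys. G a c * Fm c b) = (if a = b then 1 else 0)"
      if "a \<in> set xs \<union> set ys" "b \<in> set xs \<union> set ys" for a b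
      using GF[unfolded setas, OF that] .
    show "L a b = 0" "D a b = 0" "D b a = 0" if "a \<in> set xs" "b \<in> set ys" for a b
      using LDxy[OF that] by simp_all
  qed (rule R abx dx(4) List.finite_set | assumption)+
  have "sigma_block X f gs j u = mat_of xs G"
    unfolding sigma_block_def inv Let_def xs_def[symmetric] option.sel
    by (rule eq_matI) (auto simp: as nth_append)
  then have sig: "mat_inverse (sigma_block X f gs j u) = Some (mat_of xs H)"
    using mat_inverse_mat_of[OF dx(2) GH] by simp
  have HD: "H a b = D a b" if ab: "a \<in> set (gs ! j)" "b \<in> set (gs ! j)" for a b
  proof -
    have Lc: "L c a = (if c = a then 1 else 0)" if ca: "c \<in> set xs" "a \<in> set (gs ! j)" for c a
    proof -
      obtain i where "i \<le> j" "c \<in> set (gs ! i)" using ca(1) inx by blast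
      then show ?thesis by (rule L[OF _ j _ ca(2)])
    qed
    have abx: "a \<in> set xs" "b \<in> set xs" using ab inx by auto
    have "H a b = (\<Sum>c\<in>set xs. \<Sum>d\<in>set xs. if d = b then (if c = a then D c d else 0) else 0)"
      unfolding H_def by (intro sum.cong refl) (auto simp: Lc ab)
    also have "\<dots> = D a b" using abx by simp
    finally show ?thesis .
  qed
  show ?thesis
    unfolding h_block_def sig Let_def option.sel
    by (rule eq_matI) (simp_all add: xs nth_append HD)
qed

section \<open>Fisher information of multinomial models\<close>

lemma finite_counts: "finite X \<Longrightarrow> finite (counts X N)"
proof (rule finite_subset)
  assume "finite X"
  show "counts X N \<subseteq> X \<rightarrow>\<^sub>E {..N}"
  proof
    fix n assume n: "n \<in> counts X N"
    have "n i \<le> N" if "i \<in> X" for i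
    proof -
      have "n i \<le> (\<Sum>i\<in>X. n i)" using \<open>finite X\<close> that by (simp add: member_le_sum)
      then show ?thesis using n by (simp add: counts_def)
    qed
    then show "n \<in> X \<rightarrow>\<^sub>E {..N}" using n by (auto simp: counts_def PiE_iff)
  qed
  show "finite (X \<rightarrow>\<^sub>E {..N})" using \<open>finite X\<close> by (intro finite_PiE) auto
qed

lemma sum_counts_insert:
  assumes "finite X" "x \<notin> X"
  shows "sum h (counts (insert x X) N) = (\<Sum>k\<le>N. \<Sum>n\<in>counts X (N - k). h (n(x := k)))"
proof -
  have "(\<Sum>k\<le>N. \<Sum>n\<in>counts X (N - k). h (n(x := k))) =
      (\<Sum>(k, n)\<in>Sigma {..N} (\<lambda>k. counts X (N - k)). h (n(x := k)))"
    by (rule sum.Sigma) (use assms finite_counts in blast)+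
  also have "\<dots> = sum h (counts (insert x X) N)"
  \<comment> \<open>Count vectors are \<open>undefined\<close> off their index set, so dropping the
    coordinate \<open>x\<close> means resetting it to \<open>undefined\<close>.\<close>
  proof (rule sum.reindex_bij_witness[where i = "\<lambda>m. (m x, m(x := undefined))" and j = "\<lambda>(k, n). n(x := k)"])
    fix a assume "a \<in> Sigma {..N} (\<lambda>k. counts X (N - k))"
    then obtain k n where a: "a = (k, n)" "k \<le> N" "n \<in> extensional X" "sum n X = N - k"
      by (auto simp: counts_def PiE_def)
    have nx: "n x = undefined" using a(3) assms(2) by (auto simp: extensional_def)
    then have "n(x := undefined) = n" by auto
    then show "((case a of (k, n) \<Rightarrow> n(x := k)) x, (case a of (k, n) \<Rightarrow> n(x := k))(x := undefined)) = a"
      using a(1) by simp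
    have "sum (n(x := k)) X = sum n X" using assms(2) by (intro sum.cong) auto
    then show "(case a of (k, n) \<Rightarrow> n(x := k)) \<in> counts (insert x X) N"
      using a assms by (auto simp: counts_def PiE_def extensional_def)
    show "h (case a of (k, n) \<Rightarrow> n(x := k)) = (case a of (k, n) \<Rightarrow> h (n(x := k)))"
      using a(1) by simp
  next
    fix m assume m: "m \<in> counts (insert x X) N"
    show "(case (m x, m(x := undefined)) of (k, n) \<Rightarrow> n(x := k)) = m" by simp
    have "sum (m(x := undefined)) X = sum m X" using assms(2) by (intro sum.cong) auto
    then show "(m x, m(x := undefined)) \<in> Sigma {..N} (\<lambda>k. counts X (N - k))"
      using m assms by (auto simp: counts_def PiE_def extensional_def)
  qed
  finally show ?thesis by simp
qed

text \<open>Stated for arbitrary real weights: applied to the tilted weights p_i exp(t a_i + s b_i)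
  it becomes the moment generating function of two linear forms in the counts.\<close>

lemma sum_multinomial_prob:
  fixes p :: "'c \<Rightarrow> real"
  assumes "finite X"
  shows "(\<Sum>n\<in>counts X N. multinomial_prob X N p n) = (\<Sum>i\<in>X. p i) ^ N"
  using assms
proof (induction X arbitrary: N)
  case empty
  have "(counts {} N :: ('c \<Rightarrow> nat) set) = (if N = 0 then {\<lambda>_. undefined} else {})" by (auto simp: counts_def)
  then show ?case by (cases "N = 0") (simp_all add: multinomial_prob_def)
next
  case (insert x X)
  have step: "multinomial_prob (insert x X) N p (n(x := k)) =
      real (N choose k) * p x ^ k * multinomial_prob X (N - k) p n" if "k \<le> N" for n k
  proof -
    have eq: "(\<Prod>i\<in>X. fact ((n(x := k)) i)) = (\<Prod>i\<in>X. (fact (n i)::real))"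
      "(\<Prod>i\<in>X. p i ^ (n(x := k)) i) = (\<Prod>i\<in>X. p i ^ n i)"
      using insert.hyps by (auto intro!: prod.cong)
    have nz: "(\<Prod>i\<in>X. (fact (n i)::real)) \<noteq> 0" using insert.hyps by simp
    show ?thesis
      unfolding multinomial_prob_def prod.insert[OF insert.hyps] eq
      using that nz by (simp add: binomial_fact field_simps)
  qed
  have "(\<Sum>n\<in>counts (insert x X) N. multinomial_prob (insert x X) N p n) =
      (\<Sum>k\<le>N. \<Sum>n\<in>counts X (N - k). real (N choose k) * p x ^ k * multinomial_prob X (N - k) p n)"
    unfolding sum_counts_insert[OF insert.hyps] by (intro sum.cong refl) (simp add: step)
  also have "\<dots> = (\<Sum>k\<le>N. real (N choose k) * p x ^ k * (\<Sum>i\<in>X. p i) ^ (N - k))"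
    by (simp only: sum_distrib_left[symmetric] insert.IH)
  also have "\<dots> = (\<Sum>i\<in>insert x X. p i) ^ N"
    using insert.hyps by (simp add: binomial_ring)
  finally show ?case .
qed

text \<open>Mixed second moments by differentiating the moment generating function.\<close>

lemma multinomial_second_moment:
  fixes a b p :: "'c \<Rightarrow> real"
  assumes fin: "finite X" and p1: "sum p X = 1" and pa: "(\<Sum>i\<in>X. p i * a i) = 0"
  shows "(\<Sum>n\<in>counts X N. multinomial_prob X N p n *
      ((\<Sum>i\<in>X. real (n i) * a i) * (\<Sum>i\<in>X. real (n i) * b i))) = real N * (\<Sum>i\<in>X. p i * (a i * b i))"
proof -
  define A where "A = (\<lambda>n :: 'c \<Rightarrow> nat. \<Sum>i\<in>X. real (n i) * a i)"
  define B where "B = (\<lambda>n :: 'c \<Rightarrow> nat. \<Sum>i\<in>X. real (n i) * b i)"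
  let ?P = "multinomial_prob X N p"
  have mgf: "(\<Sum>n\<in>counts X N. ?P n * exp (t * A n + s * B n)) =
      (\<Sum>i\<in>X. p i * exp (t * a i + s * b i)) ^ N" for t s
  proof -
    have "multinomial_prob X N (\<lambda>i. p i * exp (t * a i + s * b i)) n = ?P n * exp (t * A n + s * B n)" for n
    proof -
      have "(\<Prod>i\<in>X. exp (t * a i + s * b i) ^ n i) = exp (\<Sum>i\<in>X. real (n i) * (t * a i + s * b i))"
        by (simp add: exp_sum fin exp_of_nat_mult)
      also have "(\<Sum>i\<in>X. real (n i) * (t * a i + s * b i)) = t * A n + s * B n"
        by (simp add: A_def B_def sum_distrib_left sum.distrib[symmetric] algebra_simps)
      finally show ?thesis
        by (simp add: multinomial_prob_def power_mult_distrib prod.distrib)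
    qed
    then show ?thesis
      using sum_multinomial_prob[OF fin, of N "\<lambda>i. p i * exp (t * a i + s * b i)"] by simp
  qed
  have d1: "(\<Sum>n\<in>counts X N. ?P n * (exp (t * A n) * B n)) =
      real N * (\<Sum>i\<in>X. p i * exp (t * a i)) ^ (N - 1) * (\<Sum>i\<in>X. p i * (exp (t * a i) * b i))" for t
  proof -
    have "((\<lambda>s. \<Sum>n\<in>counts X N. ?P n * exp (t * A n + s * B n)) has_real_derivative
        (\<Sum>n\<in>counts X N. ?P n * (exp (t * A n) * B n))) (at 0)"
      by (intro DERIV_sum) (auto intro!: derivative_eq_intros)
    moreover have "((\<lambda>s. (\<Sum>i\<in>X. p i * exp (t * a i + s * b i)) ^ N) has_real_derivative
        real N * (\<Sum>i\<in>X. p i * exp (t * a i)) ^ (N - 1) * (\<Sum>i\<in>X. p i * (exp (t * a i) * b i))) (at 0)"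
    proof -
      have "((\<lambda>s. \<Sum>i\<in>X. p i * exp (t * a i + s * b i)) has_real_derivative
          (\<Sum>i\<in>X. p i * (exp (t * a i) * b i))) (at 0)"
        by (intro DERIV_sum) (auto intro!: derivative_eq_intros)
      from DERIV_power[OF this, of N] show ?thesis by (simp add: mult_ac)
    qed
    ultimately show ?thesis unfolding mgf by (rule DERIV_unique)
  qed
  have "((\<lambda>t. \<Sum>n\<in>counts X N. ?P n * (exp (t * A n) * B n)) has_real_derivative
      (\<Sum>n\<in>counts X N. ?P n * (A n * B n))) (at 0)"
    by (intro DERIV_sum) (auto intro!: derivative_eq_intros)
  moreover have "((\<lambda>t. real N * (\<Sum>i\<in>X. p i * exp (t * a i)) ^ (N - 1) * (\<Sum>i\<in>X. p i * (exp (t * a i) * b i)))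
      has_real_derivative real N * (\<Sum>i\<in>X. p i * (a i * b i))) (at 0)"
  proof -
    have 1: "((\<lambda>t. \<Sum>i\<in>X. p i * exp (t * a i)) has_real_derivative (\<Sum>i\<in>X. p i * a i)) (at 0)"
      by (intro DERIV_sum) (auto intro!: derivative_eq_intros)
    have 2: "((\<lambda>t. \<Sum>i\<in>X. p i * (exp (t * a i) * b i)) has_real_derivative (\<Sum>i\<in>X. p i * (a i * b i))) (at 0)"
      by (intro DERIV_sum) (auto intro!: derivative_eq_intros)
    \<comment> \<open>The term that differentiates the power carries the factor of
      \<open>pa\<close>, which is 0; in the other term the power is evaluated at the total mass 1.
      Centring one of the two forms is therefore enough.\<close>
    from DERIV_mult[OF DERIV_cmult[OF DERIV_power[OF 1, of "N - 1"], of "real N"] 2]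
    show ?thesis using pa p1 by (simp add: mult_ac)
  qed
  ultimately have "(\<Sum>n\<in>counts X N. ?P n * (A n * B n)) = real N * (\<Sum>i\<in>X. p i * (a i * b i))"
    unfolding d1 by (rule DERIV_unique)
  then show ?thesis by (simp add: A_def B_def)
qed

text \<open>The score is a linear form in the counts whose coefficients are the log derivatives of
  the cell probabilities. These have mean zero because the probabilities sum to 1 along every
  coordinate line, so the second moments reduce to \<open>N\<close> times the moments of a single
  trial.\<close>

lemma fisher_mat_multinomial:
  fixes p :: "('k \<Rightarrow> real) \<Rightarrow> 'c \<Rightarrow> real"
  assumes fin: "finite X"
    and pos: "\<And>a t i. a \<in> set as \<Longrightarrow> i \<in> X \<Longrightarrow> p (u(a := t)) i > 0"
    and one: "\<And>a t. a \<in> set as \<Longrightarrow> (\<Sum>i\<in>X. p (u(a := t)) i) = 1"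
    and der: "\<And>a i. a \<in> set as \<Longrightarrow> i \<in> X \<Longrightarrow>
        ((\<lambda>t. ln (p (u(a := t)) i)) has_real_derivative s a i) (at (u a))"
  shows "fisher_mat (counts X N) (\<lambda>u. multinomial_prob X N (p u)) as u =
      mat_of as (\<lambda>a b. real N * (\<Sum>i\<in>X. p u i * (s a i * s b i)))"
proof -
  have sc: "score (\<lambda>u. multinomial_prob X N (p u)) u n a = (\<Sum>i\<in>X. real (n i) * s a i)"
    if a: "a \<in> set as" for a n
  proof -
    have eq: "ln (multinomial_prob X N (p (u(a := t))) n) =
        ln (fact N / (\<Prod>i\<in>X. fact (n i))) + (\<Sum>i\<in>X. real (n i) * ln (p (u(a := t)) i))" for t
    proof -
      have "ln (\<Prod>i\<in>X. p (u(a := t)) i ^ n i) = (\<Sum>i\<in>X. real (n i) * ln (p (u(a := t)) i))"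
      proof (subst ln_prod)
        fix i assume "i \<in> X"
        with pos[OF a, of i t] show "p (u(a := t)) i ^ n i \<noteq> 0" by simp
      next
        show "(\<Sum>i\<in>X. ln (p (u(a := t)) i ^ n i)) = (\<Sum>i\<in>X. real (n i) * ln (p (u(a := t)) i))"
          using pos[OF a] by (intro sum.cong) (auto simp: ln_realpow)
      qed (rule fin)
      moreover have "0 < (\<Prod>i\<in>X. p (u(a := t)) i ^ n i)"
        using pos[OF a] by (intro prod_pos) auto
      moreover have "(0::real) < fact N / (\<Prod>i\<in>X. fact (n i))"
        by (intro divide_pos_pos prod_pos) auto
      ultimately show ?thesis
        unfolding multinomial_prob_def by (subst ln_mult) auto
    qed
    have "((\<lambda>t. ln (fact N / (\<Prod>i\<in>X. fact (n i))) + (\<Sum>i\<in>X. real (n i) * ln (p (u(a := t)) i)))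
        has_real_derivative 0 + (\<Sum>i\<in>X. real (n i) * s a i)) (at (u a))"
      by (intro DERIV_add DERIV_const DERIV_sum DERIV_cmult der a)
    then show ?thesis
      unfolding score_def eq by (simp add: DERIV_imp_deriv)
  qed
  have zero: "(\<Sum>i\<in>X. p u i * s a i) = 0" if a: "a \<in> set as" for a
  proof -
    have "((\<lambda>t. \<Sum>i\<in>X. exp (ln (p (u(a := t)) i))) has_real_derivative
        (\<Sum>i\<in>X. exp (ln (p (u(a := u a)) i)) * s a i)) (at (u a))"
      by (intro DERIV_sum DERIV_chain'[OF der, where g = exp] DERIV_exp a)
    moreover have "(\<Sum>i\<in>X. exp (ln (p (u(a := t)) i))) = 1" for t
      using pos[OF a] one[OF a] by simp
    moreover have "(\<Sum>i\<in>X. exp (ln (p (u(a := u a)) i)) * s a i) = (\<Sum>i\<in>X. p u i * s a i)"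
      using pos[OF a, of _ "u a"] by (intro sum.cong) auto
    ultimately have "((\<lambda>t. 1) has_real_derivative (\<Sum>i\<in>X. p u i * s a i)) (at (u a))"
      by simp
    then show ?thesis using DERIV_const DERIV_unique by blast
  qed
  show ?thesis
  proof (rule eq_matI)
    fix r c assume "r < dim_row (mat_of as (\<lambda>a b. real N * (\<Sum>i\<in>X. p u i * (s a i * s b i))))"
      and "c < dim_col (mat_of as (\<lambda>a b. real N * (\<Sum>i\<in>X. p u i * (s a i * s b i))))"
    then have rc: "r < length as" "c < length as" by simp_all
    have one': "sum (p u) X = 1" using one[of "as ! r" "u (as ! r)"] rc by simp
    show "fisher_mat (counts X N) (\<lambda>u. multinomial_prob X N (p u)) as u $$ (r, c) =
        mat_of as (\<lambda>a b. real N * (\<Sum>i\<in>X. p u i * (s a i * s b i))) $$ (r, c)"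
      using rc multinomial_second_moment[OF fin one' zero, of "as ! r" N "s (as ! c)"]
      by (simp add: fisher_mat_def sc)
  qed (simp_all add: fisher_mat_def)
qed

section \<open>Lebesgue measure on labelled parameter spaces\<close>

lemma space_lborel_on: "space (lborel_on J) = (J \<rightarrow>\<^sub>E UNIV)"
  by (simp add: space_PiM)

interpretation lborel_product: product_sigma_finite "\<lambda>_ :: 'k. lborel :: real measure"
  by standard

lemma measurable_component_lborel:
  "a \<in> J \<Longrightarrow> (\<lambda>y. y a) \<in> borel_measurable (lborel_on J)"
  using measurable_component_singleton[of a J "\<lambda>_. lborel :: real measure"] by simp

text \<open>The label type may be uncountable, and then coordinatewise measurability into the
  function space does not give Borel measurability. The finitely many coordinates in
  \<open>J\<close> are therefore coded as a sequence: \<open>enc\<close> is measurable into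
  functions on the naturals, where coordinates suffice, and \<open>dec\<close> is
  continuous.\<close>

lemma continuous_on_measurable_override:
  fixes F :: "('k \<Rightarrow> real) \<Rightarrow> real"
  assumes "finite J" "continuous_on UNIV F"
  shows "(\<lambda>y. F (override_on u y J)) \<in> borel_measurable (lborel_on J)"
proof -
  obtain e where e: "bij_betw e {0..<card J} J"
    using ex_bij_betw_nat_finite[OF assms(1)] by blast
  define d where "d = inv_into {0..<card J} e"
  define enc where "enc = (\<lambda>y :: 'k \<Rightarrow> real. \<lambda>n. if n < card J then y (e n) else 0)"
  define dec where "dec = (\<lambda>w :: nat \<Rightarrow> real. \<lambda>a. if a \<in> J then w (d a) else u a)"
  have eJ: "e n \<in> J" if "n < card J" for n
    using bij_betwE[OF e] that by auto
  have "enc \<in> borel_measurable (lborel_on J)"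
  proof (rule measurable_coordinatewise_then_product)
    fix n show "(\<lambda>y. enc y n) \<in> borel_measurable (lborel_on J)"
      unfolding enc_def using measurable_component_lborel[OF eJ[of n]] by (cases "n < card J") simp_all
  qed
  moreover have "continuous_on UNIV dec"
  proof (rule continuous_on_coordinatewise_then_product)
    fix a show "continuous_on UNIV (\<lambda>w. dec w a)"
      unfolding dec_def by (cases "a \<in> J") simp_all
  qed
  then have "continuous_on UNIV (F \<circ> dec)"
    by (rule continuous_on_compose) (rule continuous_on_subset[OF assms(2)], simp)
  then have "F \<circ> dec \<in> borel_measurable borel"
    by (rule borel_measurable_continuous_onI)
  ultimately have meas: "(\<lambda>y. (F \<circ> dec) (enc y)) \<in> borel_measurable (lborel_on J)"
    by (rule measurable_compose)
  have eq: "dec (enc y) = override_on u y J" for y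
  proof
    fix a show "dec (enc y) a = override_on u y J a"
    proof (cases "a \<in> J")
      case True
      have "e (d a) = a"
        unfolding d_def by (rule bij_betw_inv_into_right[OF e True])
      moreover have "d a < card J"
        using bspec[OF bij_betwE[OF bij_betw_inv_into[OF e]] True] unfolding d_def by simp
      ultimately show ?thesis using True by (simp add: dec_def enc_def)
    qed (simp add: dec_def)
  qed
  show ?thesis using meas unfolding comp_apply eq .
qed

lemma override_on_extensional:
  "y \<in> extensional J \<Longrightarrow> override_on (\<lambda>_. undefined) y J = y"
  by (rule ext) (auto simp: override_on_def extensional_def)

text \<open>Integrate out the last coordinate first.\<close>

lemma nn_integral_triangular_shift:
  fixes S :: "'k \<Rightarrow> ('k \<Rightarrow> real) \<Rightarrow> real"
  assumes "distinct xs"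
    and "\<And>a. a \<in> set xs \<Longrightarrow> continuous_on UNIV (S a)"
    and "\<And>i j v r. i \<le> j \<Longrightarrow> j < length xs \<Longrightarrow> S (xs ! i) (v(xs ! j := r)) = S (xs ! i) v"
    and "f \<in> borel_measurable (lborel_on (set xs))"
  shows "(\<integral>\<^sup>+y. f (\<lambda>a\<in>set xs. y a + S a (override_on u y (set xs))) \<partial>lborel_on (set xs)) =
    (\<integral>\<^sup>+y. f y \<partial>lborel_on (set xs))"
  using assms
proof (induction xs arbitrary: f rule: rev_induct)
  case Nil
  have "(\<lambda>a. undefined) = (y :: 'k \<Rightarrow> real)" if "y \<in> space (lborel_on {})" for y
    using that by (simp add: space_lborel_on)
  then show ?case by (intro nn_integral_cong) (auto simp: restrict_def)
next
  case (snoc x xs)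
  let ?J = "set xs"
  have x: "x \<notin> ?J" and set_eq: "set (xs @ [x]) = insert x ?J" using snoc.prems(1) by auto
  have f: "f \<in> borel_measurable (lborel_on (insert x ?J))" using snoc.prems(4) by simp
  \<comment> \<open>No shift reads the last coordinate. With the others fixed, the map thus
    translates that coordinate by the constant \<open>c y\<close> and does not change the remaining
    components of the image, so translation invariance on the line removes it.\<close>
  have Sx: "S a (v(x := r)) = S a v" if a: "a \<in> insert x ?J" for a v r
  proof -
    from a have "a \<in> set (xs @ [x])" by simp
    then obtain i where "i < length (xs @ [x])" "(xs @ [x]) ! i = a" by (metis in_set_conv_nth)
    then show ?thesis using snoc.prems(3)[of i "length xs" v r] by (simp add: fun_upd_def)
  qed
  have Smeas: "(\<lambda>y. S a (override_on u y J)) \<in> borel_measurable (lborel_on J)"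
    if "a \<in> insert x ?J" "finite J" for a J
    by (rule continuous_on_measurable_override[OF that(2) snoc.prems(2)]) (use that(1) in simp)
  define T where "T = (\<lambda>J. \<lambda>y. \<lambda>a\<in>J. y a + S a (override_on u y J))"
  have T: "T J \<in> lborel_on J \<rightarrow>\<^sub>M lborel_on J" if "J \<subseteq> insert x ?J" for J
    unfolding T_def
  proof (rule measurable_restrict)
    fix a assume a: "a \<in> J"
    have "(\<lambda>y. S a (override_on u y J)) \<in> borel_measurable (lborel_on J)"
      by (rule Smeas) (use subsetD[OF that a] finite_subset[OF that] in simp_all)
    then show "(\<lambda>y. y a + S a (override_on u y J)) \<in> lborel_on J \<rightarrow>\<^sub>M lborel"
      using borel_measurable_add[OF measurable_component_lborel[OF a]] by simp
  qed
  define c where "c = (\<lambda>y. S x (override_on u y ?J))"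
  have Tx: "T (insert x ?J) (y(x := r)) = (T ?J y)(x := r + c y)" for y r
  proof
    fix a
    have "override_on u (y(x := r)) (insert x ?J) = (override_on u y ?J)(x := r)"
      using x by (auto simp: override_on_def fun_eq_iff)
    then show "T (insert x ?J) (y(x := r)) a = ((T ?J y)(x := r + c y)) a"
      using x Sx by (auto simp: T_def c_def restrict_def)
  qed
  define g where "g = (\<lambda>y. \<integral>\<^sup>+r. f (y(x := r)) \<partial>lborel)"
  have upd: "(\<lambda>(y, r). y(x := r)) \<in> lborel_on ?J \<Otimes>\<^sub>M lborel \<rightarrow>\<^sub>M lborel_on (insert x ?J)"
    by (rule measurable_add_dim)
  have g: "g \<in> borel_measurable (lborel_on ?J)"
    unfolding g_def
    using measurable_compose[OF upd f]
    by (intro lborel.borel_measurable_nn_integral) (simp add: case_prod_beta')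
  have shift: "(\<integral>\<^sup>+r. h (r + c) \<partial>lborel) = (\<integral>\<^sup>+r. h r \<partial>lborel)"
    if "h \<in> borel_measurable lborel" for h :: "real \<Rightarrow> ennreal" and c
    using nn_integral_real_affine[of h 1 c] that by (simp add: add.commute)
  have "(\<integral>\<^sup>+y. f (T (insert x ?J) y) \<partial>lborel_on (insert x ?J)) =
      (\<integral>\<^sup>+y. \<integral>\<^sup>+r. f (T (insert x ?J) (y(x := r))) \<partial>lborel \<partial>lborel_on ?J)"
    by (rule lborel_product.product_nn_integral_insert)
       (use x measurable_compose[OF T[OF order_refl] f] in simp_all)
  also have "\<dots> = (\<integral>\<^sup>+y. g (T ?J y) \<partial>lborel_on ?J)"
  proof (rule nn_integral_cong)
    fix y assume y: "y \<in> space (lborel_on ?J)"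
    have "T ?J y \<in> space (lborel_on ?J)" using measurable_space[OF T y] by auto
    then have "(\<lambda>r. (T ?J y, r)) \<in> lborel \<rightarrow>\<^sub>M lborel_on ?J \<Otimes>\<^sub>M lborel" by simp
    from measurable_compose[OF measurable_compose[OF this upd] f]
    have m: "(\<lambda>r. f ((T ?J y)(x := r))) \<in> borel_measurable lborel" by simp
    show "(\<integral>\<^sup>+r. f (T (insert x ?J) (y(x := r))) \<partial>lborel) = g (T ?J y)"
      unfolding Tx g_def using shift[OF m, of "c y"] .
  qed
  also have "\<dots> = (\<integral>\<^sup>+y. g y \<partial>lborel_on ?J)"
    unfolding T_def
  proof (rule snoc.IH)
    show "distinct xs" using snoc.prems(1) by simp
    show "continuous_on UNIV (S a)" if "a \<in> ?J" for a using snoc.prems(2)[of a] that by simp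
    show "S (xs ! i) (v(xs ! j := r)) = S (xs ! i) v" if "i \<le> j" "j < length xs" for i j v r
      using snoc.prems(3)[of i j v r] that by (simp add: nth_append fun_upd_def)
    show "g \<in> borel_measurable (lborel_on ?J)" by (rule g)
  qed
  also have "\<dots> = (\<integral>\<^sup>+y. f y \<partial>lborel_on (insert x ?J))"
    unfolding g_def
    by (rule lborel_product.product_nn_integral_insert[symmetric]) (use x f in simp_all)
  finally show ?case unfolding set_eq T_def .
qed

lemma triangular_shift_measure_preserving:
  fixes S :: "'k \<Rightarrow> ('k \<Rightarrow> real) \<Rightarrow> real" and u :: "'k \<Rightarrow> real"
  assumes "distinct xs"
    and S: "\<And>a. a \<in> set xs \<Longrightarrow> continuous_on UNIV (S a)"
    and "\<And>i j v r. i \<le> j \<Longrightarrow> j < length xs \<Longrightarrow> S (xs ! i) (v(xs ! j := r)) = S (xs ! i) v"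
  defines "T \<equiv> \<lambda>y. \<lambda>a\<in>set xs. y a + S a (override_on u y (set xs))"
  shows "T \<in> lborel_on (set xs) \<rightarrow>\<^sub>M lborel_on (set xs)"
    and "distr (lborel_on (set xs)) (lborel_on (set xs)) T = lborel_on (set xs)"
proof -
  show T: "T \<in> lborel_on (set xs) \<rightarrow>\<^sub>M lborel_on (set xs)"
    unfolding T_def
  proof (rule measurable_restrict)
    fix a assume a: "a \<in> set xs"
    show "(\<lambda>y. y a + S a (override_on u y (set xs))) \<in> lborel_on (set xs) \<rightarrow>\<^sub>M lborel"
      using borel_measurable_add[OF measurable_component_lborel[OF a]
          continuous_on_measurable_override[OF List.finite_set S[OF a], of u]] by simp
  qed
  show "distr (lborel_on (set xs)) (lborel_on (set xs)) T = lborel_on (set xs)"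
  proof (rule measure_eqI)
    fix A assume "A \<in> sets (distr (lborel_on (set xs)) (lborel_on (set xs)) T)"
    then have A: "A \<in> sets (lborel_on (set xs))" by simp
    have "emeasure (distr (lborel_on (set xs)) (lborel_on (set xs)) T) A =
        (\<integral>\<^sup>+y. indicator A (T y) \<partial>lborel_on (set xs))"
    proof -
      have "(\<integral>\<^sup>+y. indicator A y \<partial>distr (lborel_on (set xs)) (lborel_on (set xs)) T) =
          (\<integral>\<^sup>+y. indicator A (T y) \<partial>lborel_on (set xs))"
        by (rule nn_integral_distr[OF T]) (use A in simp)
      then show ?thesis using A by simp
    qed
    also have "\<dots> = (\<integral>\<^sup>+y. indicator A y \<partial>lborel_on (set xs))"
      unfolding T_def
    proof (rule nn_integral_triangular_shift[where S = S and xs = xs and f = "indicator A" and u = u])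
      show "indicator A \<in> borel_measurable (lborel_on (set xs))" using A by simp
    qed (rule assms(1) S assms(3) | assumption)+
    finally show "emeasure (distr (lborel_on (set xs)) (lborel_on (set xs)) T) A = emeasure (lborel_on (set xs)) A"
      using A by simp
  qed simp
qed

section \<open>Reference priors in triangular coordinates\<close>

text \<open>The change of coordinates is given implicitly: the added term is a function of the new
  coordinates. In this form the inverse is explicit, subtraction of \<open>t\<close>, and
  \<open>t_dep\<close> makes the map triangular with respect to the groups. Off the labels \<phi> is
  the identity, so it preserves the parameter space.\<close>

locale triangular_shift =
  fixes gs :: "'k list list" and \<phi> :: "('k \<Rightarrow> real) \<Rightarrow> 'k \<Rightarrow> real"
    and t :: "'k \<Rightarrow> ('k \<Rightarrow> real) \<Rightarrow> real"
  assumes dist: "distinct (concat gs)"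
    and cont_\<phi>: "\<And>a. continuous_on UNIV (\<lambda>u. \<phi> u a)"
    and cont_t: "\<And>a. continuous_on UNIV (t a)"
    and \<phi>_in: "\<And>a u. a \<in> set (concat gs) \<Longrightarrow> \<phi> u a = u a + t a (\<phi> u)"
    and \<phi>_out: "\<And>a u. a \<notin> set (concat gs) \<Longrightarrow> \<phi> u a = u a"
    and t_dep: "\<And>j a v w. j < length gs \<Longrightarrow> a \<in> set (gs ! j) \<Longrightarrow>
        (\<And>b. b \<in> set (concat (take j gs)) \<Longrightarrow> v b = w b) \<Longrightarrow> t a v = t a w"
begin

abbreviation "m \<equiv> length gs"
abbreviation "L \<equiv> set (concat gs)"
abbreviation "A k \<equiv> set (gs ! k)"
abbreviation "B k \<equiv> set (concat (take k gs))"
abbreviation "C k \<equiv> set (concat (drop k gs))"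

declare set_concat [simp del]

lemma BC: "B k \<union> C k = L" "B k \<inter> C k = {}"
proof -
  have eq: "concat gs = concat (take k gs) @ concat (drop k gs)"
    by (metis append_take_drop_id concat_append)
  show "B k \<union> C k = L" using arg_cong[OF eq, of set] by (simp only: set_append)
  show "B k \<inter> C k = {}" using dist by (subst (asm) eq) (simp only: distinct_append)
qed

lemma B_Suc: "k < m \<Longrightarrow> B (Suc k) = B k \<union> A k"
  by (simp add: take_Suc_conv_app_nth)

lemma C_Suc: "k < m \<Longrightarrow> C k = A k \<union> C (Suc k)"
  by (simp add: Cons_nth_drop_Suc[symmetric])

lemma A_C_disjoint: "k < m \<Longrightarrow> A k \<inter> C (Suc k) = {}"
  using BC(2)[of "Suc k"] B_Suc[of k] by blast

lemma A_B_disjoint: "k < m \<Longrightarrow> A k \<inter> B k = {}"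
  using BC(2)[of k] C_Suc[of k] by blast

lemma A_subset: "k < m \<Longrightarrow> A k \<subseteq> L"
  using BC(1)[of k] C_Suc[of k] by blast

lemma in_B: "a \<in> B k \<longleftrightarrow> (\<exists>i<min k m. a \<in> A i)"
  by (rule in_set_concat_take)

lemma group_unique:
  assumes "i < m" "j < m" "a \<in> A i" "a \<in> A j"
  shows "i = j"
proof (rule ccontr)
  assume "i \<noteq> j"
  then consider "i < j" | "j < i" by linarith
  then show False
  proof cases
    case 1
    then have "a \<in> B j" using assms in_B[of a j] by auto
    then show False using A_B_disjoint[OF assms(2)] assms(4) by blast
  next
    case 2
    then have "a \<in> B i" using assms in_B[of a i] by auto
    then show False using A_B_disjoint[OF assms(1)] assms(3) by blast
  qed
qed

text \<open>Induction over the groups: the shift on group \<open>k\<close> reads \<phi> only on the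
  preceding groups, where agreement is already known.\<close>

lemma \<phi>_agree:
  assumes "k \<le> m" "\<And>b. b \<in> B k \<Longrightarrow> u b = v b" "b \<in> B k"
  shows "\<phi> u b = \<phi> v b"
  using assms
proof (induction k arbitrary: b)
  case (Suc k)
  have k: "k < m" using Suc.prems(1) by simp
  have IH: "\<phi> u b = \<phi> v b" if "b \<in> B k" for b
    using Suc.IH[OF _ _ that] Suc.prems(2) B_Suc[OF k] k by auto
  show ?case
  proof (cases "b \<in> B k")
    case False
    then have b: "b \<in> A k" using Suc.prems(3) B_Suc[OF k] by auto
    have "t b (\<phi> u) = t b (\<phi> v)" by (rule t_dep[OF k b IH])
    then show ?thesis using \<phi>_in[of b] A_subset[OF k] b Suc.prems(2)[OF Suc.prems(3)] by auto
  qed (rule IH)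
qed simp

definition \<psi> :: "('k \<Rightarrow> real) \<Rightarrow> 'k \<Rightarrow> real" where
  "\<psi> v = (\<lambda>a. if a \<in> L then v a - t a v else v a)"

lemma \<psi>_\<phi>: "\<psi> (\<phi> u) = u"
proof
  fix a show "\<psi> (\<phi> u) a = u a"
    using \<phi>_in[of a u] \<phi>_out[of a u] by (cases "a \<in> L") (simp_all add: \<psi>_def)
qed

text \<open>Again group by group. Once \<phi> undoes \<psi> on the preceding groups, the shift
  evaluated at the image equals the shift that \<psi> has subtracted.\<close>

lemma \<phi>_\<psi>: "\<phi> (\<psi> v) = v"
proof -
  have "\<phi> (\<psi> v) a = v a" if "k \<le> m" "a \<in> B k" for k a
    using that
  proof (induction k arbitrary: a)
    case (Suc k)
    have k: "k < m" using Suc.prems(1) by simp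
    have IH: "\<phi> (\<psi> v) b = v b" if "b \<in> B k" for b
      using Suc.IH[OF _ that] k by simp
    show ?case
    proof (cases "a \<in> B k")
      case False
      then have a: "a \<in> A k" using Suc.prems(2) B_Suc[OF k] by auto
      have "t a (\<phi> (\<psi> v)) = t a v" by (rule t_dep[OF k a IH])
      then show ?thesis using \<phi>_in[of a "\<psi> v"] A_subset[OF k] a by (auto simp: \<psi>_def)
    qed (rule IH)
  qed simp
  from this[of m] have in_L: "\<phi> (\<psi> v) a = v a" if "a \<in> L" for a
    using that by simp
  show ?thesis
  proof
    fix a show "\<phi> (\<psi> v) a = v a"
      using in_L[of a] \<phi>_out[of a "\<psi> v"] by (cases "a \<in> L") (simp_all add: \<psi>_def)
  qed
qed

lemma cont_\<psi>: "continuous_on UNIV \<psi>"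
proof (rule continuous_on_coordinatewise_then_product)
  fix a show "continuous_on UNIV (\<lambda>v. \<psi> v a)"
  proof (cases "a \<in> L")
    case True
    have "continuous_on UNIV (\<lambda>v. v a - t a v)"
      by (rule continuous_on_diff[OF continuous_on_product_coordinates cont_t])
    then show ?thesis using True by (simp add: \<psi>_def)
  qed (simp add: \<psi>_def)
qed

lemma PS_iff: "u \<in> parameter_space gs \<longleftrightarrow> (\<forall>a. a \<notin> L \<longrightarrow> u a = undefined)"
  by (simp add: parameter_space_def PiE_iff extensional_def)

lemma override_PS: "u \<in> parameter_space gs \<Longrightarrow> S \<subseteq> L \<Longrightarrow> override_on u y S \<in> parameter_space gs"
  unfolding PS_iff override_on_def by auto

lemma \<phi>_PS: "u \<in> parameter_space gs \<Longrightarrow> \<phi> u \<in> parameter_space gs"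
  unfolding PS_iff using \<phi>_out by simp

lemma \<psi>_PS: "v \<in> parameter_space gs \<Longrightarrow> \<psi> v \<in> parameter_space gs"
  unfolding PS_iff \<psi>_def by simp

text \<open>The substitution for an integral over the labels \<open>S\<close> when all other labels
  are held at \<open>u\<close>.\<close>

definition \<Psi> :: "'k set \<Rightarrow> ('k \<Rightarrow> real) \<Rightarrow> ('k \<Rightarrow> real) \<Rightarrow> 'k \<Rightarrow> real" where
  "\<Psi> S u y = (\<lambda>a\<in>S. \<phi> (override_on u y S) a)"

text \<open>The condition \<open>ord\<close> says that neither a label itself nor any label after it
  in the list belongs to an earlier group. The shift of a label then depends only on labels standing
  before it, which is the triangularity that a coordinatewise integration needs.\<close>

lemma \<Psi>_measure_preserving:
  assumes xs: "distinct xs" "set xs \<subseteq> L"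
    and ord: "\<And>i j l. i \<le> j \<Longrightarrow> j < length xs \<Longrightarrow> l < m \<Longrightarrow> xs ! i \<in> A l \<Longrightarrow> xs ! j \<notin> B l"
  shows "\<Psi> (set xs) u \<in> lborel_on (set xs) \<rightarrow>\<^sub>M lborel_on (set xs)"
    and "distr (lborel_on (set xs)) (lborel_on (set xs)) (\<Psi> (set xs) u) = lborel_on (set xs)"
proof -
  define S where "S = (\<lambda>a u. t a (\<phi> u))"
  have eq: "\<Psi> (set xs) u = (\<lambda>y. \<lambda>a\<in>set xs. y a + S a (override_on u y (set xs)))"
  proof (intro ext)
    fix y a
    show "\<Psi> (set xs) u y a = (\<lambda>a\<in>set xs. y a + S a (override_on u y (set xs))) a"
      using xs(2) \<phi>_in[of a "override_on u y (set xs)"] by (auto simp: \<Psi>_def S_def)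
  qed
  have cont: "continuous_on UNIV (S a)" for a
    unfolding S_def
    by (rule continuous_on_compose2[OF cont_t continuous_on_coordinatewise_then_product[OF cont_\<phi>]]) simp
  have dep: "S (xs ! i) (v(xs ! j := r)) = S (xs ! i) v" if ij: "i \<le> j" "j < length xs" for i j v r
  proof -
    have "xs ! i \<in> L" using ij xs(2) by (meson nth_mem order_le_less_trans subsetD)
    then obtain l where l: "l < m" "xs ! i \<in> A l" unfolding in_set_concat_nth by blast
    have nb: "xs ! j \<notin> B l" by (rule ord[OF ij l])
    show ?thesis
      unfolding S_def
    proof (rule t_dep[OF l], rule \<phi>_agree)
      show "l \<le> m" using l(1) by simp
      show "(v(xs ! j := r)) b = v b" if "b \<in> B l" for b using that nb by auto
    qed
  qed
  note tr = triangular_shift_measure_preserving[where S = S and xs = xs and u = u]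
  show "\<Psi> (set xs) u \<in> lborel_on (set xs) \<rightarrow>\<^sub>M lborel_on (set xs)"
    unfolding eq by (rule tr(1)) (rule xs(1) cont dep | assumption)+
  show "distr (lborel_on (set xs)) (lborel_on (set xs)) (\<Psi> (set xs) u) = lborel_on (set xs)"
    unfolding eq by (rule tr(2)) (rule xs(1) cont dep | assumption)+
qed

text \<open>The substitution for expectations over all groups from \<open>k\<close> on. The list
  runs through the groups in order, so a label of an earlier group can only stand further to the
  left.\<close>

lemma \<Psi>_tail:
  "\<Psi> (C k) u \<in> lborel_on (C k) \<rightarrow>\<^sub>M lborel_on (C k)"
  "distr (lborel_on (C k)) (lborel_on (C k)) (\<Psi> (C k) u) = lborel_on (C k)"
proof -
  let ?xs = "concat (drop k gs)"
  have d: "distinct ?xs"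
    using dist by (metis append_take_drop_id concat_append distinct_append)
  have sub: "set ?xs \<subseteq> L" using BC(1)[of k] by blast
  have ord: "?xs ! j \<notin> B l" if ij: "i \<le> j" "j < length ?xs" and l: "l < m" "?xs ! i \<in> A l" for i j l
  proof
    assume jl: "?xs ! j \<in> B l"
    have jC: "?xs ! j \<in> C k" and iC: "?xs ! i \<in> C k" using ij by (auto intro!: nth_mem)
    have kl: "k \<le> l"
    proof (rule ccontr)
      assume "\<not> k \<le> l"
      then have "?xs ! i \<in> B k" using l in_B[of "?xs ! i" k] by auto
      then show False using iC BC(2)[of k] by blast
    qed
    have "drop k gs = take (l - k) (drop k gs) @ drop l gs"
      using kl by (metis append_take_drop_id drop_drop le_add_diff_inverse2)
    then have split: "?xs = concat (take (l - k) (drop k gs)) @ concat (drop l gs)"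
      by (metis concat_append)
    let ?n = "length (concat (take (l - k) (drop k gs)))"
    have len: "length ?xs = ?n + length (concat (drop l gs))"
      using arg_cong[OF split, of length] by (simp only: length_append)
    have notC: "?xs ! j \<notin> C l" using jl BC(2)[of l] by blast
    have jn: "j < ?n"
    proof (rule ccontr)
      assume nj: "\<not> j < ?n"
      have "?xs ! j = concat (drop l gs) ! (j - ?n)"
        using arg_cong[OF split, of "\<lambda>x. x ! j"] nj by (simp only: nth_append if_False)
      moreover have "j - ?n < length (concat (drop l gs))" using len ij(2) nj by linarith
      ultimately have "?xs ! j \<in> C l" by (simp only: nth_mem)
      then show False using notC by blast
    qed
    then have "i < ?n" using ij by linarith
    moreover have "?xs ! i = concat (take (l - k) (drop k gs)) ! i"
      using arg_cong[OF split, of "\<lambda>x. x ! i"] calculation by (simp only: nth_append if_True)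
    ultimately have "?xs ! i \<in> set (concat (take (l - k) (drop k gs)))"
      by (simp only: nth_mem)
    moreover have "?xs ! i \<in> C l" using l C_Suc[OF l(1)] by blast
    ultimately show False
      using arg_cong[OF split, of distinct] d by (simp only: distinct_append) blast
  qed
  show "\<Psi> (C k) u \<in> lborel_on (C k) \<rightarrow>\<^sub>M lborel_on (C k)"
    by (rule \<Psi>_measure_preserving(1)[OF d sub ord])
  show "distr (lborel_on (C k)) (lborel_on (C k)) (\<Psi> (C k) u) = lborel_on (C k)"
    by (rule \<Psi>_measure_preserving(2)[OF d sub ord])
qed

text \<open>The substitution for the normalizing constant of one group. The shifts on a group read
  only preceding groups, so here they are constants.\<close>

lemma \<Psi>_group:
  assumes k: "k < m"
  shows "\<Psi> (A k) u \<in> lborel_on (A k) \<rightarrow>\<^sub>M lborel_on (A k)"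
  "distr (lborel_on (A k)) (lborel_on (A k)) (\<Psi> (A k) u) = lborel_on (A k)"
proof -
  have d: "distinct (gs ! k)" using dist k by (auto simp: distinct_concat_iff)
  have ord: "gs ! k ! j \<notin> B l" if ij: "i \<le> j" "j < length (gs ! k)" and l: "l < m" "gs ! k ! i \<in> A l" for i j l
  proof -
    have "gs ! k ! i \<in> A k" "gs ! k ! j \<in> A k" using ij by simp_all
    then show ?thesis using group_unique[OF l(1) k l(2)] A_B_disjoint[OF k] by blast
  qed
  show "\<Psi> (A k) u \<in> lborel_on (A k) \<rightarrow>\<^sub>M lborel_on (A k)"
    by (rule \<Psi>_measure_preserving(1)[OF d A_subset[OF k] ord])
  show "distr (lborel_on (A k)) (lborel_on (A k)) (\<Psi> (A k) u) = lborel_on (A k)"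
    by (rule \<Psi>_measure_preserving(2)[OF d A_subset[OF k] ord])
qed

text \<open>Changing the later groups of \<open>u\<close> leaves \<phi> unchanged on the groups up
  to \<open>k\<close>. An integrand that is a function of \<phi> thus becomes a function of the
  substitution alone.\<close>

lemma \<phi>_override_tail:
  assumes k: "k < m"
  shows "\<phi> (override_on u y (C (Suc k))) = override_on (\<phi> u) (\<Psi> (C (Suc k)) u y) (C (Suc k))"
proof
  fix a
  have agree: "override_on u y (C (Suc k)) b = u b" if "b \<in> B (Suc k)" for b
    using that BC(2)[of "Suc k"] by (auto simp: override_on_def)
  show "\<phi> (override_on u y (C (Suc k))) a = override_on (\<phi> u) (\<Psi> (C (Suc k)) u y) (C (Suc k)) a"
  proof (cases "a \<in> C (Suc k)")
    case True then show ?thesis by (simp add: \<Psi>_def)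
  next
    case False
    show ?thesis
    proof (cases "a \<in> L")
      case True
      then have a: "a \<in> B (Suc k)" using False BC(1)[of "Suc k"] by blast
      have "\<phi> (override_on u y (C (Suc k))) a = \<phi> u a"
        by (rule \<phi>_agree[OF _ agree a]) (use k in simp)
      then show ?thesis using False by (simp add: override_on_def)
    next
      case notL: False
      then show ?thesis
        using False \<phi>_out[OF notL] by (simp add: override_on_def)
    qed
  qed
qed

lemma \<phi>_override_group:
  assumes k: "k < m" and a: "a \<in> B k"
  shows "\<phi> (override_on u y (A k)) a = \<phi> u a"
proof (rule \<phi>_agree[OF _ _ a])
  show "k \<le> m" using k by simp
  show "override_on u y (A k) b = u b" if "b \<in> B k" for b
    using that A_B_disjoint[OF k] by (auto simp: override_on_def)
qed

end

section \<open>The reference construction in triangular coordinates\<close>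

locale triangular_model = triangular_shift gs \<phi> t
  for gs :: "'k list list" and \<phi> :: "('k \<Rightarrow> real) \<Rightarrow> 'k \<Rightarrow> real"
    and t :: "'k \<Rightarrow> ('k \<Rightarrow> real) \<Rightarrow> real" +
  fixes X :: "'x set" and f :: "('k \<Rightarrow> real) \<Rightarrow> 'x \<Rightarrow> real" and G g :: "nat \<Rightarrow> ('k \<Rightarrow> real) \<Rightarrow> real"
  assumes det_h: "\<And>u j. u \<in> parameter_space gs \<Longrightarrow> j < length gs \<Longrightarrow>
        Determinant.det (h_block X f gs j u) = G j (\<phi> u) * g j (\<phi> u)"
    and G_pos: "\<And>j v. 0 < G j v" and g_pos: "\<And>j v. 0 < g j v"
    and cont_G: "\<And>j. continuous_on UNIV (G j)" and cont_g: "\<And>j. continuous_on UNIV (g j)"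
    and G_dep: "\<And>j v w. j < length gs \<Longrightarrow> (\<And>b. b \<notin> set (gs ! j) \<Longrightarrow> v b = w b) \<Longrightarrow> G j v = G j w"
    and g_dep: "\<And>j v w. j < length gs \<Longrightarrow> (\<And>b. b \<in> set (gs ! j) \<Longrightarrow> v b = w b) \<Longrightarrow> g j v = g j w"

text \<open>The projections of the region are boxes in the coordinates \<phi>, with the same set
  \<open>Bx\<close> for every label. There are two instances: \<open>Bx\<close> is the whole line
  for the untruncated construction, and a symmetric interval for the truncated ones.\<close>

locale triangular_region = triangular_model gs \<phi> t X f G g
  for X :: "'x set" and f :: "('k \<Rightarrow> real) \<Rightarrow> 'x \<Rightarrow> real" and gs :: "'k list list"
    and \<phi> :: "('k \<Rightarrow> real) \<Rightarrow> 'k \<Rightarrow> real" and t :: "'k \<Rightarrow> ('k \<Rightarrow> real) \<Rightarrow> real"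
    and G g :: "nat \<Rightarrow> ('k \<Rightarrow> real) \<Rightarrow> real" +
  fixes K :: "('k \<Rightarrow> real) set" and Bx :: "real set"
  assumes Bx: "Bx \<in> sets borel" and Bx_pos: "emeasure lborel Bx > 0"
    and proj: "\<And>k u. k < length gs \<Longrightarrow> u \<in> parameter_space gs \<Longrightarrow>
        in_projection K gs k u \<longleftrightarrow> (\<forall>b\<in>set (concat (take (Suc k) gs)). \<phi> u b \<in> Bx)"
begin

text \<open>In the coordinates \<phi>, \<open>s k\<close> is the expected unnormalized conditional
  density of group \<open>k\<close>, \<open>Z k\<close> its mass and \<open>R k\<close> the joint
  density of the groups from \<open>k\<close> on. The rest of this context shows that the
  construction produces them.\<close>

definition s :: "nat \<Rightarrow> ('k \<Rightarrow> real) \<Rightarrow> real" where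
  "s k v = (\<Prod>a\<in>A k. indicator Bx (v a)) * sqrt (g k v)"

definition Z :: "nat \<Rightarrow> real" where
  "Z k = (\<integral>y. s k y \<partial>lborel_on (A k))"

definition R :: "nat \<Rightarrow> ('k \<Rightarrow> real) \<Rightarrow> real" where
  "R k v = (\<Prod>r\<in>{k..<m}. s r v / Z r)"

lemma s_eq: "s k v = (if \<forall>a\<in>A k. v a \<in> Bx then sqrt (g k v) else 0)"
proof (cases "\<forall>a\<in>A k. v a \<in> Bx")
  case True
  then have "(\<Prod>a\<in>A k. indicator Bx (v a)) = (1::real)" by (intro prod.neutral) simp
  then show ?thesis using True by (simp add: s_def)
next
  case False
  then obtain a where "a \<in> A k" "v a \<notin> Bx" by blast
  then have "(\<Prod>a\<in>A k. indicator Bx (v a)) = (0::real)"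
    by (intro prod_zero bexI[of _ a]) simp_all
  then show ?thesis using False by (simp add: s_def)
qed

lemma s_nonneg: "0 \<le> s k v"
  using g_pos[of k v] by (simp add: s_eq)

lemma s_dep:
  assumes "k < m" "\<And>b. b \<in> A k \<Longrightarrow> v b = w b"
  shows "s k v = s k w"
proof -
  have "g k v = g k w" by (rule g_dep[OF assms])
  moreover have "(\<Prod>a\<in>A k. indicator Bx (v a)) = (\<Prod>a\<in>A k. indicator Bx (w a) :: real)"
    by (intro prod.cong refl) (simp add: assms(2))
  ultimately show ?thesis by (simp add: s_def)
qed

lemma Z_nonneg: "0 \<le> Z k"
  unfolding Z_def by (intro Bochner_Integration.integral_nonneg s_nonneg)

lemma R_nonneg: "0 \<le> R k v"
  unfolding R_def by (intro prod_nonneg divide_nonneg_nonneg ballI s_nonneg Z_nonneg)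

lemma R_Suc: "k < m \<Longrightarrow> R k v = s k v / Z k * R (Suc k) v"
  unfolding R_def by (simp add: prod.atLeast_Suc_lessThan)

lemma R_dep:
  assumes "\<And>b. b \<in> C k \<Longrightarrow> v b = w b"
  shows "R k v = R k w"
  unfolding R_def
proof (intro prod.cong refl arg_cong2[where f = "(/)"])
  fix r assume r: "r \<in> {k..<m}"
  have "A r \<subseteq> C k"
  proof
    fix a assume "a \<in> A r"
    then show "a \<in> C k" using r in_set_concat_drop[of k gs a] by auto
  qed
  then show "s r v = s r w" using r by (intro s_dep assms) auto
qed

lemma s_measurable_override:
  assumes "finite S"
  shows "(\<lambda>y. s k (override_on u y S)) \<in> borel_measurable (lborel_on S)"
  unfolding s_def
proof (intro borel_measurable_times borel_measurable_prod)
  show "(\<lambda>y. sqrt (g k (override_on u y S))) \<in> borel_measurable (lborel_on S)"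
    by (rule continuous_on_measurable_override[OF assms]) (intro continuous_on_real_sqrt cont_g)
next
  fix a
  have "(\<lambda>y. override_on u y S a) \<in> borel_measurable (lborel_on S)"
  proof (cases "a \<in> S")
    case True
    then show ?thesis using measurable_component_lborel[OF True] by (simp only: override_on_apply_in)
  next
    case False
    show ?thesis unfolding override_on_apply_notin[OF False] by (rule borel_measurable_const)
  qed
  then show "(\<lambda>y. indicator Bx (override_on u y S a) :: real) \<in> borel_measurable (lborel_on S)"
    by (rule measurable_compose) (rule borel_measurable_indicator[OF Bx])
qed

lemma R_measurable_override:
  assumes "finite S"
  shows "(\<lambda>y. R k (override_on u y S)) \<in> borel_measurable (lborel_on S)"
  unfolding R_def
  by (intro borel_measurable_prod borel_measurable_divide borel_measurable_const s_measurable_override assms)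

lemma measurable_extensional:
  assumes "(\<lambda>y. F (override_on (\<lambda>_. undefined) y S)) \<in> borel_measurable (lborel_on S)"
  shows "F \<in> borel_measurable (lborel_on S)"
proof -
  have eq: "F y = F (override_on (\<lambda>_. undefined) y S)" if "y \<in> space (lborel_on S)" for y
    using that by (simp add: space_lborel_on PiE_def override_on_extensional)
  have "F \<in> borel_measurable (lborel_on S) \<longleftrightarrow>
      (\<lambda>y. F (override_on (\<lambda>_. undefined) y S)) \<in> borel_measurable (lborel_on S)"
    by (rule measurable_cong) (rule eq)
  then show ?thesis using assms by blast
qed

lemma s_measurable: "s k \<in> borel_measurable (lborel_on (A r))"
  by (rule measurable_extensional[OF s_measurable_override]) simp

lemma R_measurable: "R k \<in> borel_measurable (lborel_on (C r))"
  by (rule measurable_extensional[OF R_measurable_override]) simp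

text \<open>\<open>s k\<close> is strictly positive on the product of copies of \<open>Bx\<close>, a
  set of positive measure because \<open>Bx\<close> has positive length, so its integral cannot
  vanish.\<close>

lemma Z_pos:
  assumes "k < m" "integrable (lborel_on (A k)) (s k)"
  shows "Z k > 0"
proof (rule ccontr)
  assume "\<not> Z k > 0"
  then have "Z k = 0" using Z_nonneg[of k] by linarith
  then have AE: "AE y in lborel_on (A k). s k y = 0"
    unfolding Z_def using integral_nonneg_eq_0_iff_AE[OF assms(2)] s_nonneg by blast
  define N where "N = (A k \<rightarrow>\<^sub>E Bx)"
  have N: "N \<in> sets (lborel_on (A k))"
    unfolding N_def by (rule sets_PiM_I_finite) (use Bx in simp_all)
  have "AE y in lborel_on (A k). y \<notin> N"
    using AE
  proof (rule AE_mp, intro AE_I2 impI notI)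
    fix y assume "s k y = 0" "y \<in> N"
    then show False using g_pos[of k y] by (auto simp: s_eq N_def PiE_iff split: if_splits)
  qed
  then have "emeasure (lborel_on (A k)) N = 0"
    using N sets.sets_into_space[OF N] by (subst (asm) AE_iff_measurable[OF N]) auto
  moreover have "emeasure (lborel_on (A k)) N = (\<Prod>a\<in>A k. emeasure lborel Bx)"
    unfolding N_def by (rule lborel_product.emeasure_PiM) (use Bx in simp_all)
  ultimately show False using Bx_pos by (simp add: prod_zero_iff)
qed

text \<open>Stated with the nonnegative integral, so that it includes integrability of
  \<open>R k\<close>.\<close>

definition normalized :: "nat \<Rightarrow> bool" where
  "normalized k \<longleftrightarrow> (\<integral>\<^sup>+y. ennreal (R k y) \<partial>lborel_on (C k)) = 1"

lemma normalized_integrable: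
  assumes "normalized k"
  shows "integrable (lborel_on (C k)) (R k)" "(\<integral>y. R k y \<partial>lborel_on (C k)) = 1"
proof -
  show int: "integrable (lborel_on (C k)) (R k)"
    by (rule integrableI_nonneg[OF R_measurable]) (use assms R_nonneg in \<open>auto simp: normalized_def\<close>)
  show "(\<integral>y. R k y \<partial>lborel_on (C k)) = 1"
    using assms unfolding normalized_def
    by (subst integral_eq_nn_integral[OF R_measurable]) (use R_nonneg in auto)
qed

lemma normalized_step:
  assumes k: "k < m" and IH: "normalized (Suc k)" and int: "integrable (lborel_on (A k)) (s k)"
  shows "normalized k"
proof -
  let ?C = "C (Suc k)"
  have disj: "A k \<inter> ?C = {}" by (rule A_C_disjoint[OF k])
  have Z: "Z k > 0" by (rule Z_pos[OF k int])
  have "(\<integral>\<^sup>+y. ennreal (R k y) \<partial>lborel_on (A k \<union> ?C)) =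
      (\<integral>\<^sup>+x. \<integral>\<^sup>+y. ennreal (R k (merge (A k) ?C (x, y))) \<partial>lborel_on ?C \<partial>lborel_on (A k))"
    using R_measurable[of k k] unfolding C_Suc[OF k]
    by (intro lborel_product.product_nn_integral_fold disj List.finite_set measurable_compose[OF _ measurable_ennreal])
  also have "\<dots> = (\<integral>\<^sup>+x. ennreal (s k x / Z k) \<partial>lborel_on (A k))"
  proof (rule nn_integral_cong)
    fix x
    have eq: "ennreal (R k (merge (A k) ?C (x, y))) = ennreal (s k x / Z k) * ennreal (R (Suc k) y)" for y
    proof -
      have "s k (merge (A k) ?C (x, y)) = s k x"
        by (rule s_dep[OF k]) (simp add: merge_def)
      moreover have "R (Suc k) (merge (A k) ?C (x, y)) = R (Suc k) y"
        by (rule R_dep) (use disj in \<open>auto simp: merge_def\<close>)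
      ultimately show ?thesis
        unfolding R_Suc[OF k]
        by (simp only: ennreal_mult[OF divide_nonneg_nonneg[OF s_nonneg Z_nonneg] R_nonneg])
    qed
    have meas: "(\<lambda>y. ennreal (R (Suc k) y)) \<in> borel_measurable (lborel_on ?C)"
      by (rule measurable_compose[OF R_measurable measurable_ennreal])
    show "(\<integral>\<^sup>+y. ennreal (R k (merge (A k) ?C (x, y))) \<partial>lborel_on ?C) = ennreal (s k x / Z k)"
      unfolding eq nn_integral_cmult[OF meas] using IH unfolding normalized_def by simp
  qed
  also have "\<dots> = ennreal (\<integral>x. s k x / Z k \<partial>lborel_on (A k))"
    by (rule nn_integral_eq_integral)
       (use int s_nonneg Z in \<open>auto intro!: AE_I2 Bochner_Integration.integrable_divide\<close>)
  also have "(\<integral>x. s k x / Z k \<partial>lborel_on (A k)) = 1"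
    using Z by (simp add: Z_def[symmetric])
  finally show ?thesis unfolding normalized_def C_Suc[OF k] by simp
qed

text \<open>The guard is essential: if a preceding group lies outside \<open>Bx\<close>, the kernel
  is identically 0, and the quotient 0 / 0 makes the constructed tail 0, whereas \<open>R k\<close>
  does not look at the preceding groups. For \<open>k = 0\<close> the guard is void.\<close>

definition tail_ok :: "nat \<Rightarrow> bool" where
  "tail_ok k \<longleftrightarrow> (\<forall>u\<in>parameter_space gs. (\<forall>b\<in>B k. \<phi> u b \<in> Bx) \<longrightarrow>
     ref_tail X f gs K (m - k) u = R k (\<phi> u))"

text \<open>The part of the integrand that comes from \<open>G\<close>. The part from
  \<open>g\<close> is a constant multiple of the tail density, so the integrability of this part
  decides the finiteness of the expectation.\<close>

definition inner :: "nat \<Rightarrow> ('k \<Rightarrow> real) \<Rightarrow> ('k \<Rightarrow> real) \<Rightarrow> real" where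
  "inner k u w = ln (G k (override_on (\<phi> u) w (C (Suc k)))) * R (Suc k) w"

definition inner_ok :: "nat \<Rightarrow> bool" where
  "inner_ok k \<longleftrightarrow> (\<forall>u\<in>parameter_space gs. (\<forall>b\<in>B (Suc k). \<phi> u b \<in> Bx) \<longrightarrow>
     integrable (lborel_on (C (Suc k))) (inner k u))"

text \<open>\<open>G k\<close> may depend on every group except \<open>k\<close>, also on later
  ones, so this is a genuine expectation. What matters is only that the result does not involve
  group \<open>k\<close>.\<close>

definition e :: "nat \<Rightarrow> ('k \<Rightarrow> real) \<Rightarrow> real" where
  "e k u = (\<integral>w. inner k u w \<partial>lborel_on (C (Suc k)))"

lemma inner_measurable: "inner k u \<in> borel_measurable (lborel_on (C (Suc k)))"
  unfolding inner_def
proof (rule borel_measurable_times[OF _ R_measurable], rule continuous_on_measurable_override[OF List.finite_set])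
  have "G k v \<noteq> 0" for v using G_pos[of k v] by simp
  then show "continuous_on UNIV (\<lambda>v. ln (G k v))"
    by (intro continuous_on_ln cont_G) auto
qed

abbreviation "intg k u \<equiv> ref_integrand X f gs (ref_tail X f gs K (m - Suc k)) k u"

lemma ref_integrand_eq:
  assumes k: "k < m" and tail: "tail_ok (Suc k)"
    and u: "u \<in> parameter_space gs" and ub: "\<forall>b\<in>B (Suc k). \<phi> u b \<in> Bx"
  shows "intg k u y = inner k u (\<Psi> (C (Suc k)) u y) + ln (g k (\<phi> u)) * R (Suc k) (\<Psi> (C (Suc k)) u y)"
proof -
  let ?C = "C (Suc k)"
  let ?\<mu> = "override_on u y ?C"
  have mu: "?\<mu> \<in> parameter_space gs"
    by (rule override_PS[OF u]) (use BC(1)[of "Suc k"] in blast)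
  have phi: "\<phi> ?\<mu> = override_on (\<phi> u) (\<Psi> ?C u y) ?C" by (rule \<phi>_override_tail[OF k])
  have b: "\<phi> ?\<mu> b = \<phi> u b" if "b \<in> B (Suc k)" for b
    unfolding phi using that BC(2)[of "Suc k"] by (auto simp: override_on_def)
  have T: "ref_tail X f gs K (m - Suc k) ?\<mu> = R (Suc k) (\<phi> ?\<mu>)"
    using tail mu b ub unfolding tail_ok_def by simp
  have R: "R (Suc k) (\<phi> ?\<mu>) = R (Suc k) (\<Psi> ?C u y)"
    by (rule R_dep) (simp add: phi)
  have g: "g k (\<phi> ?\<mu>) = g k (\<phi> u)"
    by (rule g_dep[OF k b]) (use B_Suc[OF k] in blast)
  have "ln (Determinant.det (h_block X f gs k ?\<mu>)) = ln (G k (\<phi> ?\<mu>)) + ln (g k (\<phi> u))"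
    unfolding det_h[OF mu k] g by (rule ln_mult_pos[OF G_pos g_pos])
  then show ?thesis
    unfolding ref_integrand_def Let_def later_labels_def T R[unfolded phi] inner_def phi by (simp add: distrib_right)
qed

text \<open>The substitution preserves Lebesgue measure, and the two integrands then differ by an
  integrable multiple of \<open>R (Suc k)\<close>. The equivalence is used in both directions: to
  establish finiteness on boxes and to exploit an assumed finiteness on the whole space.\<close>

lemma ref_integrand_integrable_iff:
  assumes k: "k < m" and tail: "tail_ok (Suc k)" and norm: "normalized (Suc k)"
    and u: "u \<in> parameter_space gs" and ub: "\<forall>b\<in>B (Suc k). \<phi> u b \<in> Bx"
  shows "integrable (lborel_on (later_labels gs k)) (intg k u) \<longleftrightarrow>
      integrable (lborel_on (C (Suc k))) (inner k u)"
    and "integrable (lborel_on (C (Suc k))) (inner k u) \<Longrightarrow>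
      ref_expectation X f gs (ref_tail X f gs K (m - Suc k)) k u = e k u + ln (g k (\<phi> u))"
proof -
  let ?C = "C (Suc k)"
  let ?M = "lborel_on ?C"
  define h where "h = (\<lambda>w. inner k u w + ln (g k (\<phi> u)) * R (Suc k) w)"
  have later: "later_labels gs k = ?C" by (simp add: later_labels_def)
  have eq: "intg k u = (\<lambda>y. h (\<Psi> ?C u y))"
    unfolding h_def by (rule ext) (rule ref_integrand_eq[OF k tail u ub])
  have R_int: "integrable ?M (\<lambda>w. ln (g k (\<phi> u)) * R (Suc k) w)"
    by (rule integrable_mult_right[OF normalized_integrable(1)[OF norm]])
  have h_meas: "h \<in> borel_measurable ?M"
    unfolding h_def
    by (rule borel_measurable_add[OF inner_measurable]) (rule borel_measurable_times[OF borel_measurable_const R_measurable])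
  have 1: "integrable ?M (intg k u) \<longleftrightarrow> integrable ?M h"
    unfolding eq using integrable_distr_eq[OF \<Psi>_tail(1) , of h "Suc k" u] h_meas \<Psi>_tail(2)[of "Suc k" u] by simp
  have 2: "integrable ?M h \<longleftrightarrow> integrable ?M (inner k u)"
  proof
    assume "integrable ?M h"
    from Bochner_Integration.integrable_diff[OF this R_int]
    show "integrable ?M (inner k u)" by (simp add: h_def)
  next
    assume "integrable ?M (inner k u)"
    from Bochner_Integration.integrable_add[OF this R_int]
    show "integrable ?M h" by (simp add: h_def)
  qed
  show "integrable (lborel_on (later_labels gs k)) (intg k u) \<longleftrightarrow> integrable ?M (inner k u)"
    unfolding later using 1 2 by simp
  assume int: "integrable ?M (inner k u)"
  have "ref_expectation X f gs (ref_tail X f gs K (m - Suc k)) k u = (\<integral>y. h (\<Psi> ?C u y) \<partial>?M)"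
    unfolding ref_expectation_def later eq ..
  also have "\<dots> = (\<integral>w. h w \<partial>?M)"
    using integral_distr[OF \<Psi>_tail(1), of h "Suc k" u] h_meas \<Psi>_tail(2)[of "Suc k" u] by simp
  also have "\<dots> = e k u + ln (g k (\<phi> u))"
    unfolding h_def e_def Bochner_Integration.integral_add[OF int R_int]
    using normalized_integrable(2)[OF norm] by simp
  finally show "ref_expectation X f gs (ref_tail X f gs K (m - Suc k)) k u = e k u + ln (g k (\<phi> u))" .
qed

lemma ref_kernel_eq:
  assumes k: "k < m" and tail: "tail_ok (Suc k)" and norm: "normalized (Suc k)" and inner: "inner_ok k"
    and u: "u \<in> parameter_space gs"
  shows "ref_kernel X f gs K (ref_tail X f gs K (m - Suc k)) k u =
    (if \<forall>b\<in>B k. \<phi> u b \<in> Bx then exp (e k u / 2) * s k (\<phi> u) else 0)"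
proof (cases "\<forall>b\<in>B (Suc k). \<phi> u b \<in> Bx")
  case True
  have int: "integrable (lborel_on (C (Suc k))) (inner k u)"
    using inner u True unfolding inner_ok_def by blast
  have "exp (1 / 2 * (e k u + ln (g k (\<phi> u)))) = exp (e k u / 2) * sqrt (g k (\<phi> u))"
    using g_pos[of k "\<phi> u"] by (simp add: distrib_left exp_add ln_sqrt[symmetric])
  moreover have "\<forall>b\<in>B k. \<phi> u b \<in> Bx" "\<forall>b\<in>A k. \<phi> u b \<in> Bx"
    using True B_Suc[OF k] by blast+
  ultimately show ?thesis
    unfolding ref_kernel_def s_eq ref_integrand_integrable_iff(2)[OF k tail norm u True int]
    using proj[OF k u] True by simp
next
  case False
  then have "\<not> (\<forall>b\<in>B k. \<phi> u b \<in> Bx) \<or> \<not> (\<forall>b\<in>A k. \<phi> u b \<in> Bx)"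
    using B_Suc[OF k] by blast
  then show ?thesis
    unfolding ref_kernel_def s_eq using proj[OF k u] False by auto
qed

text \<open>As \<open>G k\<close> ignores group \<open>k\<close>, varying this group leaves the
  expectation \<open>e k\<close> unchanged. The kernel is therefore a constant times
  \<open>s k\<close> along the group, and the constant will cancel in the normalization.\<close>

lemma ref_kernel_group:
  assumes k: "k < m" and tail: "tail_ok (Suc k)" and norm: "normalized (Suc k)" and inner: "inner_ok k"
    and u: "u \<in> parameter_space gs"
  shows "ref_kernel X f gs K (ref_tail X f gs K (m - Suc k)) k (override_on u y (A k)) =
    (if \<forall>b\<in>B k. \<phi> u b \<in> Bx then exp (e k u / 2) else 0) * s k (\<Psi> (A k) u y)"
proof -
  let ?v = "override_on u y (A k)"
  have v: "?v \<in> parameter_space gs" by (rule override_PS[OF u A_subset[OF k]])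
  have b: "\<phi> ?v b = \<phi> u b" if "b \<in> B k" for b by (rule \<phi>_override_group[OF k that])
  have "override_on (\<phi> ?v) w (C (Suc k)) a = override_on (\<phi> u) w (C (Suc k)) a" if a: "a \<notin> A k" for w a
  proof (cases "a \<in> L")
    case True
    then have "a \<in> B k \<or> a \<in> C (Suc k)" using BC(1)[of k] C_Suc[OF k] a by blast
    then show ?thesis using b by (auto simp: override_on_def)
  next
    case False
    then show ?thesis using \<phi>_out[OF False] a by (simp add: override_on_def)
  qed
  then have "G k (override_on (\<phi> ?v) w (C (Suc k))) = G k (override_on (\<phi> u) w (C (Suc k)))" for w
    by (intro G_dep[OF k])
  then have e: "e k ?v = e k u"
    unfolding e_def inner_def by simp
  have s: "s k (\<phi> ?v) = s k (\<Psi> (A k) u y)"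
    by (rule s_dep[OF k]) (simp add: \<Psi>_def)
  have "(\<forall>b\<in>B k. \<phi> ?v b \<in> Bx) \<longleftrightarrow> (\<forall>b\<in>B k. \<phi> u b \<in> Bx)" using b by simp
  then show ?thesis
    unfolding ref_kernel_eq[OF k tail norm inner v] e s by simp
qed

text \<open>Outside the projection of the region the kernel is 0 and thus integrable, so
  integrability of \<open>s k\<close> is demanded only at points whose preceding groups lie in the
  box.\<close>

lemma ref_kernel_integral:
  assumes k: "k < m" and tail: "tail_ok (Suc k)" and norm: "normalized (Suc k)" and inner: "inner_ok k"
    and u: "u \<in> parameter_space gs"
  defines "ker \<equiv> \<lambda>y. ref_kernel X f gs K (ref_tail X f gs K (m - Suc k)) k (override_on u y (A k))"
  shows "integrable (lborel_on (A k)) ker \<longleftrightarrow>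
      ((\<forall>b\<in>B k. \<phi> u b \<in> Bx) \<longrightarrow> integrable (lborel_on (A k)) (s k))"
    and "(\<integral>y. ker y \<partial>lborel_on (A k)) = (if \<forall>b\<in>B k. \<phi> u b \<in> Bx then exp (e k u / 2) else 0) * Z k"
proof -
  let ?M = "lborel_on (A k)"
  let ?c = "if \<forall>b\<in>B k. \<phi> u b \<in> Bx then exp (e k u / 2) else (0::real)"
  have ker: "ker = (\<lambda>y. ?c * s k (\<Psi> (A k) u y))"
    unfolding ker_def by (rule ext) (rule ref_kernel_group[OF k tail norm inner u])
  have i1: "integrable ?M (\<lambda>y. s k (\<Psi> (A k) u y)) \<longleftrightarrow> integrable ?M (s k)"
    using integrable_distr_eq[OF \<Psi>_group(1)[OF k], of "s k" u] s_measurable[of k k] \<Psi>_group(2)[OF k, of u] by simp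
  have i2: "(\<integral>y. s k (\<Psi> (A k) u y) \<partial>?M) = Z k"
    unfolding Z_def
    using integral_distr[OF \<Psi>_group(1)[OF k], of "s k" u] s_measurable[of k k] \<Psi>_group(2)[OF k, of u] by simp
  show "integrable ?M ker \<longleftrightarrow> ((\<forall>b\<in>B k. \<phi> u b \<in> Bx) \<longrightarrow> integrable ?M (s k))"
    unfolding ker using i1 by (cases "\<forall>b\<in>B k. \<phi> u b \<in> Bx") auto
  show "(\<integral>y. ker y \<partial>?M) = ?c * Z k"
    unfolding ker using i2 by simp
qed

lemma tail_step:
  assumes k: "k < m" and tail: "tail_ok (Suc k)" and norm: "normalized (Suc k)" and inner: "inner_ok k"
  shows "tail_ok k"
  unfolding tail_ok_def
proof (intro ballI impI)
  fix u assume u: "u \<in> parameter_space gs" and ub: "\<forall>b\<in>B k. \<phi> u b \<in> Bx"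
  let ?T = "ref_tail X f gs K (m - Suc k)"
  have mk: "m - k = Suc (m - Suc k)" "m - Suc (m - Suc k) = k" using k by simp_all
  \<comment> \<open>The positive factor exp (e/2) occurs in the kernel and in its integral and
    cancels here.\<close>
  have cond: "ref_conditional X f gs K ?T k u = s k (\<phi> u) / Z k"
    unfolding ref_conditional_def ref_kernel_integral(2)[OF k tail norm inner u]
      ref_kernel_eq[OF k tail norm inner u]
    using ub by simp
  have "ref_tail X f gs K (m - k) u = s k (\<phi> u) / Z k * ?T u"
    unfolding mk(1) ref_tail.simps mk(2) cond ..
  also have "\<dots> = R k (\<phi> u)"
  proof (cases "\<forall>b\<in>A k. \<phi> u b \<in> Bx")
    case True
    then have "\<forall>b\<in>B (Suc k). \<phi> u b \<in> Bx" using ub B_Suc[OF k] by blast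
    then have "?T u = R (Suc k) (\<phi> u)" using tail u unfolding tail_ok_def by blast
    then show ?thesis by (simp add: R_Suc[OF k])
  next
    \<comment> \<open>The construction says nothing about the tail at a point where group
      \<open>k\<close> leaves the box, but both products are 0 there because \<open>s k\<close>
      vanishes.\<close>
    case False
    then have "s k (\<phi> u) = 0" by (simp only: s_eq if_False)
    then show ?thesis by (simp add: R_Suc[OF k])
  qed
  finally show "ref_tail X f gs K (m - k) u = R k (\<phi> u)" .
qed

text \<open>Induction from the last group backwards, in the order of the construction itself. The
  shape of \<open>step\<close> lets an instance prove the integrability of \<open>s k\<close> with
  the help of \<open>inner_ok k\<close>.\<close>

lemma main:
  assumes step: "\<And>k. k < m \<Longrightarrow> tail_ok (Suc k) \<Longrightarrow> normalized (Suc k) \<Longrightarrow>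
      inner_ok k \<and> (inner_ok k \<longrightarrow> integrable (lborel_on (A k)) (s k))"
  shows "k \<le> m \<Longrightarrow> tail_ok k \<and> normalized k \<and> (\<forall>r\<in>{k..<m}. 0 < Z r)"
proof (induction "m - k" arbitrary: k)
  case 0
  then have k: "k = m" by simp
  \<comment> \<open>No group is left: the integral runs over the one-point space of the empty
    product, which has mass 1.\<close>
  have "(\<integral>\<^sup>+y. ennreal 1 \<partial>lborel_on ({} :: 'k set)) = 1"
    by (simp add: lborel_product.emeasure_PiM[of "{}", simplified] PiM_empty)
  then show ?case unfolding k by (simp add: tail_ok_def normalized_def R_def)
next
  case (Suc d)
  then have k: "k < m" by simp
  have IH: "tail_ok (Suc k)" "normalized (Suc k)" "\<forall>r\<in>{Suc k..<m}. 0 < Z r"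
    using Suc.hyps(1)[of "Suc k"] Suc.hyps(2) k by auto
  have inner: "inner_ok k" and int: "integrable (lborel_on (A k)) (s k)"
    using step[OF k IH(1,2)] by blast+
  have "0 < Z r" if "r \<in> {k..<m}" for r
    using IH(3) Z_pos[OF k int] that by (cases "r = k") auto
  then show ?case
    using tail_step[OF k IH(1,2) inner] normalized_step[OF k IH(2) int] by blast
qed

lemma ref_finiteI:
  assumes step: "\<And>k. k < m \<Longrightarrow> tail_ok (Suc k) \<Longrightarrow> normalized (Suc k) \<Longrightarrow>
      inner_ok k \<and> integrable (lborel_on (A k)) (s k)"
  shows "ref_finite X f gs K"
  unfolding ref_finite_def Let_def
proof (intro allI impI ballI conjI)
  fix k u assume k: "k < m" and u: "u \<in> parameter_space gs"
  have ok: "tail_ok (Suc k)" "normalized (Suc k)"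
    using main[of "Suc k"] step k by auto
  have inner: "inner_ok k" and int: "integrable (lborel_on (A k)) (s k)" using step[OF k ok] by blast+
  show "integrable (lborel_on (later_labels gs k)) (intg k u)" if pr: "in_projection K gs k u"
  proof -
    have ub: "\<forall>b\<in>B (Suc k). \<phi> u b \<in> Bx" using pr proj[OF k u] by blast
    then show ?thesis
      using ref_integrand_integrable_iff(1)[OF k ok u ub] inner u unfolding inner_ok_def by blast
  qed
  show "integrable (lborel_on (A k))
      (\<lambda>y. ref_kernel X f gs K (ref_tail X f gs K (m - Suc k)) k (override_on u y (A k)))"
    using ref_kernel_integral(1)[OF k ok inner u] int by blast
qed

text \<open>The point \<open>u0\<close> witnesses that the region is not empty. At a point outside
  the projection the kernel is 0, and its integrability would carry no information about
  \<open>s k\<close>.\<close>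

lemma ref_finiteD:
  assumes fin: "ref_finite X f gs K" and k: "k < m" and ok: "tail_ok (Suc k)" "normalized (Suc k)"
    and ne: "u0 \<in> parameter_space gs" "\<forall>b\<in>L. \<phi> u0 b \<in> Bx"
  shows "inner_ok k \<and> (inner_ok k \<longrightarrow> integrable (lborel_on (A k)) (s k))"
proof (intro conjI impI)
  have fin': "in_projection K gs k u \<longrightarrow> integrable (lborel_on (later_labels gs k)) (intg k u)"
    "integrable (lborel_on (A k))
      (\<lambda>y. ref_kernel X f gs K (ref_tail X f gs K (m - Suc k)) k (override_on u y (A k)))"
    if "u \<in> parameter_space gs" for u
    using fin k that unfolding ref_finite_def Let_def by blast+
  show "inner_ok k"
    unfolding inner_ok_def
  proof (intro ballI impI)
    fix u assume u: "u \<in> parameter_space gs" and ub: "\<forall>b\<in>B (Suc k). \<phi> u b \<in> Bx"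
    then show "integrable (lborel_on (C (Suc k))) (inner k u)"
      using ref_integrand_integrable_iff(1)[OF k ok u ub] fin'(1)[OF u] proj[OF k u] by blast
  qed
  assume inner: "inner_ok k"
  have "\<forall>b\<in>B k. \<phi> u0 b \<in> Bx" using ne(2) BC(1)[of k] by blast
  then show "integrable (lborel_on (A k)) (s k)"
    using ref_kernel_integral(1)[OF k ok inner ne(1)] fin'(2)[OF ne(1)] by blast
qed

lemma ref_density_eq:
  assumes "tail_ok 0" "u \<in> parameter_space gs"
  shows "ref_density X f gs K u = R 0 (\<phi> u)"
  using assms by (simp add: tail_ok_def)

end

section \<open>Finite construction or limit along an exhaustion by boxes\<close>

context triangular_region begin

lemma R_0:
  "R 0 v = (if \<forall>a\<in>L. v a \<in> Bx then (\<Prod>r<m. sqrt (g r v)) / (\<Prod>r<m. Z r) else 0)"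
proof -
  have eq: "R 0 v = (\<Prod>r<m. s r v) / (\<Prod>r<m. Z r)"
    unfolding R_def prod_dividef by (simp add: atLeast0LessThan)
  show ?thesis
  proof (cases "\<forall>a\<in>L. v a \<in> Bx")
    case True
    then have "s r v = sqrt (g r v)" if "r < m" for r
      using A_subset[OF that] by (auto simp: s_eq)
    then have "(\<Prod>r<m. s r v) = (\<Prod>r<m. sqrt (g r v))" by (intro prod.cong) auto
    then show ?thesis unfolding eq using True by simp
  next
    case False
    then obtain a where a: "a \<in> L" "v a \<notin> Bx" by blast
    then obtain r where r: "r < m" "a \<in> A r" unfolding in_set_concat_nth by blast
    then have "s r v = 0" using a by (auto simp: s_eq)
    then have "(\<Prod>r<m. s r v) = 0" using r by (intro prod_zero bexI[of _ r]) auto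
    then show ?thesis unfolding eq using False by auto
  qed
qed

text \<open>The tail density lives on the box, so a bound for ln G is needed only there, where
  compactness provides it.\<close>

lemma R_support:
  assumes "R k w \<noteq> 0" "a \<in> C k" "k \<le> m"
  shows "w a \<in> Bx"
proof -
  obtain r where r: "r < m" "k \<le> r" "a \<in> A r" using assms(2) in_set_concat_drop[OF assms(3)] by blast
  have "s r w \<noteq> 0"
  proof
    assume "s r w = 0"
    then have "R k w = 0" unfolding R_def using r by (intro prod_zero bexI[of _ r]) auto
    then show False using assms(1) by simp
  qed
  then show ?thesis using r(3) by (auto simp: s_eq split: if_splits)
qed

end

context triangular_model begin

text \<open>A product of compact sets, hence compact in the product topology. Coordinates off the
  labels are pinned to \<open>undefined\<close>, as in the parameter space.\<close>

definition box :: "real \<Rightarrow> ('k \<Rightarrow> real) set" where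
  "box c = {v. \<forall>a. v a \<in> (if a \<in> L then {-c..c} else {undefined})}"

lemma compact_box: "compact (box c)"
proof -
  have eq: "box c = PiE UNIV (\<lambda>a. if a \<in> L then {-c..c} else {undefined})"
    unfolding box_def PiE_UNIV_domain Pi_def by simp
  have "compactin (product_topology (\<lambda>_ :: 'k. euclidean :: real topology) UNIV)
      (PiE UNIV (\<lambda>a. if a \<in> L then {-c..c} else {undefined}))"
    unfolding compactin_PiE by (auto simp: compactin_euclidean_iff)
  then show ?thesis
    unfolding euclidean_product_topology compactin_euclidean_iff eq .
qed

lemma bounded_box:
  assumes "continuous_on UNIV F"
  shows "\<exists>M::real. M \<ge> 0 \<and> (\<forall>v\<in>box c. \<bar>F v\<bar> \<le> M)"
proof -
  have "compact (F ` box c)"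
    by (rule compact_continuous_image[OF continuous_on_subset[OF assms] compact_box]) simp
  then have "bounded (F ` box c)" by (rule compact_imp_bounded)
  then obtain M where "\<forall>x\<in>F ` box c. norm x \<le> M" unfolding bounded_iff by blast
  then have M: "\<bar>F v\<bar> \<le> M" if "v \<in> box c" for v using that by auto
  have "\<bar>F v\<bar> \<le> max 0 M" if "v \<in> box c" for v using M[OF that] by linarith
  then show ?thesis by (intro exI[of _ "max 0 M"]) simp
qed

lemma box_subset_PS: "box c \<subseteq> parameter_space gs"
proof
  fix v assume "v \<in> box c"
  then have "v a \<in> (if a \<in> L then {-c..c} else {undefined})" for a unfolding box_def by blast
  then have "v a = undefined" if "a \<notin> L" for a using that by (metis singletonD)
  then show "v \<in> parameter_space gs" unfolding PS_iff by blast
qed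

lemma in_box_iff: "v \<in> parameter_space gs \<Longrightarrow> v \<in> box c \<longleftrightarrow> (\<forall>a\<in>L. v a \<in> {-c..c})"
  unfolding box_def PS_iff by auto

lemma in_image_box_iff: "u \<in> \<psi> ` box c \<longleftrightarrow> \<phi> u \<in> box c"
proof
  assume "u \<in> \<psi> ` box c"
  then obtain v where "u = \<psi> v" "v \<in> box c" ..
  then show "\<phi> u \<in> box c" by (simp only: \<phi>_\<psi>)
next
  assume "\<phi> u \<in> box c"
  then have "\<psi> (\<phi> u) \<in> \<psi> ` box c" by (rule imageI)
  then show "u \<in> \<psi> ` box c" by (simp only: \<psi>_\<phi>)
qed

text \<open>The reason for taking the compact regions as images of boxes under \<psi>: as \<psi> is
  triangular, their projections to the first groups are again boxes in the coordinates
  \<phi>.\<close>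

lemma projection_box:
  assumes c: "0 < c" and k: "k < m" and u: "u \<in> parameter_space gs"
  shows "in_projection (\<psi> ` box c) gs k u \<longleftrightarrow> (\<forall>b\<in>B (Suc k). \<phi> u b \<in> {-c..c})"
proof
  assume "in_projection (\<psi> ` box c) gs k u"
  then obtain y where y: "override_on u y (C (Suc k)) \<in> \<psi> ` box c"
    unfolding in_projection_def later_labels_def by blast
  then have "\<phi> (override_on u y (C (Suc k))) \<in> box c" by (simp only: in_image_box_iff)
  then have in_box: "override_on (\<phi> u) (\<Psi> (C (Suc k)) u y) (C (Suc k)) \<in> box c"
    by (simp only: \<phi>_override_tail[OF k])
  show "\<forall>b\<in>B (Suc k). \<phi> u b \<in> {-c..c}"
  proof
    fix b assume b: "b \<in> B (Suc k)"
    then have "b \<in> L" "b \<notin> C (Suc k)" using BC[of "Suc k"] by blast+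
    then show "\<phi> u b \<in> {-c..c}"
      using in_box unfolding box_def by (auto dest!: spec[of _ b])
  qed
next
  assume b: "\<forall>b\<in>B (Suc k). \<phi> u b \<in> {-c..c}"
  \<comment> \<open>Complete the given groups by zeros in the new coordinates; 0 lies in the
    interval since \<open>c\<close> is positive. On the first groups \<psi> reads only values taken
    from \<phi> u, so it returns \<open>u\<close> there.\<close>
  define w where "w = override_on (\<phi> u) (\<lambda>_. 0) (C (Suc k))"
  have w_PS: "w \<in> parameter_space gs"
    unfolding w_def by (rule override_PS[OF \<phi>_PS[OF u]]) (use BC(1)[of "Suc k"] in blast)
  have w: "w \<in> box c"
    unfolding in_box_iff[OF w_PS]
  proof
    fix a assume "a \<in> L"
    then show "w a \<in> {-c..c}"
      using b c BC(1)[of "Suc k"] unfolding w_def by (cases "a \<in> C (Suc k)") auto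
  qed
  have "\<psi> w a = u a" if a: "a \<notin> C (Suc k)" for a
  proof (cases "a \<in> L")
    case True
    then have aB: "a \<in> B (Suc k)" using a BC(1)[of "Suc k"] by blast
    then obtain j where j: "j < Suc k" "a \<in> A j" unfolding in_B by auto
    have "t a w = t a (\<phi> u)"
    proof (rule t_dep[OF _ j(2)])
      show "j < m" using j k by simp
      fix b assume "b \<in> B j"
      then obtain i where "i < min j m" "b \<in> A i" unfolding in_B by blast
      then have "b \<in> B (Suc k)" unfolding in_B using j k by (intro exI[of _ i]) auto
      then have "b \<notin> C (Suc k)" using BC(2)[of "Suc k"] by blast
      then show "w b = \<phi> u b" by (simp add: w_def)
    qed
    then show ?thesis using True a \<phi>_in[OF True, of u] by (simp add: \<psi>_def w_def)
  next
    case False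
    then show ?thesis using a \<phi>_out[OF False] by (simp add: \<psi>_def w_def)
  qed
  then have "override_on u (\<psi> w) (C (Suc k)) = \<psi> w"
    by (auto simp: override_on_def)
  then show "in_projection (\<psi> ` box c) gs k u"
    unfolding in_projection_def later_labels_def using w by (metis imageI)
qed

text \<open>On the compact box the continuous functions ln G and sqrt g are bounded. Bounded times
  an integrable density, and bounded on a set of finite measure, give all the integrability that the
  construction needs.\<close>

lemma box_construction:
  assumes c: "0 < c"
  shows "ref_finite X f gs (\<psi> ` box c)"
    and "\<exists>z>0. \<forall>u\<in>parameter_space gs. ref_density X f gs (\<psi> ` box c) u =
      (if \<phi> u \<in> box c then (\<Prod>r<m. sqrt (g r (\<phi> u))) / z else 0)"
proof -
  interpret triangular_region X f gs \<phi> t G g "\<psi> ` box c" "{-c..c}"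
    by unfold_locales (use c projection_box[OF c] in auto)
  have inner: "inner_ok k" if k: "k < m" and norm: "normalized (Suc k)" for k
    unfolding inner_ok_def
  proof (intro ballI impI)
    fix u assume u: "u \<in> parameter_space gs" and ub: "\<forall>b\<in>B (Suc k). \<phi> u b \<in> {-c..c}"
    have "G k v \<noteq> 0" for v using G_pos[of k v] by simp
    then have "continuous_on UNIV (\<lambda>v. ln (G k v))"
      by (intro continuous_on_ln cont_G) auto
    from bounded_box[OF this, where c = c]
    obtain M where M: "M \<ge> 0" "\<forall>v\<in>box c. \<bar>ln (G k v)\<bar> \<le> M" by blast
    show "integrable (lborel_on (C (Suc k))) (inner k u)"
    proof (rule Bochner_Integration.integrable_bound[OF integrable_mult_right[of M, OF normalized_integrable(1)[OF norm]]
          inner_measurable], rule AE_I2)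
      fix w
      let ?v = "override_on (\<phi> u) w (C (Suc k))"
      show "norm (inner k u w) \<le> norm (M * R (Suc k) w)"
      proof (cases "R (Suc k) w = 0")
        case True then show ?thesis by (simp add: inner_def)
      next
        case False
        have v_PS: "?v \<in> parameter_space gs"
          by (rule override_PS[OF \<phi>_PS[OF u]]) (use BC(1)[of "Suc k"] in blast)
        have "?v \<in> box c"
          unfolding in_box_iff[OF v_PS]
        proof
          fix a assume aL: "a \<in> L"
          show "?v a \<in> {-c..c}"
          proof (cases "a \<in> C (Suc k)")
            case True
            then show ?thesis using R_support[OF False True] k by simp
          next
            case notC: False
            then show ?thesis using ub BC(1)[of "Suc k"] aL by auto
          qed
        qed
        then have "\<bar>ln (G k ?v)\<bar> \<le> M" using M(2) by blast
        then show ?thesis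
          using R_nonneg[of "Suc k" w] M(1) by (simp add: inner_def abs_mult mult_right_mono)
      qed
    qed
  qed
  have s_int: "integrable (lborel_on (A k)) (s k)" if k: "k < m" for k
  proof -
    have "continuous_on UNIV (\<lambda>v. sqrt (g k v))" by (intro continuous_on_real_sqrt cont_g)
    from bounded_box[OF this, where c = c]
    obtain M where M: "M \<ge> 0" "\<forall>v\<in>box c. \<bar>sqrt (g k v)\<bar> \<le> M" by blast
    define N where "N = (A k \<rightarrow>\<^sub>E {-c..c})"
    have N: "N \<in> sets (lborel_on (A k))"
      unfolding N_def by (rule sets_PiM_I_finite) simp_all
    have "emeasure (lborel_on (A k)) N = (\<Prod>a\<in>A k. emeasure lborel {-c..c})"
      unfolding N_def by (rule lborel_product.emeasure_PiM) simp_all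
    also have "\<dots> < \<infinity>" using c by (simp add: ennreal_power)
    finally have "integrable (lborel_on (A k)) (\<lambda>w. M * indicator N w)"
      using N by (intro integrable_mult_right integrable_real_indicator)
    then show ?thesis
    proof (rule Bochner_Integration.integrable_bound[OF _ s_measurable], intro AE_I2)
      fix w assume w: "w \<in> space (lborel_on (A k))"
      show "norm (s k w) \<le> norm (M * indicator N w)"
      proof (cases "\<forall>a\<in>A k. w a \<in> {-c..c}")
        case True
        \<comment> \<open>\<open>w\<close> itself is defined on group \<open>k\<close> only and need
          not lie in the box. The modified point does, and \<open>g k\<close> cannot distinguish the
          two.\<close>
        define w' where "w' = (\<lambda>a. if a \<in> A k then w a else if a \<in> L then 0 else undefined)"
        have "w' \<in> box c" using True c A_subset[OF k] by (auto simp: w'_def box_def)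
        moreover have "g k w = g k w'" by (rule g_dep[OF k]) (simp add: w'_def)
        ultimately have "\<bar>sqrt (g k w)\<bar> \<le> M" using M(2) by simp
        moreover have "w \<in> N" using True w by (auto simp: N_def space_lborel_on PiE_iff)
        ultimately show ?thesis using M(1) s_eq[of k w] True by simp
      next
        case False
        then have "s k w = 0" by (simp only: s_eq if_False)
        then show ?thesis by simp
      qed
    qed
  qed
  show "ref_finite X f gs (\<psi> ` box c)"
    by (rule ref_finiteI) (use inner s_int in blast)
  have "tail_ok 0 \<and> normalized 0 \<and> (\<forall>r\<in>{0..<m}. 0 < Z r)"
    by (rule main) (use inner s_int in blast)+
  then have tail: "tail_ok 0" and Z: "0 < (\<Prod>r<m. Z r)" by (auto intro!: prod_pos)
  show "\<exists>z>0. \<forall>u\<in>parameter_space gs. ref_density X f gs (\<psi> ` box c) u =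
      (if \<phi> u \<in> box c then (\<Prod>r<m. sqrt (g r (\<phi> u))) / z else 0)"
  proof (intro exI conjI ballI)
    fix u assume u: "u \<in> parameter_space gs"
    show "ref_density X f gs (\<psi> ` box c) u =
        (if \<phi> u \<in> box c then (\<Prod>r<m. sqrt (g r (\<phi> u))) / (\<Prod>r<m. Z r) else 0)"
      unfolding ref_density_eq[OF tail u] R_0 in_box_iff[OF \<phi>_PS[OF u]] ..
  qed (rule Z)
qed

text \<open>Both branches of the definition are settled without deciding which one applies. In the
  finite case the product of the \<open>Z\<close> is the normalizing constant; otherwise the
  densities on growing boxes agree with the claimed one up to a factor on their box.\<close>

theorem reference_prior: "reference_prior_proportional_to X f gs (\<lambda>u. \<Prod>r<m. sqrt (g r (\<phi> u)))"
proof (cases "ref_finite X f gs UNIV")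
  case True
  interpret triangular_region X f gs \<phi> t G g UNIV UNIV
    by unfold_locales (simp_all add: in_projection_def)
  have u0: "(\<lambda>_. undefined) \<in> parameter_space gs" unfolding PS_iff by simp
  have "tail_ok 0 \<and> normalized 0 \<and> (\<forall>r\<in>{0..<m}. 0 < Z r)"
  proof (rule main)
    show "inner_ok k \<and> (inner_ok k \<longrightarrow> integrable (lborel_on (A k)) (s k))"
      if "k < m" "tail_ok (Suc k)" "normalized (Suc k)" for k
      by (rule ref_finiteD[OF True that u0]) simp
  qed simp
  then have tail: "tail_ok 0" and Z: "0 < (\<Prod>r<m. Z r)" by (auto intro!: prod_pos)
  show ?thesis
    unfolding reference_prior_proportional_to_def is_reference_prior_def if_P[OF True]
  proof (intro exI conjI ballI)
    fix u assume u: "u \<in> parameter_space gs"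
    show "1 / (\<Prod>r<m. Z r) * (\<Prod>r<m. sqrt (g r (\<phi> u))) = ref_density X f gs UNIV u"
      unfolding ref_density_eq[OF tail u] R_0 by simp
  qed (use Z in simp)
next
  case False
  define p where "p = (\<lambda>u. \<Prod>r<m. sqrt (g r (\<phi> u)))"
  have p_pos: "0 < p u" for u
    unfolding p_def using g_pos by (intro prod_pos) simp
  define K where "K = (\<lambda>n :: nat. \<psi> ` box (real n + 1))"
  \<comment> \<open>The point with all new coordinates 0 lies in every box, so no denominator in the
    sequence vanishes.\<close>
  define u0 where "u0 = \<psi> (\<lambda>a. if a \<in> L then 0 else undefined)"
  have v0: "(\<lambda>a. if a \<in> L then 0 else undefined) \<in> box (real n + 1)" for n
    by (auto simp: box_def)
  have u0_box: "\<phi> u0 \<in> box (real n + 1)" for n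
    unfolding u0_def \<phi>_\<psi> by (rule v0)
  have u0_PS: "u0 \<in> parameter_space gs"
    unfolding u0_def by (rule \<psi>_PS) (use v0[of 0] box_subset_PS in blast)
  have eventually_box: "\<exists>n0. \<forall>n\<ge>n0. \<phi> u \<in> box (real n + 1)" if u: "u \<in> parameter_space gs" for u
  proof -
    obtain n0 :: nat where n0: "(\<Sum>a\<in>L. \<bar>\<phi> u a\<bar>) \<le> real n0" using real_arch_simple by blast
    have "\<phi> u \<in> box (real n + 1)" if n: "n0 \<le> n" for n
      unfolding in_box_iff[OF \<phi>_PS[OF u]]
    proof
      fix a assume "a \<in> L"
      then have "\<bar>\<phi> u a\<bar> \<le> (\<Sum>a\<in>L. \<bar>\<phi> u a\<bar>)" by (intro member_le_sum) auto
      then have "\<bar>\<phi> u a\<bar> \<le> real n + 1" using n0 n by linarith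
      then show "\<phi> u a \<in> {- (real n + 1)..real n + 1}" by auto
    qed
    then show ?thesis by blast
  qed
  have mono: "box c \<subseteq> box d" if "c \<le> d" for c d
  proof
    fix v assume "v \<in> box c"
    then have "\<And>a. v a \<in> (if a \<in> L then {-c..c} else {undefined})" by (simp add: box_def)
    moreover have "(if a \<in> L then {-c..c} else {undefined}) \<subseteq> (if a \<in> L then {-d..d} else {undefined})" for a
      using that by auto
    ultimately show "v \<in> box d" unfolding box_def by blast
  qed
  have incs: "incseq K"
    unfolding K_def by (intro incseq_SucI image_mono mono) simp
  have comp: "compact (K n)" for n
    unfolding K_def by (rule compact_continuous_image[OF continuous_on_subset[OF cont_\<psi>] compact_box]) simp
  have un: "(\<Union>n. K n) = parameter_space gs"
  proof
    show "(\<Union>n. K n) \<subseteq> parameter_space gs"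
      unfolding K_def using box_subset_PS \<psi>_PS by blast
    show "parameter_space gs \<subseteq> (\<Union>n. K n)"
    proof
      fix u assume "u \<in> parameter_space gs"
      then obtain n where "\<phi> u \<in> box (real n + 1)" using eventually_box by blast
      then show "u \<in> (\<Union>n. K n)" unfolding K_def by (auto simp: in_image_box_iff simp del: image_iff)
    qed
  qed
  have fin: "ref_finite X f gs (K n)" for n
    unfolding K_def by (rule box_construction(1)) simp
  have lim: "(\<lambda>n. ref_density X f gs (K n) u / ref_density X f gs (K n) u0) \<longlonglongrightarrow> 1 / p u0 * p u"
    if u: "u \<in> parameter_space gs" for u
  proof -
    obtain n0 where n0: "\<And>n. n \<ge> n0 \<Longrightarrow> \<phi> u \<in> box (real n + 1)" using eventually_box[OF u] by blast
    \<comment> \<open>The constant \<open>z\<close> depends on \<open>n\<close> but cancels, so the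
      sequence is constant from \<open>n0\<close> on and no limit theorem is needed.\<close>
    have "ref_density X f gs (K n) u / ref_density X f gs (K n) u0 = 1 / p u0 * p u" if n: "n0 \<le> n" for n
    proof -
      have "0 < real n + 1" by simp
      from box_construction(2)[OF this]
      obtain z where z: "z > 0" "\<forall>u\<in>parameter_space gs. ref_density X f gs (K n) u =
          (if \<phi> u \<in> box (real n + 1) then p u / z else 0)" unfolding K_def p_def by blast
      then show ?thesis using u u0_PS u0_box n0[OF n] by simp
    qed
    then have "\<forall>\<^sub>F n in sequentially. ref_density X f gs (K n) u / ref_density X f gs (K n) u0 = 1 / p u0 * p u"
      by (auto simp: eventually_sequentially)
    then show ?thesis by (rule tendsto_eventually)
  qed
  have "is_reference_prior X f gs (\<lambda>u. 1 / p u0 * p u)"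
    unfolding is_reference_prior_def if_not_P[OF False]
    by (intro exI[of _ K] exI[of _ u0] conjI allI ballI incs comp un fin u0_PS lim)
  then show ?thesis
    unfolding reference_prior_proportional_to_def p_def[symmetric]
    using p_pos[of u0] by (intro exI[of _ "1 / p u0"]) simp
qed

end

lemma reference_prior_proportional_to_cong:
  assumes "reference_prior_proportional_to X f gs h" "0 < c"
    and "\<And>u. u \<in> parameter_space gs \<Longrightarrow> h u = c * h' u"
  shows "reference_prior_proportional_to X f gs h'"
proof -
  obtain d where d: "d > 0" "is_reference_prior X f gs (\<lambda>u. d * h u)"
    using assms(1) unfolding reference_prior_proportional_to_def by blast
  have eq: "d * h u = d * c * h' u" if "u \<in> parameter_space gs" for u
    using assms(3)[OF that] by simp
  have "(\<forall>u\<in>parameter_space gs. d * h u = F u) \<longleftrightarrow> (\<forall>u\<in>parameter_space gs. d * c * h' u = F u)"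
    "(\<forall>u\<in>parameter_space gs. s u \<longlonglongrightarrow> d * h u) \<longleftrightarrow> (\<forall>u\<in>parameter_space gs. s u \<longlonglongrightarrow> d * c * h' u)"
    for F :: "_ \<Rightarrow> real" and s
    by (intro ball_cong refl, simp only: eq)+
  with d(2) have "is_reference_prior X f gs (\<lambda>u. (d * c) * h' u)"
    unfolding is_reference_prior_def by (simp only:)
  then show ?thesis
    unfolding reference_prior_proportional_to_def using d(1) assms(2) by (intro exI[of _ "d * c"]) simp
qed

section \<open>Contingency tables and Moebius inversion\<close>

lemma sum_Pow_insert:
  assumes "finite S" "\<gamma> \<notin> S"
  shows "(\<Sum>D\<in>Pow (insert \<gamma> S). g D) = (\<Sum>D\<in>Pow S. g D + g (insert \<gamma> D) :: real)"
proof -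
  have "inj_on (insert \<gamma>) (Pow S)" using assms(2) by (auto simp: inj_on_def)
  moreover have "Pow S \<inter> insert \<gamma> ` Pow S = {}" using assms(2) by auto
  ultimately show ?thesis
    using assms by (simp add: Pow_insert sum.union_disjoint sum.reindex sum.distrib)
qed

lemma card_insert_diff:
  assumes "finite S" "\<gamma> \<notin> S" "F \<subseteq> S"
  shows "card (insert \<gamma> S - F) = Suc (card (S - F))" "card (insert \<gamma> S - insert \<gamma> F) = card (S - F)"
proof -
  have "insert \<gamma> S - F = insert \<gamma> (S - F)" "insert \<gamma> S - insert \<gamma> F = S - F" using assms by auto
  then show "card (insert \<gamma> S - F) = Suc (card (S - F))" "card (insert \<gamma> S - insert \<gamma> F) = card (S - F)"
    using assms by simp_all
qed

text \<open>Pairing \<open>F\<close> with \<open>insert \<gamma> F\<close> turns an alternating sum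
  into a sum of differences in direction \<gamma>. It drives the inversion formulas and every later
  vanishing argument: if \<open>h\<close> ignores \<gamma>, all differences are 0.\<close>

lemma alternating_sum_insert:
  assumes "finite S" "\<gamma> \<notin> S"
  shows "(\<Sum>F\<in>Pow (insert \<gamma> S). (-1) ^ card (insert \<gamma> S - F) * h F) =
    (\<Sum>F\<in>Pow S. (-1) ^ card (S - F) * (h (insert \<gamma> F) - h F :: real))"
  unfolding sum_Pow_insert[OF assms]
  by (intro sum.cong refl) (use card_insert_diff[OF assms] in \<open>simp add: algebra_simps\<close>)

text \<open>In the induction the sums over \<open>D\<close> and over
  \<open>insert \<gamma> D\<close> are added; the terms without \<gamma> cancel and the same double
  sum over \<open>S\<close> remains, for the function shifted by \<gamma>.\<close>

lemma moebius_up: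
  fixes h :: "'v set \<Rightarrow> real"
  assumes "finite S"
  shows "(\<Sum>D\<in>Pow S. \<Sum>F\<in>Pow D. (-1) ^ card (D - F) * h F) = h S"
  using assms
proof (induction S arbitrary: h)
  case (insert \<gamma> S)
  have "(\<Sum>D\<in>Pow (insert \<gamma> S). \<Sum>F\<in>Pow D. (-1) ^ card (D - F) * h F) =
      (\<Sum>D\<in>Pow S. \<Sum>F\<in>Pow D. (-1) ^ card (D - F) * h (insert \<gamma> F))"
    unfolding sum_Pow_insert[OF insert.hyps]
  proof (intro sum.cong refl)
    fix D assume "D \<in> Pow S"
    then have D: "finite D" "\<gamma> \<notin> D" using insert.hyps by (auto intro: finite_subset)
    show "(\<Sum>F\<in>Pow D. (-1) ^ card (D - F) * h F) +
        (\<Sum>F\<in>Pow (insert \<gamma> D). (-1) ^ card (insert \<gamma> D - F) * h F) =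
        (\<Sum>F\<in>Pow D. (-1) ^ card (D - F) * h (insert \<gamma> F))"
      unfolding alternating_sum_insert[OF D] by (simp add: right_diff_distrib sum_subtractf)
  qed
  then show ?case using insert.IH[of "\<lambda>F. h (insert \<gamma> F)"] by simp
qed simp

lemma moebius_down:
  fixes k :: "'v set \<Rightarrow> real"
  assumes "finite S"
  shows "(\<Sum>F\<in>Pow S. (-1) ^ card (S - F) * (\<Sum>E\<in>Pow F. k E)) = k S"
  using assms
proof (induction S arbitrary: k)
  case (insert \<gamma> S)
  have "(\<Sum>F\<in>Pow (insert \<gamma> S). (-1) ^ card (insert \<gamma> S - F) * (\<Sum>E\<in>Pow F. k E)) =
      (\<Sum>F\<in>Pow S. (-1) ^ card (S - F) * (\<Sum>E\<in>Pow F. k (insert \<gamma> E)))"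
    unfolding alternating_sum_insert[OF insert.hyps]
  proof (intro sum.cong refl)
    fix F assume "F \<in> Pow S"
    then have F: "finite F" "\<gamma> \<notin> F" using insert.hyps by (auto intro: finite_subset)
    show "(-1) ^ card (S - F) * ((\<Sum>E\<in>Pow (insert \<gamma> F). k E) - (\<Sum>E\<in>Pow F. k E)) =
        (-1) ^ card (S - F) * (\<Sum>E\<in>Pow F. k (insert \<gamma> E))"
      unfolding sum_Pow_insert[OF F] by (simp add: sum.distrib)
  qed
  then show ?case using insert.IH[of "\<lambda>E. k (insert \<gamma> E)"] by simp
qed simp

section \<open>Cells, their supports and the Moebius transform of tables\<close>

lemma cells_iff: "i \<in> cells I A \<longleftrightarrow> dom i = A \<and> (\<forall>\<gamma>\<in>A. the (i \<gamma>) \<in> I \<gamma>)"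
  by (simp add: cells_def)

lemma dom_cells: "i \<in> cells I A \<Longrightarrow> dom i = A"
  by (simp add: cells_iff)

lemma cells_star_iff: "i \<in> cells_star I z A \<longleftrightarrow> i \<in> cells I A \<and> (\<forall>\<gamma>\<in>A. the (i \<gamma>) \<noteq> z \<gamma>)"
  by (simp add: cells_star_def)

lemma cells_star_cells: "i \<in> cells_star I z A \<Longrightarrow> i \<in> cells I A"
  by (simp add: cells_star_iff)

lemma cells_empty [simp]: "cells I {} = {Map.empty}"
  by (auto simp: cells_iff)

lemma cells_restrict: "i \<in> cells I A \<Longrightarrow> B \<subseteq> A \<Longrightarrow> i |` B \<in> cells I B"
  by (auto simp: cells_iff)

lemma cells_star_restrict: "i \<in> cells_star I z A \<Longrightarrow> B \<subseteq> A \<Longrightarrow> i |` B \<in> cells_star I z B"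
  unfolding cells_star_iff using cells_restrict by auto

lemma cells_add:
  assumes "i \<in> cells I A" "j \<in> cells I B"
  shows "i ++ j \<in> cells I (A \<union> B)"
proof -
  have "the ((i ++ j) \<gamma>) \<in> I \<gamma>" if "\<gamma> \<in> A \<union> B" for \<gamma>
    using assms that by (cases "\<gamma> \<in> B") (auto simp: cells_iff map_add_dom_app_simps)
  then show ?thesis using assms by (auto simp: cells_iff)
qed

lemma outside_dom: "dom i \<subseteq> A \<Longrightarrow> x \<notin> A \<Longrightarrow> i x = None"
  by auto

lemma restrict_add_left: "dom j \<inter> A = {} \<Longrightarrow> dom i \<subseteq> A \<Longrightarrow> (i ++ j) |` A = i"
  by (rule ext) (auto simp: restrict_map_def map_add_def outside_dom split: option.splits)

lemma restrict_add_right: "dom j = B \<Longrightarrow> (i ++ j) |` B = j"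
  by (rule ext) (auto simp: restrict_map_def map_add_def split: option.splits)

lemma restrict_split: "dom x \<subseteq> A \<union> B \<Longrightarrow> (x |` A) ++ (x |` B) = x"
  by (rule ext) (auto simp: restrict_map_def map_add_def split: option.splits)

lemma restrict_dom: "dom x \<subseteq> A \<Longrightarrow> x |` A = x"
  by (rule ext) (auto simp: restrict_map_def outside_dom)

lemma sum_cells_Un:
  assumes "A \<inter> B = {}" "finite (cells I A)" "finite (cells I B)"
  shows "(\<Sum>x\<in>cells I (A \<union> B). F x) = (\<Sum>y\<in>cells I A. \<Sum>r\<in>cells I B. F (y ++ r))"
proof -
  have "(\<Sum>y\<in>cells I A. \<Sum>r\<in>cells I B. F (y ++ r)) = (\<Sum>(y, r)\<in>cells I A \<times> cells I B. F (y ++ r))"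
    by (rule sum.cartesian_product)
  also have "\<dots> = (\<Sum>x\<in>cells I (A \<union> B). F x)"
  proof (rule sum.reindex_bij_witness[where i = "\<lambda>x. (x |` A, x |` B)" and j = "\<lambda>(y, r). y ++ r"])
    fix a assume "a \<in> cells I A \<times> cells I B"
    then obtain y r where a: "a = (y, r)" "y \<in> cells I A" "r \<in> cells I B" by blast
    have "(y ++ r) |` A = y" "(y ++ r) |` B = r"
      using restrict_add_left[of r A y] restrict_add_right[of r B y] a dom_cells assms(1) by blast+
    then show "((case a of (y, r) \<Rightarrow> y ++ r) |` A, (case a of (y, r) \<Rightarrow> y ++ r) |` B) = a" using a by simp
    show "(case a of (y, r) \<Rightarrow> y ++ r) \<in> cells I (A \<union> B)" using a cells_add by auto
    show "F (case a of (y, r) \<Rightarrow> y ++ r) = (case a of (y, r) \<Rightarrow> F (y ++ r))" using a by simp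
  next
    fix x assume x: "x \<in> cells I (A \<union> B)"
    show "(case (x |` A, x |` B) of (y, r) \<Rightarrow> y ++ r) = x"
      using restrict_split[of x A B] dom_cells[OF x] by simp
    show "(x |` A, x |` B) \<in> cells I A \<times> cells I B" using cells_restrict[OF x] by auto
  qed
  finally show ?thesis by simp
qed

text \<open>A cell on \<open>A\<close> is determined by its support and its restriction to it. This
  identifies the cells on \<open>A\<close> with the disjoint union over D \<subseteq> A of the cells
  on \<open>D\<close> without base levels.\<close>

definition supp :: "('v \<Rightarrow> 'a) \<Rightarrow> ('v, 'a) cell \<Rightarrow> 'v set" where
  "supp z x = {\<gamma> \<in> dom x. x \<gamma> \<noteq> Some (z \<gamma>)}"

lemma supp_subset: "supp z x \<subseteq> dom x"
  by (auto simp: supp_def)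

lemma dom_base_cell [simp]: "dom (base_cell z A) = A"
  by (auto simp: base_cell_def)

lemma restrict_supp_add_base:
  assumes "dom x = A" "supp z x \<subseteq> D" "D \<subseteq> A"
  shows "(x |` D) ++ base_cell z (A - D) = x"
proof
  fix \<gamma>
  show "((x |` D) ++ base_cell z (A - D)) \<gamma> = x \<gamma>"
    using assms by (auto simp: restrict_map_def base_cell_def map_add_def supp_def split: option.splits)
qed

lemma supp_star_add_base:
  assumes "i \<in> cells_star I z D" "D \<subseteq> A"
  shows "supp z (i ++ base_cell z (A - D)) = D"
proof -
  have dom: "dom i = D" using assms(1) by (simp add: cells_star_iff cells_iff)
  have i: "\<exists>a. i \<gamma> = Some a \<and> a \<noteq> z \<gamma>" if "\<gamma> \<in> D" for \<gamma>
    using assms(1) that dom by (metis cells_star_iff domD option.sel)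
  have "\<gamma> \<in> supp z (i ++ base_cell z (A - D)) \<longleftrightarrow> \<gamma> \<in> D" for \<gamma>
  proof (cases "\<gamma> \<in> D")
    case True
    then show ?thesis using i[OF True]
      by (auto simp: supp_def map_add_def base_cell_def restrict_map_def)
  next
    case False
    then have "i \<gamma> = None" using dom by auto
    then show ?thesis using False
      by (auto simp: supp_def map_add_def base_cell_def restrict_map_def split: if_splits)
  qed
  then show ?thesis by blast
qed

lemma cells_star_restrict_supp: "x \<in> cells I A \<Longrightarrow> D \<subseteq> supp z x \<Longrightarrow> x |` D \<in> cells_star I z D"
  unfolding cells_star_iff using cells_restrict[of x I A D] supp_subset[of z x]
  by (auto simp: cells_iff supp_def)

lemma supp_add: "dom x \<inter> dom y = {} \<Longrightarrow> supp z (x ++ y) = supp z x \<union> supp z y"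
  by (auto simp: supp_def map_add_def split: option.splits)

text \<open>The additive counterpart of \<open>log_linear\<close>: the interaction at
  \<open>i\<close> of a real function on the cells over \<open>A\<close>. Being linear, it can be
  applied term by term to a logarithm.\<close>

definition Mob :: "('v \<Rightarrow> 'a) \<Rightarrow> 'v set \<Rightarrow> (('v, 'a) cell \<Rightarrow> real) \<Rightarrow> ('v, 'a) cell \<Rightarrow> real" where
  "Mob z A f i = (\<Sum>F\<in>Pow (dom i). (-1) ^ card (dom i - F) * f ((i |` F) ++ base_cell z (A - F)))"

lemma Mob_cong:
  "(\<And>F. F \<subseteq> dom i \<Longrightarrow> f ((i |` F) ++ base_cell z (A - F)) = h ((i |` F) ++ base_cell z (A - F)))
    \<Longrightarrow> Mob z A f i = Mob z A h i"
  unfolding Mob_def by (intro sum.cong refl) simp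

lemma Mob_add: "Mob z A (\<lambda>x. f x + h x) i = Mob z A f i + Mob z A h i"
  unfolding Mob_def by (simp add: distrib_left sum.distrib)

lemma Mob_diff: "Mob z A (\<lambda>x. f x - h x) i = Mob z A f i - Mob z A h i"
  unfolding Mob_def by (simp add: right_diff_distrib sum_subtractf)

lemma Mob_sum: "Mob z A (\<lambda>x. \<Sum>l\<in>S. f l x) i = (\<Sum>l\<in>S. Mob z A (f l) i)"
  unfolding Mob_def sum_distrib_left by (rule sum.swap)

lemma Mob_const:
  assumes "finite (dom i)" "i \<noteq> Map.empty"
  shows "Mob z A (\<lambda>x. c) i = 0"
proof -
  obtain \<gamma> where "\<gamma> \<in> dom i" using assms(2) by auto
  then have eq: "dom i = insert \<gamma> (dom i - {\<gamma>})" by auto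
  show ?thesis
    unfolding Mob_def by (subst (1 2) eq, subst alternating_sum_insert) (use assms in auto)
qed

text \<open>If \<open>i\<close> has a coordinate outside \<open>B\<close>, the function does not
  change in that direction and the paired terms cancel. This removes separator marginals and log
  normalizers from the clique parameters.\<close>

lemma Mob_restrict:
  assumes "finite (dom i)" "B \<subseteq> A" "dom i \<subseteq> A"
  shows "Mob z A (\<lambda>x. f (x |` B)) i = (if dom i \<subseteq> B then Mob z B f i else 0)"
proof (cases "dom i \<subseteq> B")
  case True
  have eq: "(i |` F ++ base_cell z (A - F)) |` B = i |` F ++ base_cell z (B - F)" if "F \<subseteq> dom i" for F
    using that True assms by (intro ext) (auto simp: restrict_map_def base_cell_def map_add_def split: option.splits)
  have "(\<Sum>F\<in>Pow (dom i). (-1) ^ card (dom i - F) * f ((i |` F ++ base_cell z (A - F)) |` B)) =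
      (\<Sum>F\<in>Pow (dom i). (-1) ^ card (dom i - F) * f (i |` F ++ base_cell z (B - F)))"
    by (intro sum.cong refl) (simp add: eq)
  then show ?thesis using True by (simp add: Mob_def)
next
  case False
  then obtain \<gamma> where \<gamma>: "\<gamma> \<in> dom i" "\<gamma> \<notin> B" by blast
  then have eq: "dom i = insert \<gamma> (dom i - {\<gamma>})" by auto
  have same: "(i |` insert \<gamma> F ++ base_cell z (A - insert \<gamma> F)) |` B = (i |` F ++ base_cell z (A - F)) |` B" for F
    using \<gamma> by (intro ext) (auto simp: restrict_map_def base_cell_def map_add_def split: option.splits)
  show ?thesis
    unfolding Mob_def by (subst (1 2) eq, subst alternating_sum_insert) (use assms False same in auto)
qed

lemma Mob_inversion:
  assumes "x \<in> cells I A" "finite A"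
  shows "(\<Sum>D\<in>Pow (supp z x). Mob z A f (x |` D)) = f x"
proof -
  have fin: "finite (supp z x)" using supp_subset[of z x] assms dom_cells finite_subset by metis
  have "(\<Sum>D\<in>Pow (supp z x). Mob z A f (x |` D)) = (\<Sum>D\<in>Pow (supp z x). \<Sum>F\<in>Pow D.
      (-1) ^ card (D - F) * f ((x |` F) ++ base_cell z (A - F)))"
  proof (intro sum.cong refl)
    fix D assume "D \<in> Pow (supp z x)"
    then have "dom (x |` D) = D" using supp_subset[of z x] by auto
    then show "Mob z A f (x |` D) = (\<Sum>F\<in>Pow D. (-1) ^ card (D - F) * f ((x |` F) ++ base_cell z (A - F)))"
      unfolding Mob_def by (intro sum.cong) (auto simp: Int_absorb1)
  qed
  also have "\<dots> = f ((x |` supp z x) ++ base_cell z (A - supp z x))"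
    by (rule moebius_up[OF fin])
  also have "(x |` supp z x) ++ base_cell z (A - supp z x) = x"
    by (rule restrict_supp_add_base) (use supp_subset[of z x] dom_cells[OF assms(1)] in auto)
  finally show ?thesis .
qed

text \<open>The converse of the expansion: in a function written as a sum over subsets of the
  support, the transform reads off the coefficient.\<close>

lemma Mob_of_sum:
  assumes i: "i \<in> cells_star I z D" and DA: "D \<subseteq> A" "finite D"
    and f: "\<And>F. F \<subseteq> D \<Longrightarrow> f ((i |` F) ++ base_cell z (A - F)) = (\<Sum>E\<in>Pow F. k (i |` E))"
  shows "Mob z A f i = k i"
proof -
  have D: "dom i = D" using i cells_star_cells dom_cells by metis
  have "Mob z A f i = (\<Sum>F\<in>Pow D. (-1) ^ card (D - F) * (\<Sum>E\<in>Pow F. k (i |` E)))"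
    unfolding Mob_def D by (intro sum.cong refl) (simp add: f)
  also have "\<dots> = k (i |` D)" by (rule moebius_down[OF DA(2)])
  finally show ?thesis using restrict_dom[of i D] D by simp
qed

lemma log_linear_eq_Mob:
  assumes "finite (dom i)" "\<And>F. F \<subseteq> dom i \<Longrightarrow> 0 < q ((i |` F) ++ base_cell z (A - F))"
  shows "log_linear z A q i = Mob z A (\<lambda>x. ln (q x)) i"
proof -
  have sgn: "ln (y powi ((-1) ^ n)) = (-1) ^ n * ln y" if "0 < y" for y :: real and n :: nat
    using that by (cases "even n") (simp_all add: power_int_minus ln_inverse)
  have "log_linear z A q i = (\<Sum>F\<in>Pow (dom i).
      ln (q ((i |` F) ++ base_cell z (A - F)) powi ((-1) ^ card (dom i - F))))"
    unfolding log_linear_def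
  proof (rule ln_prod)
    fix F assume "F \<in> Pow (dom i)"
    then have "0 < q ((i |` F) ++ base_cell z (A - F))" using assms(2) by simp
    then show "q ((i |` F) ++ base_cell z (A - F)) powi ((-1) ^ card (dom i - F)) \<noteq> 0"
      by (simp add: power_int_eq_0_iff)
  qed (use assms in simp)
  also have "\<dots> = Mob z A (\<lambda>x. ln (q x)) i"
    unfolding Mob_def by (intro sum.cong refl sgn) (use assms in auto)
  finally show ?thesis .
qed

lemma sum_cells_star:
  assumes "finite A" "\<And>D. D \<subseteq> A \<Longrightarrow> finite (cells I D)" "\<And>\<gamma>. \<gamma> \<in> A \<Longrightarrow> z \<gamma> \<in> I \<gamma>"
  shows "(\<Sum>x\<in>cells I A. f x) = (\<Sum>D\<in>Pow A. \<Sum>i\<in>cells_star I z D. f (i ++ base_cell z (A - D)))"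
proof -
  have base: "base_cell z (A - D) \<in> cells I (A - D)" for D
    using assms(3) by (auto simp: cells_iff base_cell_def)
  have fin: "finite (cells_star I z D)" if "D \<subseteq> A" for D
    by (rule finite_subset[OF _ assms(2)[OF that]]) (auto simp: cells_star_iff)
  have "(\<Sum>D\<in>Pow A. \<Sum>i\<in>cells_star I z D. f (i ++ base_cell z (A - D))) =
      (\<Sum>(D, i)\<in>Sigma (Pow A) (cells_star I z). f (i ++ base_cell z (A - D)))"
    by (rule sum.Sigma) (use assms(1) fin in auto)
  also have "\<dots> = (\<Sum>x\<in>cells I A. f x)"
  proof (rule sum.reindex_bij_witness[where i = "\<lambda>x. (supp z x, x |` supp z x)"
        and j = "\<lambda>(D, i). i ++ base_cell z (A - D)"])
    fix a assume "a \<in> Sigma (Pow A) (cells_star I z)"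
    then obtain D i where a: "a = (D, i)" "D \<subseteq> A" "i \<in> cells_star I z D" by blast
    have "dom i = D" using a(3) cells_star_cells dom_cells by metis
    then have "(i ++ base_cell z (A - D)) |` D = i" by (intro restrict_add_left) auto
    then show "(supp z (case a of (D, i) \<Rightarrow> i ++ base_cell z (A - D)),
        (case a of (D, i) \<Rightarrow> i ++ base_cell z (A - D)) |` supp z (case a of (D, i) \<Rightarrow> i ++ base_cell z (A - D))) = a"
      using supp_star_add_base[OF a(3,2)] a(1) by simp
    have "D \<union> (A - D) = A" using a(2) by auto
    then show "(case a of (D, i) \<Rightarrow> i ++ base_cell z (A - D)) \<in> cells I A"
      using cells_add[OF cells_star_cells[OF a(3)] base[of D]] a(1) by simp
    show "f (case a of (D, i) \<Rightarrow> i ++ base_cell z (A - D)) = (case a of (D, i) \<Rightarrow> f (i ++ base_cell z (A - D)))"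
      using a(1) by simp
  next
    fix x assume x: "x \<in> cells I A"
    have sub: "supp z x \<subseteq> A" using supp_subset[of z x] dom_cells[OF x] by simp
    show "(case (supp z x, x |` supp z x) of (D, i) \<Rightarrow> i ++ base_cell z (A - D)) = x"
      using restrict_supp_add_base[OF dom_cells[OF x] order_refl sub] by simp
    show "(supp z x, x |` supp z x) \<in> Sigma (Pow A) (cells_star I z)"
      using sub cells_star_restrict_supp[OF x order_refl] by simp
  qed
  finally show ?thesis by simp
qed

text \<open>Double counting: a cell on \<open>D\<close> without base levels is extended by every
  cell on A - D, and these extensions are the cells on \<open>A\<close> that lie above it. The
  coefficients |I_{C - D}| / 2 of the explicit densities originate here.\<close>

lemma sum_cells_supp:
  assumes "finite A" "\<And>D. D \<subseteq> A \<Longrightarrow> finite (cells I D)"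
  shows "(\<Sum>x\<in>cells I A. \<Sum>E\<in>Pow (supp z x). t (x |` E)) =
    (\<Sum>D\<in>Pow A. \<Sum>i\<in>cells_star I z D. t i * real (card (cells I (A - D))))"
proof -
  have fin: "finite (cells_star I z D)" if "D \<subseteq> A" for D
    by (rule finite_subset[OF _ assms(2)[OF that]]) (auto simp: cells_star_iff)
  have fsupp: "finite (supp z x)" if "x \<in> cells I A" for x
    using supp_subset[of z x] dom_cells[OF that] assms(1) finite_subset by metis
  have "(\<Sum>x\<in>cells I A. \<Sum>E\<in>Pow (supp z x). t (x |` E)) =
      (\<Sum>(x, E)\<in>Sigma (cells I A) (\<lambda>x. Pow (supp z x)). t (x |` E))"
    by (rule sum.Sigma) (use assms fsupp in auto)
  also have "\<dots> = (\<Sum>b\<in>Sigma (Sigma (Pow A) (cells_star I z)) (\<lambda>p. cells I (A - fst p)). t (snd (fst b)))"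
  proof (rule sum.reindex_bij_witness[where j = "\<lambda>a. ((snd a, fst a |` snd a), fst a |` (A - snd a))"
        and i = "\<lambda>b. (snd (fst b) ++ snd b, fst (fst b))"])
    fix a assume "a \<in> Sigma (cells I A) (\<lambda>x. Pow (supp z x))"
    then obtain x E where a: "a = (x, E)" "x \<in> cells I A" "E \<subseteq> supp z x" by blast
    have EA: "E \<subseteq> A" using a supp_subset[of z x] dom_cells by blast
    have "x |` E ++ x |` (A - E) = x" by (rule restrict_split) (use dom_cells[OF a(2)] in auto)
    then show "(snd (fst ((snd a, fst a |` snd a), fst a |` (A - snd a))) ++ snd ((snd a, fst a |` snd a), fst a |` (A - snd a)),
        fst (fst ((snd a, fst a |` snd a), fst a |` (A - snd a)))) = a"
      using a(1) by simp
    show "((snd a, fst a |` snd a), fst a |` (A - snd a)) \<in>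
        Sigma (Sigma (Pow A) (cells_star I z)) (\<lambda>p. cells I (A - fst p))"
      using a EA cells_star_restrict_supp[OF a(2,3)] cells_restrict[OF a(2), of "A - E"] by auto
    show "t (snd (fst ((snd a, fst a |` snd a), fst a |` (A - snd a)))) = (case a of (x, E) \<Rightarrow> t (x |` E))"
      using a(1) by simp
  next
    fix b assume "b \<in> Sigma (Sigma (Pow A) (cells_star I z)) (\<lambda>p. cells I (A - fst p))"
    then obtain D i y where b: "b = ((D, i), y)" "D \<subseteq> A" "i \<in> cells_star I z D" "y \<in> cells I (A - D)" by auto
    have di: "dom i = D" "dom y = A - D" using b cells_star_cells dom_cells by metis+
    have "(i ++ y) |` D = i" "(i ++ y) |` (A - D) = y"
      using restrict_add_left[of y D i] restrict_add_right[of y "A - D" i] di by auto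
    then show "((snd (snd (fst b) ++ snd b, fst (fst b)), fst (snd (fst b) ++ snd b, fst (fst b)) |` snd (snd (fst b) ++ snd b, fst (fst b))),
        fst (snd (fst b) ++ snd b, fst (fst b)) |` (A - snd (snd (fst b) ++ snd b, fst (fst b)))) = b"
      using b(1) by simp
    have "D \<union> (A - D) = A" using b(2) by auto
    then have "i ++ y \<in> cells I A" using cells_add[OF cells_star_cells[OF b(3)] b(4)] by simp
    moreover have "D \<subseteq> supp z (i ++ y)"
    proof
      fix \<gamma> assume g: "\<gamma> \<in> D"
      then obtain a where "i \<gamma> = Some a" "a \<noteq> z \<gamma>"
        using b(3) di(1) by (metis cells_star_iff domD option.sel)
      moreover have "y \<gamma> = None" using g di(2) by auto
      ultimately show "\<gamma> \<in> supp z (i ++ y)" by (auto simp: supp_def map_add_def)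
    qed
    ultimately show "(snd (fst b) ++ snd b, fst (fst b)) \<in> Sigma (cells I A) (\<lambda>x. Pow (supp z x))"
      using b(1) by simp
  qed
  also have "\<dots> = (\<Sum>p\<in>Sigma (Pow A) (cells_star I z). \<Sum>y\<in>cells I (A - fst p). t (snd p))"
    by (subst sum.Sigma) (use assms fin in \<open>auto simp: case_prod_beta\<close>)
  also have "\<dots> = (\<Sum>(D, i)\<in>Sigma (Pow A) (cells_star I z). \<Sum>y\<in>cells I (A - D). t i)"
    by (rule sum.cong) auto
  also have "\<dots> = (\<Sum>D\<in>Pow A. \<Sum>i\<in>cells_star I z D. \<Sum>y\<in>cells I (A - D). t i)"
    by (rule sum.Sigma[symmetric]) (use assms fin in auto)
  finally show ?thesis by (simp add: mult.commute)
qed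

section \<open>Markov tables as products of conditional tables\<close>

lemma restrict_restrict_subset: "B \<subseteq> A \<Longrightarrow> (x |` A) |` B = x |` B"
  by (simp add: Int_absorb1)

lemma restrict_add_disjoint: "dom r \<inter> B = {} \<Longrightarrow> (y ++ r) |` B = y |` B"
  by (rule ext) (auto simp: restrict_map_def map_add_def split: option.splits)

locale clique_model =
  fixes V :: "'v set" and E :: "'v set set" and I :: "'v \<Rightarrow> 'a set" and z :: "'v \<Rightarrow> 'a"
    and Cs :: "'v set list"
  assumes finV: "finite V"
    and finI: "\<And>\<gamma>. \<gamma> \<in> V \<Longrightarrow> finite (I \<gamma>)" and zI: "\<And>\<gamma>. \<gamma> \<in> V \<Longrightarrow> z \<gamma> \<in> I \<gamma>"
    and simple: "simple_graph V E" and perfect: "perfect_clique_order V E Cs"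
begin

abbreviation "n \<equiv> length Cs"
abbreviation "S l \<equiv> separator Cs l"
abbreviation "Rd l \<equiv> residual Cs l"
abbreviation "H l \<equiv> \<Union>j<l. Cs ! j"
abbreviation "cl D \<equiv> cells I D"

lemma C_clique: "l < n \<Longrightarrow> Cs ! l \<in> cliques V E"
  using perfect unfolding perfect_clique_order_def by (metis nth_mem)

lemma C_sub: "l < n \<Longrightarrow> Cs ! l \<subseteq> V"
  and C_complete: "l < n \<Longrightarrow> complete_in E (Cs ! l)"
  using C_clique[of l] by (simp_all add: cliques_def)

lemma SR: "S l \<union> Rd l = Cs ! l" "S l \<inter> Rd l = {}" "S l \<subseteq> H l" "Rd l \<inter> H l = {}"
  by (auto simp: separator_def residual_def)

lemma H_Suc: "H (Suc l) = H l \<union> Rd l"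
  using SR[of l] by (auto simp: lessThan_Suc)

lemma S_0 [simp]: "S 0 = {}" and R_0 [simp]: "Rd 0 = Cs ! 0"
  by (simp_all add: separator_def residual_def)

lemma clique_containing:
  assumes D: "D \<subseteq> V" "complete_in E D"
  shows "\<exists>l<n. D \<subseteq> Cs ! l"
proof -
  define X where "X = {C. C \<subseteq> V \<and> complete_in E C \<and> D \<subseteq> C}"
  have fin: "finite X" by (rule finite_subset[of X "Pow V"]) (use finV in \<open>auto simp: X_def\<close>)
  have "D \<in> X" using D by (simp add: X_def)
  from finite_has_maximal2[OF fin this]
  obtain C where C: "C \<in> X" "D \<subseteq> C" "\<forall>b\<in>X. C \<subseteq> b \<longrightarrow> C = b" by blast
  have "D' = C" if "D' \<subseteq> V" "complete_in E D'" "C \<subseteq> D'" for D'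
  proof -
    have "D' \<in> X" using that C(2) by (auto simp: X_def)
    then show ?thesis using C(3) that(3) by blast
  qed
  then have "C \<in> cliques V E"
    using C(1) unfolding cliques_def X_def by blast
  then have "C \<in> set Cs" using perfect by (simp add: perfect_clique_order_def)
  then show ?thesis using C(2) by (metis in_set_conv_nth)
qed

lemma n_pos: "0 < n"
  using clique_containing[of "{}"] by (auto simp: complete_in_def)

lemma H_n: "H n = V"
proof
  show "H n \<subseteq> V" using C_sub by blast
  show "V \<subseteq> H n"
  proof
    fix \<gamma> assume "\<gamma> \<in> V"
    then show "\<gamma> \<in> H n" using clique_containing[of "{\<gamma>}"] by (auto simp: complete_in_def)
  qed
qed

lemma H_sub: "l \<le> n \<Longrightarrow> H l \<subseteq> V"
  by (rule UN_least) (use C_sub in auto)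

lemma sub_V: "l < n \<Longrightarrow> S l \<subseteq> V" "l < n \<Longrightarrow> Rd l \<subseteq> V"
  using SR(1)[of l] C_sub[of l] by blast+

lemma running_intersection: "0 < l \<Longrightarrow> l < n \<Longrightarrow> \<exists>i<l. S l \<subseteq> Cs ! i"
  using perfect by (simp add: perfect_clique_order_def)

lemma finite_cells: "D \<subseteq> V \<Longrightarrow> finite (cl D)"
proof -
  assume D: "D \<subseteq> V"
  have "cl D \<subseteq> {m. dom m = D \<and> ran m \<subseteq> (\<Union>\<gamma>\<in>D. I \<gamma>)}"
    by (force simp: cells_iff ran_def)
  moreover have "finite {m. dom m = D \<and> ran m \<subseteq> (\<Union>\<gamma>\<in>D. I \<gamma>)}"
    by (rule finite_set_of_finite_maps) (use D finV finI finite_subset in blast)+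
  ultimately show ?thesis by (rule finite_subset)
qed

lemma base_cells: "D \<subseteq> V \<Longrightarrow> base_cell z D \<in> cl D"
  using zI by (auto simp: cells_iff base_cell_def)

section \<open>Tables built from conditional tables along a perfect order\<close>

definition cond_kernel :: "(nat \<Rightarrow> ('v, 'a) cell \<Rightarrow> ('v, 'a) cell \<Rightarrow> real) \<Rightarrow> bool" where
  "cond_kernel q \<longleftrightarrow> (\<forall>l<n. \<forall>s\<in>cl (S l). (\<forall>r\<in>cl (Rd l). 0 < q l s r) \<and> (\<Sum>r\<in>cl (Rd l). q l s r) = 1)"

definition partial_product :: "(nat \<Rightarrow> ('v, 'a) cell \<Rightarrow> ('v, 'a) cell \<Rightarrow> real) \<Rightarrow> nat \<Rightarrow> ('v, 'a) cell \<Rightarrow> real" where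
  "partial_product q l x = (\<Prod>k<l. q k (x |` S k) (x |` Rd k))"

abbreviation "kernel_product q \<equiv> partial_product q n"

lemma cond_kernel_pos: "cond_kernel q \<Longrightarrow> l < n \<Longrightarrow> s \<in> cl (S l) \<Longrightarrow> r \<in> cl (Rd l) \<Longrightarrow> 0 < q l s r"
  and cond_kernel_sum: "cond_kernel q \<Longrightarrow> l < n \<Longrightarrow> s \<in> cl (S l) \<Longrightarrow> (\<Sum>r\<in>cl (Rd l). q l s r) = 1"
  by (simp_all add: cond_kernel_def)

lemma partial_product_pos:
  assumes "cond_kernel q" "l \<le> n" "x \<in> cl D" "H l \<subseteq> D"
  shows "0 < partial_product q l x"
  unfolding partial_product_def
proof (rule prod_pos)
  fix k assume k: "k \<in> {..<l}"
  then have "S k \<subseteq> D" "Rd k \<subseteq> D" using SR(1)[of k] assms(4) by blast+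
  then show "0 < q k (x |` S k) (x |` Rd k)"
    using cond_kernel_pos[OF assms(1)] cells_restrict[OF assms(3)] k assms(2) by simp
qed

text \<open>The factors before \<open>l\<close> live on the history \<open>H l\<close>, which is
  disjoint from the residual. Summing over the residual therefore affects only factor
  \<open>l\<close> and the test function.\<close>

lemma partial_product_step:
  assumes q: "cond_kernel q" and l: "l < n"
  shows "(\<Sum>y\<in>cl (H (Suc l)). partial_product q (Suc l) y * \<Phi> (y |` H l) (y |` Rd l)) =
    (\<Sum>y\<in>cl (H l). partial_product q l y * (\<Sum>r\<in>cl (Rd l). q l (y |` S l) r * \<Phi> y r))"
proof -
  have disj: "H l \<inter> Rd l = {}" using SR(4)[of l] by blast
  have "(\<Sum>y\<in>cl (H (Suc l)). partial_product q (Suc l) y * \<Phi> (y |` H l) (y |` Rd l)) =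
      (\<Sum>y\<in>cl (H l). \<Sum>r\<in>cl (Rd l). partial_product q (Suc l) (y ++ r) * \<Phi> ((y ++ r) |` H l) ((y ++ r) |` Rd l))"
    unfolding H_Suc by (rule sum_cells_Un[OF disj]) (use l H_sub[of l] sub_V finite_cells in auto)
  also have "\<dots> = (\<Sum>y\<in>cl (H l). \<Sum>r\<in>cl (Rd l). partial_product q l y * (q l (y |` S l) r * \<Phi> y r))"
  proof (intro sum.cong refl)
    fix y r assume y: "y \<in> cl (H l)" and r: "r \<in> cl (Rd l)"
    have keep: "(y ++ r) |` B = y |` B" if "B \<subseteq> H l" for B
      by (rule restrict_add_disjoint) (use that disj dom_cells[OF r] in blast)
    have "partial_product q l (y ++ r) = partial_product q l y"
      unfolding partial_product_def
    proof (rule prod.cong[OF refl])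
      fix k assume "k \<in> {..<l}"
      then have "S k \<subseteq> H l" "Rd k \<subseteq> H l" using SR(1)[of k] by blast+
      then show "q k ((y ++ r) |` S k) ((y ++ r) |` Rd k) = q k (y |` S k) (y |` Rd k)"
        by (simp only: keep)
    qed
    moreover have "(y ++ r) |` Rd l = r" by (rule restrict_add_right[OF dom_cells[OF r]])
    moreover have "(y ++ r) |` H l = y" using keep[of "H l"] restrict_dom[of y "H l"] dom_cells[OF y] by simp
    ultimately show "partial_product q (Suc l) (y ++ r) * \<Phi> ((y ++ r) |` H l) ((y ++ r) |` Rd l) =
        partial_product q l y * (q l (y |` S l) r * \<Phi> y r)"
      using keep[OF SR(3)[of l]] by (simp add: partial_product_def)
  qed
  finally show ?thesis by (simp add: sum_distrib_left)
qed

text \<open>Residuals are summed out from the last clique down to \<open>l\<close>. The test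
  function depends on the history only, so each conditional table sums to 1.\<close>

lemma sum_kernel_product_history:
  assumes q: "cond_kernel q" and l: "l \<le> n"
  shows "(\<Sum>x\<in>cl V. kernel_product q x * F (x |` H l)) = (\<Sum>y\<in>cl (H l). partial_product q l y * F y)"
  using l
proof (induction l arbitrary: F rule: inc_induct)
  case base
  show ?case unfolding H_n by (intro sum.cong refl) (simp add: restrict_dom dom_cells)
next
  case (step l)
  have sub: "(x |` H (Suc l)) |` H l = x |` H l" for x :: "('v, 'a) cell"
    by (rule restrict_restrict_subset) (use H_Suc[of l] in blast)
  have "(\<Sum>x\<in>cl V. kernel_product q x * F (x |` H l)) = (\<Sum>y\<in>cl (H (Suc l)). partial_product q (Suc l) y * F (y |` H l))"
    using step.IH[of "\<lambda>y. F (y |` H l)"] unfolding sub .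
  also have "\<dots> = (\<Sum>y\<in>cl (H l). partial_product q l y * (\<Sum>r\<in>cl (Rd l). q l (y |` S l) r * F y))"
    by (rule partial_product_step[OF q step.hyps(2), of "\<lambda>y r. F y"])
  also have "\<dots> = (\<Sum>y\<in>cl (H l). partial_product q l y * F y)"
  proof (intro sum.cong refl)
    fix y assume "y \<in> cl (H l)"
    then have "y |` S l \<in> cl (S l)" by (rule cells_restrict) (rule SR(3))
    then show "partial_product q l y * (\<Sum>r\<in>cl (Rd l). q l (y |` S l) r * F y) = partial_product q l y * F y"
      using cond_kernel_sum[OF q step.hyps(2)] by (simp add: sum_distrib_right[symmetric])
  qed
  finally show ?case .
qed

text \<open>Under the product table, the law of the residual given the whole history is the kernel
  at the separator cell. All facts about marginals and scores are instances for a suitable test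
  function.\<close>

lemma sum_kernel_product_conditional:
  assumes q: "cond_kernel q" and l: "l < n"
  shows "(\<Sum>x\<in>cl V. kernel_product q x * \<Phi> (x |` H l) (x |` Rd l)) =
    (\<Sum>x\<in>cl V. kernel_product q x * (\<Sum>r\<in>cl (Rd l). q l (x |` S l) r * \<Phi> (x |` H l) r))"
proof -
  have 1: "(x |` H (Suc l)) |` H l = x |` H l" "(x |` H (Suc l)) |` Rd l = x |` Rd l" for x :: "('v, 'a) cell"
    by (rule restrict_restrict_subset, use H_Suc[of l] in blast)+
  have 2: "(x |` H l) |` S l = x |` S l" for x :: "('v, 'a) cell"
    by (rule restrict_restrict_subset[OF SR(3)])
  have "(\<Sum>x\<in>cl V. kernel_product q x * \<Phi> (x |` H l) (x |` Rd l)) =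
      (\<Sum>y\<in>cl (H (Suc l)). partial_product q (Suc l) y * \<Phi> (y |` H l) (y |` Rd l))"
    using sum_kernel_product_history[OF q, of "Suc l" "\<lambda>y. \<Phi> (y |` H l) (y |` Rd l)"] l unfolding 1 by simp
  also have "\<dots> = (\<Sum>y\<in>cl (H l). partial_product q l y * (\<Sum>r\<in>cl (Rd l). q l (y |` S l) r * \<Phi> y r))"
    by (rule partial_product_step[OF q l])
  also have "\<dots> = (\<Sum>x\<in>cl V. kernel_product q x * (\<Sum>r\<in>cl (Rd l). q l (x |` S l) r * \<Phi> (x |` H l) r))"
    using sum_kernel_product_history[OF q, of l "\<lambda>y. \<Sum>r\<in>cl (Rd l). q l (y |` S l) r * \<Phi> y r"] l unfolding 2 by simp
  finally show ?thesis .
qed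

lemma sum_kernel_product: "cond_kernel q \<Longrightarrow> (\<Sum>x\<in>cl V. kernel_product q x) = 1"
  using sum_kernel_product_history[of q 0 "\<lambda>_. 1"] by (simp add: partial_product_def)

text \<open>The marginal probability of a separator cell, written with the kernels of earlier
  cliques only. This form shows that it does not depend on the tables of clique
  \<open>l\<close>.\<close>

definition w :: "(nat \<Rightarrow> ('v, 'a) cell \<Rightarrow> ('v, 'a) cell \<Rightarrow> real) \<Rightarrow> nat \<Rightarrow> ('v, 'a) cell \<Rightarrow> real" where
  "w q l s = (\<Sum>y\<in>cl (H l). partial_product q l y * (if y |` S l = s then 1 else 0))"

lemma w_eq:
  assumes "cond_kernel q" "l < n"
  shows "(\<Sum>x\<in>cl V. kernel_product q x * (if x |` S l = s then 1 else 0)) = w q l s"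
proof -
  have 2: "(x |` H l) |` S l = x |` S l" for x :: "('v, 'a) cell"
    by (rule restrict_restrict_subset[OF SR(3)])
  show ?thesis
    using sum_kernel_product_history[OF assms(1), of l "\<lambda>y. if y |` S l = s then 1 else 0"] assms(2)
    unfolding w_def 2 by simp
qed

lemma w_pos:
  assumes q: "cond_kernel q" and l: "l < n" and s: "s \<in> cl (S l)"
  shows "0 < w q l s"
  unfolding w_def
proof (rule sum_pos2)
  show "finite (cl (H l))" using finite_cells H_sub[of l] l by simp
  have "s ++ base_cell z (H l - S l) \<in> cl (S l \<union> (H l - S l))"
    using H_sub[of l] l by (intro cells_add s base_cells) auto
  moreover have "S l \<union> (H l - S l) = H l" using SR(3)[of l] by blast
  ultimately show y: "s ++ base_cell z (H l - S l) \<in> cl (H l)" by simp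
  have "(s ++ base_cell z (H l - S l)) |` S l = s"
    by (rule restrict_add_left) (use dom_cells[OF s] in auto)
  then show "0 < partial_product q l (s ++ base_cell z (H l - S l)) * (if (s ++ base_cell z (H l - S l)) |` S l = s then 1 else 0)"
    using partial_product_pos[OF q _ y] l by simp
  show "0 \<le> partial_product q l y * (if y |` S l = s then 1 else 0)" if "y \<in> cl (H l)" for y
    using partial_product_pos[OF q _ that] l by (simp add: less_imp_le)
qed

lemma marginal_eq:
  assumes "i \<in> cl D"
  shows "marginal V I p i = (\<Sum>x\<in>cl V. if x |` D = i then p x else 0)"
proof -
  have "{j. j \<in> cl V \<and> j |` dom i = i} = cl V \<inter> {x. x |` D = i}" using dom_cells[OF assms] by auto
  then show ?thesis
    unfolding marginal_def using finite_cells[OF order_refl] by (simp add: sum.inter_restrict)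
qed

lemma marginal_separator:
  assumes q: "cond_kernel q" and l: "l < n" and s: "s \<in> cl (S l)" and p: "\<And>x. x \<in> cl V \<Longrightarrow> p x = kernel_product q x"
  shows "marginal V I p s = w q l s"
  unfolding marginal_eq[OF s] w_eq[OF q l, symmetric] by (intro sum.cong refl) (simp add: p)

text \<open>The residual cell stands to the left because \<open>conditional\<close> combines its
  cells in that order.\<close>

lemma marginal_clique:
  assumes q: "cond_kernel q" and l: "l < n" and s: "s \<in> cl (S l)" and r: "r \<in> cl (Rd l)"
    and p: "\<And>x. x \<in> cl V \<Longrightarrow> p x = kernel_product q x"
  shows "marginal V I p (r ++ s) = w q l s * q l s r"
proof -
  have rs: "r ++ s \<in> cl (Cs ! l)" using cells_add[OF r s] SR(1)[of l] by (simp add: Un_commute)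
  have iff: "x |` (Cs ! l) = r ++ s \<longleftrightarrow> (x |` H l) |` S l = s \<and> x |` Rd l = r" if x: "x \<in> cl V" for x
  proof -
    have eqs: "(x |` H l) |` S l = x |` S l" "(x |` (Cs ! l)) |` S l = x |` S l" "(x |` (Cs ! l)) |` Rd l = x |` Rd l"
      by (rule restrict_restrict_subset, use SR[of l] in blast)+
    have "(r ++ s) |` S l = s" by (rule restrict_add_right[OF dom_cells[OF s]])
    moreover have "(r ++ s) |` Rd l = r"
      by (rule restrict_add_left) (use SR(2)[of l] dom_cells[OF s] dom_cells[OF r] in auto)
    moreover have "x |` (Cs ! l) = (x |` Rd l) ++ (x |` S l)"
    proof -
      have "dom (x |` (Cs ! l)) \<subseteq> Rd l \<union> S l" using SR(1)[of l] by auto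
      from restrict_split[OF this] show ?thesis by (simp only: eqs)
    qed
    ultimately show ?thesis using eqs by metis
  qed
  have "marginal V I p (r ++ s) =
      (\<Sum>x\<in>cl V. kernel_product q x * (if (x |` H l) |` S l = s \<and> x |` Rd l = r then 1 else 0))"
    unfolding marginal_eq[OF rs] by (intro sum.cong refl) (simp add: p iff)
  also have "\<dots> = (\<Sum>x\<in>cl V. kernel_product q x * (\<Sum>r'\<in>cl (Rd l). q l (x |` S l) r' *
      (if (x |` H l) |` S l = s \<and> r' = r then 1 else 0)))"
    by (rule sum_kernel_product_conditional[OF q l, of "\<lambda>y r'. if y |` S l = s \<and> r' = r then 1 else 0"])
  also have "\<dots> = (\<Sum>x\<in>cl V. kernel_product q x * (if x |` S l = s then 1 else 0) * q l s r)"
  proof (intro sum.cong refl)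
    fix x :: "('v, 'a) cell"
    have 2: "(x |` H l) |` S l = x |` S l" by (rule restrict_restrict_subset[OF SR(3)])
    have "(\<Sum>r'\<in>cl (Rd l). q l (x |` S l) r' * (if (x |` H l) |` S l = s \<and> r' = r then 1 else 0)) =
        (\<Sum>r'\<in>cl (Rd l). if r' = r then (if x |` S l = s then q l s r else 0) else 0)"
      unfolding 2 by (intro sum.cong refl) auto
    also have "\<dots> = (if x |` S l = s then q l s r else 0)"
      using r finite_cells[OF sub_V(2)[OF l]] by simp
    finally show "kernel_product q x * (\<Sum>r'\<in>cl (Rd l). q l (x |` S l) r' * (if (x |` H l) |` S l = s \<and> r' = r then 1 else 0)) =
        kernel_product q x * (if x |` S l = s then 1 else 0) * q l s r" by simp
  qed
  also have "\<dots> = w q l s * q l s r"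
    unfolding sum_distrib_right[symmetric] w_eq[OF q l] ..
  finally show ?thesis .
qed

lemma conditional_eq:
  assumes "cond_kernel q" "l < n" "s \<in> cl (S l)" "r \<in> cl (Rd l)" "\<And>x. x \<in> cl V \<Longrightarrow> p x = kernel_product q x"
  shows "conditional V I p s r = q l s r"
proof -
  have 1: "marginal V I p (r ++ s) = w q l s * q l s r"
    by (rule marginal_clique[OF assms(1-4)]) (rule assms(5))
  have 2: "marginal V I p s = w q l s"
    by (rule marginal_separator[OF assms(1-3)]) (rule assms(5))
  show ?thesis
    unfolding conditional_def 1 2 using w_pos[OF assms(1-3)] by simp
qed

text \<open>Sum out the residuals from the last clique on, absorbing each normalization into an earlier clique.\<close>

lemma absorb:
  assumes "k \<le> n" "\<And>l y. l < k \<Longrightarrow> y \<in> cl (Cs ! l) \<Longrightarrow> (0::real) < F l y"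
  shows "\<exists>q Z. 0 < Z \<and> (\<forall>l<k. \<forall>s\<in>cl (S l). (\<forall>r\<in>cl (Rd l). 0 < q l s r) \<and> (\<Sum>r\<in>cl (Rd l). q l s r) = 1) \<and>
    (\<forall>x\<in>cl V. (\<Prod>l<k. F l (x |` (Cs ! l))) = Z * partial_product q k x)"
  using assms
proof (induction k arbitrary: F)
  case 0
  show ?case by (intro exI[of _ "\<lambda>_ _ _. 1"] exI[of _ 1]) (simp add: partial_product_def)
next
  case (Suc k)
  have k: "k < n" using Suc.prems(1) by simp
  define W where "W = (\<lambda>s. \<Sum>r\<in>cl (Rd k). F k (s ++ r))"
  have sr: "s ++ r \<in> cl (Cs ! k)" if "s \<in> cl (S k)" "r \<in> cl (Rd k)" for s r
    using cells_add[OF that] SR(1)[of k] by simp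
  have Fpos: "0 < F k (s ++ r)" if "s \<in> cl (S k)" "r \<in> cl (Rd k)" for s r
    using Suc.prems(2)[OF lessI sr[OF that]] .
  have W: "0 < W s" if "s \<in> cl (S k)" for s
    unfolding W_def
    by (rule sum_pos2[OF finite_cells[OF sub_V(2)[OF k]] base_cells[OF sub_V(2)[OF k]]])
       (use Fpos[OF that] base_cells[OF sub_V(2)[OF k]] in \<open>auto intro: less_imp_le\<close>)
  obtain i where i: "i < k \<and> S k \<subseteq> Cs ! i \<or> k = 0"
    using running_intersection[OF _ k] by blast
  define F' where "F' = (\<lambda>l y. if l = i then F l y * W (y |` S k) else F l y)"
  have F'_pos: "\<And>l y. l < k \<Longrightarrow> y \<in> cl (Cs ! l) \<Longrightarrow> 0 < F' l y"
  proof -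
    fix l y assume l: "l < k" and y: "y \<in> cl (Cs ! l)"
    have "0 < F l y" using Suc.prems(2)[OF less_SucI[OF l] y] .
    moreover have "0 < W (y |` S k)" if "l = i" using W cells_restrict[OF y] i l that by auto
    ultimately show "0 < F' l y" by (cases "l = i") (simp_all add: F'_def)
  qed
  from Suc.IH[of F', OF less_imp_le[OF k] F'_pos]
  obtain q Z where q: "0 < Z" "\<forall>l<k. \<forall>s\<in>cl (S l). (\<forall>r\<in>cl (Rd l). 0 < q l s r) \<and> (\<Sum>r\<in>cl (Rd l). q l s r) = (1::real)"
    "\<forall>x\<in>cl V. (\<Prod>l<k. F' l (x |` (Cs ! l))) = Z * partial_product q k x" by blast
  define q' where "q' = (\<lambda>l s r. if l = k then F k (s ++ r) / W s else q l s r)"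
  \<comment> \<open>The first clique has an empty separator and no earlier clique to absorb into;
    its normalization is a number and goes into the constant.\<close>
  define Z' where "Z' = (if k = 0 then Z * W Map.empty else Z)"
  have "0 < Z'" using q(1) W[of Map.empty] by (auto simp: Z'_def)
  moreover have "(\<forall>r\<in>cl (Rd l). 0 < q' l s r) \<and> (\<Sum>r\<in>cl (Rd l). q' l s r) = 1" if l: "l < Suc k" and s: "s \<in> cl (S l)" for l s
  proof (cases "l = k")
    case True
    have "(\<Sum>r\<in>cl (Rd k). F k (s ++ r) / W s) = W s / W s"
      by (simp only: sum_divide_distrib[symmetric] W_def)
    then show ?thesis
      using True Fpos[of s] W[of s] s by (simp add: q'_def)
  next
    case False
    then show ?thesis using q(2) l s by (simp add: q'_def)
  qed
  moreover have "(\<Prod>l<Suc k. F l (x |` (Cs ! l))) = Z' * partial_product q' (Suc k) x" if x: "x \<in> cl V" for x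
  proof -
    have xs: "x |` S k \<in> cl (S k)" "x |` Rd k \<in> cl (Rd k)" using cells_restrict[OF x] sub_V[OF k] by blast+
    have "dom (x |` (Cs ! k)) \<subseteq> S k \<union> Rd k" using SR(1)[of k] by auto
    from restrict_split[OF this]
    have "x |` (Cs ! k) = ((x |` (Cs ! k)) |` S k) ++ ((x |` (Cs ! k)) |` Rd k)" by (rule sym)
    moreover have "(x |` (Cs ! k)) |` S k = x |` S k" "(x |` (Cs ! k)) |` Rd k = x |` Rd k"
      by (rule restrict_restrict_subset, use SR(1)[of k] in blast)+
    ultimately have "x |` (Cs ! k) = (x |` S k) ++ (x |` Rd k)" by (simp only:)
    then have Fk: "F k (x |` (Cs ! k)) = W (x |` S k) * q' k (x |` S k) (x |` Rd k)"
      using W[OF xs(1)] by (simp add: q'_def)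
    have prod': "Z' * partial_product q' k x = (\<Prod>l<k. F l (x |` (Cs ! l))) * W (x |` S k)"
    proof (cases "k = 0")
      case True
      then have "x |` S k = Map.empty" by simp
      moreover have "Z = 1" using q(3) x True by (auto simp: partial_product_def)
      ultimately show ?thesis using True by (simp add: Z'_def partial_product_def)
    next
      case False
      then have i: "i < k" "S k \<subseteq> Cs ! i" using i by auto
      have "(\<Prod>l<k. F' l (x |` (Cs ! l))) =
          (\<Prod>l<k. F l (x |` (Cs ! l)) * (if l = i then W (x |` S k) else 1))"
      proof (intro prod.cong refl)
        fix l
        show "F' l (x |` (Cs ! l)) = F l (x |` (Cs ! l)) * (if l = i then W (x |` S k) else 1)"
          by (cases "l = i") (simp_all only: F'_def restrict_restrict_subset[OF i(2)] if_True if_False mult_1_right simp_thms refl)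
      qed
      also have "\<dots> = (\<Prod>l<k. F l (x |` (Cs ! l))) * W (x |` S k)"
        using i(1) by (simp add: prod.distrib)
      moreover have "partial_product q' k x = partial_product q k x" unfolding partial_product_def q'_def by (intro prod.cong) auto
      ultimately show ?thesis using q(3) x False by (simp add: Z'_def)
    qed
    have "partial_product q' (Suc k) x = partial_product q' k x * q' k (x |` S k) (x |` Rd k)" by (simp add: partial_product_def)
    then show ?thesis using prod' Fk by (simp add: mult.assoc[symmetric])
  qed
  ultimately show ?case by (intro exI[of _ q'] exI[of _ Z']) blast
qed

lemma absorb_all:
  assumes "\<And>l y. l < n \<Longrightarrow> y \<in> cl (Cs ! l) \<Longrightarrow> (0::real) < F l y"
  obtains q Z where "0 < Z" "cond_kernel q" "\<And>x. x \<in> cl V \<Longrightarrow> (\<Prod>l<n. F l (x |` (Cs ! l))) = Z * kernel_product q x"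
  using absorb[of n F, OF order_refl assms] unfolding cond_kernel_def by blast

section \<open>Hammersley-Clifford: Markov tables and their factorization\<close>

lemma marginal_outside:
  assumes x: "x \<in> cl V" and U: "U \<subseteq> V"
  shows "marginal V I p (x |` U) = (\<Sum>r\<in>cl (V - U). p ((x |` U) ++ r))"
proof -
  have xU: "x |` U \<in> cl U" by (rule cells_restrict[OF x U])
  have UV: "U \<union> (V - U) = V" using U by blast
  have "marginal V I p (x |` U) = (\<Sum>y\<in>cl (U \<union> (V - U)). if y |` U = x |` U then p y else 0)"
    unfolding marginal_eq[OF xU] UV ..
  also have "\<dots> = (\<Sum>y\<in>cl U. \<Sum>r\<in>cl (V - U). if (y ++ r) |` U = x |` U then p (y ++ r) else 0)"
    by (rule sum_cells_Un) (use U finite_cells in auto)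
  also have "\<dots> = (\<Sum>y\<in>cl U. if y = x |` U then (\<Sum>r\<in>cl (V - U). p (y ++ r)) else 0)"
  proof (intro sum.cong refl)
    fix y assume y: "y \<in> cl U"
    have "(y ++ r) |` U = y" if "r \<in> cl (V - U)" for r
      by (rule restrict_add_left) (use dom_cells[OF that] dom_cells[OF y] in auto)
    then show "(\<Sum>r\<in>cl (V - U). if (y ++ r) |` U = x |` U then p (y ++ r) else 0) =
        (if y = x |` U then (\<Sum>r\<in>cl (V - U). p (y ++ r)) else 0)"
      by (simp cong: sum.cong)
  qed
  also have "\<dots> = (\<Sum>r\<in>cl (V - U). p ((x |` U) ++ r))"
    using xU finite_cells[OF U] by simp
  finally show ?thesis .
qed

text \<open>The two-way table in the variables \<gamma> and \<delta> when all other variables are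
  held at \<open>x\<close>.\<close>

definition two :: "'v \<Rightarrow> 'v \<Rightarrow> ('v, 'a) cell \<Rightarrow> (('v, 'a) cell \<Rightarrow> real) \<Rightarrow> ('v, 'a) cell \<Rightarrow> ('v, 'a) cell \<Rightarrow> real" where
  "two \<gamma> \<delta> x p c d = p ((x |` (V - {\<gamma>, \<delta>})) ++ (c ++ d))"

text \<open>All three conditional probabilities have the sum of the two-way table as denominator.
  Clearing it leaves: entry times total equals row sum times column sum.\<close>

lemma conditional_independence_iff:
  assumes x: "x \<in> cl V" and gd: "\<gamma> \<in> V" "\<delta> \<in> V" "\<gamma> \<noteq> \<delta>" and pos: "\<And>y. y \<in> cl V \<Longrightarrow> 0 < p y"
  shows "conditional V I p (x |` (V - {\<gamma>, \<delta>})) (x |` {\<gamma>, \<delta>}) =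
      conditional V I p (x |` (V - {\<gamma>, \<delta>})) (x |` {\<gamma>}) * conditional V I p (x |` (V - {\<gamma>, \<delta>})) (x |` {\<delta>}) \<longleftrightarrow>
    p x * (\<Sum>c\<in>cl {\<gamma>}. \<Sum>d\<in>cl {\<delta>}. two \<gamma> \<delta> x p c d) =
      (\<Sum>d\<in>cl {\<delta>}. two \<gamma> \<delta> x p (x |` {\<gamma>}) d) * (\<Sum>c\<in>cl {\<gamma>}. two \<gamma> \<delta> x p c (x |` {\<delta>}))"
proof -
  let ?W = "V - {\<gamma>, \<delta>}"
  let ?M = "\<Sum>c\<in>cl {\<gamma>}. \<Sum>d\<in>cl {\<delta>}. two \<gamma> \<delta> x p c d"
  have dx: "dom x = V" by (rule dom_cells[OF x])
  have fin: "finite (cl {\<gamma>})" "finite (cl {\<delta>})" using finite_cells gd by auto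
  have VW: "V - ?W = {\<gamma>} \<union> {\<delta>}" "V - (V - {\<delta>}) = {\<delta>}" "V - (V - {\<gamma>}) = {\<gamma>}" using gd by auto
  have M: "marginal V I p (x |` ?W) = ?M"
    unfolding marginal_outside[OF x Diff_subset] VW two_def
    by (rule sum_cells_Un) (use gd fin in auto)
  have comb: "x |` A ++ x |` B = x |` (A \<union> B)" for A B
    by (rule ext) (auto simp: restrict_map_def map_add_def split: option.splits)
  have full: "marginal V I p (x |` {\<gamma>, \<delta>} ++ x |` ?W) = p x"
  proof -
    have "{\<gamma>, \<delta>} \<union> ?W = V" using gd by auto
    then have "x |` {\<gamma>, \<delta>} ++ x |` ?W = x |` V" unfolding comb by simp
    then show ?thesis
      using marginal_outside[OF x order_refl, of p] restrict_dom[of x V] dx by simp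
  qed
  have m1: "marginal V I p (x |` {\<gamma>} ++ x |` ?W) = (\<Sum>d\<in>cl {\<delta>}. two \<gamma> \<delta> x p (x |` {\<gamma>}) d)"
  proof -
    have "{\<gamma>} \<union> ?W = V - {\<delta>}" "?W \<union> {\<gamma>} = V - {\<delta>}" using gd by auto
    then have "x |` {\<gamma>} ++ x |` ?W = x |` (V - {\<delta>})" "x |` ?W ++ x |` {\<gamma>} = x |` (V - {\<delta>})"
      unfolding comb by simp_all
    then show ?thesis
      using marginal_outside[where p = p and U = "V - {\<delta>}", OF x Diff_subset] unfolding VW two_def map_add_assoc by simp
  qed
  have m2: "marginal V I p (x |` {\<delta>} ++ x |` ?W) = (\<Sum>c\<in>cl {\<gamma>}. two \<gamma> \<delta> x p c (x |` {\<delta>}))"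
  proof -
    have "{\<delta>} \<union> ?W = V - {\<gamma>}" "?W \<union> {\<delta>} = V - {\<gamma>}" using gd by auto
    then have 1: "x |` {\<delta>} ++ x |` ?W = x |` (V - {\<gamma>})" "x |` ?W ++ x |` {\<delta>} = x |` (V - {\<gamma>})"
      unfolding comb by simp_all
    have "c ++ x |` {\<delta>} = x |` {\<delta>} ++ c" if "c \<in> cl {\<gamma>}" for c
      by (rule map_add_comm) (use dom_cells[OF that] gd in auto)
    then have "(\<Sum>c\<in>cl {\<gamma>}. two \<gamma> \<delta> x p c (x |` {\<delta>})) = (\<Sum>c\<in>cl {\<gamma>}. p ((x |` ?W ++ x |` {\<delta>}) ++ c))"
      unfolding two_def by (intro sum.cong refl) simp
    then show ?thesis
      using marginal_outside[where p = p and U = "V - {\<gamma>}", OF x Diff_subset] unfolding VW 1 by simp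
  qed
  have "?M > 0"
  proof -
    have "0 < two \<gamma> \<delta> x p c d" if "c \<in> cl {\<gamma>}" "d \<in> cl {\<delta>}" for c d
    proof -
      have eq: "?W \<union> ({\<gamma>} \<union> {\<delta>}) = V" using gd by auto
      show ?thesis
        unfolding two_def
        using pos[OF cells_add[OF cells_restrict[OF x, of ?W, OF Diff_subset] cells_add[OF that], unfolded eq]] .
    qed
    moreover have "x |` {\<gamma>} \<in> cl {\<gamma>}" "x |` {\<delta>} \<in> cl {\<delta>}" using cells_restrict[OF x] gd by auto
    moreover have "cl {\<gamma>} \<noteq> {}" "cl {\<delta>} \<noteq> {}" using calculation(2,3) by blast+
    ultimately show ?thesis by (intro sum_pos[OF fin(1)] sum_pos[OF fin(2)])
  qed
  moreover have "u / M = a / M * (b / M) \<longleftrightarrow> u * M = a * b" if "0 < M" for u a b M :: real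
  proof -
    have "u / M = a / M * (b / M) \<longleftrightarrow> (u * M) / (M * M) = (a * b) / (M * M)" using that by simp
    also have "\<dots> \<longleftrightarrow> u * M = a * b" using that by (simp only: divide_cancel_right) simp
    finally show ?thesis .
  qed
  ultimately show ?thesis
    unfolding conditional_def full m1 m2 M by (simp only:)
qed


lemma positive_markovD:
  assumes "p \<in> positive_markov V E I"
  shows "\<And>x. x \<in> cl V \<Longrightarrow> 0 < p x" "(\<Sum>x\<in>cl V. p x) = 1" "p \<in> extensional (cl V)"
  using assms unfolding positive_markov_def by blast+

lemma two_cell:
  assumes x: "x \<in> cl V" and gd: "\<gamma> \<in> V" "\<delta> \<in> V" "\<gamma> \<noteq> \<delta>" and c: "c \<in> cl {\<gamma>}" and d: "d \<in> cl {\<delta>}"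
  defines "y \<equiv> (x |` (V - {\<gamma>, \<delta>})) ++ (c ++ d)"
  shows "y \<in> cl V" "y |` (V - {\<gamma>, \<delta>}) = x |` (V - {\<gamma>, \<delta>})" "y |` {\<gamma>} = c" "y |` {\<delta>} = d"
proof -
  have dcd: "dom c = {\<gamma>}" "dom d = {\<delta>}" using c d dom_cells by blast+
  have eq: "(V - {\<gamma>, \<delta>}) \<union> ({\<gamma>} \<union> {\<delta>}) = V" using gd by auto
  show "y \<in> cl V"
    unfolding y_def
    using cells_add[OF cells_restrict[OF x, of "V - {\<gamma>, \<delta>}", OF Diff_subset] cells_add[OF c d], unfolded eq] .
  show "y |` (V - {\<gamma>, \<delta>}) = x |` (V - {\<gamma>, \<delta>})"
    unfolding y_def by (rule restrict_add_left) (use dcd in auto)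
  have cd: "c \<alpha> = None" if "\<alpha> \<noteq> \<gamma>" for \<alpha> using dcd that by auto
  have dd: "d \<alpha> = None" if "\<alpha> \<noteq> \<delta>" for \<alpha> using dcd that by auto
  have cg: "c \<gamma> \<noteq> None" and ddel: "d \<delta> \<noteq> None" using dcd by auto
  show "y |` {\<gamma>} = c"
    unfolding y_def using cg cd dd gd(3)
    by (intro ext) (auto simp: restrict_map_def map_add_def split: option.splits)
  show "y |` {\<delta>} = d"
    unfolding y_def using ddel dd
    by (intro ext) (auto simp: restrict_map_def map_add_def split: option.splits)
qed

text \<open>Conditional independence gives the two-way table rank one. Writing each entry as row sum
  times column sum over the total makes both products equal after multiplication by the squared
  total.\<close>

lemma cross_ratio:
  assumes p: "p \<in> positive_markov V E I" and x: "x \<in> cl V"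
    and gd: "\<gamma> \<in> V" "\<delta> \<in> V" "\<gamma> \<noteq> \<delta>" "{\<gamma>, \<delta>} \<notin> E"
    and c: "c \<in> cl {\<gamma>}" "c' \<in> cl {\<gamma>}" and d: "d \<in> cl {\<delta>}" "d' \<in> cl {\<delta>}"
  shows "two \<gamma> \<delta> x p c d * two \<gamma> \<delta> x p c' d' = two \<gamma> \<delta> x p c d' * two \<gamma> \<delta> x p c' d"
proof -
  let ?T = "two \<gamma> \<delta> x p"
  let ?M = "\<Sum>c\<in>cl {\<gamma>}. \<Sum>d\<in>cl {\<delta>}. ?T c d"
  note pos = positive_markovD(1)[OF p]
  have fin: "finite (cl {\<gamma>})" "finite (cl {\<delta>})" using finite_cells gd by auto
  have Tpos: "0 < ?T c d" if "c \<in> cl {\<gamma>}" "d \<in> cl {\<delta>}" for c d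
    unfolding two_def by (rule pos[OF two_cell(1)[OF x gd(1-3) that]])
  have ne: "cl {\<gamma>} \<noteq> {}" "cl {\<delta>} \<noteq> {}" using c d by blast+
  have M: "0 < ?M" by (intro sum_pos[OF fin(1) ne(1)] sum_pos[OF fin(2) ne(2)] Tpos)
  have key: "?T c d * ?M = (\<Sum>d\<in>cl {\<delta>}. ?T c d) * (\<Sum>c\<in>cl {\<gamma>}. ?T c d)"
    if cd: "c \<in> cl {\<gamma>}" "d \<in> cl {\<delta>}" for c d
  proof -
    let ?y = "(x |` (V - {\<gamma>, \<delta>})) ++ (c ++ d)"
    note y = two_cell[OF x gd(1-3) cd]
    have "markov V E I p" using p by (simp add: positive_markov_def)
    then have "conditional V I p (?y |` (V - {\<gamma>, \<delta>})) (?y |` {\<gamma>, \<delta>}) =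
        conditional V I p (?y |` (V - {\<gamma>, \<delta>})) (?y |` {\<gamma>}) * conditional V I p (?y |` (V - {\<gamma>, \<delta>})) (?y |` {\<delta>})"
      using gd y(1) unfolding markov_def Let_def by blast
    then have "p ?y * (\<Sum>c\<in>cl {\<gamma>}. \<Sum>d\<in>cl {\<delta>}. two \<gamma> \<delta> ?y p c d) =
      (\<Sum>d\<in>cl {\<delta>}. two \<gamma> \<delta> ?y p (?y |` {\<gamma>}) d) * (\<Sum>c\<in>cl {\<gamma>}. two \<gamma> \<delta> ?y p c (?y |` {\<delta>}))"
      using conditional_independence_iff[where p = p, OF y(1) gd(1-3) pos] by blast
    moreover have "two \<gamma> \<delta> ?y p = ?T" unfolding two_def y(2) ..
    ultimately show ?thesis unfolding y(3,4) by (simp only: two_def)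
  qed
  have "(?T c d * ?M) * (?T c' d' * ?M) = (?T c d' * ?M) * (?T c' d * ?M)"
    unfolding key[OF c(1) d(1)] key[OF c(2) d(2)] key[OF c(1) d(2)] key[OF c(2) d(1)] by (simp only: mult_ac)
  then have "(?T c d * ?T c' d') * (?M * ?M) = (?T c d' * ?T c' d) * (?M * ?M)"
    by (simp only: mult_ac)
  moreover have "?M * ?M \<noteq> 0" using M by simp
  ultimately show ?thesis by (simp only: mult_cancel_right) blast
qed

text \<open>For nonadjacent \<gamma>, \<delta> in \<open>D\<close>, pairing in both directions turns
  the alternating sum into mixed second differences of ln p. Each is the logarithm of a cross ratio
  of a slice, hence 0.\<close>

lemma Mob_noncomplete:
  assumes p: "p \<in> positive_markov V E I" and i: "i \<in> cells_star I z D" and D: "D \<subseteq> V" "\<not> complete_in E D"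
  shows "Mob z V (\<lambda>x. ln (p x)) i = 0"
proof -
  obtain \<gamma> \<delta> where gd: "\<gamma> \<in> D" "\<delta> \<in> D" "\<gamma> \<noteq> \<delta>" "{\<gamma>, \<delta>} \<notin> E"
    using D(2) unfolding complete_in_def by blast
  have gdV: "\<gamma> \<in> V" "\<delta> \<in> V" using gd D by auto
  define D' where "D' = D - {\<gamma>, \<delta>}"
  have ci: "i \<in> cl D" by (rule cells_star_cells[OF i])
  have di: "dom i = insert \<gamma> (insert \<delta> D')" using dom_cells[OF ci] gd by (auto simp: D'_def)
  have fin: "finite D'" "finite (insert \<delta> D')" using finite_subset[OF D(1) finV] by (auto simp: D'_def)
  have notin: "\<delta> \<notin> D'" "\<gamma> \<notin> insert \<delta> D'" using gd by (auto simp: D'_def)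
  define h where "h = (\<lambda>F. ln (p ((i |` F) ++ base_cell z (V - F))))"
  have "Mob z V (\<lambda>x. ln (p x)) i = (\<Sum>F\<in>Pow D'. (-1) ^ card (D' - F) *
      ((h (insert \<gamma> (insert \<delta> F)) - h (insert \<delta> F)) - (h (insert \<gamma> F) - h F)))"
    unfolding Mob_def di alternating_sum_insert[OF fin(2) notin(2)]
    unfolding alternating_sum_insert[OF fin(1) notin(1)] h_def ..
  also have "\<dots> = 0"
  proof (rule sum.neutral, rule ballI)
    fix F assume "F \<in> Pow D'"
    then have F: "F \<subseteq> D'" by simp
    define x where "x = (i |` F) ++ base_cell z (V - F)"
    have FV: "F \<subseteq> D" "F \<subseteq> V" using F D by (auto simp: D'_def)
    have "F \<union> (V - F) = V" using FV by auto
    then have x: "x \<in> cl V"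
      unfolding x_def using cells_add[OF cells_restrict[OF ci FV(1)] base_cells[of "V - F"]] by simp
    have gF: "\<gamma> \<notin> F" "\<delta> \<notin> F" using F by (auto simp: D'_def)
    let ?T = "two \<gamma> \<delta> x p"
    have dN: "i \<gamma> \<noteq> None" "i \<delta> \<noteq> None" using di by auto
    have hs: "h (insert \<gamma> (insert \<delta> F)) = ln (?T (i |` {\<gamma>}) (i |` {\<delta>}))"
      "h (insert \<delta> F) = ln (?T (base_cell z {\<gamma>}) (i |` {\<delta>}))"
      "h (insert \<gamma> F) = ln (?T (i |` {\<gamma>}) (base_cell z {\<delta>}))"
      "h F = ln (?T (base_cell z {\<gamma>}) (base_cell z {\<delta>}))"
      unfolding h_def two_def x_def
      by (intro arg_cong[where f = ln] arg_cong[where f = p] ext,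
          use gF gdV gd(3) dN FV in \<open>auto simp: restrict_map_def base_cell_def map_add_def split: option.splits\<close>)+
    have m: "i |` {\<gamma>} \<in> cl {\<gamma>}" "i |` {\<delta>} \<in> cl {\<delta>}" "base_cell z {\<gamma>} \<in> cl {\<gamma>}" "base_cell z {\<delta>} \<in> cl {\<delta>}"
      using cells_restrict[OF ci] gd base_cells gdV by auto
    have Tpos: "0 < ?T c d" if "c \<in> cl {\<gamma>}" "d \<in> cl {\<delta>}" for c d
      unfolding two_def by (rule positive_markovD(1)[OF p two_cell(1)[OF x gdV gd(3) that]])
    have "ln (?T (i |` {\<gamma>}) (i |` {\<delta>})) + ln (?T (base_cell z {\<gamma>}) (base_cell z {\<delta>})) =
        ln (?T (i |` {\<gamma>}) (base_cell z {\<delta>})) + ln (?T (base_cell z {\<gamma>}) (i |` {\<delta>}))"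
      using cross_ratio[OF p x gdV gd(3,4) m(1) m(3) m(2) m(4)] Tpos[OF m(1,2)] Tpos[OF m(3,4)] Tpos[OF m(1,4)] Tpos[OF m(3,2)]
      by (simp only: ln_mult_pos[symmetric])
    then show "(-1) ^ card (D' - F) * ((h (insert \<gamma> (insert \<delta> F)) - h (insert \<delta> F)) - (h (insert \<gamma> F) - h F)) = 0"
      unfolding hs by simp
  qed
  finally show ?thesis .
qed

text \<open>A clique is complete, so none contains two nonadjacent vertices. Sorting the factors by
  whether their clique contains \<gamma> writes the table as a factor free of \<gamma> times a
  factor free of \<delta>.\<close>

lemma kernel_product_markov:
  assumes q: "cond_kernel q"
  shows "restrict (kernel_product q) (cl V) \<in> positive_markov V E I"
proof -
  define p where "p = restrict (kernel_product q) (cl V)"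
  have p_eq: "p x = kernel_product q x" if "x \<in> cl V" for x using that by (simp add: p_def)
  have pos: "0 < p x" if "x \<in> cl V" for x
    using partial_product_pos[OF q order_refl that] p_eq[OF that] H_n by simp
  have "(\<Sum>x\<in>cl V. p x) = 1"
    using sum_kernel_product[OF q] by (simp add: p_eq cong: sum.cong)
  moreover have "markov V E I p"
    unfolding markov_def Let_def
  proof (intro ballI impI, elim conjE)
    fix \<gamma> \<delta> x assume gd: "\<gamma> \<in> V" "\<delta> \<in> V" "\<gamma> \<noteq> \<delta>" "{\<gamma>, \<delta>} \<notin> E" and x: "x \<in> cl V"
    let ?W = "V - {\<gamma>, \<delta>}"
    define f where "f = (\<lambda>y. \<Prod>l | l < n \<and> \<gamma> \<notin> Cs ! l. q l (y |` S l) (y |` Rd l))"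
    define g where "g = (\<lambda>y. \<Prod>l | l < n \<and> \<gamma> \<in> Cs ! l. q l (y |` S l) (y |` Rd l))"
    have T: "two \<gamma> \<delta> x p c d = f (x |` ?W ++ d) * g (x |` ?W ++ c)" if cd: "c \<in> cl {\<gamma>}" "d \<in> cl {\<delta>}" for c d
    proof -
      let ?y = "x |` ?W ++ (c ++ d)"
      have y: "?y \<in> cl V" by (rule two_cell(1)[OF x gd(1-3) cd])
      have dcd: "dom c = {\<gamma>}" "dom d = {\<delta>}" using cd dom_cells by blast+
      have c0: "c \<alpha> = None" if "\<alpha> \<noteq> \<gamma>" for \<alpha> using dcd that by auto
      have d0: "d \<alpha> = None" if "\<alpha> \<noteq> \<delta>" for \<alpha> using dcd that by auto
      have rf: "?y |` B = (x |` ?W ++ d) |` B" if "\<gamma> \<notin> B" for B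
      proof
        fix \<alpha> show "(?y |` B) \<alpha> = ((x |` ?W ++ d) |` B) \<alpha>"
        proof (cases "\<alpha> \<in> B")
          case True
          then have "c \<alpha> = None" using that by (intro c0) blast
          then show ?thesis by (simp add: restrict_map_def map_add_def split: option.splits)
        qed simp
      qed
      have rg: "?y |` B = (x |` ?W ++ c) |` B" if "\<delta> \<notin> B" for B
      proof
        fix \<alpha> show "(?y |` B) \<alpha> = ((x |` ?W ++ c) |` B) \<alpha>"
        proof (cases "\<alpha> \<in> B")
          case True
          then have "d \<alpha> = None" using that by (intro d0) blast
          then show ?thesis by (simp add: restrict_map_def map_add_def split: option.splits)
        qed simp
      qed
      have "p ?y = (\<Prod>l\<in>{l. l < n \<and> \<gamma> \<notin> Cs ! l} \<union> {l. l < n \<and> \<gamma> \<in> Cs ! l}. q l (?y |` S l) (?y |` Rd l))"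
        unfolding p_eq[OF y] partial_product_def by (rule prod.cong) auto
      also have "\<dots> = f ?y * g ?y"
        unfolding f_def g_def by (rule prod.union_disjoint) auto
      also have "f ?y = f (x |` ?W ++ d)"
        unfolding f_def
      proof (rule prod.cong[OF refl])
        fix l assume "l \<in> {l. l < n \<and> \<gamma> \<notin> Cs ! l}"
        then have ns: "\<gamma> \<notin> S l" "\<gamma> \<notin> Rd l" using SR(1)[of l] by auto
        show "q l (?y |` S l) (?y |` Rd l) = q l ((x |` ?W ++ d) |` S l) ((x |` ?W ++ d) |` Rd l)"
          unfolding rf[OF ns(1)] rf[OF ns(2)] ..
      qed
      also have "g ?y = g (x |` ?W ++ c)"
        unfolding g_def
      proof (rule prod.cong[OF refl])
        fix l assume "l \<in> {l. l < n \<and> \<gamma> \<in> Cs ! l}"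
        then have "\<delta> \<notin> Cs ! l" using C_complete[of l] gd unfolding complete_in_def by blast
        then have ns: "\<delta> \<notin> S l" "\<delta> \<notin> Rd l" using SR(1)[of l] by auto
        show "q l (?y |` S l) (?y |` Rd l) = q l ((x |` ?W ++ c) |` S l) ((x |` ?W ++ c) |` Rd l)"
          unfolding rg[OF ns(1)] rg[OF ns(2)] ..
      qed
      finally show ?thesis by (simp only: two_def)
    qed
    have x0: "x |` {\<gamma>} \<in> cl {\<gamma>}" "x |` {\<delta>} \<in> cl {\<delta>}" using cells_restrict[OF x] gd by auto
    have "two \<gamma> \<delta> x p (x |` {\<gamma>}) (x |` {\<delta>}) = p x"
    proof -
      have "x |` ?W ++ (x |` {\<gamma>} ++ x |` {\<delta>}) = x"
        using dom_cells[OF x] by (intro ext) (auto simp: restrict_map_def map_add_def split: option.splits)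
      then show ?thesis by (simp add: two_def)
    qed
    then have px: "p x = f (x |` ?W ++ x |` {\<delta>}) * g (x |` ?W ++ x |` {\<gamma>})" using T[OF x0] by simp
    have "(\<Sum>c\<in>cl {\<gamma>}. \<Sum>d\<in>cl {\<delta>}. two \<gamma> \<delta> x p c d) =
        (\<Sum>c\<in>cl {\<gamma>}. \<Sum>d\<in>cl {\<delta>}. f (x |` ?W ++ d) * g (x |` ?W ++ c))"
      by (intro sum.cong refl T)
    also have "\<dots> = (\<Sum>c\<in>cl {\<gamma>}. g (x |` ?W ++ c)) * (\<Sum>d\<in>cl {\<delta>}. f (x |` ?W ++ d))"
      unfolding sum_product by (simp only: mult.commute)
    finally have M: "(\<Sum>c\<in>cl {\<gamma>}. \<Sum>d\<in>cl {\<delta>}. two \<gamma> \<delta> x p c d) =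
      (\<Sum>c\<in>cl {\<gamma>}. g (x |` ?W ++ c)) * (\<Sum>d\<in>cl {\<delta>}. f (x |` ?W ++ d))" .
    have e1: "(\<Sum>d\<in>cl {\<delta>}. two \<gamma> \<delta> x p (x |` {\<gamma>}) d) = (\<Sum>d\<in>cl {\<delta>}. f (x |` ?W ++ d)) * g (x |` ?W ++ x |` {\<gamma>})"
      unfolding sum_distrib_right by (intro sum.cong refl T x0)
    have e2: "(\<Sum>c\<in>cl {\<gamma>}. two \<gamma> \<delta> x p c (x |` {\<delta>})) = f (x |` ?W ++ x |` {\<delta>}) * (\<Sum>c\<in>cl {\<gamma>}. g (x |` ?W ++ c))"
      unfolding sum_distrib_left by (intro sum.cong refl T x0)
    show "conditional V I p (x |` ?W) (x |` {\<gamma>, \<delta>}) =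
        conditional V I p (x |` ?W) (x |` {\<gamma>}) * conditional V I p (x |` ?W) (x |` {\<delta>})"
    proof (rule iffD2[OF conditional_independence_iff[where p = p, OF x gd(1-3)]])
      show "0 < p y" if "y \<in> cl V" for y by (rule pos[OF that])
      show "p x * (\<Sum>c\<in>cl {\<gamma>}. \<Sum>d\<in>cl {\<delta>}. two \<gamma> \<delta> x p c d) =
          (\<Sum>d\<in>cl {\<delta>}. two \<gamma> \<delta> x p (x |` {\<gamma>}) d) * (\<Sum>c\<in>cl {\<gamma>}. two \<gamma> \<delta> x p c (x |` {\<delta>}))"
        unfolding M e1 e2 px by (simp only: mult_ac)
    qed
  qed
  ultimately show ?thesis
    using pos unfolding positive_markov_def p_def[symmetric] by (simp add: p_def)
qed

text \<open>Assigns each complete set to exactly one clique containing it, so that a sum over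
  complete sets can be regrouped by cliques.\<close>

definition first_clique :: "'v set \<Rightarrow> nat" where
  "first_clique D = (LEAST l. l < n \<and> D \<subseteq> Cs ! l)"

lemma first_clique: "D \<subseteq> V \<Longrightarrow> complete_in E D \<Longrightarrow> first_clique D < n \<and> D \<subseteq> Cs ! first_clique D"
  using clique_containing[of D] unfolding first_clique_def by (metis (mono_tags, lifting) LeastI)

lemma complete_subset: "complete_in E C \<Longrightarrow> D \<subseteq> C \<Longrightarrow> complete_in E D"
  by (auto simp: complete_in_def)

text \<open>Collecting the interactions of each clique gives positive clique potentials, which
  absorption then turns into conditional tables. No normalization of \<open>P\<close> is assumed; it
  is returned in \<open>Z\<close>.\<close>

lemma log_additive_factorization:
  assumes P: "\<And>x. x \<in> cl V \<Longrightarrow> P x = exp (\<Sum>D | D \<subseteq> supp z x \<and> complete_in E D. \<theta> (x |` D))"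
  obtains q Z where "0 < Z" "cond_kernel q" "\<And>x. x \<in> cl V \<Longrightarrow> P x = Z * kernel_product q x"
proof -
  define F where "F = (\<lambda>l y. exp (\<Sum>D | D \<subseteq> supp z y \<and> first_clique D = l. \<theta> (y |` D)))"
  have "(\<Prod>l<n. F l (x |` (Cs ! l))) = P x" if x: "x \<in> cl V" for x
  proof -
    have sV: "supp z x \<subseteq> V" using supp_subset[of z x] dom_cells[OF x] by simp
    have fin: "finite {D. D \<subseteq> supp z x \<and> complete_in E D}"
      by (rule finite_subset[of _ "Pow V"]) (use sV finV in auto)
    have sup: "supp z (x |` (Cs ! l)) = supp z x \<inter> Cs ! l" for l
      by (auto simp: supp_def)
    have "(\<Sum>D | D \<subseteq> supp z (x |` (Cs ! l)) \<and> first_clique D = l. \<theta> ((x |` (Cs ! l)) |` D)) =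
        (\<Sum>D\<in>{D \<in> {D. D \<subseteq> supp z x \<and> complete_in E D}. first_clique D = l}. \<theta> (x |` D))" if l: "l < n" for l
    proof (rule sum.cong)
      show "{D. D \<subseteq> supp z (x |` (Cs ! l)) \<and> first_clique D = l} = {D \<in> {D. D \<subseteq> supp z x \<and> complete_in E D}. first_clique D = l}"
        unfolding sup using C_complete[OF l] complete_subset first_clique sV by blast
      fix D assume "D \<in> {D \<in> {D. D \<subseteq> supp z x \<and> complete_in E D}. first_clique D = l}"
      then have "D \<subseteq> Cs ! l" using first_clique[of D] sV by blast
      then show "\<theta> ((x |` (Cs ! l)) |` D) = \<theta> (x |` D)" by (simp only: restrict_restrict_subset)
    qed
    then have "(\<Prod>l<n. F l (x |` (Cs ! l))) =
        exp (\<Sum>l<n. \<Sum>D\<in>{D \<in> {D. D \<subseteq> supp z x \<and> complete_in E D}. first_clique D = l}. \<theta> (x |` D))"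
      unfolding F_def by (simp add: exp_sum)
    also have "(\<Sum>l<n. \<Sum>D\<in>{D \<in> {D. D \<subseteq> supp z x \<and> complete_in E D}. first_clique D = l}. \<theta> (x |` D)) =
        (\<Sum>D | D \<subseteq> supp z x \<and> complete_in E D. \<theta> (x |` D))"
      by (rule sum.group[OF fin]) (use first_clique sV in auto)
    finally show ?thesis using P[OF x] by simp
  qed
  moreover have "0 < F l y" for l y by (simp add: F_def)
  ultimately show ?thesis using absorb_all[of F] that by metis
qed

lemma log_sum_complete:
  assumes p: "p \<in> positive_markov V E I" and x: "x \<in> cl V"
  shows "ln (p x) = (\<Sum>D | D \<subseteq> supp z x \<and> complete_in E D. Mob z V (\<lambda>x. ln (p x)) (x |` D))"
proof -
  have sV: "supp z x \<subseteq> V" using supp_subset[of z x] dom_cells[OF x] by simp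
  have "ln (p x) = (\<Sum>D\<in>Pow (supp z x). Mob z V (\<lambda>x. ln (p x)) (x |` D))"
    by (rule Mob_inversion[OF x finV, symmetric])
  also have "\<dots> = (\<Sum>D | D \<subseteq> supp z x \<and> complete_in E D. Mob z V (\<lambda>x. ln (p x)) (x |` D))"
  proof (rule sum.mono_neutral_right)
    show "finite (Pow (supp z x))" using finite_subset[OF sV finV] by simp
    show "\<forall>D\<in>Pow (supp z x) - {D. D \<subseteq> supp z x \<and> complete_in E D}. Mob z V (\<lambda>x. ln (p x)) (x |` D) = 0"
    proof
      fix D assume "D \<in> Pow (supp z x) - {D. D \<subseteq> supp z x \<and> complete_in E D}"
      then have D: "D \<subseteq> supp z x" "\<not> complete_in E D" by auto
      show "Mob z V (\<lambda>x. ln (p x)) (x |` D) = 0"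
        by (rule Mob_noncomplete[OF p cells_star_restrict_supp[OF x D(1)] _ D(2)]) (use D(1) sV in blast)
    qed
  qed auto
  finally show ?thesis .
qed

text \<open>Interactions on noncomplete sets vanish, so the table is log additive over complete
  sets. The constant is 1 because both the table and the product of conditional tables have total
  mass 1.\<close>

lemma positive_markov_factorization:
  assumes p: "p \<in> positive_markov V E I"
  obtains q where "cond_kernel q" "p = restrict (kernel_product q) (cl V)"
proof -
  have "p x = exp (\<Sum>D | D \<subseteq> supp z x \<and> complete_in E D. Mob z V (\<lambda>x. ln (p x)) (x |` D))" if "x \<in> cl V" for x
    using log_sum_complete[OF p that] positive_markovD(1)[OF p that] by (metis exp_ln)
  from log_additive_factorization[OF this]
  obtain q Z where q: "cond_kernel q" "\<And>x. x \<in> cl V \<Longrightarrow> p x = Z * kernel_product q x" by blast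
  have "1 = Z * (\<Sum>x\<in>cl V. kernel_product q x)"
    unfolding positive_markovD(2)[OF p, symmetric] sum_distrib_left by (intro sum.cong refl q(2))
  then have "Z = 1" using sum_kernel_product[OF q(1)] by simp
  then have "p = restrict (kernel_product q) (cl V)"
    using q(2) positive_markovD(3)[OF p] by (intro ext) (auto simp: extensional_def restrict_def)
  then show ?thesis using q(1) that by blast
qed

end

text \<open>The list need not be sorted by rank, so a null vector is used instead of a triangular
  shape: in the row of a nonzero entry of least rank, all other contributions come from smaller
  ranks and vanish, and that entry would be 0.\<close>

lemma det_unitriangular_rank:
  fixes T :: "'k \<Rightarrow> 'k \<Rightarrow> real" and rank :: "'k \<Rightarrow> nat"
  assumes dist: "distinct xs" and diag: "\<And>a. a \<in> set xs \<Longrightarrow> T a a = 1"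
    and tri: "\<And>a b. a \<in> set xs \<Longrightarrow> b \<in> set xs \<Longrightarrow> a \<noteq> b \<Longrightarrow> T b a \<noteq> 0 \<Longrightarrow> rank a < rank b"
  shows "Determinant.det (mat_of xs T) \<noteq> 0"
proof
  assume "Determinant.det (mat_of xs T) = 0"
  then obtain v where v: "v \<in> carrier_vec (length xs)" "v \<noteq> 0\<^sub>v (length xs)"
    "mat_of xs T *\<^sub>v v = 0\<^sub>v (length xs)"
    using det_0_iff_vec_prod_zero_field[OF mat_of_carrier] by blast
  have "\<exists>i<length xs. vec_index v i \<noteq> 0"
  proof (rule ccontr)
    assume "\<not> (\<exists>i<length xs. vec_index v i \<noteq> 0)"
    then have "v = 0\<^sub>v (length xs)" using v(1) by (intro eq_vecI) auto
    then show False using v(2) by blast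
  qed
  define X where "X = {i. i < length xs \<and> vec_index v i \<noteq> 0}"
  have "\<exists>i. i \<in> X" using \<open>\<exists>i<length xs. vec_index v i \<noteq> 0\<close> by (auto simp: X_def)
  then obtain i where i: "i \<in> X" "\<And>j. j \<in> X \<Longrightarrow> rank (xs ! i) \<le> rank (xs ! j)"
    by (metis (mono_tags) ex_has_least_nat[of "\<lambda>i. i \<in> X" _ "\<lambda>i. rank (xs ! i)"])
  have il: "i < length xs" using i(1) by (simp add: X_def)
  have "0 = vec_index (mat_of xs T *\<^sub>v v) i" using v(3) il by simp
  also have "\<dots> = (\<Sum>j = 0..<length xs. T (xs ! i) (xs ! j) * vec_index v j)"
    using il v(1) by (simp add: mult_mat_vec_def scalar_prod_def)
  also have "\<dots> = (\<Sum>j = 0..<length xs. if j = i then vec_index v i else 0)"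
  proof (rule sum.cong[OF refl])
    fix j assume "j \<in> {0..<length xs}"
    then have j: "j < length xs" by simp
    show "T (xs ! i) (xs ! j) * vec_index v j = (if j = i then vec_index v i else 0)"
    proof (cases "j = i")
      case True
      then show ?thesis using diag[of "xs ! i"] il by simp
    next
      case False
      then have "xs ! j \<noteq> xs ! i" using dist j il by (simp add: nth_eq_iff_index_eq)
      have "T (xs ! i) (xs ! j) * vec_index v j = 0"
      proof (rule ccontr)
        assume "T (xs ! i) (xs ! j) * vec_index v j \<noteq> 0"
        then have nz: "T (xs ! i) (xs ! j) \<noteq> 0" "j \<in> X" using j by (auto simp: X_def)
        have "rank (xs ! j) < rank (xs ! i)"
          by (rule tri[OF _ _ \<open>xs ! j \<noteq> xs ! i\<close> nz(1)]) (use j il in simp_all)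
        then show False using i(2)[OF nz(2)] by linarith
      qed
      then show ?thesis using False by simp
    qed
  qed
  also have "\<dots> = vec_index v i" using il by simp
  finally show False using i(1) by (simp add: X_def)
qed

context clique_model begin

definition Keys :: "(nat \<times> ('v, 'a) cell) set" where
  "Keys = Sigma {..<n} (\<lambda>l. cl (S l))"

lemma finite_Keys: "finite Keys"
  unfolding Keys_def by (rule finite_SigmaI) (use finite_cells sub_V in auto)

lemma Keys_iff: "(l, s) \<in> Keys \<longleftrightarrow> l < n \<and> s \<in> cl (S l)"
  by (auto simp: Keys_def)

lemma w_0: "w q 0 Map.empty = 1"
  by (simp add: w_def partial_product_def)

text \<open>The first clique has the empty separator, so its marginal is a conditional table as well
  and the target density becomes a uniform product over all conditional tables.\<close>

lemma prior_prob_kernel_product: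
  assumes q: "cond_kernel q"
  shows "prior_prob V I Cs (restrict (kernel_product q) (cl V)) =
    (\<Prod>k\<in>Keys. sqrt (\<Prod>r\<in>cl (Rd (fst k)). q (fst k) (snd k) r))"
proof -
  define p where "p = restrict (kernel_product q) (cl V)"
  have p: "p x = kernel_product q x" if "x \<in> cl V" for x using that by (simp add: p_def)
  define h where "h = (\<lambda>l. \<Prod>s\<in>cl (S l). sqrt (\<Prod>r\<in>cl (Rd l). q l s r))"
  have "(\<Prod>i\<in>cl (Cs ! 0). marginal V I p i) = (\<Prod>r\<in>cl (Rd 0). q 0 Map.empty r)"
  proof (rule prod.cong)
    fix r assume r: "r \<in> cl (Rd 0)"
    have "marginal V I p (r ++ Map.empty) = w q 0 Map.empty * q 0 Map.empty r"
      by (rule marginal_clique[OF q n_pos _ r p]) simp_all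
    then show "marginal V I p r = q 0 Map.empty r" by (simp add: w_0)
  qed simp
  then have "sqrt (\<Prod>i\<in>cl (Cs ! 0). marginal V I p i) = h 0" by (simp add: h_def)
  moreover have "(\<Prod>l\<in>{0<..<n}. \<Prod>s\<in>cl (S l). sqrt (\<Prod>r\<in>cl (Rd l). conditional V I p s r)) = (\<Prod>l\<in>{0<..<n}. h l)"
    unfolding h_def
  proof (intro prod.cong refl arg_cong[where f = sqrt])
    fix l s r assume "l \<in> {0<..<n}" "s \<in> cl (S l)" "r \<in> cl (Rd l)"
    then show "conditional V I p s r = q l s r"
      by (intro conditional_eq[where p = p, OF q]) (simp_all add: p)
  qed
  moreover have "{..<n} = insert 0 {0<..<n}" using n_pos by auto
  ultimately have "prior_prob V I Cs p = (\<Prod>l<n. h l)"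
    unfolding prior_prob_def by simp
  also have "\<dots> = (\<Prod>k\<in>Keys. sqrt (\<Prod>r\<in>cl (Rd (fst k)). q (fst k) (snd k) r))"
    unfolding h_def Keys_def
    by (subst prod.Sigma) (use finite_cells sub_V in \<open>auto simp: case_prod_beta\<close>)
  finally show ?thesis by (simp add: p_def)
qed

end

section \<open>Fisher information of conditional logit models\<close>

text \<open>
  The logits of the conditional tables are \<open>\<Sum>a. v a * \<xi> a k r\<close>, where \<open>k = (l, s)\<close> names a
  conditional table, \<open>\<xi> a k r \<in> {0, 1}\<close> and \<open>v = \<phi> u\<close>. The map \<open>\<kappa>\<close> identifies the labels of a
  group with the pairs of a table of that group and a non-base cell.
\<close>

locale feature_model = clique_model V E I z Cs
  for V :: "'v set" and E :: "'v set set" and I :: "'v \<Rightarrow> 'a set" and z :: "'v \<Rightarrow> 'a"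
    and Cs :: "'v set list" +
  fixes N :: nat and gs :: "'k list list" and \<beta> :: "nat \<times> ('v, 'a) cell \<Rightarrow> nat"
    and ce :: "'k \<Rightarrow> ('v, 'a) cell" and tot :: "nat \<times> ('v, 'a) cell \<Rightarrow> ('v, 'a) cell \<Rightarrow> ('v, 'a) cell"
    and \<kappa> :: "'k \<Rightarrow> (nat \<times> ('v, 'a) cell) \<times> ('v, 'a) cell"
    and \<phi> :: "('k \<Rightarrow> real) \<Rightarrow> 'k \<Rightarrow> real" and t :: "'k \<Rightarrow> ('k \<Rightarrow> real) \<Rightarrow> real"
    and \<Theta> :: "(('v, 'a) cell \<Rightarrow> real) \<Rightarrow> 'k \<Rightarrow> real"
    and qv :: "('k \<Rightarrow> real) \<Rightarrow> nat \<Rightarrow> ('v, 'a) cell \<Rightarrow> ('v, 'a) cell \<Rightarrow> real"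
    and \<xi> :: "'k \<Rightarrow> nat \<times> ('v, 'a) cell \<Rightarrow> ('v, 'a) cell \<Rightarrow> real"
  defines "\<xi> \<equiv> \<lambda>a k r. if a \<in> set (gs ! \<beta> k) \<and> ce a \<subseteq>\<^sub>m tot k r then 1 else 0"
    and "qv \<equiv> \<lambda>v l s r. exp (\<Sum>a\<in>set (concat gs). v a * \<xi> a (l, s) r) /
        (\<Sum>r'\<in>cells I (residual Cs l). exp (\<Sum>a\<in>set (concat gs). v a * \<xi> a (l, s) r'))"
  assumes N: "N \<ge> 1"
    and dist: "distinct (concat gs)"
    and \<beta>_range: "\<And>k. k \<in> Keys \<Longrightarrow> \<beta> k < length gs"
    and \<beta>_same: "\<And>k k'. k \<in> Keys \<Longrightarrow> k' \<in> Keys \<Longrightarrow> \<beta> k = \<beta> k' \<Longrightarrow> fst k = fst k'"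
    and \<kappa>_bij: "\<And>j. j < length gs \<Longrightarrow> bij_betw \<kappa> (set (gs ! j))
        (Sigma {k \<in> Keys. \<beta> k = j} (\<lambda>k. cells I (residual Cs (fst k)) - {base_cell z (residual Cs (fst k))}))"
    and \<xi>_diag: "\<And>j a. j < length gs \<Longrightarrow> a \<in> set (gs ! j) \<Longrightarrow> ce a \<subseteq>\<^sub>m tot (fst (\<kappa> a)) (snd (\<kappa> a))"
    and \<xi>_tri: "\<And>j a b. j < length gs \<Longrightarrow> a \<in> set (gs ! j) \<Longrightarrow> b \<in> set (gs ! j) \<Longrightarrow> a \<noteq> b \<Longrightarrow>
        ce a \<subseteq>\<^sub>m tot (fst (\<kappa> b)) (snd (\<kappa> b)) \<Longrightarrow> card (dom (ce a)) < card (dom (ce b))"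
    and \<xi>_base: "\<And>k a. k \<in> Keys \<Longrightarrow> a \<in> set (gs ! \<beta> k) \<Longrightarrow> \<not> ce a \<subseteq>\<^sub>m tot k (base_cell z (residual Cs (fst k)))"
    and cont_\<phi>: "\<And>a. continuous_on UNIV (\<lambda>u. \<phi> u a)"
    and cont_t: "\<And>a. continuous_on UNIV (t a)"
    and \<phi>_in: "\<And>a u. a \<in> set (concat gs) \<Longrightarrow> \<phi> u a = u a + t a (\<phi> u)"
    and \<phi>_out: "\<And>a u. a \<notin> set (concat gs) \<Longrightarrow> \<phi> u a = u a"
    and t_dep: "\<And>j a v w. j < length gs \<Longrightarrow> a \<in> set (gs ! j) \<Longrightarrow>
        (\<And>b. b \<in> set (concat (take j gs)) \<Longrightarrow> v b = w b) \<Longrightarrow> t a v = t a w"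
    and diff_\<phi>: "\<And>u a c. \<exists>d. ((\<lambda>\<tau>. \<phi> (u(a := \<tau>)) c) has_real_derivative d) (at (u a))"
    and prob: "\<And>u. u \<in> parameter_space gs \<Longrightarrow> prob_of V E I \<Theta> u = restrict (partial_product (qv (\<phi> u)) (length Cs)) (cells I V)"
begin

abbreviation "L \<equiv> set (concat gs)"
abbreviation "b0 l \<equiv> base_cell z (Rd l)"

section \<open>The two factors of the block determinants\<close>

definition cv :: "('k \<Rightarrow> real) \<Rightarrow> nat \<times> ('v, 'a) cell \<Rightarrow> ('v, 'a) cell \<Rightarrow> real" where
  "cv v k r = (\<Sum>a\<in>L. v a * \<xi> a k r)"

definition Zv :: "('k \<Rightarrow> real) \<Rightarrow> nat \<times> ('v, 'a) cell \<Rightarrow> real" where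
  "Zv v k = (\<Sum>r\<in>cl (Rd (fst k)). exp (cv v k r))"

lemma qv_eq: "qv v l s r = exp (cv v (l, s) r) / Zv v (l, s)"
  by (simp add: qv_def cv_def Zv_def)

lemma Zv_pos:
  assumes "fst k < n"
  shows "0 < Zv v k"
  unfolding Zv_def
  by (rule sum_pos2[OF finite_cells[OF sub_V(2)[OF assms]] base_cells[OF sub_V(2)[OF assms]]]) auto

lemma cond_kernel_qv: "cond_kernel (qv v)"
  unfolding cond_kernel_def
proof (intro allI impI ballI conjI)
  fix l s assume l: "l < n"
  show "0 < qv v l s r" for r using Zv_pos[of "(l, s)" v] l by (simp add: qv_eq)
  show "(\<Sum>r\<in>cl (Rd l). qv v l s r) = 1"
    unfolding qv_eq sum_divide_distrib[symmetric] using Zv_pos[of "(l, s)" v] l by (simp add: Zv_def)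
qed

lemma ln_qv: "l < n \<Longrightarrow> ln (qv v l s r) = cv v (l, s) r - ln (Zv v (l, s))"
  using Zv_pos[of "(l, s)" v] by (simp add: qv_eq ln_div)

lemma in_group_iff:
  assumes "i < length gs" "j < length gs" "a \<in> set (gs ! i)"
  shows "a \<in> set (gs ! j) \<longleftrightarrow> i = j"
proof (cases "i = j")
  case False
  have "set (gs ! i) \<inter> set (gs ! j) = {}" if "i < j" "j < length gs" for i j
  proof -
    have "concat gs = concat (take j gs) @ concat (drop j gs)"
      by (metis append_take_drop_id concat_append)
    then have "set (concat (take j gs)) \<inter> set (concat (drop j gs)) = {}"
      using dist by (metis distinct_append)
    moreover have "set (gs ! i) \<subseteq> set (concat (take j gs))" using that in_set_concat_take[of _ j gs] by auto
    moreover have "set (gs ! j) \<subseteq> set (concat (drop j gs))" using that in_set_concat_drop[of j gs] by auto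
    ultimately show ?thesis by blast
  qed
  from this[of i j] this[of j i] show ?thesis using False assms by (metis disjoint_iff nat_neq_iff)
qed (use assms in simp)

lemma \<xi>_zero: "a \<notin> set (gs ! \<beta> k) \<Longrightarrow> \<xi> a k r = 0"
  by (simp add: \<xi>_def)

lemma cv_dep:
  assumes "\<And>a. a \<in> set (gs ! \<beta> k) \<Longrightarrow> v a = v' a"
  shows "cv v k r = cv v' k r"
  unfolding cv_def
proof (rule sum.cong[OF refl])
  fix a show "v a * \<xi> a k r = v' a * \<xi> a k r"
    using assms[of a] \<xi>_zero[of a k r] by (cases "a \<in> set (gs ! \<beta> k)") simp_all
qed

lemma qv_dep:
  assumes "\<And>a. a \<in> set (gs ! \<beta> (l, s)) \<Longrightarrow> v a = v' a"
  shows "qv v l s r = qv v' l s r"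
  unfolding qv_eq Zv_def using cv_dep[of "(l, s)" v v'] assms by simp

lemma cont_cv: "continuous_on UNIV (\<lambda>v. cv v k r)"
  unfolding cv_def by (intro continuous_on_sum continuous_on_mult continuous_on_const continuous_on_product_coordinates)

lemma cont_Zv: "continuous_on UNIV (\<lambda>v. Zv v k)"
  unfolding Zv_def by (intro continuous_on_sum continuous_on_exp cont_cv)

lemma cont_qv:
  assumes "l < n"
  shows "continuous_on UNIV (\<lambda>v. qv v l s r)"
  unfolding qv_eq
proof (intro continuous_on_divide continuous_on_exp cont_cv cont_Zv ballI)
  show "Zv v (l, s) \<noteq> 0" for v using Zv_pos[of "(l, s)" v] assms by simp
qed

lemma cont_w:
  assumes "l < n"
  shows "continuous_on UNIV (\<lambda>v. w (qv v) l s)"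
  unfolding w_def partial_product_def
proof (intro continuous_on_sum continuous_on_mult continuous_on_const continuous_on_prod)
  fix k assume "k \<in> {..<l}"
  then have "k < n" using assms by simp
  then show "continuous_on UNIV (\<lambda>v. qv v k s r)" for s r by (rule cont_qv)
qed

definition g :: "nat \<Rightarrow> ('k \<Rightarrow> real) \<Rightarrow> real" where
  "g j v = (\<Prod>k\<in>{k \<in> Keys. \<beta> k = j}. \<Prod>r\<in>cl (Rd (fst k)). qv v (fst k) (snd k) r)"

text \<open>The design matrix of a group: a row is a non-base cell of one of its tables, named by
  \<kappa>, a column is a label, and the matrix maps coordinates to logits.\<close>

definition T :: "'k \<Rightarrow> 'k \<Rightarrow> real" where
  "T b a = \<xi> a (fst (\<kappa> b)) (snd (\<kappa> b))"

text \<open>Each coordinate contributes the expected number of observations in its separator cell;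
  the squared determinant is a constant of the design. The value 1 beyond the last group keeps
  positivity and continuity free of side conditions.\<close>

definition G :: "nat \<Rightarrow> ('k \<Rightarrow> real) \<Rightarrow> real" where
  "G j v = (if j < length gs then (Determinant.det (mat_of (gs ! j) T))\<^sup>2 *
     (\<Prod>a\<in>set (gs ! j). real N * w (qv v) (fst (fst (\<kappa> a))) (snd (fst (\<kappa> a)))) else 1)"

lemma \<kappa>_mem:
  assumes "j < length gs" "a \<in> set (gs ! j)"
  shows "fst (\<kappa> a) \<in> Keys" "\<beta> (fst (\<kappa> a)) = j" "snd (\<kappa> a) \<in> cl (Rd (fst (fst (\<kappa> a))))"
    "snd (\<kappa> a) \<noteq> b0 (fst (fst (\<kappa> a)))"
proof -
  have "\<kappa> a \<in> Sigma {k \<in> Keys. \<beta> k = j} (\<lambda>k. cl (Rd (fst k)) - {b0 (fst k)})"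
    using bij_betwE[OF \<kappa>_bij[OF assms(1)]] assms(2) by blast
  then show "fst (\<kappa> a) \<in> Keys" "\<beta> (fst (\<kappa> a)) = j" "snd (\<kappa> a) \<in> cl (Rd (fst (fst (\<kappa> a))))"
    "snd (\<kappa> a) \<noteq> b0 (fst (fst (\<kappa> a)))" by auto
qed

lemma KeysD: "k \<in> Keys \<Longrightarrow> fst k < n \<and> snd k \<in> cl (S (fst k))"
  using Keys_iff[of "fst k" "snd k"] by simp

lemma det_T: "j < length gs \<Longrightarrow> Determinant.det (mat_of (gs ! j) T) \<noteq> 0"
proof (rule det_unitriangular_rank[where rank = "\<lambda>a. card (dom (ce a))"])
  assume j: "j < length gs"
  show "distinct (gs ! j)" using dist j by (auto simp: distinct_concat_iff)
  show "T a a = 1" if "a \<in> set (gs ! j)" for a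
    using \<xi>_diag[OF j that] \<kappa>_mem(2)[OF j that] that by (simp add: T_def \<xi>_def)
  show "card (dom (ce a)) < card (dom (ce b))"
    if "a \<in> set (gs ! j)" "b \<in> set (gs ! j)" "a \<noteq> b" "T b a \<noteq> 0" for a b
    using \<xi>_tri[OF j that(1-3)] that(4) by (simp add: T_def \<xi>_def split: if_splits)
qed

lemma g_pos: "0 < g j v"
  unfolding g_def
proof (intro prod_pos)
  fix k r assume "k \<in> {k \<in> Keys. \<beta> k = j}" "r \<in> cl (Rd (fst k))"
  then show "0 < qv v (fst k) (snd k) r" using KeysD cond_kernel_pos[OF cond_kernel_qv] by blast
qed

lemma G_pos: "0 < G j v"
proof (cases "j < length gs")
  case True
  have "0 < real N * w (qv v) (fst (fst (\<kappa> a))) (snd (fst (\<kappa> a)))" if "a \<in> set (gs ! j)" for a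
    using N w_pos[OF cond_kernel_qv] KeysD[OF \<kappa>_mem(1)[OF True that]] by simp
  then have "0 < (\<Prod>a\<in>set (gs ! j). real N * w (qv v) (fst (fst (\<kappa> a))) (snd (fst (\<kappa> a))))"
    by (rule prod_pos)
  then show ?thesis using det_T[OF True] True by (simp add: G_def)
qed (simp add: G_def)

lemma cont_g: "continuous_on UNIV (g j)"
  unfolding g_def
proof (intro continuous_on_prod)
  fix k r assume "k \<in> {k \<in> Keys. \<beta> k = j}"
  then have "fst k < n" using KeysD by blast
  then show "continuous_on UNIV (\<lambda>v. qv v (fst k) (snd k) r)" by (rule cont_qv)
qed

lemma cont_G: "continuous_on UNIV (G j)"
proof (cases "j < length gs")
  case True
  have "continuous_on UNIV (\<lambda>v. (Determinant.det (mat_of (gs ! j) T))\<^sup>2 *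
     (\<Prod>a\<in>set (gs ! j). real N * w (qv v) (fst (fst (\<kappa> a))) (snd (fst (\<kappa> a)))))"
  proof (intro continuous_on_mult continuous_on_const continuous_on_prod)
    fix a assume "a \<in> set (gs ! j)"
    then have "fst (fst (\<kappa> a)) < n" using KeysD \<kappa>_mem(1)[OF True] by blast
    then show "continuous_on UNIV (\<lambda>v. w (qv v) (fst (fst (\<kappa> a))) (snd (fst (\<kappa> a))))" by (rule cont_w)
  qed
  then show ?thesis using True by (simp add: G_def)
qed (simp add: G_def)

lemma g_dep:
  assumes "\<And>b. b \<in> set (gs ! j) \<Longrightarrow> v b = v' b"
  shows "g j v = g j v'"
  unfolding g_def
proof (intro prod.cong refl)
  fix k r assume "k \<in> {k \<in> Keys. \<beta> k = j}"
  then show "qv v (fst k) (snd k) r = qv v' (fst k) (snd k) r" by (intro qv_dep) (simp add: assms)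
qed

text \<open>The weight of a separator cell of clique \<open>l\<close> involves tables of cliques
  before \<open>l\<close>. By \<beta>_same, the tables of group \<open>j\<close> all belong to one
  clique, here \<open>l\<close>, so none of the tables involved lies in group
  \<open>j\<close>.\<close>

lemma G_dep:
  assumes j: "j < length gs" and vv': "\<And>b. b \<notin> set (gs ! j) \<Longrightarrow> v b = v' b"
  shows "G j v = G j v'"
proof -
  have "w (qv v) (fst k) (snd k) = w (qv v') (fst k) (snd k)" if k: "k \<in> Keys" "\<beta> k = j" for k
    unfolding w_def
  proof (intro sum.cong refl arg_cong2[where f = times])
    fix y assume y: "y \<in> cl (H (fst k))"
    show "partial_product (qv v) (fst k) y = partial_product (qv v') (fst k) y"
      unfolding partial_product_def
    proof (rule prod.cong[OF refl])
      fix i assume i: "i \<in> {..<fst k}"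
      have in_Keys: "(i, y |` S i) \<in> Keys"
      proof -
        have "S i \<subseteq> H (fst k)" using SR(1)[of i] i by blast
        then show ?thesis using cells_restrict[OF y] KeysD[OF k(1)] i by (simp add: Keys_iff)
      qed
      have "\<beta> (i, y |` S i) \<noteq> j" using \<beta>_same[OF in_Keys k(1)] k(2) i by auto
      then show "qv v i (y |` S i) (y |` Rd i) = qv v' i (y |` S i) (y |` Rd i)"
        using in_group_iff[OF \<beta>_range[OF in_Keys] j] by (intro qv_dep vv') blast
    qed
  qed
  then show ?thesis using \<kappa>_mem(1,2)[OF j] j by (simp add: G_def)
qed

text \<open>\<open>es v b l x\<close> is the contribution of clique \<open>l\<close> to the score of the coordinate \<open>v b\<close>.\<close>

definition ex :: "('k \<Rightarrow> real) \<Rightarrow> 'k \<Rightarrow> nat \<Rightarrow> ('v, 'a) cell \<Rightarrow> real" where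
  "ex v b l s = (\<Sum>r\<in>cl (Rd l). qv v l s r * \<xi> b (l, s) r)"

definition es :: "('k \<Rightarrow> real) \<Rightarrow> 'k \<Rightarrow> nat \<Rightarrow> ('v, 'a) cell \<Rightarrow> real" where
  "es v b l x = \<xi> b (l, x |` S l) (x |` Rd l) - ex v b l (x |` S l)"

definition cov :: "('k \<Rightarrow> real) \<Rightarrow> 'k \<Rightarrow> 'k \<Rightarrow> nat \<Rightarrow> ('v, 'a) cell \<Rightarrow> real" where
  "cov v b c l s = (\<Sum>r\<in>cl (Rd l). qv v l s r * ((\<xi> b (l, s) r - ex v b l s) * (\<xi> c (l, s) r - ex v c l s)))"

lemma centered: "l < n \<Longrightarrow> s \<in> cl (S l) \<Longrightarrow> (\<Sum>r\<in>cl (Rd l). qv v l s r * (\<xi> b (l, s) r - ex v b l s)) = 0"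
  using cond_kernel_sum[OF cond_kernel_qv] by (simp add: right_diff_distrib sum_subtractf sum_distrib_right[symmetric] ex_def[symmetric])

text \<open>The scores of different cliques are martingale differences: given the history of the
  later clique, the earlier score is fixed and the later one is centred.\<close>

lemma cross_es:
  assumes ll: "l < l'" "l' < n"
  shows "(\<Sum>x\<in>cl V. kernel_product (qv v) x * (es v b l x * es v c l' x)) = 0"
proof -
  have sub: "S l \<subseteq> H l'" "Rd l \<subseteq> H l'" using SR(1)[of l] ll by blast+
  have rr: "(x |` H l') |` S l = x |` S l" "(x |` H l') |` Rd l = x |` Rd l" "(x |` H l') |` S l' = x |` S l'" for x :: "('v, 'a) cell"
    by (rule restrict_restrict_subset, rule sub SR(3))+
  define \<Phi> where "\<Phi> = (\<lambda>y r. es v b l y * (\<xi> c (l', y |` S l') r - ex v c l' (y |` S l')))"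
  have eq: "es v b l x * es v c l' x = \<Phi> (x |` H l') (x |` Rd l')" for x
    unfolding \<Phi>_def es_def rr ..
  have "(\<Sum>x\<in>cl V. kernel_product (qv v) x * (es v b l x * es v c l' x)) =
      (\<Sum>x\<in>cl V. kernel_product (qv v) x * (\<Sum>r\<in>cl (Rd l'). qv v l' (x |` S l') r * \<Phi> (x |` H l') r))"
    unfolding eq by (rule sum_kernel_product_conditional[OF cond_kernel_qv ll(2)])
  also have "\<dots> = 0"
  proof (rule sum.neutral, rule ballI)
    fix x assume x: "x \<in> cl V"
    have s: "x |` S l' \<in> cl (S l')" by (rule cells_restrict[OF x sub_V(1)[OF ll(2)]])
    have "(\<Sum>r\<in>cl (Rd l'). qv v l' (x |` S l') r * \<Phi> (x |` H l') r) =
        es v b l (x |` H l') * (\<Sum>r\<in>cl (Rd l'). qv v l' (x |` S l') r * (\<xi> c (l', x |` S l') r - ex v c l' (x |` S l')))"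
      unfolding \<Phi>_def rr sum_distrib_left by (simp only: mult_ac)
    also have "\<dots> = 0" unfolding centered[OF ll(2) s] by simp
    finally show "kernel_product (qv v) x * (\<Sum>r\<in>cl (Rd l'). qv v l' (x |` S l') r * \<Phi> (x |` H l') r) = 0" by simp
  qed
  finally show ?thesis .
qed

lemma square_es:
  assumes l: "l < n"
  shows "(\<Sum>x\<in>cl V. kernel_product (qv v) x * (es v b l x * es v c l x)) = (\<Sum>s\<in>cl (S l). w (qv v) l s * cov v b c l s)"
proof -
  have rr: "(x |` H l) |` S l = x |` S l" for x :: "('v, 'a) cell"
    by (rule restrict_restrict_subset[OF SR(3)])
  define \<Phi> where "\<Phi> = (\<lambda>y r. (\<xi> b (l, y |` S l) r - ex v b l (y |` S l)) * (\<xi> c (l, y |` S l) r - ex v c l (y |` S l)))"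
  have "(\<Sum>x\<in>cl V. kernel_product (qv v) x * (es v b l x * es v c l x)) =
      (\<Sum>x\<in>cl V. kernel_product (qv v) x * \<Phi> (x |` H l) (x |` Rd l))"
    unfolding \<Phi>_def es_def rr ..
  also have "\<dots> = (\<Sum>x\<in>cl V. kernel_product (qv v) x * (\<Sum>r\<in>cl (Rd l). qv v l (x |` S l) r * \<Phi> (x |` H l) r))"
    by (rule sum_kernel_product_conditional[OF cond_kernel_qv l])
  also have "\<dots> = (\<Sum>x\<in>cl V. \<Sum>s\<in>cl (S l). if x |` S l = s then kernel_product (qv v) x * cov v b c l s else 0)"
  proof (rule sum.cong[OF refl])
    fix x assume x: "x \<in> cl V"
    have s: "x |` S l \<in> cl (S l)" by (rule cells_restrict[OF x sub_V(1)[OF l]])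
    have fin: "finite (cl (S l))" by (rule finite_cells[OF sub_V(1)[OF l]])
    have "(\<Sum>s\<in>cl (S l). if x |` S l = s then kernel_product (qv v) x * cov v b c l s else 0) = kernel_product (qv v) x * cov v b c l (x |` S l)"
      using s fin by simp
    then show "kernel_product (qv v) x * (\<Sum>r\<in>cl (Rd l). qv v l (x |` S l) r * \<Phi> (x |` H l) r) =
        (\<Sum>s\<in>cl (S l). if x |` S l = s then kernel_product (qv v) x * cov v b c l s else 0)"
      by (simp only: \<Phi>_def rr cov_def)
  qed
  also have "\<dots> = (\<Sum>s\<in>cl (S l). \<Sum>x\<in>cl V. kernel_product (qv v) x * (if x |` S l = s then 1 else 0) * cov v b c l s)"
    by (subst sum.swap) (intro sum.cong refl, simp)
  also have "\<dots> = (\<Sum>s\<in>cl (S l). w (qv v) l s * cov v b c l s)"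
    unfolding sum_distrib_right[symmetric] w_eq[OF cond_kernel_qv l] ..
  finally show ?thesis .
qed

text \<open>The Fisher information in the coordinates \<open>v\<close>: feature covariances within
  each conditional table, weighted by the expected number of observations in its separator
  cell.\<close>

definition D :: "('k \<Rightarrow> real) \<Rightarrow> 'k \<Rightarrow> 'k \<Rightarrow> real" where
  "D v b c = real N * (\<Sum>k\<in>Keys. w (qv v) (fst k) (snd k) * cov v b c (fst k) (snd k))"

lemma D_eq: "real N * (\<Sum>x\<in>cl V. kernel_product (qv v) x * ((\<Sum>l<n. es v b l x) * (\<Sum>l<n. es v c l x))) = D v b c"
proof -
  have "(\<Sum>x\<in>cl V. kernel_product (qv v) x * ((\<Sum>l<n. es v b l x) * (\<Sum>l<n. es v c l x))) =
      (\<Sum>x\<in>cl V. \<Sum>l<n. \<Sum>l'<n. kernel_product (qv v) x * (es v b l x * es v c l' x))"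
    by (simp only: sum_product) (simp only: sum_distrib_left)
  also have "\<dots> = (\<Sum>l<n. \<Sum>l'<n. \<Sum>x\<in>cl V. kernel_product (qv v) x * (es v b l x * es v c l' x))"
    by (subst sum.swap) (intro sum.cong refl sum.swap)
  also have "\<dots> = (\<Sum>l<n. \<Sum>l'<n. if l' = l then (\<Sum>s\<in>cl (S l). w (qv v) l s * cov v b c l s) else 0)"
  proof (intro sum.cong refl)
    fix l l' assume l: "l \<in> {..<n}" "l' \<in> {..<n}"
    then consider "l = l'" | "l < l'" | "l' < l" by linarith
    then show "(\<Sum>x\<in>cl V. kernel_product (qv v) x * (es v b l x * es v c l' x)) =
        (if l' = l then (\<Sum>s\<in>cl (S l). w (qv v) l s * cov v b c l s) else 0)"
    proof cases
      case 1 then show ?thesis using square_es[of l v b c] l by simp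
    next
      case 2 then show ?thesis using cross_es[OF 2, of v b c] l by simp
    next
      case 3
      have "(\<Sum>x\<in>cl V. kernel_product (qv v) x * (es v b l x * es v c l' x)) = (\<Sum>x\<in>cl V. kernel_product (qv v) x * (es v c l' x * es v b l x))"
        by (simp only: mult_ac)
      then show ?thesis using cross_es[OF 3, of v c b] l 3 by simp
    qed
  qed
  also have "\<dots> = (\<Sum>l<n. \<Sum>s\<in>cl (S l). w (qv v) l s * cov v b c l s)"
    by (intro sum.cong refl) simp
  also have "\<dots> = (\<Sum>k\<in>Keys. w (qv v) (fst k) (snd k) * cov v b c (fst k) (snd k))"
    unfolding Keys_def by (subst sum.Sigma) (use finite_cells sub_V in \<open>auto simp: case_prod_beta\<close>)
  finally show ?thesis by (simp add: D_def)
qed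

section \<open>Block structure and determinant of the information matrix\<close>

lemma cov_zero:
  assumes "b \<notin> set (gs ! \<beta> (l, s)) \<or> c \<notin> set (gs ! \<beta> (l, s))"
  shows "cov v b c l s = 0"
proof -
  have "\<xi> b (l, s) r - ex v b l s = 0 \<or> \<xi> c (l, s) r - ex v c l s = 0" for r
    using assms \<xi>_zero[of b "(l, s)"] \<xi>_zero[of c "(l, s)"] by (auto simp: ex_def)
  then show ?thesis unfolding cov_def by (intro sum.neutral) auto
qed

lemma sum_group:
  assumes j: "j < length gs"
  shows "(\<Sum>a\<in>set (gs ! j). F (\<kappa> a)) = (\<Sum>k\<in>{k \<in> Keys. \<beta> k = j}. \<Sum>r\<in>cl (Rd (fst k)) - {b0 (fst k)}. F (k, r) :: real)"
proof -
  have "(\<Sum>a\<in>set (gs ! j). F (\<kappa> a)) = sum F (Sigma {k \<in> Keys. \<beta> k = j} (\<lambda>k. cl (Rd (fst k)) - {b0 (fst k)}))"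
    by (rule sum.reindex_bij_betw[OF \<kappa>_bij[OF j]])
  also have "\<dots> = (\<Sum>k\<in>{k \<in> Keys. \<beta> k = j}. \<Sum>r\<in>cl (Rd (fst k)) - {b0 (fst k)}. F (k, r))"
    by (subst sum.Sigma) (use finite_Keys KeysD finite_cells sub_V in auto)
  finally show ?thesis .
qed

lemma prod_group:
  assumes j: "j < length gs"
  shows "(\<Prod>a\<in>set (gs ! j). F (\<kappa> a)) = (\<Prod>k\<in>{k \<in> Keys. \<beta> k = j}. \<Prod>r\<in>cl (Rd (fst k)) - {b0 (fst k)}. F (k, r) :: real)"
proof -
  have "(\<Prod>a\<in>set (gs ! j). F (\<kappa> a)) = prod F (Sigma {k \<in> Keys. \<beta> k = j} (\<lambda>k. cl (Rd (fst k)) - {b0 (fst k)}))"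
    by (rule prod.reindex_bij_betw[OF \<kappa>_bij[OF j]])
  also have "\<dots> = (\<Prod>k\<in>{k \<in> Keys. \<beta> k = j}. \<Prod>r\<in>cl (Rd (fst k)) - {b0 (fst k)}. F (k, r))"
    by (subst prod.Sigma) (use finite_Keys KeysD finite_cells sub_V in auto)
  finally show ?thesis .
qed

text \<open>The information about the logits of the non-base cells: one weighted multinomial
  covariance block diag q - q q^T per conditional table.\<close>

definition W :: "('k \<Rightarrow> real) \<Rightarrow> 'k \<Rightarrow> 'k \<Rightarrow> real" where
  "W v a b = (if fst (\<kappa> a) = fst (\<kappa> b)
     then (real N * w (qv v) (fst (fst (\<kappa> a))) (snd (fst (\<kappa> a)))) *
       ((if a = b then qv v (fst (fst (\<kappa> a))) (snd (fst (\<kappa> a))) (snd (\<kappa> a)) else 0) -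
        qv v (fst (fst (\<kappa> a))) (snd (fst (\<kappa> a))) (snd (\<kappa> a)) * qv v (fst (fst (\<kappa> b))) (snd (fst (\<kappa> b))) (snd (\<kappa> b)))
     else 0)"

lemma cov_expand:
  assumes k: "k \<in> Keys" and b: "b \<in> set (gs ! \<beta> k)" and c: "c \<in> set (gs ! \<beta> k)"
  defines "Rs \<equiv> cl (Rd (fst k)) - {b0 (fst k)}"
  shows "cov v b c (fst k) (snd k) = (\<Sum>r\<in>Rs. qv v (fst k) (snd k) r * (\<xi> b k r * \<xi> c k r)) -
    (\<Sum>r\<in>Rs. \<Sum>r'\<in>Rs. qv v (fst k) (snd k) r * \<xi> b k r * (qv v (fst k) (snd k) r' * \<xi> c k r'))"
proof -
  let ?R = "cl (Rd (fst k))" and ?q = "qv v (fst k) (snd k)"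
  have l: "fst k < n" "snd k \<in> cl (S (fst k))" using KeysD[OF k] by blast+
  have fin: "finite ?R" by (rule finite_cells[OF sub_V(2)[OF l(1)]])
  have b0: "\<xi> b k (b0 (fst k)) = 0" "\<xi> c k (b0 (fst k)) = 0"
    using \<xi>_base[OF k b] \<xi>_base[OF k c] by (simp_all add: \<xi>_def)
  have drop: "sum F ?R = sum F Rs" if "F (b0 (fst k)) = 0" for F :: "('v, 'a) cell \<Rightarrow> real"
    unfolding Rs_def by (rule sum.mono_neutral_right[OF fin]) (use that in auto)
  have "cov v b c (fst k) (snd k) = (\<Sum>r\<in>?R. ?q r * (\<xi> b k r * \<xi> c k r)) - ex v c (fst k) (snd k) * (\<Sum>r\<in>?R. ?q r * \<xi> b k r)
      - ex v b (fst k) (snd k) * (\<Sum>r\<in>?R. ?q r * \<xi> c k r) + ex v b (fst k) (snd k) * ex v c (fst k) (snd k) * (\<Sum>r\<in>?R. ?q r)"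
    unfolding cov_def
    by (simp add: algebra_simps sum.distrib sum_subtractf sum_distrib_left) (rule sum_distrib_right[symmetric])
  also have "\<dots> = (\<Sum>r\<in>?R. ?q r * (\<xi> b k r * \<xi> c k r)) - (\<Sum>r\<in>?R. ?q r * \<xi> b k r) * (\<Sum>r\<in>?R. ?q r * \<xi> c k r)"
    using cond_kernel_sum[OF cond_kernel_qv l] by (simp add: ex_def)
  also have "(\<Sum>r\<in>?R. ?q r * (\<xi> b k r * \<xi> c k r)) = (\<Sum>r\<in>Rs. ?q r * (\<xi> b k r * \<xi> c k r))"
    by (rule drop) (simp add: b0)
  also have "(\<Sum>r\<in>?R. ?q r * \<xi> b k r) = (\<Sum>r\<in>Rs. ?q r * \<xi> b k r)"
    by (rule drop) (simp add: b0)
  also have "(\<Sum>r\<in>?R. ?q r * \<xi> c k r) = (\<Sum>r\<in>Rs. ?q r * \<xi> c k r)"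
    by (rule drop) (simp add: b0)
  finally show ?thesis by (simp only: sum_product)
qed

text \<open>The chain rule T^T W T for the linear map from coordinates to logits. Features vanish at
  the base cell, so covariances over all cells of a table reduce to sums over its non-base
  cells.\<close>

lemma D_group:
  assumes j: "j < length gs" and b: "b \<in> set (gs ! j)" and c: "c \<in> set (gs ! j)"
  shows "D v b c = (\<Sum>a\<in>set (gs ! j). \<Sum>a'\<in>set (gs ! j). T a b * W v a a' * T a' c)"
proof -
  let ?K = "{k \<in> Keys. \<beta> k = j}"
  define q where "q = (\<lambda>k. qv v (fst k) (snd k))"
  define ww where "ww = (\<lambda>k. real N * w (qv v) (fst k) (snd k))"
  define Rs where "Rs = (\<lambda>k :: nat \<times> ('v, 'a) cell. cl (Rd (fst k)) - {b0 (fst k)})"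
  have finK: "finite ?K" using finite_Keys by simp
  have finR: "finite (Rs k)" if "k \<in> ?K" for k
    unfolding Rs_def using that KeysD finite_cells sub_V(2) by auto
  define F where "F = (\<lambda>p p'. \<xi> b (fst p) (snd p) *
     (if fst p = fst p' then ww (fst p) * ((if p = p' then q (fst p) (snd p) else 0) - q (fst p) (snd p) * q (fst p') (snd p')) else 0) *
     \<xi> c (fst p') (snd p'))"
  have "(\<Sum>a\<in>set (gs ! j). \<Sum>a'\<in>set (gs ! j). T a b * W v a a' * T a' c) =
      (\<Sum>a\<in>set (gs ! j). \<Sum>a'\<in>set (gs ! j). F (\<kappa> a) (\<kappa> a'))"
  proof (intro sum.cong refl)
    fix a a' assume a: "a \<in> set (gs ! j)" "a' \<in> set (gs ! j)"
    have "\<kappa> a = \<kappa> a' \<longleftrightarrow> a = a'"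
      using bij_betw_imp_inj_on[OF \<kappa>_bij[OF j]] a by (auto dest: inj_onD)
    then show "T a b * W v a a' * T a' c = F (\<kappa> a) (\<kappa> a')"
      by (simp add: F_def T_def W_def q_def ww_def)
  qed
  also have "\<dots> = (\<Sum>a\<in>set (gs ! j). \<Sum>k'\<in>?K. \<Sum>r'\<in>Rs k'. F (\<kappa> a) (k', r'))"
    unfolding Rs_def by (intro sum.cong refl sum_group[OF j])
  also have "\<dots> = (\<Sum>k\<in>?K. \<Sum>r\<in>Rs k. \<Sum>k'\<in>?K. \<Sum>r'\<in>Rs k'. F (k, r) (k', r'))"
    unfolding Rs_def by (rule sum_group[OF j])
  also have "\<dots> = (\<Sum>k\<in>?K. ww k * cov v b c (fst k) (snd k))"
  proof (rule sum.cong[OF refl])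
    fix k assume k: "k \<in> ?K"
    have kk: "k \<in> Keys" "b \<in> set (gs ! \<beta> k)" "c \<in> set (gs ! \<beta> k)" using k b c by auto
    have "(\<Sum>r\<in>Rs k. \<Sum>k'\<in>?K. \<Sum>r'\<in>Rs k'. F (k, r) (k', r')) = (\<Sum>r\<in>Rs k. \<Sum>r'\<in>Rs k. F (k, r) (k, r'))"
    proof (rule sum.cong[OF refl])
      fix r
      have "(\<Sum>k'\<in>?K. \<Sum>r'\<in>Rs k'. F (k, r) (k', r')) = (\<Sum>k'\<in>?K. if k' = k then (\<Sum>r'\<in>Rs k. F (k, r) (k, r')) else 0)"
        by (intro sum.cong refl) (auto simp: F_def intro: sum.neutral)
      also have "\<dots> = (\<Sum>r'\<in>Rs k. F (k, r) (k, r'))" using k finK by simp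
      finally show "(\<Sum>k'\<in>?K. \<Sum>r'\<in>Rs k'. F (k, r) (k', r')) = (\<Sum>r'\<in>Rs k. F (k, r) (k, r'))" .
    qed
    also have "\<dots> = (\<Sum>r\<in>Rs k. \<Sum>r'\<in>Rs k. (if r' = r then ww k * (q k r * (\<xi> b k r * \<xi> c k r)) else 0) -
        ww k * (q k r * \<xi> b k r * (q k r' * \<xi> c k r')))"
      by (intro sum.cong refl) (auto simp: F_def algebra_simps)
    also have "\<dots> = (\<Sum>r\<in>Rs k. ww k * (q k r * (\<xi> b k r * \<xi> c k r))) -
        (\<Sum>r\<in>Rs k. \<Sum>r'\<in>Rs k. ww k * (q k r * \<xi> b k r * (q k r' * \<xi> c k r')))"
      using finR[OF k] by (simp add: sum_subtractf)
    also have "\<dots> = ww k * cov v b c (fst k) (snd k)"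
      unfolding cov_expand[OF kk] Rs_def q_def by (simp only: right_diff_distrib sum_distrib_left)
    finally show "(\<Sum>r\<in>Rs k. \<Sum>k'\<in>?K. \<Sum>r'\<in>Rs k'. F (k, r) (k', r')) = ww k * cov v b c (fst k) (snd k)" .
  qed
  also have "\<dots> = (\<Sum>k\<in>Keys. ww k * cov v b c (fst k) (snd k))"
  proof (rule sum.mono_neutral_left[OF finite_Keys])
    show "\<forall>k\<in>Keys - ?K. ww k * cov v b c (fst k) (snd k) = 0"
    proof
      fix k assume k: "k \<in> Keys - ?K"
      then have "b \<notin> set (gs ! \<beta> k)" using in_group_iff[OF j \<beta>_range b] by auto
      then have "cov v b c (fst k) (snd k) = 0" by (intro cov_zero) simp
      then show "ww k * cov v b c (fst k) (snd k) = 0" by simp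
    qed
  qed auto
  also have "\<dots> = D v b c" by (simp add: D_def ww_def sum_distrib_left mult.assoc)
  finally show ?thesis by simp
qed

lemma D_off_diagonal:
  assumes "i < length gs" "j < length gs" "i \<noteq> j" "b \<in> set (gs ! i)" "c \<in> set (gs ! j)"
  shows "D v b c = 0"
proof -
  have "cov v b c (fst k) (snd k) = 0" if k: "k \<in> Keys" for k
  proof (rule cov_zero)
    show "b \<notin> set (gs ! \<beta> (fst k, snd k)) \<or> c \<notin> set (gs ! \<beta> (fst k, snd k))"
      using in_group_iff[OF assms(1) \<beta>_range[OF k] assms(4)] in_group_iff[OF assms(2) \<beta>_range[OF k] assms(5)] assms(3)
      by auto
  qed
  then show ?thesis by (simp add: D_def)
qed

text \<open>\<open>det_multinomial_blocks\<close> gives the product over the non-base cells and, for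
  each table, the factor 1 minus their sum. That factor is the probability of the base cell, which
  completes the product over all cells.\<close>

lemma det_D:
  assumes j: "j < length gs"
  shows "Determinant.det (mat_of (gs ! j) (D v)) = G j v * g j v"
proof -
  let ?K = "{k \<in> Keys. \<beta> k = j}"
  have dj: "distinct (gs ! j)" using dist j by (auto simp: distinct_concat_iff)
  obtain bs where bs: "set bs = ?K" "distinct bs"
    using finite_distinct_list[of ?K] finite_Keys by auto
  define q where "q = (\<lambda>a. qv v (fst (fst (\<kappa> a))) (snd (fst (\<kappa> a))) (snd (\<kappa> a)))"
  define ww where "ww = (\<lambda>k. real N * w (qv v) (fst k) (snd k))"
  have "mat_of (gs ! j) (D v) = mat_of (gs ! j) (\<lambda>b c. \<Sum>a\<in>set (gs ! j). \<Sum>a'\<in>set (gs ! j). T a b * W v a a' * T a' c)"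
    by (rule mat_of_cong) (rule D_group[OF j])
  then have "Determinant.det (mat_of (gs ! j) (D v)) = (Determinant.det (mat_of (gs ! j) T))\<^sup>2 * Determinant.det (mat_of (gs ! j) (W v))"
    by (simp only: det_mat_of_congruence[OF dj])
  also have "mat_of (gs ! j) (W v) = mat_of (gs ! j) (\<lambda>a b. if fst (\<kappa> a) = fst (\<kappa> b)
      then ww (fst (\<kappa> a)) * ((if a = b then q a else 0) - q a * q b) else 0)"
    by (rule mat_of_cong) (simp only: W_def ww_def q_def)
  also have "Determinant.det \<dots> = (\<Prod>s\<in>set bs. 1 - (\<Sum>a | a \<in> set (gs ! j) \<and> fst (\<kappa> a) = s. q a)) *
      (\<Prod>a\<in>set (gs ! j). ww (fst (\<kappa> a)) * q a)"
    by (rule det_multinomial_blocks[OF dj bs(2)]) (use bs(1) \<kappa>_mem(1,2)[OF j] in auto)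
  also have "(\<Prod>s\<in>set bs. 1 - (\<Sum>a | a \<in> set (gs ! j) \<and> fst (\<kappa> a) = s. q a)) = (\<Prod>k\<in>?K. qv v (fst k) (snd k) (b0 (fst k)))"
    unfolding bs(1)
  proof (rule prod.cong[OF refl])
    fix k assume k: "k \<in> ?K"
    have l: "fst k < n" "snd k \<in> cl (S (fst k))" using KeysD k by blast+
    have finR: "finite (cl (Rd (fst k)))" by (rule finite_cells[OF sub_V(2)[OF l(1)]])
    have finK: "finite ?K" using finite_Keys by simp
    have "(\<Sum>a | a \<in> set (gs ! j) \<and> fst (\<kappa> a) = k. q a) =
        (\<Sum>a\<in>set (gs ! j). if fst (\<kappa> a) = k then qv v (fst (fst (\<kappa> a))) (snd (fst (\<kappa> a))) (snd (\<kappa> a)) else 0)"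
      unfolding q_def by (rule sum.inter_filter) simp
    also have "\<dots> = (\<Sum>k'\<in>?K. \<Sum>r\<in>cl (Rd (fst k')) - {b0 (fst k')}. if k' = k then qv v (fst k') (snd k') r else 0)"
      by (rule trans[OF sum_group[OF j, of "\<lambda>p. if fst p = k then qv v (fst (fst p)) (snd (fst p)) (snd p) else 0"]])
         (simp only: fst_conv snd_conv)
    also have "\<dots> = (\<Sum>k'\<in>?K. if k' = k then (\<Sum>r\<in>cl (Rd (fst k)) - {b0 (fst k)}. qv v (fst k) (snd k) r) else 0)"
      by (intro sum.cong refl) auto
    also have "\<dots> = (\<Sum>r\<in>cl (Rd (fst k)) - {b0 (fst k)}. qv v (fst k) (snd k) r)"
      using k finK by simp
    also have "\<dots> = 1 - qv v (fst k) (snd k) (b0 (fst k))"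
      using cond_kernel_sum[OF cond_kernel_qv l, of v] sum_diff1[OF finR, of "qv v (fst k) (snd k)" "b0 (fst k)"] base_cells[OF sub_V(2)[OF l(1)]] by simp
    finally show "1 - (\<Sum>a | a \<in> set (gs ! j) \<and> fst (\<kappa> a) = k. q a) = qv v (fst k) (snd k) (b0 (fst k))" by simp
  qed
  also have "(\<Prod>a\<in>set (gs ! j). ww (fst (\<kappa> a)) * q a) = (\<Prod>a\<in>set (gs ! j). ww (fst (\<kappa> a))) *
      (\<Prod>k\<in>?K. \<Prod>r\<in>cl (Rd (fst k)) - {b0 (fst k)}. qv v (fst k) (snd k) r)"
    unfolding prod.distrib q_def
    using prod_group[OF j, of "\<lambda>p. qv v (fst (fst p)) (snd (fst p)) (snd p)"] by simp
  finally have det: "Determinant.det (mat_of (gs ! j) (D v)) = (Determinant.det (mat_of (gs ! j) T))\<^sup>2 *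
     ((\<Prod>k\<in>?K. qv v (fst k) (snd k) (b0 (fst k))) * ((\<Prod>a\<in>set (gs ! j). ww (fst (\<kappa> a))) *
      (\<Prod>k\<in>?K. \<Prod>r\<in>cl (Rd (fst k)) - {b0 (fst k)}. qv v (fst k) (snd k) r)))" .
  have "g j v = (\<Prod>k\<in>?K. qv v (fst k) (snd k) (b0 (fst k)) * (\<Prod>r\<in>cl (Rd (fst k)) - {b0 (fst k)}. qv v (fst k) (snd k) r))"
    unfolding g_def
  proof (rule prod.cong[OF refl])
    fix k assume "k \<in> ?K"
    then have l: "fst k < n" using KeysD by blast
    show "(\<Prod>r\<in>cl (Rd (fst k)). qv v (fst k) (snd k) r) =
        qv v (fst k) (snd k) (b0 (fst k)) * (\<Prod>r\<in>cl (Rd (fst k)) - {b0 (fst k)}. qv v (fst k) (snd k) r)"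
      by (rule prod.remove[OF finite_cells[OF sub_V(2)[OF l]] base_cells[OF sub_V(2)[OF l]]])
  qed
  then have g_eq: "g j v = (\<Prod>k\<in>?K. qv v (fst k) (snd k) (b0 (fst k))) *
      (\<Prod>k\<in>?K. \<Prod>r\<in>cl (Rd (fst k)) - {b0 (fst k)}. qv v (fst k) (snd k) r)"
    by (simp only: prod.distrib)
  show ?thesis
    unfolding det g_eq G_def if_P[OF j] ww_def by (simp only: mult_ac)
qed


section \<open>The Jacobian of the coordinates and the resulting reference prior\<close>

sublocale sh: triangular_shift gs \<phi> t
proof
  show "t a v = t a w" if "j < length gs" "a \<in> set (gs ! j)" "\<And>b. b \<in> set (concat (take j gs)) \<Longrightarrow> v b = w b" for j a v w
    by (rule t_dep[OF that])
qed (rule dist cont_\<phi> cont_t \<phi>_in \<phi>_out, assumption?)+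

text \<open>The Jacobian of \<phi>, chosen from the existence of partial derivatives. Its values are
  computed on and above the diagonal blocks; below them they remain unspecified.\<close>

definition dphi :: "('k \<Rightarrow> real) \<Rightarrow> 'k \<Rightarrow> 'k \<Rightarrow> real" where
  "dphi u c a = (SOME d. ((\<lambda>\<tau>. \<phi> (u(a := \<tau>)) c) has_real_derivative d) (at (u a)))"

lemma dphi: "((\<lambda>\<tau>. \<phi> (u(a := \<tau>)) c) has_real_derivative dphi u c a) (at (u a))"
  unfolding dphi_def by (rule someI_ex[OF diff_\<phi>])

lemma dphi_triangular:
  assumes ij: "i \<le> j" "j < length gs" and c: "c \<in> set (gs ! i)" and a: "a \<in> set (gs ! j)"
  shows "dphi u c a = (if c = a then 1 else 0)"
proof -
  have i: "i < length gs" using ij by simp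
  have cL: "c \<in> L" using c i unfolding in_set_concat_nth by blast
  have eq: "\<phi> (u(a := \<tau>)) c = (if c = a then \<tau> else u c) + t c (\<phi> u)" for \<tau>
  proof -
    have "t c (\<phi> (u(a := \<tau>))) = t c (\<phi> u)"
    proof (rule t_dep[OF i c], rule sh.\<phi>_agree)
      show "i \<le> length gs" using i by simp
      fix b assume "b \<in> set (concat (take i gs))"
      then obtain k where "k < i" "k < length gs" "b \<in> set (gs ! k)" unfolding in_set_concat_take by auto
      then have "b \<noteq> a" using in_group_iff[of k j b] ij a by auto
      then show "(u(a := \<tau>)) b = u b" by simp
    qed
    then show ?thesis using \<phi>_in[OF cL, of "u(a := \<tau>)"] by simp
  qed
  have "((\<lambda>\<tau>. (if c = a then \<tau> else u c) + t c (\<phi> u)) has_real_derivative (if c = a then 1 else 0)) (at (u a))"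
    by (cases "c = a") (auto intro!: derivative_eq_intros)
  then show ?thesis using dphi[of u a c] unfolding eq by (rule DERIV_unique[rotated])
qed

text \<open>The derivative of a log normalizer is the expected feature, so the chain rule yields
  centred features summed over the cliques.\<close>

lemma ln_kernel_product_derivative:
  assumes x: "x \<in> cl V"
  shows "((\<lambda>\<tau>. ln (kernel_product (qv (\<phi> (u(a := \<tau>)))) x)) has_real_derivative
    (\<Sum>c\<in>L. dphi u c a * (\<Sum>l<n. es (\<phi> u) c l x))) (at (u a))"
proof -
  let ?v = "\<phi> u"
  let ?V = "\<lambda>\<tau>. \<phi> (u(a := \<tau>))"
  have v0: "?V (u a) = ?v" by simp
  have ln_eq: "ln (kernel_product (qv v) x) = (\<Sum>l<n. cv v (l, x |` S l) (x |` Rd l) - ln (Zv v (l, x |` S l)))" for v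
  proof -
    have "ln (kernel_product (qv v) x) = (\<Sum>l<n. ln (qv v l (x |` S l) (x |` Rd l)))"
      unfolding partial_product_def
    proof (rule ln_prod)
      fix l assume "l \<in> {..<n}"
      then have "0 < qv v l (x |` S l) (x |` Rd l)"
        using cond_kernel_pos[OF cond_kernel_qv] cells_restrict[OF x] sub_V by simp
      then show "qv v l (x |` S l) (x |` Rd l) \<noteq> 0" by simp
    qed simp
    then show ?thesis by (simp add: ln_qv)
  qed
  have d_cv: "((\<lambda>\<tau>. cv (?V \<tau>) k r) has_real_derivative (\<Sum>c\<in>L. dphi u c a * \<xi> c k r)) (at (u a))" for k r
    unfolding cv_def by (intro DERIV_sum DERIV_cmult_right dphi)
  have d_l: "((\<lambda>\<tau>. cv (?V \<tau>) (l, s) r - ln (Zv (?V \<tau>) (l, s))) has_real_derivative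
      (\<Sum>c\<in>L. dphi u c a * (\<xi> c (l, s) r - ex ?v c l s))) (at (u a))" if l: "l < n" for l s r
  proof -
    have Zp: "0 < Zv (?V (u a)) (l, s)" using Zv_pos[of "(l, s)"] l by simp
    have "((\<lambda>\<tau>. Zv (?V \<tau>) (l, s)) has_real_derivative
        (\<Sum>r'\<in>cl (Rd l). exp (cv (?V (u a)) (l, s) r') * (\<Sum>c\<in>L. dphi u c a * \<xi> c (l, s) r'))) (at (u a))"
      unfolding Zv_def fst_conv by (intro DERIV_sum DERIV_chain'[OF d_cv DERIV_exp])
    from DERIV_chain'[OF this DERIV_ln_divide[OF Zp]]
    have "((\<lambda>\<tau>. ln (Zv (?V \<tau>) (l, s))) has_real_derivative
        1 / Zv ?v (l, s) * (\<Sum>r'\<in>cl (Rd l). exp (cv ?v (l, s) r') * (\<Sum>c\<in>L. dphi u c a * \<xi> c (l, s) r'))) (at (u a))"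
      unfolding v0 .
    moreover have "1 / Zv ?v (l, s) * (\<Sum>r'\<in>cl (Rd l). exp (cv ?v (l, s) r') * (\<Sum>c\<in>L. dphi u c a * \<xi> c (l, s) r')) =
        (\<Sum>c\<in>L. dphi u c a * ex ?v c l s)"
    proof -
      have "1 / Zv ?v (l, s) * (\<Sum>r'\<in>cl (Rd l). exp (cv ?v (l, s) r') * (\<Sum>c\<in>L. dphi u c a * \<xi> c (l, s) r')) =
          (\<Sum>r'\<in>cl (Rd l). \<Sum>c\<in>L. dphi u c a * (qv ?v l s r' * \<xi> c (l, s) r'))"
        unfolding sum_distrib_left qv_eq by (intro sum.cong refl) simp
      also have "\<dots> = (\<Sum>c\<in>L. dphi u c a * ex ?v c l s)"
        unfolding ex_def sum_distrib_left by (rule sum.swap)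
      finally show ?thesis .
    qed
    ultimately have "((\<lambda>\<tau>. ln (Zv (?V \<tau>) (l, s))) has_real_derivative (\<Sum>c\<in>L. dphi u c a * ex ?v c l s)) (at (u a))"
      by (simp only:)
    from DERIV_diff[OF d_cv[of "(l, s)" r] this]
    show ?thesis by (simp only: right_diff_distrib sum_subtractf)
  qed
  have "((\<lambda>\<tau>. \<Sum>l<n. cv (?V \<tau>) (l, x |` S l) (x |` Rd l) - ln (Zv (?V \<tau>) (l, x |` S l))) has_real_derivative
      (\<Sum>l<n. \<Sum>c\<in>L. dphi u c a * (\<xi> c (l, x |` S l) (x |` Rd l) - ex ?v c l (x |` S l)))) (at (u a))"
    by (rule DERIV_sum) (rule d_l, simp)
  moreover have "(\<Sum>l<n. \<Sum>c\<in>L. dphi u c a * (\<xi> c (l, x |` S l) (x |` Rd l) - ex ?v c l (x |` S l))) =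
      (\<Sum>c\<in>L. dphi u c a * (\<Sum>l<n. es ?v c l x))"
    unfolding es_def sum_distrib_left by (rule sum.swap)
  ultimately show ?thesis unfolding ln_eq by (simp only:)
qed

lemma update_PS: "u \<in> parameter_space gs \<Longrightarrow> a \<in> L \<Longrightarrow> u(a := \<tau>) \<in> parameter_space gs"
  unfolding sh.PS_iff by auto

lemma fisher_factorization:
  assumes u: "u \<in> parameter_space gs"
  shows "fisher_mat (counts (cl V) N) (multinomial_model V E I N \<Theta>) (concat gs) u =
    mat_of (concat gs) (\<lambda>a b. \<Sum>c\<in>L. \<Sum>d\<in>L. dphi u c a * D (\<phi> u) c d * dphi u d b)"
proof -
  let ?v = "\<phi> u"
  let ?p = "prob_of V E I \<Theta>"
  have p: "?p (u(a := \<tau>)) x = kernel_product (qv (\<phi> (u(a := \<tau>)))) x" if "a \<in> L" "x \<in> cl V" for a \<tau> x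
    using prob[OF update_PS[OF u that(1)]] that(2) by simp
  have pu: "?p u x = kernel_product (qv ?v) x" if "x \<in> cl V" for x using prob[OF u] that by simp
  define sc where "sc = (\<lambda>a x. \<Sum>c\<in>L. dphi u c a * (\<Sum>l<n. es ?v c l x))"
  have "fisher_mat (counts (cl V) N) (multinomial_model V E I N \<Theta>) (concat gs) u =
      mat_of (concat gs) (\<lambda>a b. real N * (\<Sum>x\<in>cl V. ?p u x * (sc a x * sc b x)))"
    unfolding multinomial_model_def[abs_def]
  proof (rule fisher_mat_multinomial)
    show "finite (cl V)" by (rule finite_cells[OF order_refl])
    fix a assume a: "a \<in> set (concat gs)"
    show "0 < ?p (u(a := \<tau>)) x" if "x \<in> cl V" for \<tau> x
      unfolding p[OF a that] by (rule partial_product_pos[OF cond_kernel_qv order_refl that]) (simp only: H_n order_refl)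
    show "(\<Sum>x\<in>cl V. ?p (u(a := \<tau>)) x) = 1" for \<tau>
      using sum_kernel_product[OF cond_kernel_qv] p[OF a] by (simp cong: sum.cong)
    show "((\<lambda>\<tau>. ln (?p (u(a := \<tau>)) x)) has_real_derivative sc a x) (at (u a))" if x: "x \<in> cl V" for x
      unfolding p[OF a x] sc_def by (rule ln_kernel_product_derivative[OF x])
  qed
  also have "\<dots> = mat_of (concat gs) (\<lambda>a b. \<Sum>c\<in>L. \<Sum>d\<in>L. dphi u c a * D ?v c d * dphi u d b)"
  proof (rule mat_of_cong)
    fix a b
    define e where "e = (\<lambda>c x. \<Sum>l<n. es ?v c l x)"
    have D_e: "D ?v c d = real N * (\<Sum>x\<in>cl V. kernel_product (qv ?v) x * (e c x * e d x))" for c d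
      unfolding e_def by (rule D_eq[symmetric])
    have "(\<Sum>x\<in>cl V. ?p u x * (sc a x * sc b x)) =
        (\<Sum>x\<in>cl V. \<Sum>c\<in>L. \<Sum>d\<in>L. dphi u c a * (kernel_product (qv ?v) x * (e c x * e d x)) * dphi u d b)"
    proof (rule sum.cong[OF refl])
      fix x assume x: "x \<in> cl V"
      have "sc a x * sc b x = (\<Sum>c\<in>L. \<Sum>d\<in>L. dphi u c a * e c x * (dphi u d b * e d x))"
        unfolding sc_def e_def by (rule sum_product)
      then have "?p u x * (sc a x * sc b x) = (\<Sum>c\<in>L. \<Sum>d\<in>L. kernel_product (qv ?v) x * (dphi u c a * e c x * (dphi u d b * e d x)))"
        unfolding pu[OF x] by (simp only: sum_distrib_left)
      then show "?p u x * (sc a x * sc b x) = (\<Sum>c\<in>L. \<Sum>d\<in>L. dphi u c a * (kernel_product (qv ?v) x * (e c x * e d x)) * dphi u d b)"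
        by (simp only: mult_ac)
    qed
    also have "\<dots> = (\<Sum>c\<in>L. \<Sum>d\<in>L. \<Sum>x\<in>cl V. dphi u c a * (kernel_product (qv ?v) x * (e c x * e d x)) * dphi u d b)"
      by (subst sum.swap) (intro sum.cong refl sum.swap)
    finally show "real N * (\<Sum>x\<in>cl V. ?p u x * (sc a x * sc b x)) =
        (\<Sum>c\<in>L. \<Sum>d\<in>L. dphi u c a * D ?v c d * dphi u d b)"
      unfolding D_e by (simp only: sum_distrib_left sum_distrib_right mult_ac)
  qed
  finally show ?thesis .
qed

lemma det_h_block:
  assumes u: "u \<in> parameter_space gs" and j: "j < length gs"
  shows "Determinant.det (h_block (counts (cl V) N) (multinomial_model V E I N \<Theta>) gs j u) = G j (\<phi> u) * g j (\<phi> u)"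
proof -
  have "h_block (counts (cl V) N) (multinomial_model V E I N \<Theta>) gs j u = mat_of (gs ! j) (D (\<phi> u))"
  proof (rule h_block_triangular[OF dist fisher_factorization[OF u]])
    show "dphi u c a = (if c = a then 1 else 0)"
      if "i \<le> j" "j < length gs" "c \<in> set (gs ! i)" "a \<in> set (gs ! j)" for i j a c
      by (rule dphi_triangular[OF that])
    show "D (\<phi> u) a b = 0" if "i < length gs" "j < length gs" "i \<noteq> j" "a \<in> set (gs ! i)" "b \<in> set (gs ! j)" for i j a b
      by (rule D_off_diagonal[OF that])
    show "Determinant.det (mat_of (gs ! j) (D (\<phi> u))) \<noteq> 0" if "j < length gs" for j
      unfolding det_D[OF that] using G_pos[of j "\<phi> u"] g_pos[of j "\<phi> u"] by simp
  qed (rule j)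
  then show ?thesis using det_D[OF j] by simp
qed

theorem reference_prior_prior_prob:
  "reference_prior_proportional_to (counts (cl V) N) (multinomial_model V E I N \<Theta>) gs
     (\<lambda>u. prior_prob V I Cs (prob_of V E I \<Theta> u))"
proof -
  have "triangular_model gs \<phi> t (counts (cl V) N) (multinomial_model V E I N \<Theta>) G g"
  proof (unfold_locales)
    show "G j v = G j w" if "j < length gs" "\<And>b. b \<notin> set (gs ! j) \<Longrightarrow> v b = w b" for j v w
      by (rule G_dep[OF that])
    show "g j v = g j w" if "j < length gs" "\<And>b. b \<in> set (gs ! j) \<Longrightarrow> v b = w b" for j v w
      by (rule g_dep[OF that(2)])
  qed (rule det_h_block G_pos g_pos cont_G cont_g, assumption?, assumption?)+
  from triangular_model.reference_prior[OF this]
  show ?thesis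
  proof (rule reference_prior_proportional_to_cong[where c = 1])
    fix u assume u: "u \<in> parameter_space gs"
    have sqrt_prod: "sqrt (prod f A) = (\<Prod>x\<in>A. sqrt (f x))" for f :: "'b \<Rightarrow> real" and A
      by (induction A rule: infinite_finite_induct) (simp_all add: real_sqrt_mult)
    let ?F = "\<lambda>k. sqrt (\<Prod>r\<in>cl (Rd (fst k)). qv (\<phi> u) (fst k) (snd k) r)"
    have "(\<Prod>j<length gs. sqrt (g j (\<phi> u))) = (\<Prod>j\<in>{..<length gs}. \<Prod>k\<in>{k \<in> Keys. \<beta> k = j}. ?F k)"
      unfolding g_def sqrt_prod ..
    \<comment> \<open>Each conditional table lies in exactly one group, so the product over groups
      does not depend on how the tables are distributed.\<close>
    also have "\<dots> = (\<Prod>k\<in>Keys. ?F k)"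
      by (rule prod.group[OF finite_Keys]) (use \<beta>_range in auto)
    also have "\<dots> = prior_prob V I Cs (prob_of V E I \<Theta> u)"
      unfolding prob[OF u] by (rule prior_prob_kernel_product[OF cond_kernel_qv, symmetric])
    finally show "(\<Prod>j<length gs. sqrt (g j (\<phi> u))) = 1 * prior_prob V I Cs (prob_of V E I \<Theta> u)" by simp
  qed simp
qed

end

section \<open>Labels, cells and log-linear expansions\<close>

text \<open>Cuts \<open>i\<close> down to \<open>A\<close> and completes it by base levels. For
  labels inside \<open>A\<close> it inverts restriction to the support; used on separator and
  residual it splits a clique label into a table and a cell of it.\<close>

definition fill :: "('v \<Rightarrow> 'a) \<Rightarrow> 'v set \<Rightarrow> ('v, 'a) cell \<Rightarrow> ('v, 'a) cell" where
  "fill z A i = (i |` A) ++ base_cell z (A - dom i)"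

lemma fill_apply: "fill z A i \<gamma> = (if \<gamma> \<in> A then (if \<gamma> \<in> dom i then i \<gamma> else Some (z \<gamma>)) else None)"
  by (auto simp: fill_def restrict_map_def base_cell_def map_add_def split: option.splits)

lemma fill_restrict: "B \<subseteq> A \<Longrightarrow> fill z A i |` B = fill z B i"
  by (rule ext) (auto simp: fill_apply restrict_map_def)

lemma star_value: "i \<in> cells_star I z D \<Longrightarrow> \<gamma> \<in> D \<Longrightarrow> \<exists>a\<in>I \<gamma>. i \<gamma> = Some a \<and> a \<noteq> z \<gamma>"
  by (metis cells_iff cells_star_iff domD option.sel)

lemma star_dom: "i \<in> cells_star I z D \<Longrightarrow> dom i = D"
  using cells_star_cells dom_cells by metis

lemma supp_fill:
  assumes "i \<in> cells_star I z D" "D \<subseteq> A"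
  shows "supp z (fill z A i) = D"
proof -
  have d: "dom i = D" by (rule star_dom[OF assms(1)])
  have "\<gamma> \<in> supp z (fill z A i) \<longleftrightarrow> \<gamma> \<in> D" for \<gamma>
  proof (cases "\<gamma> \<in> D")
    case True
    then obtain a where "i \<gamma> = Some a" "a \<noteq> z \<gamma>" using star_value[OF assms(1)] by blast
    then show ?thesis using True assms(2) d by (auto simp: supp_def fill_apply)
  next
    case False
    then have "\<gamma> \<notin> dom i" using d by simp
    then show ?thesis using False by (auto simp: supp_def fill_apply domIff)
  qed
  then show ?thesis by blast
qed

lemma fill_cells:
  assumes i: "i \<in> cells_star I z D" and z: "\<And>\<gamma>. \<gamma> \<in> A \<Longrightarrow> z \<gamma> \<in> I \<gamma>"
  shows "fill z A i \<in> cells I A"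
proof -
  have "the (fill z A i \<gamma>) \<in> I \<gamma>" if "\<gamma> \<in> A" for \<gamma>
  proof (cases "\<gamma> \<in> dom i")
    case True
    then show ?thesis using star_value[OF i, of \<gamma>] star_dom[OF i] that by (auto simp: fill_apply)
  qed (use that z in \<open>simp add: fill_apply\<close>)
  moreover have "dom (fill z A i) = A" by (auto simp: fill_apply dom_def split: if_splits)
  ultimately show ?thesis by (simp add: cells_iff)
qed

lemma fill_supp: "dom y = A \<Longrightarrow> fill z A (y |` supp z y) = y"
  by (rule ext) (auto simp: fill_apply supp_def restrict_map_def dom_def split: if_splits)

lemma restrict_fill:
  assumes "i \<in> cells_star I z D" "D \<subseteq> A"
  shows "fill z A i |` D = i"
proof
  fix \<gamma> show "(fill z A i |` D) \<gamma> = i \<gamma>"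
  proof (cases "\<gamma> \<in> D")
    case True
    then have "\<gamma> \<in> A" "\<gamma> \<in> dom i" using star_dom[OF assms(1)] assms(2) by blast+
    then show ?thesis using True by (simp add: fill_apply)
  next
    case False
    then have "\<gamma> \<notin> dom i" using star_dom[OF assms(1)] by simp
    then show ?thesis using False by (simp add: domIff)
  qed
qed

lemma star_le_iff:
  assumes i: "i \<in> cells_star I z D" and y: "dom y = A"
  shows "i \<subseteq>\<^sub>m y \<longleftrightarrow> D \<subseteq> supp z y \<and> y |` D = i"
proof
  assume le: "i \<subseteq>\<^sub>m y"
  have d: "dom i = D" by (rule star_dom[OF i])
  have "y \<gamma> = i \<gamma>" if "\<gamma> \<in> D" for \<gamma> using le that d by (simp add: map_le_def)
  moreover have "i \<gamma> = None" if "\<gamma> \<notin> D" for \<gamma> using d that by auto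
  ultimately have "y |` D = i" by (intro ext) (auto simp: restrict_map_def)
  moreover have "D \<subseteq> supp z y"
  proof
    fix \<gamma> assume g: "\<gamma> \<in> D"
    then have "y \<gamma> = i \<gamma>" using le d by (simp add: map_le_def)
    then show "\<gamma> \<in> supp z y" using star_value[OF i g] by (auto simp: supp_def)
  qed
  ultimately show "D \<subseteq> supp z y \<and> y |` D = i" by blast
next
  assume "D \<subseteq> supp z y \<and> y |` D = i"
  then show "i \<subseteq>\<^sub>m y" by (auto simp: map_le_def restrict_map_def split: if_splits)
qed

text \<open>The labels below a cell are exactly its restrictions to subsets of its support. This
  converts sums over features into sums over sets.\<close>

lemma sum_below:
  assumes y: "y \<in> cells I A"
  shows "(\<Sum>i\<in>{i. (\<exists>D. D \<subseteq> A \<and> P D \<and> i \<in> cells_star I z D) \<and> i \<subseteq>\<^sub>m y}. h i) =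
    (\<Sum>D\<in>{D. D \<subseteq> supp z y \<and> P D}. h (y |` D))"
proof (rule sum.reindex_bij_witness[where i = "\<lambda>D. y |` D" and j = dom])
  have yA: "dom y = A" by (rule dom_cells[OF y])
  fix i assume "i \<in> {i. (\<exists>D. D \<subseteq> A \<and> P D \<and> i \<in> cells_star I z D) \<and> i \<subseteq>\<^sub>m y}"
  then obtain D where D: "D \<subseteq> A" "P D" "i \<in> cells_star I z D" "i \<subseteq>\<^sub>m y" by blast
  then have i: "D \<subseteq> supp z y" "y |` D = i" "dom i = D" using star_le_iff[OF D(3) yA] star_dom[OF D(3)] by auto
  then show "y |` dom i = i" "dom i \<in> {D. D \<subseteq> supp z y \<and> P D}" "h (y |` dom i) = h i" using D by auto
next
  fix D assume "D \<in> {D. D \<subseteq> supp z y \<and> P D}"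
  then have D: "D \<subseteq> supp z y" "P D" by auto
  then have DA: "D \<subseteq> A" using supp_subset[of z y] dom_cells[OF y] by blast
  show "dom (y |` D) = D" using DA dom_cells[OF y] by auto
  have "y |` D \<in> cells_star I z D" by (rule cells_star_restrict_supp[OF y D(1)])
  then show "y |` D \<in> {i. (\<exists>D. D \<subseteq> A \<and> P D \<and> i \<in> cells_star I z D) \<and> i \<subseteq>\<^sub>m y}"
    using DA D by (auto simp: map_le_def)
qed

lemma star_partial:
  assumes i: "i \<in> cells_star I z D" and F: "F \<subseteq> D" "D \<subseteq> A"
  shows "supp z ((i |` F) ++ base_cell z (A - F)) = F"
    and "E \<subseteq> F \<Longrightarrow> ((i |` F) ++ base_cell z (A - F)) |` E = i |` E"
proof -
  have iF: "i |` F \<in> cells_star I z F" by (rule cells_star_restrict[OF i F(1)])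
  show "supp z ((i |` F) ++ base_cell z (A - F)) = F"
    by (rule supp_star_add_base[OF iF]) (use F in blast)
  show "((i |` F) ++ base_cell z (A - F)) |` E = i |` E" if "E \<subseteq> F"
  proof
    fix \<gamma>
    have "\<gamma> \<in> E \<Longrightarrow> \<gamma> \<in> dom i" using that F star_dom[OF i] by blast
    then show "(((i |` F) ++ base_cell z (A - F)) |` E) \<gamma> = (i |` E) \<gamma>"
      using that by (auto simp: restrict_map_def base_cell_def map_add_def)
  qed
qed

text \<open>Coefficients are read off an expansion over admissible sets only, by giving inadmissible
  sets the coefficient 0.\<close>

lemma Mob_of_restricted_sum:
  assumes i: "i \<in> cells_star I z D" and DA: "D \<subseteq> A" "finite A"
    and f: "\<And>y. y \<in> cells I A \<Longrightarrow> f y = (\<Sum>E\<in>{E. E \<subseteq> supp z y \<and> P E}. h (y |` E))"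
    and zI: "\<And>\<gamma>. \<gamma> \<in> A \<Longrightarrow> z \<gamma> \<in> I \<gamma>"
  shows "Mob z A f i = (if P D then h i else 0)"
proof -
  define k where "k = (\<lambda>j. if P (dom j) then h j else 0)"
  have di: "dom i = D" by (rule star_dom[OF i])
  have "Mob z A f i = k i"
  proof (rule Mob_of_sum[OF i DA(1) finite_subset[OF DA]])
    fix F assume F: "F \<subseteq> D"
    let ?y = "(i |` F) ++ base_cell z (A - F)"
    have "base_cell z (A - F) \<in> cells I (A - F)" using zI by (auto simp: cells_iff base_cell_def)
    from cells_add[OF cells_restrict[OF cells_star_cells[OF i] F] this]
    have y: "?y \<in> cells I A" using F DA by (simp add: Un_absorb1 subset_trans)
    have fin: "finite (Pow F)" using finite_subset[OF subset_trans[OF F DA(1)] DA(2)] by simp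
    have "f ?y = (\<Sum>E\<in>{E. E \<subseteq> F \<and> P E}. h (i |` E))"
      unfolding f[OF y] star_partial(1)[OF i F DA(1)]
      by (intro sum.cong refl) (use star_partial(2)[OF i F DA(1)] in auto)
    also have "{E. E \<subseteq> F \<and> P E} = {E \<in> Pow F. P E}" by auto
    also have "(\<Sum>E\<in>{E \<in> Pow F. P E}. h (i |` E)) = (\<Sum>E\<in>Pow F. if P E then h (i |` E) else 0)"
      by (rule sum.inter_filter[OF fin])
    also have "\<dots> = (\<Sum>E\<in>Pow F. k (i |` E))"
    proof (rule sum.cong[OF refl])
      fix E assume "E \<in> Pow F"
      then have "dom (i |` E) = E" using F di by auto
      then show "(if P E then h (i |` E) else 0) = k (i |` E)" by (simp add: k_def)
    qed
    finally show "f ?y = (\<Sum>E\<in>Pow F. k (i |` E))" .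
  qed
  then show ?thesis by (simp add: k_def di)
qed

context clique_model begin

section \<open>Logit kernels and the log-linear parameters that determine them\<close>

definition logit_kernel :: "(nat \<Rightarrow> ('v, 'a) cell \<Rightarrow> ('v, 'a) cell \<Rightarrow> real) \<Rightarrow> nat \<Rightarrow> ('v, 'a) cell \<Rightarrow> ('v, 'a) cell \<Rightarrow> real" where
  "logit_kernel c l s r = exp (c l s r) / (\<Sum>r'\<in>cl (Rd l). exp (c l s r'))"

definition log_partition :: "(nat \<Rightarrow> ('v, 'a) cell \<Rightarrow> ('v, 'a) cell \<Rightarrow> real) \<Rightarrow> nat \<Rightarrow> ('v, 'a) cell \<Rightarrow> real" where
  "log_partition c l s = ln (\<Sum>r\<in>cl (Rd l). exp (c l s r))"

lemma logit_kernel_denominator: "l < n \<Longrightarrow> 0 < (\<Sum>r\<in>cl (Rd l). exp (c l s r :: real))"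
  by (rule sum_pos2[OF finite_cells[OF sub_V(2)] base_cells[OF sub_V(2)]]) auto

lemma cond_kernel_logit_kernel: "cond_kernel (logit_kernel c)"
  unfolding cond_kernel_def
proof (intro allI impI ballI conjI)
  fix l s assume l: "l < n"
  show "0 < logit_kernel c l s r" for r using logit_kernel_denominator[OF l, of c s] by (simp add: logit_kernel_def)
  show "(\<Sum>r\<in>cl (Rd l). logit_kernel c l s r) = 1"
    unfolding logit_kernel_def sum_divide_distrib[symmetric] using logit_kernel_denominator[OF l, of c s] by simp
qed

lemma ln_logit_kernel: "l < n \<Longrightarrow> ln (logit_kernel c l s r) = c l s r - log_partition c l s"
  using logit_kernel_denominator[of l c s] by (simp add: logit_kernel_def log_partition_def ln_div)

lemma kernel_product_cong:
  assumes "x \<in> cl V" "\<And>l s r. l < n \<Longrightarrow> s \<in> cl (S l) \<Longrightarrow> r \<in> cl (Rd l) \<Longrightarrow> q l s r = q' l s r"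
  shows "kernel_product q x = kernel_product q' x"
  unfolding partial_product_def by (intro prod.cong refl assms(2)) (use cells_restrict[OF assms(1)] sub_V in auto)

text \<open>Log ratios to the base cell determine a conditional table up to a factor, and summing to
  1 fixes that factor.\<close>

lemma cond_kernel_eq_logit_kernel:
  assumes q: "cond_kernel q" and l: "l < n" and s: "s \<in> cl (S l)" and r: "r \<in> cl (Rd l)"
    and c: "\<And>r. r \<in> cl (Rd l) \<Longrightarrow> ln (q l s r) - ln (q l s (base_cell z (Rd l))) = c l s r"
  shows "q l s r = logit_kernel c l s r"
proof -
  let ?b = "q l s (base_cell z (Rd l))"
  have b: "0 < ?b" by (rule cond_kernel_pos[OF q l s base_cells[OF sub_V(2)[OF l]]])
  have eq: "q l s r = ?b * exp (c l s r)" if r: "r \<in> cl (Rd l)" for r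
  proof -
    have "exp (c l s r) = q l s r / ?b"
      unfolding c[OF r, symmetric] exp_diff using cond_kernel_pos[OF q l s r] b by simp
    then show ?thesis using b by simp
  qed
  have "1 = (\<Sum>r\<in>cl (Rd l). ?b * exp (c l s r))"
    unfolding cond_kernel_sum[OF q l s, symmetric] by (rule sum.cong[OF refl eq])
  also have "\<dots> = ?b * (\<Sum>r\<in>cl (Rd l). exp (c l s r))" by (simp only: sum_distrib_left)
  finally have "?b = 1 / (\<Sum>r\<in>cl (Rd l). exp (c l s r))"
    using logit_kernel_denominator[OF l, of c s] by (simp add: field_simps)
  then show ?thesis unfolding eq[OF r] logit_kernel_def by simp
qed

definition clique_labels :: "nat \<Rightarrow> ('v, 'a) cell set" where
  "clique_labels l = {i. \<exists>D. D \<subseteq> Cs ! l \<and> D \<inter> Rd l \<noteq> {} \<and> i \<in> cells_star I z D}"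

definition residual_labels :: "nat \<Rightarrow> ('v, 'a) cell set" where
  "residual_labels l = {i. \<exists>D. D \<subseteq> Rd l \<and> D \<noteq> {} \<and> i \<in> cells_star I z D}"

definition cond_logit :: "(nat \<times> ('v, 'a) cell \<Rightarrow> ('v, 'a) cell \<Rightarrow> real) \<Rightarrow> nat \<Rightarrow> ('v, 'a) cell \<Rightarrow> ('v, 'a) cell \<Rightarrow> real" where
  "cond_logit u l s r = (\<Sum>D\<in>{D. D \<subseteq> supp z r \<and> D \<noteq> {}}. u (l, s) (r |` D))"

definition cliq_logit :: "(nat \<Rightarrow> ('v, 'a) cell \<Rightarrow> real) \<Rightarrow> nat \<Rightarrow> ('v, 'a) cell \<Rightarrow> ('v, 'a) cell \<Rightarrow> real" where
  "cliq_logit v l s r = (\<Sum>D\<in>{D. D \<subseteq> supp z (s ++ r) \<and> D \<inter> Rd l \<noteq> {}}. v l ((s ++ r) |` D))"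

lemma finite_supp: "D \<subseteq> V \<Longrightarrow> x \<in> cl D \<Longrightarrow> finite (supp z x)"
  using supp_subset[of z x] dom_cells finite_subset finV by metis

lemma finite_sub: "D \<subseteq> V \<Longrightarrow> finite D"
  using finite_subset finV by blast

lemma cond_logit_feature:
  assumes "r \<in> cl (Rd l)"
  shows "(\<Sum>i\<in>{i \<in> residual_labels l. i \<subseteq>\<^sub>m r}. u (l, s) i) = cond_logit u l s r"
  unfolding cond_logit_def residual_labels_def using sum_below[where P = "\<lambda>D. D \<noteq> {}" and z = z and h = "u (l, s)", OF assms] by (simp add: conj_ac)

lemma sr_cell: "s \<in> cl (S l) \<Longrightarrow> r \<in> cl (Rd l) \<Longrightarrow> s ++ r \<in> cl (Cs ! l)"
  using cells_add[of s I "S l" r "Rd l"] SR(1)[of l] by simp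

lemma sr_restrict:
  assumes "s \<in> cl (S l)" "r \<in> cl (Rd l)"
  shows "(s ++ r) |` S l = s" "(s ++ r) |` Rd l = r"
  using restrict_add_left[of r "S l" s] restrict_add_right[of r "Rd l" s] dom_cells[OF assms(1)] dom_cells[OF assms(2)] SR(2)[of l]
  by auto

lemma clique_split:
  assumes "y \<in> cl (Cs ! l)"
  shows "(y |` S l) ++ (y |` Rd l) = y" "y |` S l \<in> cl (S l)" "y |` Rd l \<in> cl (Rd l)"
proof -
  show "(y |` S l) ++ (y |` Rd l) = y" by (rule restrict_split) (use dom_cells[OF assms] SR(1)[of l] in simp)
  show "y |` S l \<in> cl (S l)" "y |` Rd l \<in> cl (Rd l)"
    by (rule cells_restrict[OF assms], use SR(1)[of l] in blast)+
qed

lemma cliq_logit_feature: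
  assumes "s \<in> cl (S l)" "r \<in> cl (Rd l)"
  shows "(\<Sum>i\<in>{i \<in> clique_labels l. i \<subseteq>\<^sub>m s ++ r}. v l i) = cliq_logit v l s r"
  unfolding cliq_logit_def clique_labels_def using sum_below[where P = "\<lambda>D. D \<inter> Rd l \<noteq> {}" and z = z and h = "v l", OF sr_cell[OF assms]] by (simp add: conj_ac)

lemma Mob_empty: "Mob z A f Map.empty = f (base_cell z A)"
  by (simp add: Mob_def)

lemma restrict_empty_set [simp]: "x |` {} = Map.empty"
  by (rule ext) simp

lemma Mob_cond_logit:
  assumes l: "l < n" and i: "i \<in> residual_labels l"
  shows "Mob z (Rd l) (\<lambda>r. ln (logit_kernel (cond_logit u) l s r)) i = u (l, s) i"
proof -
  obtain D where D: "D \<subseteq> Rd l" "D \<noteq> {}" "i \<in> cells_star I z D" using i by (auto simp: residual_labels_def)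
  have fin: "finite (dom i)" "i \<noteq> Map.empty"
    using star_dom[OF D(3)] D(1,2) finite_sub sub_V(2)[OF l] by (auto intro: finite_subset)
  have "Mob z (Rd l) (\<lambda>r. ln (logit_kernel (cond_logit u) l s r)) i = Mob z (Rd l) (\<lambda>r. cond_logit u l s r) i - Mob z (Rd l) (\<lambda>r. log_partition (cond_logit u) l s) i"
    unfolding ln_logit_kernel[OF l] by (rule Mob_diff)
  also have "Mob z (Rd l) (\<lambda>r. log_partition (cond_logit u) l s) i = 0" by (rule Mob_const[OF fin])
  also have "Mob z (Rd l) (\<lambda>r. cond_logit u l s r) i = (if D \<noteq> {} then u (l, s) i else 0)"
    by (rule Mob_of_restricted_sum[OF D(3,1) finite_sub[OF sub_V(2)[OF l]]])
       (use zI sub_V(2)[OF l] in \<open>auto simp: cond_logit_def\<close>)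
  finally show ?thesis using D(2) by simp
qed

lemma Mob_cliq_logit_clique:
  assumes l: "l < n" and i: "i \<in> cells_star I z D" "D \<subseteq> Cs ! l"
  shows "Mob z (Cs ! l) (\<lambda>y. cliq_logit v l (y |` S l) (y |` Rd l)) i = (if D \<inter> Rd l \<noteq> {} then v l i else 0)"
  by (rule Mob_of_restricted_sum[OF i finite_sub[OF C_sub[OF l]]])
     (use zI C_sub[OF l] clique_split(1) in \<open>auto simp: cliq_logit_def\<close>)

text \<open>The log normalizer is a function of the separator cell, while the label reaches into the
  residual, so its transform vanishes and only the logit contributes.\<close>

lemma Mob_cliq_logit:
  assumes l: "l < n" and i: "i \<in> clique_labels l"
  shows "Mob z (Cs ! l) (\<lambda>y. ln (logit_kernel (cliq_logit v) l (y |` S l) (y |` Rd l))) i = v l i"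
proof -
  obtain D where D: "D \<subseteq> Cs ! l" "D \<inter> Rd l \<noteq> {}" "i \<in> cells_star I z D" using i by (auto simp: clique_labels_def)
  have di: "dom i = D" by (rule star_dom[OF D(3)])
  have fin: "finite (dom i)" unfolding di using D(1) finite_sub[OF C_sub[OF l]] by (rule finite_subset)
  have nS: "\<not> dom i \<subseteq> S l" unfolding di using D(2) SR(2)[of l] by blast
  have "Mob z (Cs ! l) (\<lambda>y. ln (logit_kernel (cliq_logit v) l (y |` S l) (y |` Rd l))) i =
      Mob z (Cs ! l) (\<lambda>y. cliq_logit v l (y |` S l) (y |` Rd l)) i - Mob z (Cs ! l) (\<lambda>y. log_partition (cliq_logit v) l (y |` S l)) i"
    unfolding ln_logit_kernel[OF l] by (rule Mob_diff)
  also have "Mob z (Cs ! l) (\<lambda>y. log_partition (cliq_logit v) l (y |` S l)) i = 0"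
    using Mob_restrict[OF fin, of "S l" "Cs ! l" z "log_partition (cliq_logit v) l"] SR(1)[of l] di D(1) nS by auto
  finally show ?thesis unfolding Mob_cliq_logit_clique[OF l D(3,1)] using D(2) by simp
qed

lemma cond_logit_of_Mob:
  assumes l: "l < n" and r: "r \<in> cl (Rd l)" and u: "\<And>i. i \<in> residual_labels l \<Longrightarrow> u (l, s) i = Mob z (Rd l) F i"
  shows "F r - F (base_cell z (Rd l)) = cond_logit u l s r"
proof -
  have fin: "finite (Pow (supp z r))" using finite_supp[OF sub_V(2)[OF l] r] by simp
  have "F r = (\<Sum>D\<in>Pow (supp z r). Mob z (Rd l) F (r |` D))"
    by (rule Mob_inversion[OF r finite_sub[OF sub_V(2)[OF l]], symmetric])
  also have "\<dots> = Mob z (Rd l) F (r |` {}) + (\<Sum>D\<in>Pow (supp z r) - {{}}. Mob z (Rd l) F (r |` D))"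
    by (rule sum.remove[OF fin]) simp
  also have "(\<Sum>D\<in>Pow (supp z r) - {{}}. Mob z (Rd l) F (r |` D)) = cond_logit u l s r"
    unfolding cond_logit_def
  proof (rule sum.cong)
    fix D assume "D \<in> {D. D \<subseteq> supp z r \<and> D \<noteq> {}}"
    then have D: "D \<subseteq> supp z r" "D \<noteq> {}" by auto
    then have "D \<subseteq> Rd l" using supp_subset[of z r] dom_cells[OF r] by blast
    with D(2) cells_star_restrict_supp[OF r D(1)] have "r |` D \<in> residual_labels l" unfolding residual_labels_def by blast
    then show "Mob z (Rd l) F (r |` D) = u (l, s) (r |` D)" by (simp add: u)
  qed auto
  finally show ?thesis by (simp add: Mob_empty)
qed

text \<open>In the expansion of \<open>F s r\<close>, the sets missing the residual are the subsets
  of the support of \<open>s\<close>. They sum to the value at the base cell, so the difference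
  consists of the sets that meet the residual.\<close>

lemma cliq_logit_of_Mob:
  assumes l: "l < n" and s: "s \<in> cl (S l)" and r: "r \<in> cl (Rd l)"
    and v: "\<And>i. i \<in> clique_labels l \<Longrightarrow> v l i = Mob z (Cs ! l) (\<lambda>y. F (y |` S l) (y |` Rd l)) i"
  shows "F s r - F s (base_cell z (Rd l)) = cliq_logit v l s r"
proof -
  let ?F = "\<lambda>y. F (y |` S l) (y |` Rd l)" and ?b = "base_cell z (Rd l)"
  have finC: "finite (Cs ! l)" by (rule finite_sub[OF C_sub[OF l]])
  have b: "?b \<in> cl (Rd l)" by (rule base_cells[OF sub_V(2)[OF l]])
  have exp: "F s r = (\<Sum>D\<in>Pow (supp z (s ++ r)). Mob z (Cs ! l) ?F ((s ++ r) |` D))" if "r \<in> cl (Rd l)" for r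
    using Mob_inversion[OF sr_cell[OF s that] finC, of z ?F] unfolding sr_restrict[OF s that] by simp
  have fin: "finite (Pow (supp z (s ++ r)))" using finite_supp[OF C_sub[OF l] sr_cell[OF s r]] by simp
  have dS: "dom s = S l" and dR: "dom r = Rd l" using dom_cells s r by blast+
  have suppb: "supp z (s ++ ?b) = supp z s"
    using dS SR(2)[of l] by (subst supp_add) (auto simp: supp_def base_cell_def restrict_map_def split: if_splits)
  have suppr: "supp z (s ++ r) = supp z s \<union> supp z r"
    using dS dR SR(2)[of l] by (intro supp_add) simp
  have eqS: "(s ++ r) |` D = (s ++ ?b) |` D" if "D \<subseteq> S l" for D
  proof -
    have "(s ++ r) |` D = s |` D" "(s ++ ?b) |` D = s |` D"
      by (rule restrict_add_disjoint, use that SR(2)[of l] dR in \<open>simp; blast\<close>)+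
    then show ?thesis by simp
  qed
  have sub: "supp z s \<subseteq> S l" "supp z r \<subseteq> Rd l" using supp_subset[of z s] supp_subset[of z r] unfolding dS dR .
  let ?A = "{D \<in> Pow (supp z (s ++ r)). D \<inter> Rd l \<noteq> {}}" and ?B = "Pow (supp z s)"
  have split: "Pow (supp z (s ++ r)) = ?A \<union> ?B" "?A \<inter> ?B = {}"
  proof -
    have "D \<subseteq> supp z s" if "D \<subseteq> supp z s \<union> supp z r" "D \<inter> Rd l = {}" for D using that sub(2) by blast
    then show "Pow (supp z (s ++ r)) = ?A \<union> ?B" unfolding suppr by (intro equalityI subsetI) auto
    have "D \<inter> Rd l = {}" if "D \<subseteq> supp z s" for D using that sub(1) SR(2)[of l] by blast
    then show "?A \<inter> ?B = {}" by auto
  qed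
  have finAB: "finite ?A" "finite ?B"
    using fin by (auto simp: suppr)
  have "F s r = (\<Sum>D\<in>?A \<union> ?B. Mob z (Cs ! l) ?F ((s ++ r) |` D))"
    by (simp only: split(1)[symmetric] exp[OF r])
  also have "\<dots> = (\<Sum>D\<in>?A. Mob z (Cs ! l) ?F ((s ++ r) |` D)) + (\<Sum>D\<in>?B. Mob z (Cs ! l) ?F ((s ++ r) |` D))"
    by (rule sum.union_disjoint[OF finAB split(2)])
  also have "(\<Sum>D\<in>?B. Mob z (Cs ! l) ?F ((s ++ r) |` D)) = F s ?b"
    unfolding exp[OF b] suppb by (rule sum.cong[OF refl]) (use eqS sub(1) in auto)
  also have "(\<Sum>D\<in>?A. Mob z (Cs ! l) ?F ((s ++ r) |` D)) = cliq_logit v l s r"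
    unfolding cliq_logit_def
  proof (rule sum.cong)
    fix D assume D: "D \<in> {D. D \<subseteq> supp z (s ++ r) \<and> D \<inter> Rd l \<noteq> {}}"
    then have Ds: "D \<subseteq> supp z (s ++ r)" by simp
    have "supp z (s ++ r) \<subseteq> Cs ! l" using supp_subset[of z "s ++ r"] unfolding dom_cells[OF sr_cell[OF s r]] .
    with Ds have "D \<subseteq> Cs ! l" by (rule subset_trans)
    moreover have "D \<inter> Rd l \<noteq> {}" using D by simp
    moreover have "(s ++ r) |` D \<in> cells_star I z D" by (rule cells_star_restrict_supp[OF sr_cell[OF s r] Ds])
    ultimately have "(s ++ r) |` D \<in> clique_labels l" unfolding clique_labels_def by blast
    then show "Mob z (Cs ! l) ?F ((s ++ r) |` D) = v l ((s ++ r) |` D)" by (simp add: v)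
  qed auto
  finally show ?thesis by simp
qed

lemma marginal_clique':
  assumes q: "cond_kernel q" and l: "l < n" and y: "y \<in> cl (Cs ! l)" and p: "\<And>x. x \<in> cl V \<Longrightarrow> p x = kernel_product q x"
  shows "marginal V I p y = w q l (y |` S l) * q l (y |` S l) (y |` Rd l)"
proof -
  note sp = clique_split[OF y]
  have "(y |` Rd l) ++ (y |` S l) = y"
    using sp(1) map_add_comm[of "y |` S l" "y |` Rd l"] SR(2)[of l] dom_cells[OF sp(2)] dom_cells[OF sp(3)] by simp
  then show ?thesis using marginal_clique[where p = p, OF q l sp(2,3) p] by simp
qed

text \<open>The clique marginal is the separator marginal times the conditional table. Constants and
  functions of the separator disappear for labels meeting the residual, so theta^{C_l} is a
  parameter of the conditional table. The factor \<open>c\<close> allows for unnormalized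
  tables.\<close>

lemma Mob_ln_marginal:
  assumes q: "cond_kernel q" and l: "l < n" and i: "i \<in> clique_labels l" and c: "0 < c"
    and p: "\<And>x. x \<in> cl V \<Longrightarrow> p x = kernel_product q x"
  shows "Mob z (Cs ! l) (\<lambda>y. ln (c * marginal V I p y)) i = Mob z (Cs ! l) (\<lambda>y. ln (q l (y |` S l) (y |` Rd l))) i"
proof -
  obtain D where D: "D \<subseteq> Cs ! l" "D \<inter> Rd l \<noteq> {}" "i \<in> cells_star I z D" using i by (auto simp: clique_labels_def)
  have di: "dom i = D" by (rule star_dom[OF D(3)])
  have fin: "finite (dom i)" unfolding di using D(1) finite_sub[OF C_sub[OF l]] by (rule finite_subset)
  have ne: "i \<noteq> Map.empty" using di D(2) by auto
  have nS: "\<not> dom i \<subseteq> S l" unfolding di using D(2) SR(2)[of l] by blast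
  have "Mob z (Cs ! l) (\<lambda>y. ln (c * marginal V I p y)) i =
      Mob z (Cs ! l) (\<lambda>y. (ln c + ln (w q l (y |` S l))) + ln (q l (y |` S l) (y |` Rd l))) i"
  proof (rule Mob_cong)
    fix F assume F: "F \<subseteq> dom i"
    let ?y = "i |` F ++ base_cell z (Cs ! l - F)"
    have "F \<union> (Cs ! l - F) = Cs ! l" using F di D(1) by blast
    then have y: "?y \<in> cl (Cs ! l)"
      using cells_add[OF cells_restrict[OF cells_star_cells[OF D(3)], of F] base_cells[of "Cs ! l - F"]] F di C_sub[OF l] by auto
    note sp = clique_split[OF y]
    have m: "marginal V I p ?y = w q l (?y |` S l) * q l (?y |` S l) (?y |` Rd l)"
      by (rule marginal_clique'[OF q l y p])
    show "ln (c * marginal V I p ?y) = (ln c + ln (w q l (?y |` S l))) + ln (q l (?y |` S l) (?y |` Rd l))"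
      unfolding m
      using c w_pos[OF q l sp(2)] cond_kernel_pos[OF q l sp(2,3)] by (simp add: ln_mult_pos)
  qed
  also have "\<dots> = Mob z (Cs ! l) (\<lambda>y. ln c) i + Mob z (Cs ! l) (\<lambda>y. ln (w q l (y |` S l))) i +
      Mob z (Cs ! l) (\<lambda>y. ln (q l (y |` S l) (y |` Rd l))) i"
    by (simp only: Mob_add)
  also have "Mob z (Cs ! l) (\<lambda>y. ln c) i = 0" by (rule Mob_const[OF fin ne])
  also have "Mob z (Cs ! l) (\<lambda>y. ln (w q l (y |` S l))) i = 0"
    using Mob_restrict[OF fin, of "S l" "Cs ! l" z "\<lambda>s. ln (w q l s)"] SR(1)[of l] di D(1) nS by auto
  finally show ?thesis by simp
qed

lemma kernel_product_eq_cliq_logit: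
  assumes q: "cond_kernel q" and v: "\<And>l i. l < n \<Longrightarrow> i \<in> clique_labels l \<Longrightarrow>
      v l i = Mob z (Cs ! l) (\<lambda>y. ln (q l (y |` S l) (y |` Rd l))) i"
    and x: "x \<in> cl V"
  shows "kernel_product q x = kernel_product (logit_kernel (cliq_logit v)) x"
proof (rule kernel_product_cong[OF x])
  fix l s r assume l: "l < n" and s: "s \<in> cl (S l)" and r: "r \<in> cl (Rd l)"
  show "q l s r = logit_kernel (cliq_logit v) l s r"
    by (rule cond_kernel_eq_logit_kernel[OF q l s r])
       (rule cliq_logit_of_Mob[OF l s, where F = "\<lambda>s r. ln (q l s r)"], assumption, rule v[OF l])
qed

lemma kernel_product_eq_cond_logit:
  assumes q: "cond_kernel q" and u: "\<And>l s i. l < n \<Longrightarrow> s \<in> cl (S l) \<Longrightarrow> i \<in> residual_labels l \<Longrightarrow>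
      u (l, s) i = Mob z (Rd l) (\<lambda>r. ln (q l s r)) i"
    and x: "x \<in> cl V"
  shows "kernel_product q x = kernel_product (logit_kernel (cond_logit u)) x"
proof (rule kernel_product_cong[OF x])
  fix l s r assume l: "l < n" and s: "s \<in> cl (S l)" and r: "r \<in> cl (Rd l)"
  show "q l s r = logit_kernel (cond_logit u) l s r"
    by (rule cond_kernel_eq_logit_kernel[OF q l s r])
       (rule cond_logit_of_Mob[OF l, where F = "\<lambda>r. ln (q l s r)"], assumption, rule u[OF l s])
qed

section \<open>The label sets of the groups\<close>

lemma mod_group_eq: "mod_group I z Cs l = clique_labels l"
proof (cases "l = 0")
  case True
  then show ?thesis unfolding mod_group_def clique_labels_def by (auto simp: Int_absorb2)
next
  case False
  then show ?thesis unfolding mod_group_def clique_labels_def by auto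
qed

lemma cliq_group_eq: "cliq_group I z Cs l = Pair l ` clique_labels l"
proof (cases "l = 0")
  case True
  then show ?thesis unfolding cliq_group_def clique_labels_def by (auto simp: Int_absorb2)
next
  case False
  have "(\<exists>F iF D iD. i = iF ++ iD \<and> F \<subseteq> S l \<and> iF \<in> cells_star I z F \<and> D \<noteq> {} \<and> D \<subseteq> Rd l \<and> iD \<in> cells_star I z D)
      \<longleftrightarrow> i \<in> clique_labels l" for i
  proof
    assume "\<exists>F iF D iD. i = iF ++ iD \<and> F \<subseteq> S l \<and> iF \<in> cells_star I z F \<and> D \<noteq> {} \<and> D \<subseteq> Rd l \<and> iD \<in> cells_star I z D"
    then obtain F iF D iD where h: "i = iF ++ iD" "F \<subseteq> S l" "iF \<in> cells_star I z F" "D \<noteq> {}" "D \<subseteq> Rd l" "iD \<in> cells_star I z D"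
      by blast
    have dd: "dom iF = F" "dom iD = D" using star_dom h by blast+
    have "i \<in> cl (F \<union> D)" unfolding h(1) by (rule cells_add[OF cells_star_cells[OF h(3)] cells_star_cells[OF h(6)]])
    moreover have "the (i \<gamma>) \<noteq> z \<gamma>" if "\<gamma> \<in> F \<union> D" for \<gamma>
      using h(1,3,6) dd that by (cases "\<gamma> \<in> D") (auto simp: cells_star_iff map_add_dom_app_simps)
    ultimately have "i \<in> cells_star I z (F \<union> D)" by (simp add: cells_star_iff)
    moreover have "F \<union> D \<subseteq> Cs ! l" "(F \<union> D) \<inter> Rd l \<noteq> {}" using h SR(1)[of l] by blast+
    ultimately show "i \<in> clique_labels l" unfolding clique_labels_def by blast
  next
    assume "i \<in> clique_labels l"
    then obtain D where D: "D \<subseteq> Cs ! l" "D \<inter> Rd l \<noteq> {}" "i \<in> cells_star I z D" by (auto simp: clique_labels_def)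
    have "i |` (D \<inter> S l) ++ i |` (D \<inter> Rd l) = i"
      by (rule restrict_split) (use star_dom[OF D(3)] D(1) SR(1)[of l] in blast)
    moreover have "i |` (D \<inter> S l) \<in> cells_star I z (D \<inter> S l)" "i |` (D \<inter> Rd l) \<in> cells_star I z (D \<inter> Rd l)"
      using cells_star_restrict[OF D(3)] by simp_all
    ultimately show "\<exists>F iF D iD. i = iF ++ iD \<and> F \<subseteq> S l \<and> iF \<in> cells_star I z F \<and> D \<noteq> {} \<and> D \<subseteq> Rd l \<and> iD \<in> cells_star I z D"
      using D(2) by (metis Int_lower2)
  qed
  then have "clique_labels l = {iF ++ iD |F iF D iD. F \<subseteq> S l \<and> iF \<in> cells_star I z F \<and> D \<noteq> {} \<and> D \<subseteq> Rd l \<and> iD \<in> cells_star I z D}"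
    by blast
  moreover have "cliq_group I z Cs l = Pair l ` {iF ++ iD |F iF D iD.
      F \<subseteq> S l \<and> iF \<in> cells_star I z F \<and> D \<noteq> {} \<and> D \<subseteq> Rd l \<and> iD \<in> cells_star I z D}"
    unfolding cliq_group_def if_not_P[OF False] image_Collect by blast
  ultimately show ?thesis by simp
qed

lemma cond_groups_eq: "cond_groups I Cs = Keys"
  unfolding cond_groups_def using n_pos by (auto simp: Keys_iff)

lemma cond_group_eq: "k \<in> Keys \<Longrightarrow> cond_group I z Cs k = Pair k ` residual_labels (fst k)"
  using Keys_iff[of "fst k" "snd k"] unfolding cond_group_def residual_labels_def
  by (cases k; cases "fst k = 0") (auto simp: image_iff)

text \<open>The domain of a label of an earlier clique lies in the history of the later one and so
  cannot meet its residual.\<close>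

lemma clique_labels_disjoint:
  assumes "l < n" "l' < n" "i \<in> clique_labels l" "i \<in> clique_labels l'"
  shows "l = l'"
proof -
  have False if lt: "l < l'" and il: "i \<in> clique_labels l" and il': "i \<in> clique_labels l'" for l l'
  proof -
    obtain D where D: "D \<subseteq> Cs ! l" "i \<in> cells_star I z D" using il unfolding clique_labels_def by blast
    obtain D' where D': "D' \<inter> Rd l' \<noteq> {}" "i \<in> cells_star I z D'" using il' unfolding clique_labels_def by blast
    have "D = D'" using star_dom D(2) D'(2) by metis
    moreover have "Cs ! l \<subseteq> H l'" using lt by blast
    ultimately show False using D D' SR(4)[of l'] by blast
  qed
  then show ?thesis using assms by (metis nat_neq_iff)
qed

text \<open>A nonempty complete set meets the residual of the first clique containing it: otherwise
  it would lie in the separator and, by the running intersection property, in an earlier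
  clique.\<close>

lemma complete_labels:
  "{i. \<exists>D. D \<noteq> {} \<and> D \<subseteq> V \<and> complete_in E D \<and> i \<in> cells_star I z D} = (\<Union>l<n. clique_labels l)"
proof (intro equalityI subsetI)
  fix i assume "i \<in> {i. \<exists>D. D \<noteq> {} \<and> D \<subseteq> V \<and> complete_in E D \<and> i \<in> cells_star I z D}"
  then obtain D where D: "D \<noteq> {}" "D \<subseteq> V" "complete_in E D" "i \<in> cells_star I z D" by blast
  note a = first_clique[OF D(2,3)]
  have "D \<inter> Rd (first_clique D) \<noteq> {}"
  proof
    assume "D \<inter> Rd (first_clique D) = {}"
    then have DS: "D \<subseteq> S (first_clique D)" using a SR(1)[of "first_clique D"] by blast
    then have "0 < first_clique D" using D(1) by (cases "first_clique D = 0") auto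
    then obtain i where "i < first_clique D" "S (first_clique D) \<subseteq> Cs ! i" using running_intersection a by blast
    then show False using DS a not_less_Least[of i "\<lambda>l. l < n \<and> D \<subseteq> Cs ! l"] unfolding first_clique_def by auto
  qed
  then show "i \<in> (\<Union>l<n. clique_labels l)" using a D(4) unfolding clique_labels_def by blast
next
  fix i assume "i \<in> (\<Union>l<n. clique_labels l)"
  then obtain l D where l: "l < n" "D \<subseteq> Cs ! l" "D \<inter> Rd l \<noteq> {}" "i \<in> cells_star I z D" by (auto simp: clique_labels_def)
  then show "i \<in> {i. \<exists>D. D \<noteq> {} \<and> D \<subseteq> V \<and> complete_in E D \<and> i \<in> cells_star I z D}"
    using C_sub[OF l(1)] complete_subset[OF C_complete[OF l(1)] l(2)] by blast
qed

lemma bij_residual_labels: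
  assumes l: "l < n"
  shows "bij_betw (fill z (Rd l)) (residual_labels l) (cl (Rd l) - {base_cell z (Rd l)})"
proof (rule bij_betw_byWitness[where f' = "\<lambda>r. r |` supp z r"])
  have fill: "fill z (Rd l) i |` supp z (fill z (Rd l) i) = i \<and> fill z (Rd l) i \<in> cl (Rd l) \<and>
      fill z (Rd l) i \<noteq> base_cell z (Rd l)" if ic: "i \<in> residual_labels l" for i
  proof -
    obtain D where D: "D \<subseteq> Rd l" "D \<noteq> {}" "i \<in> cells_star I z D" using ic by (auto simp: residual_labels_def)
    have sup: "supp z (fill z (Rd l) i) = D" by (rule supp_fill[OF D(3,1)])
    have "fill z (Rd l) i \<in> cl (Rd l)"
      by (rule fill_cells[OF D(3)]) (use zI sub_V(2)[OF l] in blast)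
    moreover have "supp z (base_cell z (Rd l)) = {}"
      by (auto simp: supp_def base_cell_def restrict_map_def split: if_splits)
    ultimately show ?thesis using restrict_fill[OF D(3,1)] sup D(2) by metis
  qed
  show "\<forall>i\<in>residual_labels l. fill z (Rd l) i |` supp z (fill z (Rd l) i) = i" by (intro ballI fill[THEN conjunct1])
  show "fill z (Rd l) ` residual_labels l \<subseteq> cl (Rd l) - {base_cell z (Rd l)}"
    by (rule image_subsetI) (metis fill Diff_iff singletonD)
  show "\<forall>r\<in>cl (Rd l) - {base_cell z (Rd l)}. fill z (Rd l) (r |` supp z r) = r"
    by (intro ballI fill_supp[OF dom_cells]) (erule DiffD1)
  show "(\<lambda>r. r |` supp z r) ` (cl (Rd l) - {base_cell z (Rd l)}) \<subseteq> residual_labels l"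
  proof
    fix i assume "i \<in> (\<lambda>r. r |` supp z r) ` (cl (Rd l) - {base_cell z (Rd l)})"
    then obtain r where r: "r \<in> cl (Rd l)" "r \<noteq> base_cell z (Rd l)" "i = r |` supp z r" by blast
    have "supp z r \<noteq> {}"
    proof
      assume "supp z r = {}"
      then have "base_cell z (Rd l) = r"
        using restrict_supp_add_base[OF dom_cells[OF r(1)], of z "{}"] by simp
      then show False using r(2) by simp
    qed
    moreover have "supp z r \<subseteq> Rd l" using supp_subset[of z r] dom_cells[OF r(1)] by simp
    ultimately show "i \<in> residual_labels l"
      using cells_star_restrict_supp[OF r(1) order_refl, of z] unfolding residual_labels_def r(3) by blast
  qed
qed

text \<open>Each label of a clique corresponds to a separator cell, naming a conditional table, and
  a non-base cell of that table. This is the \<kappa> of the groups of theta^cliq and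
  theta^mod.\<close>

lemma bij_clique_labels:
  assumes l: "l < n"
  shows "bij_betw (\<lambda>i. (fill z (S l) i, fill z (Rd l) i)) (clique_labels l) (cl (S l) \<times> (cl (Rd l) - {base_cell z (Rd l)}))"
proof (rule bij_betw_byWitness[where f' = "\<lambda>(s, r). (s ++ r) |` supp z (s ++ r)"])
  have sub: "S l \<subseteq> Cs ! l" "Rd l \<subseteq> Cs ! l" using SR(1)[of l] by blast+
  have fill: "fill z (Cs ! l) i |` supp z (fill z (Cs ! l) i) = i" "fill z (Cs ! l) i \<in> cl (Cs ! l)"
      "fill z (S l) i ++ fill z (Rd l) i = fill z (Cs ! l) i" "fill z (S l) i \<in> cl (S l)" "fill z (Rd l) i \<in> cl (Rd l)"
      "fill z (Rd l) i \<noteq> base_cell z (Rd l)" if ig: "i \<in> clique_labels l" for i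
  proof -
    obtain D where D: "D \<subseteq> Cs ! l" "D \<inter> Rd l \<noteq> {}" "i \<in> cells_star I z D" using ig by (auto simp: clique_labels_def)
    show "fill z (Cs ! l) i |` supp z (fill z (Cs ! l) i) = i"
      using restrict_fill[OF D(3,1)] supp_fill[OF D(3,1)] by simp
    show y: "fill z (Cs ! l) i \<in> cl (Cs ! l)"
      by (rule fill_cells[OF D(3)]) (use zI C_sub[OF l] in blast)
    show "fill z (S l) i ++ fill z (Rd l) i = fill z (Cs ! l) i" "fill z (S l) i \<in> cl (S l)" "fill z (Rd l) i \<in> cl (Rd l)"
      using clique_split[OF y] unfolding fill_restrict[OF sub(1)] fill_restrict[OF sub(2)] .
    obtain \<gamma> where g: "\<gamma> \<in> D" "\<gamma> \<in> Rd l" using D(2) by blast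
    then have "fill z (Rd l) i \<gamma> \<noteq> base_cell z (Rd l) \<gamma>"
      using star_value[OF D(3) g(1)] by (auto simp: fill_apply base_cell_def)
    then show "fill z (Rd l) i \<noteq> base_cell z (Rd l)" by metis
  qed
  show "\<forall>i\<in>clique_labels l. (case (fill z (S l) i, fill z (Rd l) i) of (s, r) \<Rightarrow> (s ++ r) |` supp z (s ++ r)) = i"
    using fill(1,3) by simp
  show "(\<lambda>i. (fill z (S l) i, fill z (Rd l) i)) ` clique_labels l \<subseteq> cl (S l) \<times> (cl (Rd l) - {base_cell z (Rd l)})"
    by (rule image_subsetI) (metis fill(4) fill(5) fill(6) Diff_iff singletonD mem_Sigma_iff)
  show "\<forall>p\<in>cl (S l) \<times> (cl (Rd l) - {base_cell z (Rd l)}).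
      (fill z (S l) (case p of (s, r) \<Rightarrow> (s ++ r) |` supp z (s ++ r)), fill z (Rd l) (case p of (s, r) \<Rightarrow> (s ++ r) |` supp z (s ++ r))) = p"
  proof
    fix p assume "p \<in> cl (S l) \<times> (cl (Rd l) - {base_cell z (Rd l)})"
    then obtain s r where p: "p = (s, r)" "s \<in> cl (S l)" "r \<in> cl (Rd l)" by blast
    have "fill z (Cs ! l) ((s ++ r) |` supp z (s ++ r)) = s ++ r"
      by (rule fill_supp[OF dom_cells[OF sr_cell[OF p(2,3)]]])
    then have "fill z (S l) ((s ++ r) |` supp z (s ++ r)) = s" "fill z (Rd l) ((s ++ r) |` supp z (s ++ r)) = r"
      using fill_restrict[OF sub(1)] fill_restrict[OF sub(2)] sr_restrict[OF p(2,3)] by metis+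
    then show "(fill z (S l) (case p of (s, r) \<Rightarrow> (s ++ r) |` supp z (s ++ r)), fill z (Rd l) (case p of (s, r) \<Rightarrow> (s ++ r) |` supp z (s ++ r))) = p"
      using p(1) by simp
  qed
  show "(\<lambda>(s, r). (s ++ r) |` supp z (s ++ r)) ` (cl (S l) \<times> (cl (Rd l) - {base_cell z (Rd l)})) \<subseteq> clique_labels l"
  proof
    fix i assume "i \<in> (\<lambda>(s, r). (s ++ r) |` supp z (s ++ r)) ` (cl (S l) \<times> (cl (Rd l) - {base_cell z (Rd l)}))"
    then obtain s r where p: "s \<in> cl (S l)" "r \<in> cl (Rd l)" "r \<noteq> base_cell z (Rd l)" "i = (s ++ r) |` supp z (s ++ r)" by auto
    have y: "s ++ r \<in> cl (Cs ! l)" by (rule sr_cell[OF p(1,2)])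
    have "supp z r \<noteq> {}"
    proof
      assume "supp z r = {}"
      then have "base_cell z (Rd l) = r"
        using restrict_supp_add_base[OF dom_cells[OF p(2)], of z "{}"] by simp
      then show False using p(3) by simp
    qed
    moreover have "supp z r \<subseteq> Rd l" using supp_subset[of z r] dom_cells[OF p(2)] by simp
    moreover have "supp z (s ++ r) = supp z s \<union> supp z r"
      using dom_cells[OF p(1)] dom_cells[OF p(2)] SR(2)[of l] by (intro supp_add) simp
    moreover have "supp z (s ++ r) \<subseteq> Cs ! l" using supp_subset[of z "s ++ r"] dom_cells[OF y] by simp
    ultimately have "supp z (s ++ r) \<subseteq> Cs ! l \<and> supp z (s ++ r) \<inter> Rd l \<noteq> {}" by blast
    then show "i \<in> clique_labels l"
      using cells_star_restrict_supp[OF y order_refl, of z] unfolding clique_labels_def p(4) by blast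
  qed
qed

end

section \<open>The three parametrizations\<close>

lemma distinct_concat_nth:
  assumes "\<And>j. j < length gs \<Longrightarrow> distinct (gs ! j)"
    and "\<And>i j. i < j \<Longrightarrow> j < length gs \<Longrightarrow> set (gs ! i) \<inter> set (gs ! j) = {}"
  shows "distinct (concat gs)"
  using assms
proof (induction gs)
  case (Cons g gs)
  have "distinct (concat gs)"
    by (rule Cons.IH) (use Cons.prems(1)[of "Suc _"] Cons.prems(2)[of "Suc _" "Suc _"] in auto)
  moreover have "set g \<inter> set (gs ! j) = {}" if "j < length gs" for j
    using Cons.prems(2)[of 0 "Suc j"] that by simp
  then have "set g \<inter> set (concat gs) = {}" by (fastforce simp: in_set_conv_nth)
  ultimately show ?case using Cons.prems(1)[of 0] by simp
qed simp

text \<open>Replaces the lists by the position \<open>pos\<close> of each group, the only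
  information about the order that is needed later.\<close>

lemma ordered_groupingE:
  assumes og: "ordered_grouping B grp bs gs"
    and disj: "\<And>b b'. b \<in> B \<Longrightarrow> b' \<in> B \<Longrightarrow> b \<noteq> b' \<Longrightarrow> grp b \<inter> grp b' = {}"
  obtains pos where "distinct (concat gs)" "set (concat gs) = (\<Union>b\<in>B. grp b)"
    "\<And>b. b \<in> B \<Longrightarrow> pos b < length gs" "\<And>b. b \<in> B \<Longrightarrow> bs ! pos b = b"
    "\<And>b. b \<in> B \<Longrightarrow> set (gs ! pos b) = grp b"
    "\<And>j. j < length gs \<Longrightarrow> bs ! j \<in> B" "\<And>j. j < length gs \<Longrightarrow> pos (bs ! j) = j"
proof -
  have d: "distinct bs" "set bs = B" and len: "length bs = length gs"
    and g: "\<And>j. j < length gs \<Longrightarrow> distinct (gs ! j)" "\<And>j. j < length gs \<Longrightarrow> set (gs ! j) = grp (bs ! j)"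
    using og by (auto simp: ordered_grouping_def list_all2_conv_all_nth)
  define pos where "pos b = (THE j. j < length gs \<and> bs ! j = b)" for b
  have pos: "pos (bs ! j) = j" if j: "j < length gs" for j
    unfolding pos_def by (rule the_equality) (use j d(1) len in \<open>auto simp: nth_eq_iff_index_eq\<close>)
  have nthB: "bs ! j \<in> B" if "j < length gs" for j using that d(2) len nth_mem[of j bs] by simp
  have ex: "pos b < length gs \<and> bs ! pos b = b" if b: "b \<in> B" for b
  proof -
    obtain j where "j < length gs" "bs ! j = b" using b d(2) len by (metis in_set_conv_nth)
    then show ?thesis using pos by auto
  qed
  have dist: "distinct (concat gs)"
  proof (rule distinct_concat_nth)
    fix i j assume ij: "i < j" "j < length gs"
    have "bs ! i \<noteq> bs ! j" using ij d(1) len by (simp add: nth_eq_iff_index_eq)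
    then show "set (gs ! i) \<inter> set (gs ! j) = {}" using disj[of "bs ! i" "bs ! j"] nthB[of i] nthB[of j] g(2)[of i] g(2)[of j] ij by simp
  qed (rule g(1))
  have posg: "set (gs ! pos b) = grp b" if "b \<in> B" for b using ex[OF that] g(2)[of "pos b"] by simp
  have un: "set (concat gs) = (\<Union>b\<in>B. grp b)"
  proof (intro equalityI subsetI)
    fix a assume "a \<in> set (concat gs)"
    then obtain g where "g \<in> set gs" "a \<in> set g" by (auto simp: set_concat)
    then obtain j where j: "j < length gs" "a \<in> set (gs ! j)" by (metis in_set_conv_nth)
    then show "a \<in> (\<Union>b\<in>B. grp b)" using g(2)[OF j(1)] nthB[OF j(1)] by blast
  next
    fix a assume "a \<in> (\<Union>b\<in>B. grp b)"
    then obtain b where b: "b \<in> B" "a \<in> grp b" by blast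
    have "gs ! pos b \<in> set gs" using ex[OF b(1)] by simp
    then show "a \<in> set (concat gs)" using posg[OF b(1)] b(2) by (auto simp: set_concat)
  qed
  show ?thesis
  proof (rule that[of pos, OF dist un])
  qed (use ex posg nthB pos in blast)+
qed

text \<open>A label below the completion of another one is its restriction to a subset of its
  domain, proper if the labels differ. The size of the domain can therefore serve as rank in the
  triangularity of the design matrix.\<close>

lemma star_below_fill:
  assumes i: "i \<in> cells_star I z D" and i': "i' \<in> cells_star I z D'" and A: "D' \<subseteq> A" "finite A"
    and le: "i \<subseteq>\<^sub>m fill z A i'" and ne: "i \<noteq> i'"
  shows "card (dom i) < card (dom i')"
proof -
  have "dom (fill z A i') = A" by (auto simp: fill_apply dom_def split: if_splits)
  from iffD1[OF star_le_iff[OF i this] le]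
  have D: "D \<subseteq> D'" "fill z A i' |` D = i" unfolding supp_fill[OF i' A(1)] by blast+
  have "D \<noteq> D'" using D(2) restrict_fill[OF i' A(1)] ne by blast
  then have "card D < card D'" using D(1) finite_subset[OF A] by (intro psubset_card_mono) auto
  then show ?thesis unfolding star_dom[OF i] star_dom[OF i'] .
qed

lemma fill_le: "dom i \<subseteq> A \<Longrightarrow> i \<subseteq>\<^sub>m fill z A i"
  by (auto simp: map_le_def fill_apply)

lemma fill_add: "fill z A i ++ fill z B i = fill z (A \<union> B) i"
  by (rule ext) (auto simp: fill_apply map_add_def split: option.splits)

lemma sum_feature:
  fixes h :: "'b \<Rightarrow> real"
  assumes L: "finite L" "A \<subseteq> L" and ce: "bij_betw ce A G" and h: "\<And>a. a \<in> A \<Longrightarrow> v a = h (ce a)"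
  shows "(\<Sum>a\<in>L. v a * (if a \<in> A \<and> P (ce a) then 1 else 0)) = (\<Sum>i\<in>{i \<in> G. P i}. h i)"
proof -
  have "(\<Sum>a\<in>L. v a * (if a \<in> A \<and> P (ce a) then 1 else 0)) = (\<Sum>a\<in>{a \<in> A. P (ce a)}. h (ce a))"
    by (rule sum.mono_neutral_cong_right[OF L(1)]) (use L(2) h in auto)
  also have "\<dots> = (\<Sum>i\<in>{i \<in> G. P i}. h i)"
  proof (rule sum.reindex_bij_betw)
    show "bij_betw ce {a \<in> A. P (ce a)} {i \<in> G. P i}"
      using ce unfolding bij_betw_def by (auto intro: inj_on_subset)
  qed
  finally show ?thesis .
qed

context clique_model begin

lemma base_not_above:
  assumes "l < n" "s \<in> cl (S l)" "i \<in> clique_labels l"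
  shows "\<not> i \<subseteq>\<^sub>m s ++ base_cell z (Rd l)"
proof
  assume le: "i \<subseteq>\<^sub>m s ++ base_cell z (Rd l)"
  obtain D where D: "D \<subseteq> Cs ! l" "D \<inter> Rd l \<noteq> {}" "i \<in> cells_star I z D" using assms(3) by (auto simp: clique_labels_def)
  have dS: "dom s = S l" by (rule dom_cells[OF assms(2)])
  have "dom (s ++ base_cell z (Rd l)) = Rd l \<union> S l" using dS by simp
  from iffD1[OF star_le_iff[OF D(3) this] le]
  have "D \<subseteq> supp z (s ++ base_cell z (Rd l))" by blast
  moreover have "supp z (s ++ base_cell z (Rd l)) = supp z s"
    using dS SR(2)[of l] by (subst supp_add) (auto simp: supp_def base_cell_def restrict_map_def split: if_splits)
  ultimately have "D \<subseteq> S l" using supp_subset[of z s] dS by simp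
  then show False using D(2) SR(2)[of l] by blast
qed

lemma base_not_above':
  assumes "i \<in> residual_labels l"
  shows "\<not> i \<subseteq>\<^sub>m base_cell z (Rd l)"
proof
  assume le: "i \<subseteq>\<^sub>m base_cell z (Rd l)"
  obtain D where D: "D \<noteq> {}" "i \<in> cells_star I z D" using assms by (auto simp: residual_labels_def)
  from iffD1[OF star_le_iff[OF D(2) dom_base_cell] le]
  have "D \<subseteq> supp z (base_cell z (Rd l))" by blast
  moreover have "supp z (base_cell z (Rd l)) = {}"
    by (auto simp: supp_def base_cell_def restrict_map_def split: if_splits)
  ultimately show False using D(1) by simp
qed

text \<open>Shared by theta^cliq, where \<phi> is the identity, and theta^mod, where it is the
  passage to theta^cliq. The two differ in their labels: \<open>ce\<close> extracts the cell from a
  label and \<open>h\<close> presents the coordinates by clique and cell.\<close>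

theorem reference_prior_clique_features:
  fixes gs :: "'k list list" and ce :: "'k \<Rightarrow> ('v, 'a) cell"
  assumes N: "N \<ge> 1" and og: "ordered_grouping {..<n} grp bs gs"
    and ce: "\<And>l. l < n \<Longrightarrow> bij_betw ce (grp l) (clique_labels l)"
    and disj: "\<And>l l'. l < n \<Longrightarrow> l' < n \<Longrightarrow> l \<noteq> l' \<Longrightarrow> grp l \<inter> grp l' = {}"
    and cont: "\<And>a. continuous_on UNIV (\<lambda>u. \<phi> u a)" "\<And>a. continuous_on UNIV (t a)"
    and \<phi>: "\<And>a u. a \<in> set (concat gs) \<Longrightarrow> \<phi> u a = u a + t a (\<phi> u)"
      "\<And>a u. a \<notin> set (concat gs) \<Longrightarrow> \<phi> u a = u a"
    and t: "\<And>j a v w. j < length gs \<Longrightarrow> a \<in> set (gs ! j) \<Longrightarrow>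
        (\<And>b. b \<in> set (concat (take j gs)) \<Longrightarrow> v b = w b) \<Longrightarrow> t a v = t a w"
    and diff: "\<And>u a c. \<exists>d. ((\<lambda>\<tau>. \<phi> (u(a := \<tau>)) c) has_real_derivative d) (at (u a))"
    and h: "\<And>v l a. l < n \<Longrightarrow> a \<in> grp l \<Longrightarrow> v a = h v l (ce a)"
    and prob: "\<And>u. u \<in> parameter_space gs \<Longrightarrow>
        prob_of V E I \<Theta> u = restrict (kernel_product (logit_kernel (cliq_logit (h (\<phi> u))))) (cl V)"
  shows "reference_prior_proportional_to (counts (cl V) N) (multinomial_model V E I N \<Theta>) gs
     (\<lambda>u. prior_prob V I Cs (prob_of V E I \<Theta> u))"
proof -
  obtain pos where dist: "distinct (concat gs)" and L: "set (concat gs) = (\<Union>l\<in>{..<n}. grp l)"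
    and pos': "\<And>b. b \<in> {..<n} \<Longrightarrow> pos b < length gs" "\<And>b. b \<in> {..<n} \<Longrightarrow> bs ! pos b = b"
      "\<And>b. b \<in> {..<n} \<Longrightarrow> set (gs ! pos b) = grp b"
      "\<And>j. j < length gs \<Longrightarrow> bs ! j \<in> {..<n}" "\<And>j. j < length gs \<Longrightarrow> pos (bs ! j) = j"
    by (rule ordered_groupingE[OF og]) (use disj in auto)
  note pos = pos'[unfolded lessThan_iff]
  define lab where "lab a = (THE l. l < n \<and> a \<in> grp l)" for a
  have lab: "lab a = l" if "l < n" "a \<in> grp l" for a l
    unfolding lab_def by (rule the_equality) (use that disj in blast)+
  have group: "bs ! j < n" "set (gs ! j) = grp (bs ! j)" if "j < length gs" for j
    using pos(4)[OF that] pos(3)[OF pos(4)[OF that]] pos(5)[OF that] by simp_all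
  \<comment> \<open>All conditional tables of one clique, for all its separator cells, share the
    group of that clique.\<close>
  define \<beta> where "\<beta> k = pos (fst k)" for k :: "nat \<times> ('v, 'a) cell"
  define tot where "tot k r = snd k ++ r" for k :: "nat \<times> ('v, 'a) cell" and r :: "('v, 'a) cell"
  define \<kappa> where "\<kappa> a = ((lab a, fill z (S (lab a)) (ce a)), fill z (Rd (lab a)) (ce a))" for a
  have Keys: "fst k < n" "snd k \<in> cl (S (fst k))" if "k \<in> Keys" for k
    using that Keys_iff[of "fst k" "snd k"] by simp_all
  have total: "tot (fst (\<kappa> a)) (snd (\<kappa> a)) = fill z (Cs ! l) (ce a)" if "l < n" "a \<in> grp l" for a l
    unfolding tot_def \<kappa>_def using fill_add[of z "S l" "ce a" "Rd l"] SR(1)[of l] by (simp add: lab[OF that])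
  have label: "\<exists>D. D \<subseteq> Cs ! l \<and> D \<inter> Rd l \<noteq> {} \<and> ce a \<in> cells_star I z D" if "l < n" "a \<in> grp l" for a l
    using bij_betwE[OF ce[OF that(1)]] that(2) unfolding clique_labels_def by blast
  have "feature_model V E I z Cs N gs \<beta> ce tot \<kappa> \<phi> t \<Theta>"
  proof (intro feature_model.intro feature_model_axioms.intro)
    show "clique_model V E I z Cs" by (rule clique_model_axioms)
    show "\<beta> k < length gs" if "k \<in> Keys" for k unfolding \<beta>_def by (rule pos(1)[OF Keys(1)[OF that]])
    show "fst k = fst k'" if k: "k \<in> Keys" "k' \<in> Keys" "\<beta> k = \<beta> k'" for k k'
      using pos(2)[OF Keys(1)[OF k(1)]] pos(2)[OF Keys(1)[OF k(2)]] k(3) unfolding \<beta>_def by metis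
    show "bij_betw \<kappa> (set (gs ! j))
        (SIGMA k:{k \<in> Keys. \<beta> k = j}. cl (Rd (fst k)) - {base_cell z (Rd (fst k))})" if j: "j < length gs" for j
    proof -
      let ?l = "bs ! j"
      let ?\<kappa> = "(\<lambda>(s, r). ((?l, s), r)) \<circ> ((\<lambda>i. (fill z (S ?l) i, fill z (Rd ?l) i)) \<circ> ce)"
      have l: "?l < n" by (rule group(1)[OF j])
      have eq: "{k \<in> Keys. \<beta> k = j} = Pair ?l ` cl (S ?l)"
      proof (intro equalityI subsetI)
        fix k assume k: "k \<in> {k \<in> Keys. \<beta> k = j}"
        then have "fst k = ?l" using pos(2)[OF Keys(1)[of k]] by (simp add: \<beta>_def)
        then show "k \<in> Pair ?l ` cl (S ?l)" using Keys(2)[of k] k by (cases k) auto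
      next
        fix k assume "k \<in> Pair ?l ` cl (S ?l)"
        then show "k \<in> {k \<in> Keys. \<beta> k = j}" using l pos(5)[OF j] by (auto simp: \<beta>_def Keys_iff)
      qed
      have "bij_betw ?\<kappa> (grp ?l) ((\<lambda>(s, r). ((?l, s), r)) ` (cl (S ?l) \<times> (cl (Rd ?l) - {base_cell z (Rd ?l)})))"
        by (rule bij_betw_trans[OF bij_betw_trans[OF ce[OF l] bij_clique_labels[OF l]]])
           (rule bij_betw_imageI, auto simp: inj_on_def)
      moreover have "(\<lambda>(s, r). ((?l, s), r)) ` (cl (S ?l) \<times> (cl (Rd ?l) - {base_cell z (Rd ?l)})) =
          (SIGMA k:{k \<in> Keys. \<beta> k = j}. cl (Rd (fst k)) - {base_cell z (Rd (fst k))})"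
        unfolding eq by (auto simp: image_iff)
      moreover have "?\<kappa> a = \<kappa> a" if "a \<in> grp ?l" for a by (simp add: \<kappa>_def lab[OF l that])
      ultimately show ?thesis unfolding group(2)[OF j] using bij_betw_cong[of "grp ?l" ?\<kappa> \<kappa>] by simp
    qed
    show "ce a \<subseteq>\<^sub>m tot (fst (\<kappa> a)) (snd (\<kappa> a))" if a: "j < length gs" "a \<in> set (gs ! j)" for j a
    proof -
      have l: "bs ! j < n" "a \<in> grp (bs ! j)" using group[OF a(1)] a(2) by simp_all
      obtain D where "D \<subseteq> Cs ! (bs ! j)" "ce a \<in> cells_star I z D" using label[OF l] by blast
      then show ?thesis unfolding total[OF l] by (intro fill_le) (simp add: star_dom)
    qed
    show "card (dom (ce a)) < card (dom (ce b))"
      if a: "j < length gs" "a \<in> set (gs ! j)" "b \<in> set (gs ! j)" "a \<noteq> b" "ce a \<subseteq>\<^sub>m tot (fst (\<kappa> b)) (snd (\<kappa> b))" for j a b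
    proof -
      have l: "bs ! j < n" "a \<in> grp (bs ! j)" "b \<in> grp (bs ! j)" using group[OF a(1)] a(2,3) by simp_all
      obtain D where D: "ce a \<in> cells_star I z D" using label[OF l(1,2)] by blast
      obtain D' where D': "D' \<subseteq> Cs ! (bs ! j)" "ce b \<in> cells_star I z D'" using label[OF l(1,3)] by blast
      have "ce a \<noteq> ce b" using ce[OF l(1)] l(2,3) a(4) unfolding bij_betw_def inj_on_def by blast
      then show ?thesis
        using star_below_fill[OF D D'(2,1) finite_sub[OF C_sub[OF l(1)]]] a(5) unfolding total[OF l(1,3)] by simp
    qed
    show "\<not> ce a \<subseteq>\<^sub>m tot k (base_cell z (Rd (fst k)))" if k: "k \<in> Keys" "a \<in> set (gs ! \<beta> k)" for k a
      unfolding tot_def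
      by (rule base_not_above[OF Keys[OF k(1)]])
         (use k(2) bij_betwE[OF ce[OF Keys(1)[OF k(1)]]] pos(3)[OF Keys(1)[OF k(1)]] in \<open>simp add: \<beta>_def\<close>)
    show "prob_of V E I \<Theta> u = restrict (partial_product (\<lambda>l s r.
        exp (\<Sum>a\<in>set (concat gs). \<phi> u a * (if a \<in> set (gs ! \<beta> (l, s)) \<and> ce a \<subseteq>\<^sub>m tot (l, s) r then 1 else 0)) /
        (\<Sum>r'\<in>cl (Rd l). exp (\<Sum>a\<in>set (concat gs). \<phi> u a *
           (if a \<in> set (gs ! \<beta> (l, s)) \<and> ce a \<subseteq>\<^sub>m tot (l, s) r' then 1 else 0)))) n) (cl V)"
      if u: "u \<in> parameter_space gs" for u
      unfolding prob[OF u]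
    proof (rule restrict_ext, rule kernel_product_cong, assumption)
      fix l s r assume l: "l < n" and s: "s \<in> cl (S l)" and r: "r \<in> cl (Rd l)"
      have "(\<Sum>a\<in>set (concat gs). \<phi> u a * (if a \<in> set (gs ! \<beta> (l, s)) \<and> ce a \<subseteq>\<^sub>m tot (l, s) r then 1 else 0)) =
          cliq_logit (h (\<phi> u)) l s r" if r: "r \<in> cl (Rd l)" for r
      proof -
        have "(\<Sum>a\<in>set (concat gs). \<phi> u a * (if a \<in> grp l \<and> ce a \<subseteq>\<^sub>m s ++ r then 1 else 0)) =
            (\<Sum>i\<in>{i \<in> clique_labels l. i \<subseteq>\<^sub>m s ++ r}. h (\<phi> u) l i)"
          by (rule sum_feature[where v = "\<phi> u" and h = "h (\<phi> u) l", OF finite_set _ ce[OF l] h[OF l]]) (use L l in auto)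
        then show ?thesis unfolding cliq_logit_feature[OF s r] by (simp add: \<beta>_def tot_def pos(3)[OF l])
      qed
      note eq = this
      show "logit_kernel (cliq_logit (h (\<phi> u))) l s r = exp (\<Sum>a\<in>set (concat gs). \<phi> u a *
            (if a \<in> set (gs ! \<beta> (l, s)) \<and> ce a \<subseteq>\<^sub>m tot (l, s) r then 1 else 0)) /
          (\<Sum>r'\<in>cl (Rd l). exp (\<Sum>a\<in>set (concat gs). \<phi> u a *
             (if a \<in> set (gs ! \<beta> (l, s)) \<and> ce a \<subseteq>\<^sub>m tot (l, s) r' then 1 else 0)))"
        unfolding logit_kernel_def eq[OF r] by (simp only: eq cong: sum.cong)
    qed
  qed (rule N dist cont \<phi> t diff, assumption?, assumption?, assumption?)+
  then show ?thesis by (rule feature_model.reference_prior_prior_prob)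
qed

text \<open>Here each group parametrizes a single conditional table, so the index of the group
  already names the table and \<kappa> has only the cell to complete.\<close>

theorem reference_prior_conditional_features:
  fixes gs :: "((nat \<times> ('v, 'a) cell) \<times> ('v, 'a) cell) list list"
  assumes N: "N \<ge> 1" and og: "ordered_grouping Keys (\<lambda>k. Pair k ` residual_labels (fst k)) bs gs"
    and prob: "\<And>u. u \<in> parameter_space gs \<Longrightarrow>
        prob_of V E I \<Theta> u = restrict (kernel_product (logit_kernel (cond_logit (\<lambda>k i. u (k, i))))) (cl V)"
  shows "reference_prior_proportional_to (counts (cl V) N) (multinomial_model V E I N \<Theta>) gs
     (\<lambda>u. prior_prob V I Cs (prob_of V E I \<Theta> u))"
proof -
  obtain pos where dist: "distinct (concat gs)" and L: "set (concat gs) = (\<Union>k\<in>Keys. Pair k ` residual_labels (fst k))"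
    and pos: "\<And>b. b \<in> Keys \<Longrightarrow> pos b < length gs" "\<And>b. b \<in> Keys \<Longrightarrow> bs ! pos b = b"
      "\<And>b. b \<in> Keys \<Longrightarrow> set (gs ! pos b) = Pair b ` residual_labels (fst b)"
      "\<And>j. j < length gs \<Longrightarrow> bs ! j \<in> Keys" "\<And>j. j < length gs \<Longrightarrow> pos (bs ! j) = j"
    by (rule ordered_groupingE[OF og]) auto
  have group: "set (gs ! j) = Pair (bs ! j) ` residual_labels (fst (bs ! j))" if "j < length gs" for j
    using pos(3)[OF pos(4)[OF that]] pos(5)[OF that] by simp
  have Keys: "fst k < n" if "k \<in> Keys" for k
    using that Keys_iff[of "fst k" "snd k"] by simp
  define tot where "tot k r = r" for k :: "nat \<times> ('v, 'a) cell" and r :: "('v, 'a) cell"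
  define \<kappa> where "\<kappa> a = (fst a, fill z (Rd (fst (fst a))) (snd a))" for a :: "(nat \<times> ('v, 'a) cell) \<times> ('v, 'a) cell"
  have "feature_model V E I z Cs N gs pos snd tot \<kappa> (\<lambda>u. u) (\<lambda>_ _. 0) \<Theta>"
  proof (intro feature_model.intro feature_model_axioms.intro)
    show "clique_model V E I z Cs" by (rule clique_model_axioms)
    show "fst k = fst k'" if k: "k \<in> Keys" "k' \<in> Keys" "pos k = pos k'" for k k'
      using pos(2)[OF k(1)] pos(2)[OF k(2)] k(3) by metis
    show "bij_betw \<kappa> (set (gs ! j))
        (SIGMA k:{k \<in> Keys. pos k = j}. cl (Rd (fst k)) - {base_cell z (Rd (fst k))})" if j: "j < length gs" for j
    proof -
      let ?k = "bs ! j"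
      have l: "fst ?k < n" by (rule Keys[OF pos(4)[OF j]])
      have eq: "{k \<in> Keys. pos k = j} = {?k}" using pos(2) pos(4,5)[OF j] by auto
      have "bij_betw (Pair ?k \<circ> (fill z (Rd (fst ?k)) \<circ> snd)) (Pair ?k ` residual_labels (fst ?k))
          (Pair ?k ` (cl (Rd (fst ?k)) - {base_cell z (Rd (fst ?k))}))"
        by (rule bij_betw_trans[OF bij_betw_trans[OF _ bij_residual_labels[OF l]]])
           (auto simp: bij_betw_def inj_on_def image_iff)
      moreover have "Pair ?k ` (cl (Rd (fst ?k)) - {base_cell z (Rd (fst ?k))}) =
          (SIGMA k:{k \<in> Keys. pos k = j}. cl (Rd (fst k)) - {base_cell z (Rd (fst k))})"
        unfolding eq by (auto simp: image_iff)
      moreover have "(Pair ?k \<circ> (fill z (Rd (fst ?k)) \<circ> snd)) a = \<kappa> a" if "a \<in> Pair ?k ` residual_labels (fst ?k)" for a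
        using that by (auto simp: \<kappa>_def)
      ultimately show ?thesis unfolding group[OF j]
        using bij_betw_cong[of "Pair ?k ` residual_labels (fst ?k)" "Pair ?k \<circ> (fill z (Rd (fst ?k)) \<circ> snd)" \<kappa>] by simp
    qed
    show "snd a \<subseteq>\<^sub>m tot (fst (\<kappa> a)) (snd (\<kappa> a))" if a: "j < length gs" "a \<in> set (gs ! j)" for j a
    proof -
      have a': "fst a = bs ! j" "snd a \<in> residual_labels (fst (bs ! j))" using a(2) unfolding group[OF a(1)] by auto
      then obtain D where "D \<subseteq> Rd (fst (bs ! j))" "snd a \<in> cells_star I z D" by (auto simp: residual_labels_def)
      then show ?thesis unfolding tot_def \<kappa>_def using a'(1) by (simp add: star_dom fill_le)
    qed
    show "card (dom (snd a)) < card (dom (snd b))"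
      if a: "j < length gs" "a \<in> set (gs ! j)" "b \<in> set (gs ! j)" "a \<noteq> b" "snd a \<subseteq>\<^sub>m tot (fst (\<kappa> b)) (snd (\<kappa> b))" for j a b
    proof -
      have a': "fst a = bs ! j" "snd a \<in> residual_labels (fst (bs ! j))" using a(2) unfolding group[OF a(1)] by auto
      have b': "fst b = bs ! j" "snd b \<in> residual_labels (fst (bs ! j))" using a(3) unfolding group[OF a(1)] by auto
      obtain D where D: "snd a \<in> cells_star I z D" using a'(2) by (auto simp: residual_labels_def)
      obtain D' where D': "D' \<subseteq> Rd (fst (bs ! j))" "snd b \<in> cells_star I z D'" using b'(2) by (auto simp: residual_labels_def)
      have "snd a \<noteq> snd b" using a'(1) b'(1) a(4) by (metis prod_eqI)
      then show ?thesis
        using star_below_fill[OF D D'(2,1) finite_sub[OF sub_V(2)[OF Keys[OF pos(4)[OF a(1)]]]]] a(5) b'(1)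
        by (simp add: tot_def \<kappa>_def)
    qed
    show "\<not> snd a \<subseteq>\<^sub>m tot k (base_cell z (Rd (fst k)))" if k: "k \<in> Keys" "a \<in> set (gs ! pos k)" for k a
      unfolding tot_def by (rule base_not_above') (use k(2) pos(3)[OF k(1)] in auto)
    show "\<exists>d. ((\<lambda>\<tau>. (u(a := \<tau>)) c) has_real_derivative d) (at (u a))"
      for u :: "(nat \<times> ('v, 'a) cell) \<times> ('v, 'a) cell \<Rightarrow> real" and a c
      by (cases "a = c") (auto intro!: exI derivative_eq_intros)
    show "prob_of V E I \<Theta> u = restrict (partial_product (\<lambda>l s r.
        exp (\<Sum>a\<in>set (concat gs). u a * (if a \<in> set (gs ! pos (l, s)) \<and> snd a \<subseteq>\<^sub>m tot (l, s) r then 1 else 0)) /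
        (\<Sum>r'\<in>cl (Rd l). exp (\<Sum>a\<in>set (concat gs). u a *
           (if a \<in> set (gs ! pos (l, s)) \<and> snd a \<subseteq>\<^sub>m tot (l, s) r' then 1 else 0)))) n) (cl V)"
      if u: "u \<in> parameter_space gs" for u
      unfolding prob[OF u]
    proof (rule restrict_ext, rule kernel_product_cong, assumption)
      fix l s r assume l: "l < n" and s: "s \<in> cl (S l)" and r: "r \<in> cl (Rd l)"
      have k: "(l, s) \<in> Keys" using l s by (simp add: Keys_iff)
      have eq: "(\<Sum>a\<in>set (concat gs). u a * (if a \<in> set (gs ! pos (l, s)) \<and> snd a \<subseteq>\<^sub>m tot (l, s) r then 1 else 0)) =
          cond_logit (\<lambda>k i. u (k, i)) l s r" if r: "r \<in> cl (Rd l)" for r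
      proof -
        have "(\<Sum>a\<in>set (concat gs). u a * (if a \<in> Pair (l, s) ` residual_labels l \<and> snd a \<subseteq>\<^sub>m r then 1 else 0)) =
            (\<Sum>i\<in>{i \<in> residual_labels l. i \<subseteq>\<^sub>m r}. u ((l, s), i))"
          by (rule sum_feature[OF finite_set]) (use L k in \<open>auto simp: bij_betw_def inj_on_def image_iff\<close>)
        then show ?thesis using pos(3)[OF k] cond_logit_feature[OF r, of "\<lambda>k i. u (k, i)" s] by (simp add: tot_def)
      qed
      show "logit_kernel (cond_logit (\<lambda>k i. u (k, i))) l s r = exp (\<Sum>a\<in>set (concat gs). u a *
            (if a \<in> set (gs ! pos (l, s)) \<and> snd a \<subseteq>\<^sub>m tot (l, s) r then 1 else 0)) /
          (\<Sum>r'\<in>cl (Rd l). exp (\<Sum>a\<in>set (concat gs). u a *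
             (if a \<in> set (gs ! pos (l, s)) \<and> snd a \<subseteq>\<^sub>m tot (l, s) r' then 1 else 0)))"
        unfolding logit_kernel_def eq[OF r] by (simp only: eq cong: sum.cong)
    qed
    show "continuous_on UNIV (\<lambda>u. u a)" for a :: "(nat \<times> ('v, 'a) cell) \<times> ('v, 'a) cell"
      by (rule continuous_on_product_coordinates)
  qed (insert N, simp_all add: dist pos(1))
  then show ?thesis by (rule feature_model.reference_prior_prior_prob)
qed

section \<open>Inverting theta^cond and theta^cliq\<close>

lemma prob_of_eq:
  assumes left: "\<And>p. p \<in> positive_markov V E I \<Longrightarrow> P (\<Theta> p) = p"
    and u: "P u \<in> positive_markov V E I" "\<Theta> (P u) = u"
  shows "prob_of V E I \<Theta> u = P u"
proof -
  \<comment> \<open>\<open>prob_of\<close> is an inverse on the image. A left inverse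
    \<open>P\<close> gives injectivity, and the right inverse property at \<open>u\<close> then
    identifies the value.\<close>
  have "inj_on \<Theta> (positive_markov V E I)" by (rule inj_on_inverseI[where g = P]) (rule left)
  then show ?thesis unfolding prob_of_def using u(2,1) by (rule the_inv_into_f_eq)
qed

lemma partial_cells:
  assumes i: "i \<in> cells_star I z D" and F: "F \<subseteq> D" and D: "D \<subseteq> A" and A: "A \<subseteq> V"
  shows "(i |` F) ++ base_cell z (A - F) \<in> cl A"
proof -
  have "base_cell z (A - F) \<in> cl (A - F)" by (rule base_cells) (use A in blast)
  from cells_add[OF cells_restrict[OF cells_star_cells[OF i] F] this]
  show ?thesis using F D by (simp add: Un_absorb1 subset_trans)
qed

lemma log_linear_Mob:
  assumes i: "i \<in> cells_star I z D" and D: "D \<subseteq> A" and A: "A \<subseteq> V"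
    and f: "\<And>y. y \<in> cl A \<Longrightarrow> 0 < f y" "\<And>y. y \<in> cl A \<Longrightarrow> f y = g y"
  shows "log_linear z A f i = Mob z A (\<lambda>y. ln (g y)) i"
proof -
  have di: "dom i = D" by (rule star_dom[OF i])
  have "log_linear z A f i = Mob z A (\<lambda>y. ln (f y)) i"
    by (rule log_linear_eq_Mob)
       (use finite_sub[OF subset_trans[OF D A]] partial_cells[OF i _ D A] f(1) in \<open>simp_all add: di\<close>)
  also have "\<dots> = Mob z A (\<lambda>y. ln (g y)) i"
    by (rule Mob_cong) (use partial_cells[OF i _ D A] f(2) in \<open>simp add: di\<close>)
  finally show ?thesis .
qed

lemma cl_S_0: "cl (S 0) = {Map.empty}"
  by (auto simp: cells_iff)

lemma marginal_pos:
  assumes "cond_kernel q" "l < n" "y \<in> cl (Cs ! l)" "\<And>x. x \<in> cl V \<Longrightarrow> p x = kernel_product q x"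
  shows "0 < marginal V I p y"
  using marginal_clique'[where p = p, OF assms(1-3) assms(4)] w_pos[OF assms(1,2) clique_split(2)[OF assms(3)]]
    cond_kernel_pos[OF assms(1,2) clique_split(2,3)[OF assms(3)]] by simp

lemma theta_cond_label:
  assumes q: "cond_kernel q" and p: "\<And>x. x \<in> cl V \<Longrightarrow> p x = kernel_product q x" and k: "l < n" "s \<in> cl (S l)" and i: "i \<in> residual_labels l"
  shows "theta_cond V I z Cs p ((l, s), i) = Mob z (Rd l) (\<lambda>r. ln (q l s r)) i"
proof -
  have key: "(l, s) \<in> Keys" using k by (simp add: Keys_iff)
  then have "((l, s), i) \<in> (\<Union>g\<in>cond_groups I Cs. cond_group I z Cs g)"
    unfolding cond_groups_eq using cond_group_eq[OF key] i by (intro UN_I[of "(l, s)"]) auto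
  then have "theta_cond V I z Cs p ((l, s), i) =
      log_linear z (Rd l) (\<lambda>r. if l = 0 then marginal V I p r else conditional V I p s r) i"
    unfolding theta_cond_def by simp
  also have "\<dots> = Mob z (Rd l) (\<lambda>r. ln (q l s r)) i"
  proof -
    obtain D where D: "D \<subseteq> Rd l" "i \<in> cells_star I z D" using i by (auto simp: residual_labels_def)
    \<comment> \<open>The definition treats the first clique through its marginal; with the empty
      separator of weight 1 this is again the conditional table.\<close>
    have eq: "(if l = 0 then marginal V I p r else conditional V I p s r) = q l s r" if r: "r \<in> cl (Rd l)" for r
    proof (cases "l = 0")
      case True
      have s: "s = Map.empty" using k(2) cl_S_0 unfolding True by blast
      have r': "r \<in> cl (Cs ! 0)" using r unfolding True by simp
      have "marginal V I p r = w q 0 (r |` S 0) * q 0 (r |` S 0) (r |` Rd 0)"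
        by (rule marginal_clique'[OF q n_pos r']) (rule p)
      moreover have "r |` Rd 0 = r" using dom_cells[OF r'] by (intro restrict_dom) simp
      moreover have "r |` S 0 = Map.empty" unfolding S_0 by (rule restrict_empty_set)
      ultimately show ?thesis using True s by (simp add: w_0)
    next
      case False
      then show ?thesis using conditional_eq[OF q k r, of p] p by simp
    qed
    show ?thesis
      by (rule log_linear_Mob[OF D(2,1) sub_V(2)[OF k(1)]]) (simp_all add: eq cond_kernel_pos[OF q k])
  qed
  finally show ?thesis .
qed

text \<open>Every positive Markov table is a product of conditional tables, which their interactions
  determine; conversely any real coordinates are the interactions of logit kernels. Off the labels
  both sides are \<open>undefined\<close>.\<close>

lemma prob_of_cond:
  assumes u: "u \<in> extensional (\<Union>k\<in>Keys. Pair k ` residual_labels (fst k))"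
  shows "prob_of V E I (theta_cond V I z Cs) u = restrict (kernel_product (logit_kernel (cond_logit (\<lambda>k i. u (k, i))))) (cl V)"
proof (rule prob_of_eq[where P = "\<lambda>u. restrict (kernel_product (logit_kernel (cond_logit (\<lambda>k i. u (k, i))))) (cl V)"])
  fix p assume "p \<in> positive_markov V E I"
  from positive_markov_factorization[OF this]
  obtain q where q: "cond_kernel q" "p = restrict (kernel_product q) (cl V)" by blast
  have p: "p x = kernel_product q x" if "x \<in> cl V" for x using q(2) that by simp
  show "restrict (kernel_product (logit_kernel (cond_logit (\<lambda>k i. theta_cond V I z Cs p (k, i))))) (cl V) = p"
    unfolding q(2)
  proof (rule restrict_ext)
    fix x assume x: "x \<in> cl V"
    show "kernel_product (logit_kernel (cond_logit (\<lambda>k i. theta_cond V I z Cs (restrict (kernel_product q) (cl V)) (k, i)))) x = kernel_product q x"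
      by (rule kernel_product_eq_cond_logit[OF q(1) theta_cond_label[OF q(1)] x, symmetric]) simp_all
  qed
next
  let ?P = "restrict (kernel_product (logit_kernel (cond_logit (\<lambda>k i. u (k, i))))) (cl V)"
  show "?P \<in> positive_markov V E I" by (rule kernel_product_markov[OF cond_kernel_logit_kernel])
  show "theta_cond V I z Cs ?P = u"
  proof
    fix a :: "(nat \<times> ('v, 'a) cell) \<times> ('v, 'a) cell"
    obtain l s i where a: "a = ((l, s), i)" by (metis surj_pair)
    have un: "(\<Union>g\<in>cond_groups I Cs. cond_group I z Cs g) = (\<Union>k\<in>Keys. Pair k ` residual_labels (fst k))"
      unfolding cond_groups_eq by (rule SUP_cong[OF refl cond_group_eq])
    show "theta_cond V I z Cs ?P a = u a"
    proof (cases "(l, s) \<in> Keys \<and> i \<in> residual_labels l")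
      case True
      then have k: "l < n" "s \<in> cl (S l)" "i \<in> residual_labels l" by (auto simp: Keys_iff)
      have "theta_cond V I z Cs ?P ((l, s), i) = Mob z (Rd l) (\<lambda>r. ln (logit_kernel (cond_logit (\<lambda>k i. u (k, i))) l s r)) i"
        by (rule theta_cond_label[OF cond_kernel_logit_kernel _ k]) simp
      then show ?thesis unfolding a Mob_cond_logit[OF k(1,3)] .
    next
      case False
      then have na: "a \<notin> (\<Union>k\<in>Keys. Pair k ` residual_labels (fst k))" unfolding a by auto
      then show ?thesis unfolding theta_cond_def un using extensional_arb[OF u na] by (simp only: restrict_apply if_False)
    qed
  qed
qed

lemma theta_cliq_label:
  assumes q: "cond_kernel q" and p: "\<And>x. x \<in> cl V \<Longrightarrow> p x = kernel_product q x" and l: "l < n" and i: "i \<in> clique_labels l"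
  shows "theta_cliq V I z Cs p (l, i) = Mob z (Cs ! l) (\<lambda>y. ln (q l (y |` S l) (y |` Rd l))) i"
proof -
  obtain D where D: "D \<subseteq> Cs ! l" "i \<in> cells_star I z D" using i by (auto simp: clique_labels_def)
  have "(l, i) \<in> (\<Union>l<n. cliq_group I z Cs l)" using l i unfolding cliq_group_eq by blast
  then have "theta_cliq V I z Cs p (l, i) = log_linear z (Cs ! l) (marginal V I p) i"
    unfolding theta_cliq_def by simp
  also have "\<dots> = Mob z (Cs ! l) (\<lambda>y. ln (1 * marginal V I p y)) i"
    by (rule log_linear_Mob[OF D(2,1) C_sub[OF l]]) (simp_all add: marginal_pos[where p = p, OF q l _ p])
  also have "\<dots> = Mob z (Cs ! l) (\<lambda>y. ln (q l (y |` S l) (y |` Rd l))) i"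
    by (rule Mob_ln_marginal[OF q l i _ p]) simp_all
  finally show ?thesis .
qed

lemma prob_of_cliq:
  assumes u: "u \<in> extensional (\<Union>l<n. Pair l ` clique_labels l)"
  shows "prob_of V E I (theta_cliq V I z Cs) u = restrict (kernel_product (logit_kernel (cliq_logit (\<lambda>l i. u (l, i))))) (cl V)"
proof (rule prob_of_eq[where P = "\<lambda>u. restrict (kernel_product (logit_kernel (cliq_logit (\<lambda>l i. u (l, i))))) (cl V)"])
  fix p assume "p \<in> positive_markov V E I"
  from positive_markov_factorization[OF this]
  obtain q where q: "cond_kernel q" "p = restrict (kernel_product q) (cl V)" by blast
  show "restrict (kernel_product (logit_kernel (cliq_logit (\<lambda>l i. theta_cliq V I z Cs p (l, i))))) (cl V) = p"
    unfolding q(2)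
  proof (rule restrict_ext)
    fix x assume x: "x \<in> cl V"
    show "kernel_product (logit_kernel (cliq_logit (\<lambda>l i. theta_cliq V I z Cs (restrict (kernel_product q) (cl V)) (l, i)))) x = kernel_product q x"
      by (rule kernel_product_eq_cliq_logit[OF q(1) theta_cliq_label[OF q(1)] x, symmetric]) simp_all
  qed
next
  let ?P = "restrict (kernel_product (logit_kernel (cliq_logit (\<lambda>l i. u (l, i))))) (cl V)"
  show "?P \<in> positive_markov V E I" by (rule kernel_product_markov[OF cond_kernel_logit_kernel])
  show "theta_cliq V I z Cs ?P = u"
  proof
    fix a :: "nat \<times> ('v, 'a) cell"
    obtain l i where a: "a = (l, i)" by (metis surj_pair)
    show "theta_cliq V I z Cs ?P a = u a"
    proof (cases "l < n \<and> i \<in> clique_labels l")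
      case True
      then have k: "l < n" "i \<in> clique_labels l" by auto
      have "theta_cliq V I z Cs ?P (l, i) = Mob z (Cs ! l) (\<lambda>y. ln (logit_kernel (cliq_logit (\<lambda>l i. u (l, i))) l (y |` S l) (y |` Rd l))) i"
        by (rule theta_cliq_label[OF cond_kernel_logit_kernel _ k]) simp
      then show ?thesis unfolding a Mob_cliq_logit[OF k] .
    next
      case False
      then have na: "a \<notin> (\<Union>l<n. Pair l ` clique_labels l)" unfolding a by auto
      then show ?thesis unfolding theta_cliq_def cliq_group_eq using extensional_arb[OF u na] by (simp only: restrict_apply if_False)
    qed
  qed
qed

section \<open>Inverting theta^mod and comparing it with theta^cliq\<close>

definition mod_label_set :: "('v, 'a) cell set" where
  "mod_label_set = (\<Union>l<n. clique_labels l)"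

text \<open>The table with prescribed interactions on nonempty complete sets, scaled to 1 at the
  base cell. Leaving it unnormalized avoids a global normalizing constant that depends on
  \<open>u\<close>.\<close>

definition log_additive_table :: "(('v, 'a) cell \<Rightarrow> real) \<Rightarrow> ('v, 'a) cell \<Rightarrow> real" where
  "log_additive_table u x = exp (\<Sum>D\<in>{D. D \<subseteq> supp z x \<and> D \<noteq> {} \<and> complete_in E D}. u (x |` D))"

lemma Mob_log_additive_table:
  assumes "i \<in> mod_label_set"
  shows "Mob z V (\<lambda>x. ln (log_additive_table u x)) i = u i"
proof -
  obtain D where D: "D \<noteq> {}" "D \<subseteq> V" "complete_in E D" "i \<in> cells_star I z D"
    using assms unfolding mod_label_set_def complete_labels[symmetric] by blast
  have "Mob z V (\<lambda>x. ln (log_additive_table u x)) i = (if D \<noteq> {} \<and> complete_in E D then u i else 0)"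
    by (rule Mob_of_restricted_sum[OF D(4,2) finV]) (simp_all add: log_additive_table_def zI)
  then show ?thesis using D by simp
qed

lemma log_additive_table_factorization:
  obtains q Z where "0 < Z" "cond_kernel q" "\<And>x. x \<in> cl V \<Longrightarrow> log_additive_table u x = Z * kernel_product q x"
proof -
  \<comment> \<open>The general factorization also sums over the empty set, which gets the
    coefficient 0.\<close>
  let ?\<theta> = "\<lambda>i. if i = Map.empty then 0 else u i"
  have "log_additive_table u x = exp (\<Sum>D | D \<subseteq> supp z x \<and> complete_in E D. ?\<theta> (x |` D))" if x: "x \<in> cl V" for x
  proof -
    have fin: "finite {D. D \<subseteq> supp z x \<and> complete_in E D}"
      by (rule finite_subset[of _ "Pow (supp z x)"]) (use finite_supp[OF order_refl x] in auto)
    have ne: "x |` D \<noteq> Map.empty" if "D \<subseteq> supp z x" "D \<noteq> {}" for D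
    proof -
      have "dom (x |` D) = D" using that(1) supp_subset[of z x] by auto
      then show ?thesis using that(2) by (metis dom_empty)
    qed
    have "(\<Sum>D | D \<subseteq> supp z x \<and> complete_in E D. ?\<theta> (x |` D)) =
        (\<Sum>D\<in>{D. D \<subseteq> supp z x \<and> D \<noteq> {} \<and> complete_in E D}. u (x |` D))"
      by (rule sum.mono_neutral_cong_right[OF fin]) (use ne in auto)
    then show ?thesis unfolding log_additive_table_def by simp
  qed
  from log_additive_factorization[OF this] show ?thesis using that by blast
qed

text \<open>\<open>\<theta>\<^sup>c\<^sup>l\<^sup>i\<^sup>q\<close> as a function of \<open>\<theta>\<^sup>m\<^sup>o\<^sup>d\<close>, read off the clique marginals of the unnormalized table.\<close>

definition cliq_of_mod :: "(('v, 'a) cell \<Rightarrow> real) \<Rightarrow> ('v, 'a) cell \<Rightarrow> real" where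
  "cliq_of_mod u i = (if i \<in> mod_label_set then Mob z (Cs ! (THE l. l < n \<and> i \<in> clique_labels l))
      (\<lambda>y. ln (marginal V I (log_additive_table u) y)) i else u i)"

text \<open>The difference between theta^{C_l}(i) and theta(i), as a function of theta^cliq: the
  interactions at \<open>i\<close> of the log normalizers of the cliques whose separator contains
  the domain of \<open>i\<close>.\<close>

definition mod_shift :: "('v, 'a) cell \<Rightarrow> (('v, 'a) cell \<Rightarrow> real) \<Rightarrow> real" where
  "mod_shift i v = (\<Sum>l<n. if dom i \<subseteq> S l then Mob z (S l) (log_partition (cliq_logit (\<lambda>_. v)) l) i else 0)"

lemma cliq_of_mod_clique_labels:
  assumes "l < n" "i \<in> clique_labels l"
  shows "cliq_of_mod u i = Mob z (Cs ! l) (\<lambda>y. ln (marginal V I (log_additive_table u) y)) i"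
proof -
  have "(THE l. l < n \<and> i \<in> clique_labels l) = l" by (rule the_equality) (use assms clique_labels_disjoint in blast)+
  moreover have "i \<in> mod_label_set" using assms by (auto simp: mod_label_set_def)
  ultimately show ?thesis by (simp add: cliq_of_mod_def)
qed

lemma marginal_scale:
  assumes "y \<in> cl D" "\<And>x. x \<in> cl V \<Longrightarrow> p x = c * p' x"
  shows "marginal V I p y = c * marginal V I p' y"
  unfolding marginal_def sum_distrib_left by (rule sum.cong) (use assms(2) in auto)

text \<open>The table is a constant times a product of conditional tables. Scaling does not change
  interactions at nonempty labels, so the interactions of its clique marginals are those of the
  conditional tables.\<close>

lemma log_additive_table_normalized:
  obtains Z where "0 < Z" "\<And>x. x \<in> cl V \<Longrightarrow> log_additive_table u x = Z * kernel_product (logit_kernel (cliq_logit (\<lambda>_. cliq_of_mod u))) x"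
proof -
  obtain q Z where q: "0 < Z" "cond_kernel q" and Zq: "\<And>x. x \<in> cl V \<Longrightarrow> log_additive_table u x = Z * kernel_product q x"
    by (rule log_additive_table_factorization[where u = u]) blast
  have eq: "kernel_product q x = kernel_product (logit_kernel (cliq_logit (\<lambda>_. cliq_of_mod u))) x" if x: "x \<in> cl V" for x
  proof (rule kernel_product_eq_cliq_logit[OF q(2) _ x])
    fix l i assume l: "l < n" and i: "i \<in> clique_labels l"
    obtain D where D: "D \<subseteq> Cs ! l" "i \<in> cells_star I z D" using i by (auto simp: clique_labels_def)
    have "cliq_of_mod u i = Mob z (Cs ! l) (\<lambda>y. ln (Z * marginal V I (kernel_product q) y)) i"
      unfolding cliq_of_mod_clique_labels[OF l i]
    proof (rule Mob_cong)
      fix F assume "F \<subseteq> dom i"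
      then have "(i |` F) ++ base_cell z (Cs ! l - F) \<in> cl (Cs ! l)"
        using partial_cells[OF D(2) _ D(1) C_sub[OF l]] star_dom[OF D(2)] by simp
      from marginal_scale[OF this, of "log_additive_table u" Z "kernel_product q"] Zq
      show "ln (marginal V I (log_additive_table u) ((i |` F) ++ base_cell z (Cs ! l - F))) =
          ln (Z * marginal V I (kernel_product q) ((i |` F) ++ base_cell z (Cs ! l - F)))" by simp
    qed
    also have "\<dots> = Mob z (Cs ! l) (\<lambda>y. ln (q l (y |` S l) (y |` Rd l))) i"
      by (rule Mob_ln_marginal[OF q(2) l i q(1)]) (rule refl)
    finally show "cliq_of_mod u i = Mob z (Cs ! l) (\<lambda>y. ln (q l (y |` S l) (y |` Rd l))) i" .
  qed
  show ?thesis by (rule that[OF q(1)]) (simp only: Zq eq)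
qed

lemma marginal_log_additive_table_pos:
  assumes "l < n" "y \<in> cl (Cs ! l)"
  shows "0 < marginal V I (log_additive_table u) y"
proof -
  obtain q Z where q: "0 < Z" "cond_kernel q" and Zq: "\<And>x. x \<in> cl V \<Longrightarrow> log_additive_table u x = Z * kernel_product q x"
    by (rule log_additive_table_factorization[where u = u]) blast
  have "marginal V I (log_additive_table u) y = Z * marginal V I (kernel_product q) y"
    by (rule marginal_scale[OF assms(2)]) (rule Zq)
  moreover have "0 < marginal V I (kernel_product q) y" by (rule marginal_pos[OF q(2) assms]) (rule refl)
  ultimately show ?thesis using q(1) by simp
qed

lemma clique_labels_iff_dom:
  assumes "i \<in> cells_star I z D"
  shows "i \<in> clique_labels l \<longleftrightarrow> D \<subseteq> Cs ! l \<and> D \<inter> Rd l \<noteq> {}"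
proof
  assume "i \<in> clique_labels l"
  then obtain D' where "D' \<subseteq> Cs ! l" "D' \<inter> Rd l \<noteq> {}" "i \<in> cells_star I z D'" by (auto simp: clique_labels_def)
  moreover have "D' = D" using star_dom[OF assms] star_dom[OF \<open>i \<in> cells_star I z D'\<close>] by simp
  ultimately show "D \<subseteq> Cs ! l \<and> D \<inter> Rd l \<noteq> {}" by simp
qed (use assms in \<open>auto simp: clique_labels_def\<close>)

text \<open>
  The logarithm of the table is a constant plus the sum over the cliques of the logits minus the
  logarithms of their normalizations, which are functions on the separators; apply the Moebius
  transform.
\<close>

lemma cliq_of_mod_shift:
  assumes i: "i \<in> mod_label_set"
  shows "cliq_of_mod u i = u i + mod_shift i (cliq_of_mod u)"
proof -
  define v where "v = cliq_of_mod u"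
  obtain l0 where l0: "l0 < n" "i \<in> clique_labels l0" using i by (auto simp: mod_label_set_def)
  obtain D where D: "D \<subseteq> Cs ! l0" "D \<inter> Rd l0 \<noteq> {}" "i \<in> cells_star I z D" using l0(2) by (auto simp: clique_labels_def)
  have di: "dom i = D" by (rule star_dom[OF D(3)])
  have DV: "D \<subseteq> V" using D(1) C_sub[OF l0(1)] by blast
  have fin: "finite (dom i)" unfolding di by (rule finite_sub[OF DV])
  have ne: "i \<noteq> Map.empty" using di D(2) by auto
  obtain Z where Z: "0 < Z" "\<And>x. x \<in> cl V \<Longrightarrow> log_additive_table u x = Z * kernel_product (logit_kernel (cliq_logit (\<lambda>_. v))) x"
    unfolding v_def by (rule log_additive_table_normalized[where u = u]) blast
  have ln: "ln (log_additive_table u x) = ln Z + (\<Sum>l<n. cliq_logit (\<lambda>_. v) l (x |` S l) (x |` Rd l) - log_partition (cliq_logit (\<lambda>_. v)) l (x |` S l))"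
    if x: "x \<in> cl V" for x
  proof -
    have pos: "0 < logit_kernel (cliq_logit (\<lambda>_. v)) l (x |` S l) (x |` Rd l)" if "l < n" for l
      by (rule cond_kernel_pos[OF cond_kernel_logit_kernel that cells_restrict[OF x sub_V(1)[OF that]] cells_restrict[OF x sub_V(2)[OF that]]])
    have "ln (log_additive_table u x) = ln Z + ln (kernel_product (logit_kernel (cliq_logit (\<lambda>_. v))) x)"
      unfolding Z(2)[OF x] by (rule ln_mult_pos[OF Z(1)]) (auto simp: partial_product_def intro!: prod_pos pos)
    also have "ln (kernel_product (logit_kernel (cliq_logit (\<lambda>_. v))) x) = (\<Sum>l<n. ln (logit_kernel (cliq_logit (\<lambda>_. v)) l (x |` S l) (x |` Rd l)))"
      unfolding partial_product_def by (rule ln_prod) (simp_all add: pos[THEN less_imp_neq, THEN not_sym])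
    also have "\<dots> = (\<Sum>l<n. cliq_logit (\<lambda>_. v) l (x |` S l) (x |` Rd l) - log_partition (cliq_logit (\<lambda>_. v)) l (x |` S l))"
      by (rule sum.cong[OF refl]) (simp add: ln_logit_kernel)
    finally show ?thesis .
  qed
  have "u i = Mob z V (\<lambda>x. ln (log_additive_table u x)) i" by (rule Mob_log_additive_table[OF i, symmetric])
  also have "\<dots> = Mob z V (\<lambda>x. ln Z + (\<Sum>l<n. cliq_logit (\<lambda>_. v) l (x |` S l) (x |` Rd l) - log_partition (cliq_logit (\<lambda>_. v)) l (x |` S l))) i"
    by (rule Mob_cong) (use ln partial_cells[OF D(3) _ DV order_refl] di in simp)
  also have "\<dots> = Mob z V (\<lambda>x. ln Z) i + (\<Sum>l<n. Mob z V (\<lambda>x. cliq_logit (\<lambda>_. v) l (x |` S l) (x |` Rd l)) i -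
      Mob z V (\<lambda>x. log_partition (cliq_logit (\<lambda>_. v)) l (x |` S l)) i)"
    unfolding Mob_add Mob_sum Mob_diff ..
  also have "Mob z V (\<lambda>x. ln Z) i = 0" by (rule Mob_const[OF fin ne])
  also have "(\<Sum>l<n. Mob z V (\<lambda>x. cliq_logit (\<lambda>_. v) l (x |` S l) (x |` Rd l)) i - Mob z V (\<lambda>x. log_partition (cliq_logit (\<lambda>_. v)) l (x |` S l)) i) =
      (\<Sum>l<n. (if l = l0 then v i else 0) - (if dom i \<subseteq> S l then Mob z (S l) (log_partition (cliq_logit (\<lambda>_. v)) l) i else 0))"
  proof (rule sum.cong[OF refl])
    fix l assume "l \<in> {..<n}"
    then have l: "l < n" by simp
    have sub: "S l \<subseteq> Cs ! l" "Rd l \<subseteq> Cs ! l" using SR(1)[of l] by blast+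
    have "(\<lambda>x. cliq_logit (\<lambda>_. v) l (x |` S l) (x |` Rd l)) =
        (\<lambda>x. (\<lambda>y. cliq_logit (\<lambda>_. v) l (y |` S l) (y |` Rd l)) (x |` (Cs ! l)))"
      by (simp only: restrict_restrict_subset[OF sub(1)] restrict_restrict_subset[OF sub(2)])
    then have "Mob z V (\<lambda>x. cliq_logit (\<lambda>_. v) l (x |` S l) (x |` Rd l)) i =
        (if dom i \<subseteq> Cs ! l then Mob z (Cs ! l) (\<lambda>y. cliq_logit (\<lambda>_. v) l (y |` S l) (y |` Rd l)) i else 0)"
      using Mob_restrict[OF fin C_sub[OF l], of z "\<lambda>y. cliq_logit (\<lambda>_. v) l (y |` S l) (y |` Rd l)"] DV di by simp
    \<comment> \<open>Among all logits, only those of the clique that owns the label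
      \<open>i\<close> have an interaction at \<open>i\<close>; log normalizers can contribute from
      other cliques.\<close>
    also have "\<dots> = (if D \<subseteq> Cs ! l \<and> D \<inter> Rd l \<noteq> {} then v i else 0)"
      using Mob_cliq_logit_clique[OF l D(3), of "\<lambda>_. v"] by (auto simp: di)
    also have "\<dots> = (if l = l0 then v i else 0)"
      using clique_labels_iff_dom[OF D(3), of l] clique_labels_disjoint[OF l l0(1) _ l0(2)] l0(2) by (metis (full_types))
    finally have 1: "Mob z V (\<lambda>x. cliq_logit (\<lambda>_. v) l (x |` S l) (x |` Rd l)) i = (if l = l0 then v i else 0)" .
    have 2: "Mob z V (\<lambda>x. log_partition (cliq_logit (\<lambda>_. v)) l (x |` S l)) i =
        (if dom i \<subseteq> S l then Mob z (S l) (log_partition (cliq_logit (\<lambda>_. v)) l) i else 0)"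
      by (rule Mob_restrict[OF fin sub_V(1)[OF l]]) (simp add: di DV)
    show "Mob z V (\<lambda>x. cliq_logit (\<lambda>_. v) l (x |` S l) (x |` Rd l)) i - Mob z V (\<lambda>x. log_partition (cliq_logit (\<lambda>_. v)) l (x |` S l)) i =
      (if l = l0 then v i else 0) - (if dom i \<subseteq> S l then Mob z (S l) (log_partition (cliq_logit (\<lambda>_. v)) l) i else 0)"
      unfolding 1 2 ..
  qed
  also have "\<dots> = v i - mod_shift i v" unfolding sum_subtractf mod_shift_def using l0(1) by simp
  finally show ?thesis unfolding v_def by simp
qed

lemma prob_of_mod:
  assumes u: "u \<in> extensional mod_label_set"
  shows "prob_of V E I (theta_mod V E I z) u = restrict (kernel_product (logit_kernel (cliq_logit (\<lambda>_. cliq_of_mod u)))) (cl V)"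
proof (rule prob_of_eq[where P = "\<lambda>u. restrict (kernel_product (logit_kernel (cliq_logit (\<lambda>_. cliq_of_mod u)))) (cl V)"])
  have lab: "theta_mod V E I z p i = Mob z V (\<lambda>x. ln (p x)) i" if i: "i \<in> mod_label_set" and p: "\<And>x. x \<in> cl V \<Longrightarrow> 0 < p x" for p i
  proof -
    obtain D where D: "D \<noteq> {}" "D \<subseteq> V" "complete_in E D" "i \<in> cells_star I z D"
      using i unfolding mod_label_set_def complete_labels[symmetric] by blast
    have "theta_mod V E I z p i = log_linear z V p i" unfolding theta_mod_def using D by auto
    also have "\<dots> = Mob z V (\<lambda>x. ln (p x)) i" by (rule log_linear_Mob[OF D(4,2) order_refl p]) simp_all
    finally show ?thesis .
  qed
  {
    fix p assume p: "p \<in> positive_markov V E I"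
    note pd = positive_markovD[OF p]
    \<comment> \<open>The interaction of the empty set is ln p at the base cell, the one coefficient
      that theta^mod omits. Total mass 1 forces \<open>exp ?c * Z\<close> to be 1.\<close>
    let ?\<theta> = "theta_mod V E I z p" and ?c = "Mob z V (\<lambda>x. ln (p x)) Map.empty"
    obtain Z where Z: "0 < Z" "\<And>x. x \<in> cl V \<Longrightarrow> log_additive_table ?\<theta> x = Z * kernel_product (logit_kernel (cliq_logit (\<lambda>_. cliq_of_mod ?\<theta>))) x"
      by (rule log_additive_table_normalized[where u = ?\<theta>]) blast
    have px: "p x = exp ?c * Z * kernel_product (logit_kernel (cliq_logit (\<lambda>_. cliq_of_mod ?\<theta>))) x" if x: "x \<in> cl V" for x
    proof -
      have sV: "supp z x \<subseteq> V" using supp_subset[of z x] dom_cells[OF x] by simp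
      have fin: "finite {D. D \<subseteq> supp z x \<and> complete_in E D}"
        by (rule finite_subset[of _ "Pow V"]) (use sV finV in auto)
      have "ln (p x) = (\<Sum>D\<in>{D. D \<subseteq> supp z x \<and> complete_in E D}. Mob z V (\<lambda>x. ln (p x)) (x |` D))"
        by (rule log_sum_complete[OF p x])
      also have "\<dots> = Mob z V (\<lambda>x. ln (p x)) (x |` {}) +
          (\<Sum>D\<in>{D. D \<subseteq> supp z x \<and> complete_in E D} - {{}}. Mob z V (\<lambda>x. ln (p x)) (x |` D))"
        by (rule sum.remove[OF fin]) (simp add: complete_in_def)
      also have "(\<Sum>D\<in>{D. D \<subseteq> supp z x \<and> complete_in E D} - {{}}. Mob z V (\<lambda>x. ln (p x)) (x |` D)) =
          (\<Sum>D\<in>{D. D \<subseteq> supp z x \<and> D \<noteq> {} \<and> complete_in E D}. ?\<theta> (x |` D))"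
      proof (rule sum.cong)
        fix D assume "D \<in> {D. D \<subseteq> supp z x \<and> D \<noteq> {} \<and> complete_in E D}"
        then have D: "D \<subseteq> supp z x" "D \<noteq> {}" "complete_in E D" by auto
        have "x |` D \<in> mod_label_set"
          unfolding mod_label_set_def complete_labels[symmetric]
          using cells_star_restrict_supp[OF x D(1)] D(2,3) subset_trans[OF D(1) sV] by blast
        from lab[OF this, of p] show "Mob z V (\<lambda>x. ln (p x)) (x |` D) = ?\<theta> (x |` D)" using pd(1) by simp
      qed auto
      finally have "ln (p x) = ?c + (\<Sum>D\<in>{D. D \<subseteq> supp z x \<and> D \<noteq> {} \<and> complete_in E D}. ?\<theta> (x |` D))" by simp
      then have "p x = exp (?c + (\<Sum>D\<in>{D. D \<subseteq> supp z x \<and> D \<noteq> {} \<and> complete_in E D}. ?\<theta> (x |` D)))"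
        using pd(1)[OF x] by (metis exp_ln)
      also have "\<dots> = exp ?c * log_additive_table ?\<theta> x" unfolding log_additive_table_def by (rule exp_add)
      finally show ?thesis unfolding Z(2)[OF x] by simp
    qed
    have "1 = (\<Sum>x\<in>cl V. exp ?c * Z * kernel_product (logit_kernel (cliq_logit (\<lambda>_. cliq_of_mod ?\<theta>))) x)"
      unfolding pd(2)[symmetric] by (rule sum.cong[OF refl px])
    also have "\<dots> = exp ?c * Z" unfolding sum_distrib_left[symmetric] sum_kernel_product[OF cond_kernel_logit_kernel] by simp
    finally have "exp ?c * Z = 1" by simp
    then have "p x = kernel_product (logit_kernel (cliq_logit (\<lambda>_. cliq_of_mod ?\<theta>))) x" if "x \<in> cl V" for x using px[OF that] by simp
    then have "restrict (kernel_product (logit_kernel (cliq_logit (\<lambda>_. cliq_of_mod ?\<theta>)))) (cl V) = restrict p (cl V)" by (intro restrict_ext) simp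
    then show "restrict (kernel_product (logit_kernel (cliq_logit (\<lambda>_. cliq_of_mod ?\<theta>)))) (cl V) = p" using extensional_restrict[OF pd(3)] by simp
  }
  let ?P = "restrict (kernel_product (logit_kernel (cliq_logit (\<lambda>_. cliq_of_mod u)))) (cl V)"
  show P: "?P \<in> positive_markov V E I" by (rule kernel_product_markov[OF cond_kernel_logit_kernel])
  obtain Z where Z: "0 < Z" "\<And>x. x \<in> cl V \<Longrightarrow> log_additive_table u x = Z * kernel_product (logit_kernel (cliq_logit (\<lambda>_. cliq_of_mod u))) x"
    by (rule log_additive_table_normalized[where u = u]) blast
  show "theta_mod V E I z ?P = u"
  proof
    fix i
    show "theta_mod V E I z ?P i = u i"
    proof (cases "i \<in> mod_label_set")
      case True
      obtain D where D: "D \<noteq> {}" "D \<subseteq> V" "i \<in> cells_star I z D"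
        using True unfolding mod_label_set_def complete_labels[symmetric] by blast
      have di: "dom i = D" by (rule star_dom[OF D(3)])
      have ne: "i \<noteq> Map.empty" using di D(1) by auto
      have "theta_mod V E I z ?P i = Mob z V (\<lambda>x. ln (?P x)) i"
        by (rule lab[OF True]) (rule positive_markovD(1)[OF P])
      also have "\<dots> = Mob z V (\<lambda>x. ln (log_additive_table u x) - ln Z) i"
      proof (rule Mob_cong)
        fix F assume "F \<subseteq> dom i"
        then have x: "(i |` F) ++ base_cell z (V - F) \<in> cl V" (is "?x \<in> _")
          using partial_cells[OF D(3) _ D(2) order_refl] di by simp
        have "0 < ?P ?x" by (rule positive_markovD(1)[OF P x])
        then show "ln (?P ?x) = ln (log_additive_table u ?x) - ln Z" unfolding Z(2)[OF x] using x Z(1) by (simp add: ln_mult_pos)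
      qed
      also have "\<dots> = Mob z V (\<lambda>x. ln (log_additive_table u x)) i - Mob z V (\<lambda>x. ln Z) i" by (rule Mob_diff)
      also have "Mob z V (\<lambda>x. ln Z) i = 0" by (rule Mob_const[OF _ ne]) (simp add: di finite_sub[OF D(2)])
      also have "Mob z V (\<lambda>x. ln (log_additive_table u x)) i = u i" by (rule Mob_log_additive_table[OF True])
      also have "u i - 0 = u i" by (rule diff_zero)
      finally show ?thesis .
    next
      case False
      then have na: "i \<notin> {i |D i. D \<noteq> {} \<and> D \<subseteq> V \<and> complete_in E D \<and> i \<in> cells_star I z D}"
        unfolding mod_label_set_def complete_labels[symmetric] by simp
      then show ?thesis unfolding theta_mod_def using extensional_arb[OF u False] by (simp only: restrict_apply if_False)
    qed
  qed
qed

text \<open>A domain that meets the residual of clique \<open>l0\<close> lies only in separators of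
  later cliques, and those separators meet this residual. So the shift reads exactly the groups that
  a compatible order places before that of \<open>l0\<close>.\<close>

lemma mod_shift_cong:
  assumes l0: "l0 < n" "i \<in> clique_labels l0"
    and v: "\<And>l b. l < n \<Longrightarrow> l0 < l \<Longrightarrow> S l \<inter> Rd l0 \<noteq> {} \<Longrightarrow> b \<in> clique_labels l \<Longrightarrow> v b = v' b"
  shows "mod_shift i v = mod_shift i v'"
  unfolding mod_shift_def
proof (rule sum.cong[OF refl])
  fix l assume "l \<in> {..<n}"
  then have l: "l < n" by simp
  obtain D where D: "D \<subseteq> Cs ! l0" "D \<inter> Rd l0 \<noteq> {}" "i \<in> cells_star I z D" using l0(2) by (auto simp: clique_labels_def)
  have di: "dom i = D" by (rule star_dom[OF D(3)])
  have "Mob z (S l) (log_partition (cliq_logit (\<lambda>_. v)) l) i = Mob z (S l) (log_partition (cliq_logit (\<lambda>_. v')) l) i" if DS: "D \<subseteq> S l"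
  proof (rule Mob_cong)
    have meet: "S l \<inter> Rd l0 \<noteq> {}" using DS D(2) by blast
    have "l0 < l"
    proof (rule ccontr)
      assume "\<not> l0 < l"
      then have "l = l0 \<or> l < l0" by linarith
      then have "S l \<inter> Rd l0 = {}"
      proof
        assume "l < l0"
        then have "Cs ! l \<subseteq> H l0" by blast
        then show ?thesis using SR(1)[of l] SR(4)[of l0] by blast
      qed (use SR(2) in simp)
      then show False using meet by simp
    qed
    note eq = v[OF l this meet]
    fix F assume "F \<subseteq> dom i"
    then have s: "(i |` F) ++ base_cell z (S l - F) \<in> cl (S l)" (is "?s \<in> _")
      using partial_cells[OF D(3) _ DS sub_V(1)[OF l]] di by simp
    have "cliq_logit (\<lambda>_. v) l ?s r = cliq_logit (\<lambda>_. v') l ?s r" if r: "r \<in> cl (Rd l)" for r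
      unfolding cliq_logit_feature[OF s r, symmetric] by (rule sum.cong[OF refl]) (use eq in auto)
    then show "log_partition (cliq_logit (\<lambda>_. v)) l ?s = log_partition (cliq_logit (\<lambda>_. v')) l ?s"
      unfolding log_partition_def by (simp cong: sum.cong)
  qed
  then show "(if dom i \<subseteq> S l then Mob z (S l) (log_partition (cliq_logit (\<lambda>_. v)) l) i else 0) =
      (if dom i \<subseteq> S l then Mob z (S l) (log_partition (cliq_logit (\<lambda>_. v')) l) i else 0)" by (simp add: di)
qed

section \<open>Regularity of the passage between theta^mod and theta^cliq\<close>

lemma continuous_mod_shift: "continuous_on UNIV (mod_shift i)"
proof -
  have "continuous_on UNIV (\<lambda>v. cliq_logit (\<lambda>_. v) l s r)" for l s r
    unfolding cliq_logit_def by (intro continuous_on_sum continuous_on_product_coordinates)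
  then have "continuous_on UNIV (\<lambda>v. log_partition (cliq_logit (\<lambda>_. v)) l s)" if "l < n" for l s
    unfolding log_partition_def
    by (intro continuous_on_ln continuous_on_sum continuous_on_exp) (simp_all add: logit_kernel_denominator[OF that, THEN less_imp_neq, THEN not_sym])
  then have *: "continuous_on UNIV (\<lambda>v. Mob z (S l) (log_partition (cliq_logit (\<lambda>_. v)) l) i)" if "l < n" for l
    unfolding Mob_def using that by (intro continuous_on_sum continuous_on_mult continuous_on_const) 
  have "continuous_on UNIV (\<lambda>v. if dom i \<subseteq> S l then Mob z (S l) (log_partition (cliq_logit (\<lambda>_. v)) l) i else 0)" if "l < n" for l
    using *[OF that] by (cases "dom i \<subseteq> S l") (simp_all add: continuous_on_const)
  then have "continuous_on UNIV (\<lambda>v. mod_shift i v)"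
    unfolding mod_shift_def by (intro continuous_on_sum) simp
  then show ?thesis by simp
qed

text \<open>The cells \<open>Y F\<close> are independent of \<open>u\<close>, so continuity and
  differentiability reduce to logarithms of finitely many positive marginals, each a sum of
  exponentials of linear forms.\<close>

lemma cliq_of_mod_sum:
  assumes "l < n" "i \<in> clique_labels l"
  obtains Y where "\<And>F. F \<in> Pow (dom i) \<Longrightarrow> Y F \<in> cl (Cs ! l)"
    "\<And>u. cliq_of_mod u i = (\<Sum>F\<in>Pow (dom i). (-1) ^ card (dom i - F) * ln (marginal V I (log_additive_table u) (Y F)))"
proof -
  obtain D where D: "D \<subseteq> Cs ! l" "i \<in> cells_star I z D" using assms(2) by (auto simp: clique_labels_def)
  show ?thesis
    by (rule that[of "\<lambda>F. (i |` F) ++ base_cell z (Cs ! l - F)"])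
       (use partial_cells[OF D(2) _ D(1) C_sub[OF assms(1)]] star_dom[OF D(2)] in \<open>simp_all add: cliq_of_mod_clique_labels[OF assms] Mob_def\<close>)
qed

lemma continuous_cliq_of_mod: "continuous_on UNIV (\<lambda>u. cliq_of_mod u i)"
proof (cases "i \<in> mod_label_set")
  case True
  then obtain l where l: "l < n" "i \<in> clique_labels l" by (auto simp: mod_label_set_def)
  obtain Y where Y: "\<And>F. F \<in> Pow (dom i) \<Longrightarrow> Y F \<in> cl (Cs ! l)"
    and eq: "\<And>u. cliq_of_mod u i = (\<Sum>F\<in>Pow (dom i). (-1) ^ card (dom i - F) * ln (marginal V I (log_additive_table u) (Y F)))"
    by (rule cliq_of_mod_sum[OF l]) blast
  have m: "continuous_on UNIV (\<lambda>u. marginal V I (log_additive_table u) y)" for y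
    unfolding marginal_def log_additive_table_def
    by (intro continuous_on_sum continuous_on_exp continuous_on_product_coordinates)
  have "continuous_on UNIV (\<lambda>u. ln (marginal V I (log_additive_table u) (Y F)))" if "F \<in> Pow (dom i)" for F
    by (rule continuous_on_ln[OF m]) (use marginal_log_additive_table_pos[OF l(1) Y[OF that]] in \<open>auto simp: less_imp_neq[symmetric]\<close>)
  then show ?thesis unfolding eq by (intro continuous_on_sum continuous_on_mult continuous_on_const)
next
  case False
  then show ?thesis by (simp add: cliq_of_mod_def continuous_on_product_coordinates)
qed

lemma differentiable_cliq_of_mod: "\<exists>d. ((\<lambda>\<tau>. cliq_of_mod (u(a := \<tau>)) i) has_real_derivative d) (at (u a))"
proof -
  have coord: "(\<lambda>\<tau>. (u(a := \<tau>)) b) field_differentiable at (u a)" for b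
    by (cases "b = a") (simp_all add: field_differentiable_ident field_differentiable_const)
  have "(\<lambda>\<tau>. cliq_of_mod (u(a := \<tau>)) i) field_differentiable at (u a)"
  proof (cases "i \<in> mod_label_set")
    case True
    then obtain l where l: "l < n" "i \<in> clique_labels l" by (auto simp: mod_label_set_def)
    obtain Y where Y: "\<And>F. F \<in> Pow (dom i) \<Longrightarrow> Y F \<in> cl (Cs ! l)"
      and eq: "\<And>u. cliq_of_mod u i = (\<Sum>F\<in>Pow (dom i). (-1) ^ card (dom i - F) * ln (marginal V I (log_additive_table u) (Y F)))"
      by (rule cliq_of_mod_sum[OF l]) blast
    have exp: "(\<lambda>\<tau>. exp (f \<tau>)) field_differentiable at x" if "f field_differentiable at x" for f :: "real \<Rightarrow> real" and x
      using that unfolding field_differentiable_def by (blast intro: DERIV_fun_exp)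
    have ln: "(\<lambda>\<tau>. ln (f \<tau>)) field_differentiable at x" if f: "f field_differentiable at x" "0 < f x" for f :: "real \<Rightarrow> real" and x
    proof -
      obtain d where "(f has_real_derivative d) (at x)" using f(1) unfolding field_differentiable_def by blast
      from DERIV_chain2[where f = ln and g = f, OF DERIV_ln[OF f(2)] this]
      show ?thesis unfolding field_differentiable_def by blast
    qed
    have m: "(\<lambda>\<tau>. marginal V I (log_additive_table (u(a := \<tau>))) y) field_differentiable at (u a)" for y
      unfolding marginal_def log_additive_table_def by (intro field_differentiable_sum exp coord)
    have "(\<lambda>\<tau>. ln (marginal V I (log_additive_table (u(a := \<tau>))) (Y F))) field_differentiable at (u a)" if "F \<in> Pow (dom i)" for F
      by (rule ln[OF m]) (rule marginal_log_additive_table_pos[OF l(1) Y[OF that]])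
    then show ?thesis unfolding eq by (intro field_differentiable_sum field_differentiable_mult field_differentiable_const)
  next
    case False
    then show ?thesis using coord by (simp add: cliq_of_mod_def)
  qed
  then show ?thesis unfolding field_differentiable_def .
qed

section \<open>The reference priors in terms of cell probabilities\<close>

lemma cond_grouping:
  assumes "ordered_grouping (cond_groups I Cs) (cond_group I z Cs) bs gs"
  shows "ordered_grouping Keys (\<lambda>k. Pair k ` residual_labels (fst k)) bs gs"
proof -
  have "cond_group I z Cs (bs ! i) = Pair (bs ! i) ` residual_labels (fst (bs ! i))" if "i < length bs" for i
    using assms nth_mem[OF that] by (intro cond_group_eq) (simp add: ordered_grouping_def cond_groups_eq)
  then show ?thesis
    using assms unfolding ordered_grouping_def cond_groups_eq list_all2_conv_all_nth by simp
qed

lemma cond_labels: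
  assumes "ordered_grouping (cond_groups I Cs) (cond_group I z Cs) bs gs"
  shows "set (concat gs) = (\<Union>k\<in>Keys. Pair k ` residual_labels (fst k))"
  by (rule ordered_groupingE[OF cond_grouping[OF assms]]) auto

lemma cliq_labels:
  assumes "ordered_grouping {..<n} (cliq_group I z Cs) bs gs"
  shows "set (concat gs) = (\<Union>l<n. Pair l ` clique_labels l)"
  by (rule ordered_groupingE[OF assms[unfolded cliq_group_eq[abs_def]]]) auto

lemma mod_labels:
  assumes "ordered_grouping {..<n} (mod_group I z Cs) bs gs"
  shows "set (concat gs) = mod_label_set"
proof (rule ordered_groupingE[OF assms[unfolded mod_group_eq[abs_def]]])
  show "clique_labels b \<inter> clique_labels b' = {}" if "b \<in> {..<n}" "b' \<in> {..<n}" "b \<noteq> b'" for b b'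
    using clique_labels_disjoint[of b b'] that by (simp add: disjoint_iff) blast
qed (simp only: mod_label_set_def)

theorem reference_prior_cond:
  assumes "N \<ge> 1" "ordered_grouping (cond_groups I Cs) (cond_group I z Cs) bs gs"
  shows "reference_prior_proportional_to (counts (cl V) N) (multinomial_model V E I N (theta_cond V I z Cs)) gs
     (\<lambda>u. prior_prob V I Cs (prob_of V E I (theta_cond V I z Cs) u))"
proof -
  note og = cond_grouping[OF assms(2)] and L = cond_labels[OF assms(2)]
  show ?thesis
    by (rule reference_prior_conditional_features[OF assms(1) og prob_of_cond])
       (simp_all add: parameter_space_def PiE_def L del: set_concat)
qed

theorem reference_prior_cliq:
  assumes "N \<ge> 1" "ordered_grouping {..<n} (cliq_group I z Cs) bs gs"
  shows "reference_prior_proportional_to (counts (cl V) N) (multinomial_model V E I N (theta_cliq V I z Cs)) gs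
     (\<lambda>u. prior_prob V I Cs (prob_of V E I (theta_cliq V I z Cs) u))"
proof -
  have og: "ordered_grouping {..<n} (\<lambda>l. Pair l ` clique_labels l) bs gs"
    using assms(2) unfolding cliq_group_eq[abs_def] .
  note L = cliq_labels[OF assms(2)]
  show ?thesis
  proof (rule reference_prior_clique_features[where ce = snd and \<phi> = "\<lambda>u. u" and t = "\<lambda>_ _. 0" and h = "\<lambda>v l i. v (l, i)", OF assms(1) og])
    show "prob_of V E I (theta_cliq V I z Cs) u = restrict (kernel_product (logit_kernel (cliq_logit (\<lambda>l i. u (l, i))))) (cl V)"
      if "u \<in> parameter_space gs" for u
      by (rule prob_of_cliq) (use that in \<open>simp add: parameter_space_def PiE_def L del: set_concat\<close>)
    show "\<exists>d. ((\<lambda>\<tau>. (u(a := \<tau>)) c) has_real_derivative d) (at (u a))"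
      for u :: "nat \<times> ('v, 'a) cell \<Rightarrow> real" and a c
      by (cases "a = c") (auto intro!: exI derivative_eq_intros)
    show "bij_betw snd (Pair l ` clique_labels l) (clique_labels l)" for l by (auto simp: bij_betw_def inj_on_def image_iff)
  qed (auto simp: continuous_on_product_coordinates)
qed

theorem reference_prior_mod:
  assumes "N \<ge> 1" "ordered_grouping {..<n} (mod_group I z Cs) bs gs" "compatible_order Cs bs"
  shows "reference_prior_proportional_to (counts (cl V) N) (multinomial_model V E I N (theta_mod V E I z)) gs
     (\<lambda>u. prior_prob V I Cs (prob_of V E I (theta_mod V E I z) u))"
proof -
  have og: "ordered_grouping {..<n} clique_labels bs gs"
    using assms(2) unfolding mod_group_eq[abs_def] .
  have disj: "clique_labels l \<inter> clique_labels l' = {}" if "l < n" "l' < n" "l \<noteq> l'" for l l'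
    using clique_labels_disjoint[OF that(1,2)] that(3) by (meson disjoint_iff)
  show ?thesis
  proof (rule ordered_groupingE[OF og])
    show "clique_labels b \<inter> clique_labels b' = {}" if "b \<in> {..<n}" "b' \<in> {..<n}" "b \<noteq> b'" for b b'
      by (rule disj) (use that in blast)+
    fix pos
    assume L: "set (concat gs) = (\<Union>l\<in>{..<n}. clique_labels l)"
      and pos': "\<And>b. b \<in> {..<n} \<Longrightarrow> pos b < length gs" "\<And>b. b \<in> {..<n} \<Longrightarrow> bs ! pos b = b"
        "\<And>b. b \<in> {..<n} \<Longrightarrow> set (gs ! pos b) = clique_labels b"
        "\<And>j. j < length gs \<Longrightarrow> bs ! j \<in> {..<n}" "\<And>j. j < length gs \<Longrightarrow> pos (bs ! j) = j"
  note pos = pos'[unfolded lessThan_iff]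
  have len: "length bs = length gs" using og list_all2_lengthD unfolding ordered_grouping_def by blast
  have Lm: "set (concat gs) = mod_label_set" unfolding L mod_label_set_def ..
  show ?thesis
  proof (rule reference_prior_clique_features[where ce = "\<lambda>i. i" and \<phi> = cliq_of_mod and t = mod_shift and h = "\<lambda>v l i. v i", OF assms(1) og])
    show "prob_of V E I (theta_mod V E I z) u = restrict (kernel_product (logit_kernel (cliq_logit (\<lambda>l i. cliq_of_mod u i)))) (cl V)"
      if "u \<in> parameter_space gs" for u
      by (rule prob_of_mod) (use that in \<open>simp add: parameter_space_def PiE_def Lm del: set_concat\<close>)
    show "cliq_of_mod u a = u a" if "a \<notin> set (concat gs)" for a u using that unfolding Lm by (simp add: cliq_of_mod_def)
    show "cliq_of_mod u a = u a + mod_shift a (cliq_of_mod u)" if "a \<in> set (concat gs)" for a u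
      using that unfolding Lm by (rule cliq_of_mod_shift)
    show "mod_shift a v = mod_shift a w"
      if a: "j < length gs" "a \<in> set (gs ! j)" and vw: "\<And>b. b \<in> set (concat (take j gs)) \<Longrightarrow> v b = w b" for j a v w
    proof (rule mod_shift_cong)
      have j: "bs ! j < n" "pos (bs ! j) = j" using pos(4,5)[OF a(1)] .
      show "bs ! j < n" "a \<in> clique_labels (bs ! j)" using j pos(3)[OF j(1)] a(2) by simp_all
      fix l b assume l: "l < n" "bs ! j < l" "S l \<inter> Rd (bs ! j) \<noteq> {}" and b: "b \<in> clique_labels l"
      \<comment> \<open>Were the group of \<open>l\<close> placed after position \<open>j\<close>,
        compatibility would make its separator disjoint from the residual of the clique at
        \<open>j\<close>. All labels read by the shift thus lie in preceding groups.\<close>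
      have "\<not> j < pos l"
      proof
        assume "j < pos l"
        then have "bs ! j < bs ! pos l \<longrightarrow> S (bs ! pos l) \<inter> Rd (bs ! j) = {}"
          using sorted_wrt_nth_less[OF assms(3)[unfolded compatible_order_def]] pos(1)[OF l(1)] len by simp
        then show False using l pos(2)[OF l(1)] by simp
      qed
      moreover have "pos l \<noteq> j" using pos(2)[OF l(1)] l(2) by auto
      ultimately have "pos l < j" by linarith
      then have "gs ! pos l \<in> set (take j gs)" using a(1) by (force simp: in_set_conv_nth)
      then have "b \<in> set (concat (take j gs))" using b pos(3)[OF l(1)] by (auto simp: set_concat)
      then show "v b = w b" by (rule vw)
    qed
    show "\<exists>d. ((\<lambda>\<tau>. cliq_of_mod (u(a := \<tau>)) c) has_real_derivative d) (at (u a))" for u a c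
      by (rule differentiable_cliq_of_mod)
    show "continuous_on UNIV (\<lambda>u. cliq_of_mod u a)" for a by (rule continuous_cliq_of_mod)
    show "continuous_on UNIV (mod_shift a)" for a by (rule continuous_mod_shift)
    show "bij_betw (\<lambda>i. i) (clique_labels l) (clique_labels l)" for l by (auto simp: bij_betw_def inj_on_def)
  qed (use disj in auto)
  qed
qed

end

section \<open>The explicit densities\<close>

lemma sqrt_exp: "sqrt (exp x) = exp (x / 2)"
  by (rule real_sqrt_unique) (simp_all add: exp_double[symmetric])

text \<open>The Jeffreys-type factor of one table: half the sum of its logits minus half the number
  of cells times the log normalizer. All explicit densities are built from this.\<close>

lemma sqrt_prod_exp_div:
  fixes c :: "'b \<Rightarrow> real"
  assumes "finite A" "0 < Z"
  shows "sqrt (\<Prod>r\<in>A. exp (c r) / Z) = exp (((\<Sum>r\<in>A. c r) - real (card A) * ln Z) / 2)"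
proof -
  have "(\<Prod>r\<in>A. exp (c r) / Z) = (\<Prod>r\<in>A. exp (c r - ln Z))"
    using assms(2) by (simp add: exp_diff)
  also have "\<dots> = exp (\<Sum>r\<in>A. c r - ln Z)" by (rule exp_sum[OF assms(1), symmetric])
  finally show ?thesis by (simp add: sqrt_exp sum_subtractf)
qed

lemma cells_star_empty: "cells_star I z {} = {Map.empty}"
  by (auto simp: cells_star_iff cells_iff)

lemma star_nonempty: "i \<in> cells_star I z D \<Longrightarrow> D \<noteq> {} \<Longrightarrow> i \<noteq> Map.empty"
  using star_dom by (metis dom_empty)

context clique_model begin

lemma star_base_restrict:
  assumes "i \<in> cells_star I z D" "D \<subseteq> A" "A \<subseteq> V"
  shows "i ++ base_cell z (A - D) \<in> cl A" "supp z (i ++ base_cell z (A - D)) = D"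
    and "F \<subseteq> D \<Longrightarrow> (i ++ base_cell z (A - D)) |` F = i |` F"
proof -
  have "i |` D = i" using star_dom[OF assms(1)] by (intro restrict_dom) simp
  then show "i ++ base_cell z (A - D) \<in> cl A" using partial_cells[OF assms(1) order_refl assms(2,3)] by simp
  show "supp z (i ++ base_cell z (A - D)) = D" by (rule supp_star_add_base[OF assms(1,2)])
  show "(i ++ base_cell z (A - D)) |` F = i |` F" if "F \<subseteq> D"
    by (rule restrict_add_disjoint) (use that in auto)
qed

lemma sum_Pow_nonempty:
  assumes "finite S'" "f {} = (0::real)"
  shows "(\<Sum>D\<in>Pow S'. f D) = (\<Sum>D\<in>Pow S' - {{}}. f D)"
  using sum.remove[of "Pow S'" "{}" f] assms by simp

text \<open>Double counting by \<open>sum_cells_supp\<close> evaluates the sum of the logits, and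
  classifying cells by their support evaluates the normalizer; the base cell, with logit 0, supplies
  the 1 in \<open>log_norm\<close>.\<close>

lemma block_prior_eq:
  fixes t :: "('v, 'a) cell \<Rightarrow> real"
  assumes A: "A \<subseteq> V" and c: "\<And>r. r \<in> cl A \<Longrightarrow> c r = (\<Sum>D\<in>{D. D \<subseteq> supp z r \<and> D \<noteq> {}}. t (r |` D))"
  shows "block_prior I z A t = sqrt (\<Prod>r\<in>cl A. exp (c r) / (\<Sum>r'\<in>cl A. exp (c r')))"
proof -
  have finA: "finite A" by (rule finite_sub[OF A])
  have finD: "finite (cl D)" if "D \<subseteq> A" for D using finite_cells that A by blast
  have base: "base_cell z A \<in> cl A" by (rule base_cells[OF A])
  have Z: "0 < (\<Sum>r'\<in>cl A. exp (c r'))" by (rule sum_pos2[OF finite_cells[OF A] base]) auto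
  \<comment> \<open>The counting lemma sums over all subsets of the support; the empty one is
    neutralized here.\<close>
  define t0 where "t0 i = (if i = Map.empty then 0 else t i)" for i :: "('v, 'a) cell"
  have c': "c r = (\<Sum>D\<in>Pow (supp z r). t0 (r |` D))" if r: "r \<in> cl A" for r
  proof -
    have fin: "finite (supp z r)" by (rule finite_supp[OF A r])
    have "(\<Sum>D\<in>Pow (supp z r). t0 (r |` D)) = (\<Sum>D\<in>Pow (supp z r) - {{}}. t0 (r |` D))"
      by (rule sum_Pow_nonempty[OF fin]) (simp add: t0_def)
    also have "\<dots> = c r" unfolding c[OF r]
    proof (rule sum.cong)
      fix D assume "D \<in> {D. D \<subseteq> supp z r \<and> D \<noteq> {}}"
      then have "r |` D \<noteq> Map.empty" using star_nonempty[OF cells_star_restrict_supp[OF r]] by blast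
      then show "t0 (r |` D) = t (r |` D)" by (simp add: t0_def)
    qed auto
    finally show ?thesis ..
  qed
  have "(\<Sum>r\<in>cl A. c r) = (\<Sum>r\<in>cl A. \<Sum>D\<in>Pow (supp z r). t0 (r |` D))" by (rule sum.cong[OF refl c'])
  also have "\<dots> = (\<Sum>D\<in>Pow A. \<Sum>i\<in>cells_star I z D. t0 i * real (card (cl (A - D))))"
    by (rule sum_cells_supp[OF finA finD])
  also have "\<dots> = (\<Sum>D\<in>Pow A - {{}}. \<Sum>i\<in>cells_star I z D. t0 i * real (card (cl (A - D))))"
    by (rule sum_Pow_nonempty[OF finA]) (simp add: cells_star_empty t0_def)
  also have "\<dots> = (\<Sum>D\<in>Pow A - {{}}. \<Sum>i\<in>cells_star I z D. t i * real (card (cl (A - D))))"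
    by (intro sum.cong refl) (use star_nonempty in \<open>auto simp: t0_def\<close>)
  finally have sumc: "(\<Sum>r\<in>cl A. c r) = (\<Sum>D\<in>Pow A - {{}}. \<Sum>i\<in>cells_star I z D. t i * real (card (cl (A - D))))" .
  define e where "e D i = c (i ++ base_cell z (A - D))" for D and i :: "('v, 'a) cell"
  have e: "e D i = (\<Sum>F\<in>Pow D - {{}}. t (i |` F))" if D: "D \<in> Pow A" "i \<in> cells_star I z D" for D i
  proof -
    have DA: "D \<subseteq> A" using D(1) by simp
    note b = star_base_restrict[OF D(2) DA A]
    show ?thesis unfolding e_def c[OF b(1)] b(2)
      by (rule sum.cong) (use b(3) in auto)
  qed
  have "(\<Sum>r\<in>cl A. exp (c r)) = (\<Sum>D\<in>Pow A. \<Sum>i\<in>cells_star I z D. exp (e D i))"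
    unfolding e_def by (rule sum_cells_star[OF finA finD]) (use zI A in auto)
  also have "\<dots> = (\<Sum>i\<in>cells_star I z {}. exp (e {} i)) + (\<Sum>D\<in>Pow A - {{}}. \<Sum>i\<in>cells_star I z D. exp (e D i))"
    by (rule sum.remove) (simp_all add: finA)
  also have "(\<Sum>i\<in>cells_star I z {}. exp (e {} i)) = 1"
    using e[of "{}" Map.empty] by (simp add: cells_star_empty)
  also have "(\<Sum>D\<in>Pow A - {{}}. \<Sum>i\<in>cells_star I z D. exp (e D i)) =
      (\<Sum>D\<in>Pow A - {{}}. \<Sum>i\<in>cells_star I z D. exp (\<Sum>F\<in>Pow D - {{}}. t (i |` F)))"
    by (intro sum.cong refl arg_cong[where f = exp] e) auto
  finally have "ln (\<Sum>r\<in>cl A. exp (c r)) = log_norm I z A t" by (simp add: log_norm_def)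
  then show ?thesis
    unfolding sqrt_prod_exp_div[OF finite_cells[OF A] Z] sumc block_prior_def
    by (simp add: diff_divide_distrib sum_divide_distrib)
qed

lemma prod_Keys:
  "(\<Prod>k\<in>Keys. f k) = f (0, Map.empty) * (\<Prod>l\<in>{0<..<n}. \<Prod>s\<in>cl (S l). f (l, s))"
proof -
  have "(\<Prod>k\<in>Keys. f k) = (\<Prod>(l, s)\<in>Sigma {..<n} (\<lambda>l. cl (S l)). f (l, s))"
    by (simp add: Keys_def)
  also have "\<dots> = (\<Prod>l<n. \<Prod>s\<in>cl (S l). f (l, s))"
    by (rule prod.Sigma[symmetric]) (use finite_cells sub_V in auto)
  also have "{..<n} = insert 0 {0<..<n}" using n_pos by auto
  also have "(\<Prod>l\<in>insert 0 {0<..<n}. \<Prod>s\<in>cl (S l). f (l, s)) =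
      (\<Prod>s\<in>cl (S 0). f (0, s)) * (\<Prod>l\<in>{0<..<n}. \<Prod>s\<in>cl (S l). f (l, s))"
    by (rule prod.insert) auto
  finally show ?thesis unfolding cl_S_0 by simp
qed

lemma prior_cond_eq:
  "prior_cond I z Cs u = (\<Prod>k\<in>Keys. sqrt (\<Prod>r\<in>cl (Rd (fst k)). logit_kernel (cond_logit (\<lambda>k i. u (k, i))) (fst k) (snd k) r))"
proof -
  have "block_prior I z (Rd l) (\<lambda>i. u ((l, s), i)) = sqrt (\<Prod>r\<in>cl (Rd l). logit_kernel (cond_logit (\<lambda>k i. u (k, i))) l s r)"
    if l: "l < n" for l s
    unfolding logit_kernel_def by (rule block_prior_eq[OF sub_V(2)[OF l]]) (rule cond_logit_def)
  from this[OF n_pos] this show ?thesis unfolding prior_cond_def prod_Keys by simp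
qed

text \<open>A label meeting the residual is a pair of a label in the separator and a nonempty label in the residual.\<close>

lemma cliq_logit_split:
  assumes s: "s \<in> cl (S l)" and r: "r \<in> cl (Rd l)" and l: "l < n"
    and T: "\<And>x y. T x y = (if y = Map.empty then 0 else v l (x ++ y))"
  shows "cliq_logit v l s r = (\<Sum>F\<in>Pow (supp z s). \<Sum>D\<in>Pow (supp z r). T (s |` F) (r |` D))"
proof -
  have ds: "dom s = S l" and dr: "dom r = Rd l" using dom_cells s r by blast+
  have fin: "finite (supp z s)" "finite (supp z r)"
    using finite_supp[OF sub_V(1)[OF l] s] finite_supp[OF sub_V(2)[OF l] r] .
  have sub: "supp z s \<subseteq> S l" "supp z r \<subseteq> Rd l"
    using supp_subset[of z s] supp_subset[of z r] unfolding ds dr .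
  have supp: "supp z (s ++ r) = supp z s \<union> supp z r" by (rule supp_add) (use ds dr SR(2)[of l] in simp)
  have "(\<Sum>F\<in>Pow (supp z s). \<Sum>D\<in>Pow (supp z r). T (s |` F) (r |` D)) =
      (\<Sum>F\<in>Pow (supp z s). \<Sum>D\<in>Pow (supp z r) - {{}}. T (s |` F) (r |` D))"
    by (intro sum.cong refl sum_Pow_nonempty fin) (simp add: T)
  also have "\<dots> = (\<Sum>(F, D)\<in>Pow (supp z s) \<times> (Pow (supp z r) - {{}}). T (s |` F) (r |` D))"
    by (rule sum.cartesian_product)
  also have "\<dots> = cliq_logit v l s r" unfolding cliq_logit_def
  proof (rule sum.reindex_bij_witness[where i = "\<lambda>D. (D \<inter> S l, D \<inter> Rd l)" and j = "\<lambda>(F, D). F \<union> D"])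
    fix p assume "p \<in> Pow (supp z s) \<times> (Pow (supp z r) - {{}})"
    then obtain F D where p: "p = (F, D)" "F \<subseteq> supp z s" "D \<subseteq> supp z r" "D \<noteq> {}" by auto
    have FD: "F \<subseteq> S l" "D \<subseteq> Rd l" using p sub by blast+
    then have "(F \<union> D) \<inter> S l = F" "(F \<union> D) \<inter> Rd l = D" using SR(2)[of l] by blast+
    then show "((case p of (F, D) \<Rightarrow> F \<union> D) \<inter> S l, (case p of (F, D) \<Rightarrow> F \<union> D) \<inter> Rd l) = p"
      by (simp add: p(1))
    show "(case p of (F, D) \<Rightarrow> F \<union> D) \<in> {D. D \<subseteq> supp z (s ++ r) \<and> D \<inter> Rd l \<noteq> {}}"
      unfolding supp p(1) using p(2-4) FD(2) by auto
    have "(s ++ r) |` (F \<union> D) = s |` F ++ r |` D"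
    proof
      fix \<gamma>
      have "\<gamma> \<in> D \<Longrightarrow> \<gamma> \<in> dom r" "\<gamma> \<in> F \<Longrightarrow> \<gamma> \<notin> dom r" using FD dr SR(2)[of l] by blast+
      then show "((s ++ r) |` (F \<union> D)) \<gamma> = (s |` F ++ r |` D) \<gamma>"
        by (cases "\<gamma> \<in> D"; cases "\<gamma> \<in> F") (auto simp: restrict_map_def map_add_def domIff split: option.splits)
    qed
    moreover have "r |` D \<noteq> Map.empty" by (rule star_nonempty[OF cells_star_restrict_supp[OF r p(3)] p(4)])
    ultimately show "v l ((s ++ r) |` (case p of (F, D) \<Rightarrow> F \<union> D)) = (case p of (F, D) \<Rightarrow> T (s |` F) (r |` D))"
      by (simp add: p(1) T)
  next
    fix D assume "D \<in> {D. D \<subseteq> supp z (s ++ r) \<and> D \<inter> Rd l \<noteq> {}}"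
    then have D: "D \<subseteq> supp z s \<union> supp z r" "D \<inter> Rd l \<noteq> {}" unfolding supp by auto
    show "(case (D \<inter> S l, D \<inter> Rd l) of (F, D) \<Rightarrow> F \<union> D) = D" using D(1) sub by auto
    have "D \<inter> S l \<subseteq> supp z s" "D \<inter> Rd l \<subseteq> supp z r" using D(1) sub SR(2)[of l] by blast+
    then show "(D \<inter> S l, D \<inter> Rd l) \<in> Pow (supp z s) \<times> (Pow (supp z r) - {{}})" using D(2) by simp
  qed
  finally show ?thesis ..
qed

text \<open>k_l(j_H) is the log normalizer of the conditional table whose separator cell is
  \<open>j\<close> completed by base levels: only subsets of the domain of \<open>j\<close> lie in
  the support of that cell.\<close>

lemma log_norm_cliq_eq:
  assumes l: "l < n" and j: "j \<in> cells_star I z H'" "H' \<subseteq> S l"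
  shows "log_partition (cliq_logit v) l (j ++ base_cell z (S l - H')) = log_norm_cliq I z (Rd l) (v l) j"
proof -
  define T where "T x y = (if y = Map.empty then 0 else v l (x ++ y))" for x y :: "('v, 'a) cell"
  let ?s = "j ++ base_cell z (S l - H')"
  have sub: "S l \<subseteq> V" "Rd l \<subseteq> V" using sub_V l by blast+
  note s = star_base_restrict[OF j(1,2) sub(1)]
  have finR: "finite (Rd l)" by (rule finite_sub[OF sub(2)])
  define e where "e D i = cliq_logit v l ?s (i ++ base_cell z (Rd l - D))" for D and i :: "('v, 'a) cell"
  have e: "e D i = (\<Sum>K\<in>Pow (dom j). \<Sum>M\<in>Pow D - {{}}. v l ((j |` K) ++ (i |` M)))"
    if D: "D \<in> Pow (Rd l)" "i \<in> cells_star I z D" for D i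
  proof -
    have DR: "D \<subseteq> Rd l" using D(1) by simp
    have finD: "finite D" by (rule finite_subset[OF DR finR])
    note r = star_base_restrict[OF D(2) DR sub(2)]
    have "e D i = (\<Sum>K\<in>Pow H'. \<Sum>M\<in>Pow D. T (?s |` K) ((i ++ base_cell z (Rd l - D)) |` M))"
      unfolding e_def cliq_logit_split[where T = T and v = v, OF s(1) r(1) l T_def] s(2) r(2) ..
    also have "\<dots> = (\<Sum>K\<in>Pow H'. \<Sum>M\<in>Pow D - {{}}. v l ((j |` K) ++ (i |` M)))"
    proof (rule sum.cong[OF refl])
      fix K assume K: "K \<in> Pow H'"
      have "(\<Sum>M\<in>Pow D. T (?s |` K) ((i ++ base_cell z (Rd l - D)) |` M)) =
          (\<Sum>M\<in>Pow D - {{}}. T (?s |` K) ((i ++ base_cell z (Rd l - D)) |` M))"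
        by (rule sum_Pow_nonempty[OF finD]) (simp add: T_def)
      also have "\<dots> = (\<Sum>M\<in>Pow D - {{}}. v l ((j |` K) ++ (i |` M)))"
      proof (rule sum.cong[OF refl])
        fix M assume "M \<in> Pow D - {{}}"
        then have M: "M \<subseteq> D" "M \<noteq> {}" by auto
        have "i |` M \<noteq> Map.empty" by (rule star_nonempty[OF cells_star_restrict[OF D(2) M(1)] M(2)])
        then show "T (?s |` K) ((i ++ base_cell z (Rd l - D)) |` M) = v l ((j |` K) ++ (i |` M))"
          using s(3)[of K] r(3)[OF M(1)] K by (simp add: T_def)
      qed
      finally show "(\<Sum>M\<in>Pow D. T (?s |` K) ((i ++ base_cell z (Rd l - D)) |` M)) =
          (\<Sum>M\<in>Pow D - {{}}. v l ((j |` K) ++ (i |` M)))" .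
    qed
    finally show ?thesis unfolding star_dom[OF j(1)] .
  qed
  have "(\<Sum>r\<in>cl (Rd l). exp (cliq_logit v l ?s r)) = (\<Sum>D\<in>Pow (Rd l). \<Sum>i\<in>cells_star I z D. exp (e D i))"
    unfolding e_def by (rule sum_cells_star[OF finR]) (use zI sub finite_cells in auto)
  also have "\<dots> = (\<Sum>i\<in>cells_star I z {}. exp (e {} i)) + (\<Sum>D\<in>Pow (Rd l) - {{}}. \<Sum>i\<in>cells_star I z D. exp (e D i))"
    by (rule sum.remove) (simp_all add: finR)
  also have "(\<Sum>i\<in>cells_star I z {}. exp (e {} i)) = 1"
    using e[of "{}" Map.empty] by (simp add: cells_star_empty)
  also have "(\<Sum>D\<in>Pow (Rd l) - {{}}. \<Sum>i\<in>cells_star I z D. exp (e D i)) =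
      (\<Sum>D\<in>Pow (Rd l) - {{}}. \<Sum>i\<in>cells_star I z D. exp (\<Sum>K\<in>Pow (dom j). \<Sum>M\<in>Pow D - {{}}. v l ((j |` K) ++ (i |` M))))"
    by (intro sum.cong refl arg_cong[where f = exp] e) auto
  finally show ?thesis unfolding log_partition_def log_norm_cliq_def by simp
qed

text \<open>The double counting is applied once on the residual and once on the separator, which
  accounts for the product of two cardinalities in the coefficient.\<close>

lemma sum_cliq_logit:
  assumes l: "l < n"
  shows "(\<Sum>s\<in>cl (S l). \<Sum>r\<in>cl (Rd l). cliq_logit v l s r) =
    (\<Sum>F\<in>Pow (S l). \<Sum>iF\<in>cells_star I z F. \<Sum>D\<in>Pow (Rd l) - {{}}. \<Sum>iD\<in>cells_star I z D.
       v l (iF ++ iD) * (real (card (cl (S l - F))) * real (card (cl (Rd l - D)))))"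
proof -
  define T where "T x y = (if y = Map.empty then 0 else v l (x ++ y))" for x y :: "('v, 'a) cell"
  have sub: "S l \<subseteq> V" "Rd l \<subseteq> V" using sub_V l by blast+
  have fin: "finite (S l)" "finite (Rd l)" using finite_sub sub by blast+
  have finD: "finite (cl D)" if "D \<subseteq> S l \<or> D \<subseteq> Rd l" for D using finite_cells that sub by blast
  define G where "G x = (\<Sum>D\<in>Pow (Rd l). \<Sum>iD\<in>cells_star I z D. T x iD * real (card (cl (Rd l - D))))" for x
  have G: "G x = (\<Sum>D\<in>Pow (Rd l) - {{}}. \<Sum>iD\<in>cells_star I z D. v l (x ++ iD) * real (card (cl (Rd l - D))))" for x
  proof -
    have "G x = (\<Sum>D\<in>Pow (Rd l) - {{}}. \<Sum>iD\<in>cells_star I z D. T x iD * real (card (cl (Rd l - D))))"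
      unfolding G_def by (rule sum_Pow_nonempty[OF fin(2)]) (simp add: cells_star_empty T_def)
    also have "\<dots> = (\<Sum>D\<in>Pow (Rd l) - {{}}. \<Sum>iD\<in>cells_star I z D. v l (x ++ iD) * real (card (cl (Rd l - D))))"
      by (intro sum.cong refl) (use star_nonempty in \<open>auto simp: T_def\<close>)
    finally show ?thesis .
  qed
  have "(\<Sum>s\<in>cl (S l). \<Sum>r\<in>cl (Rd l). cliq_logit v l s r) = (\<Sum>s\<in>cl (S l). \<Sum>F\<in>Pow (supp z s). G (s |` F))"
  proof (rule sum.cong[OF refl])
    fix s assume s: "s \<in> cl (S l)"
    have "(\<Sum>r\<in>cl (Rd l). cliq_logit v l s r) =
        (\<Sum>r\<in>cl (Rd l). \<Sum>F\<in>Pow (supp z s). \<Sum>D\<in>Pow (supp z r). T (s |` F) (r |` D))"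
      by (rule sum.cong[OF refl]) (rule cliq_logit_split[where T = T and v = v, OF s _ l T_def])
    also have "\<dots> = (\<Sum>F\<in>Pow (supp z s). \<Sum>r\<in>cl (Rd l). \<Sum>D\<in>Pow (supp z r). T (s |` F) (r |` D))"
      by (rule sum.swap)
    also have "\<dots> = (\<Sum>F\<in>Pow (supp z s). G (s |` F))"
      unfolding G_def by (intro sum.cong refl sum_cells_supp fin finD) simp
    finally show "(\<Sum>r\<in>cl (Rd l). cliq_logit v l s r) = (\<Sum>F\<in>Pow (supp z s). G (s |` F))" .
  qed
  also have "\<dots> = (\<Sum>F\<in>Pow (S l). \<Sum>iF\<in>cells_star I z F. G iF * real (card (cl (S l - F))))"
    by (rule sum_cells_supp[OF fin(1)]) (simp add: finD)
  finally show ?thesis unfolding G sum_distrib_right by (simp only: mult.assoc mult.commute[of "real (card (cl (S l - _)))"])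
qed

text \<open>The log normalizer is a function on the separator cells. Expanding it into interactions
  and counting cells produces the alternating sums over H \<subseteq> F of the explicit
  density.\<close>

lemma sum_log_partition_cliq_logit:
  assumes l: "l < n"
  shows "(\<Sum>s\<in>cl (S l). log_partition (cliq_logit v) l s) =
    (\<Sum>F\<in>Pow (S l). \<Sum>jF\<in>cells_star I z F. real (card (cl (S l - F))) *
       (\<Sum>H'\<in>Pow F. (-1) ^ card (F - H') * log_norm_cliq I z (Rd l) (v l) (jF |` H')))"
proof -
  have sub: "S l \<subseteq> V" using sub_V l by blast
  have fin: "finite (S l)" by (rule finite_sub[OF sub])
  have "(\<Sum>s\<in>cl (S l). log_partition (cliq_logit v) l s) = (\<Sum>s\<in>cl (S l). \<Sum>F\<in>Pow (supp z s). Mob z (S l) (log_partition (cliq_logit v) l) (s |` F))"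
    by (rule sum.cong[OF refl]) (rule Mob_inversion[OF _ fin, symmetric])
  also have "\<dots> = (\<Sum>F\<in>Pow (S l). \<Sum>jF\<in>cells_star I z F. Mob z (S l) (log_partition (cliq_logit v) l) jF * real (card (cl (S l - F))))"
    by (rule sum_cells_supp[OF fin]) (use finite_cells sub in blast)
  also have "\<dots> = (\<Sum>F\<in>Pow (S l). \<Sum>jF\<in>cells_star I z F. real (card (cl (S l - F))) *
       (\<Sum>H'\<in>Pow F. (-1) ^ card (F - H') * log_norm_cliq I z (Rd l) (v l) (jF |` H')))"
  proof (intro sum.cong refl)
    fix F jF assume F: "F \<in> Pow (S l)" and j: "jF \<in> cells_star I z F"
    have "Mob z (S l) (log_partition (cliq_logit v) l) jF =
        (\<Sum>H'\<in>Pow F. (-1) ^ card (F - H') * log_norm_cliq I z (Rd l) (v l) (jF |` H'))"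
      unfolding Mob_def star_dom[OF j]
    proof (rule sum.cong[OF refl])
      fix H' assume "H' \<in> Pow F"
      then have H: "H' \<subseteq> F" "H' \<subseteq> S l" using F by auto
      show "(-1) ^ card (F - H') * log_partition (cliq_logit v) l (jF |` H' ++ base_cell z (S l - H')) =
          (-1) ^ card (F - H') * log_norm_cliq I z (Rd l) (v l) (jF |` H')"
        unfolding log_norm_cliq_eq[OF l cells_star_restrict[OF j H(1)] H(2)] ..
    qed
    then show "Mob z (S l) (log_partition (cliq_logit v) l) jF * real (card (cl (S l - F))) = real (card (cl (S l - F))) *
        (\<Sum>H'\<in>Pow F. (-1) ^ card (F - H') * log_norm_cliq I z (Rd l) (v l) (jF |` H'))" by simp
  qed
  finally show ?thesis .
qed

lemma prior_cliq_eq: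
  "prior_cliq I z Cs u = (\<Prod>k\<in>Keys. sqrt (\<Prod>r\<in>cl (Rd (fst k)). logit_kernel (cliq_logit (\<lambda>l i. u (l, i))) (fst k) (snd k) r))"
proof -
  define v where "v l i = u (l, i)" for l i
  have v: "v l = (\<lambda>i. u (l, i))" for l by (rule ext) (simp add: v_def)
  have first: "block_prior I z (Cs ! 0) (v 0) = sqrt (\<Prod>r\<in>cl (Rd 0). logit_kernel (cliq_logit v) 0 Map.empty r)"
    unfolding logit_kernel_def R_0
  proof (rule block_prior_eq[OF C_sub[OF n_pos]])
    fix r assume r: "r \<in> cl (Cs ! 0)"
    have "supp z r \<subseteq> Cs ! 0" using supp_subset[of z r] dom_cells[OF r] by simp
    \<comment> \<open>The residual of the first clique is the whole clique, so for subsets of the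
      support meeting it just means being nonempty.\<close>
    then have "{D. D \<subseteq> supp z r \<and> D \<inter> Cs ! 0 \<noteq> {}} = {D. D \<subseteq> supp z r \<and> D \<noteq> {}}" by blast
    then show "cliq_logit v 0 Map.empty r = (\<Sum>D\<in>{D. D \<subseteq> supp z r \<and> D \<noteq> {}}. v 0 (r |` D))"
      unfolding cliq_logit_def R_0 by simp
  qed
  have later: "exp ((\<Sum>F\<in>Pow (S l). \<Sum>iF\<in>cells_star I z F. \<Sum>D\<in>Pow (Rd l) - {{}}. \<Sum>iD\<in>cells_star I z D.
                v l (iF ++ iD) * (real (card (cl (S l - F))) * real (card (cl (Rd l - D))) / 2))
             - (\<Sum>F\<in>Pow (S l). \<Sum>jF\<in>cells_star I z F.
                  real (card (cl (S l - F))) * real (card (cl (Rd l))) / 2 *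
                  (\<Sum>H'\<in>Pow F. (-1) ^ card (F - H') * log_norm_cliq I z (Rd l) (v l) (jF |` H')))) =
      (\<Prod>s\<in>cl (S l). sqrt (\<Prod>r\<in>cl (Rd l). logit_kernel (cliq_logit v) l s r))" (is "exp (?A - ?B) = _") if l: "l < n" for l
  proof -
    have sub: "S l \<subseteq> V" "Rd l \<subseteq> V" using sub_V l by blast+
    let ?N = "real (card (cl (Rd l)))"
    have A: "?A = (\<Sum>s\<in>cl (S l). \<Sum>r\<in>cl (Rd l). cliq_logit v l s r) / 2"
      unfolding sum_cliq_logit[OF l] sum_divide_distrib by (intro sum.cong refl) simp
    have B: "?B = (\<Sum>s\<in>cl (S l). log_partition (cliq_logit v) l s) * (?N / 2)"
      unfolding sum_log_partition_cliq_logit[OF l] sum_distrib_right by (intro sum.cong refl) (simp only: times_divide_eq_right times_divide_eq_left mult_ac)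
    have "(\<Prod>s\<in>cl (S l). sqrt (\<Prod>r\<in>cl (Rd l). logit_kernel (cliq_logit v) l s r)) =
        (\<Prod>s\<in>cl (S l). exp (((\<Sum>r\<in>cl (Rd l). cliq_logit v l s r) - ?N * log_partition (cliq_logit v) l s) / 2))"
      unfolding logit_kernel_def log_partition_def sqrt_prod_exp_div[OF finite_cells[OF sub(2)] logit_kernel_denominator[OF l]] ..
    also have "\<dots> = exp (\<Sum>s\<in>cl (S l). ((\<Sum>r\<in>cl (Rd l). cliq_logit v l s r) - ?N * log_partition (cliq_logit v) l s) / 2)"
      by (rule exp_sum[OF finite_cells[OF sub(1)], symmetric])
    also have "(\<Sum>s\<in>cl (S l). ((\<Sum>r\<in>cl (Rd l). cliq_logit v l s r) - ?N * log_partition (cliq_logit v) l s) / 2) =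
        (\<Sum>s\<in>cl (S l). \<Sum>r\<in>cl (Rd l). cliq_logit v l s r) / 2 - (\<Sum>s\<in>cl (S l). log_partition (cliq_logit v) l s) * (?N / 2)"
      unfolding sum_divide_distrib[symmetric] sum_subtractf sum_distrib_left[symmetric] diff_divide_distrib by simp
    finally show ?thesis unfolding A B ..
  qed
  show ?thesis
    unfolding prior_cliq_def prod_Keys Let_def v[symmetric] fst_conv snd_conv v_def[symmetric] first
    by (intro arg_cong2[where f = times] refl prod.cong later) simp
qed

text \<open>Evaluates the density of theta^cliq at the parameter of a given table. This makes it
  available for theta^mod, where theta^cliq is reached through the table.\<close>

lemma prior_cliq_theta:
  assumes q: "cond_kernel q"
  shows "prior_cliq I z Cs (theta_cliq V I z Cs (restrict (kernel_product q) (cl V))) = prior_prob V I Cs (restrict (kernel_product q) (cl V))"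
proof -
  let ?q = "logit_kernel (cliq_logit (\<lambda>l i. theta_cliq V I z Cs (restrict (kernel_product q) (cl V)) (l, i)))"
  have "restrict (kernel_product q) (cl V) = restrict (kernel_product ?q) (cl V)"
    by (intro restrict_ext kernel_product_eq_cliq_logit[OF q theta_cliq_label[OF q]]) simp_all
  then have "prior_prob V I Cs (restrict (kernel_product q) (cl V)) = prior_prob V I Cs (restrict (kernel_product ?q) (cl V))" by simp
  then show ?thesis unfolding prior_prob_kernel_product[OF cond_kernel_logit_kernel] prior_cliq_eq by simp
qed

section \<open>The reference priors in explicit form\<close>

theorem reference_prior_cond_explicit:
  assumes "N \<ge> 1" "ordered_grouping (cond_groups I Cs) (cond_group I z Cs) bs gs"
  shows "reference_prior_proportional_to (counts (cl V) N) (multinomial_model V E I N (theta_cond V I z Cs)) gs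
     (prior_cond I z Cs)"
proof (rule reference_prior_proportional_to_cong[where c = 1, OF reference_prior_cond[OF assms]])
  fix u assume u: "u \<in> parameter_space gs"
  have "u \<in> extensional (\<Union>k\<in>Keys. Pair k ` residual_labels (fst k))"
    using u cond_labels[OF assms(2)] by (simp add: parameter_space_def PiE_def del: set_concat)
  from prob_of_cond[OF this]
  show "prior_prob V I Cs (prob_of V E I (theta_cond V I z Cs) u) = 1 * prior_cond I z Cs u"
    by (simp add: prior_prob_kernel_product[OF cond_kernel_logit_kernel] prior_cond_eq)
qed simp

theorem reference_prior_cliq_explicit:
  assumes "N \<ge> 1" "ordered_grouping {..<n} (cliq_group I z Cs) bs gs"
  shows "reference_prior_proportional_to (counts (cl V) N) (multinomial_model V E I N (theta_cliq V I z Cs)) gs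
     (prior_cliq I z Cs)"
proof (rule reference_prior_proportional_to_cong[where c = 1, OF reference_prior_cliq[OF assms]])
  fix u assume u: "u \<in> parameter_space gs"
  have "u \<in> extensional (\<Union>l<n. Pair l ` clique_labels l)"
    using u cliq_labels[OF assms(2)] by (simp add: parameter_space_def PiE_def del: set_concat)
  from prob_of_cliq[OF this]
  show "prior_prob V I Cs (prob_of V E I (theta_cliq V I z Cs) u) = 1 * prior_cliq I z Cs u"
    by (simp add: prior_prob_kernel_product[OF cond_kernel_logit_kernel] prior_cliq_eq)
qed simp

theorem reference_prior_mod_explicit:
  assumes "N \<ge> 1" "ordered_grouping {..<n} (mod_group I z Cs) bs gs" "compatible_order Cs bs"
  shows "reference_prior_proportional_to (counts (cl V) N) (multinomial_model V E I N (theta_mod V E I z)) gs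
     (\<lambda>u. prior_cliq I z Cs (theta_cliq V I z Cs (prob_of V E I (theta_mod V E I z) u)))"
proof (rule reference_prior_proportional_to_cong[where c = 1, OF reference_prior_mod[OF assms]])
  fix u assume u: "u \<in> parameter_space gs"
  have "u \<in> extensional mod_label_set"
    using u mod_labels[OF assms(2)] by (simp add: parameter_space_def PiE_def del: set_concat)
  from prob_of_mod[OF this]
  show "prior_prob V I Cs (prob_of V E I (theta_mod V E I z) u) =
      1 * prior_cliq I z Cs (theta_cliq V I z Cs (prob_of V E I (theta_mod V E I z) u))"
    by (simp add: prior_cliq_theta[OF cond_kernel_logit_kernel])
qed simp

end

theorem theorem3p1:
  fixes V :: "'v set" and E :: "'v set set" and I :: "'v \<Rightarrow> 'a set" and z :: "'v \<Rightarrow> 'a"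
    and Cs :: "'v set list" and N :: nat
  assumes "finite V" and "V \<noteq> {}"
    and "\<And>\<gamma>. \<gamma> \<in> V \<Longrightarrow> finite (I \<gamma>)" and "\<And>\<gamma>. \<gamma> \<in> V \<Longrightarrow> z \<gamma> \<in> I \<gamma>"
    and "simple_graph V E" and "decomposable V E" and "perfect_clique_order V E Cs"
    and "N \<ge> 1"
  shows
    "(\<forall>bs gs. ordered_grouping (cond_groups I Cs) (cond_group I z Cs) bs gs \<longrightarrow>
        reference_prior_proportional_to (counts (cells I V) N)
          (multinomial_model V E I N (theta_cond V I z Cs)) gs
          (\<lambda>\<theta>. prior_prob V I Cs (prob_of V E I (theta_cond V I z Cs) \<theta>)) \<and>
        reference_prior_proportional_to (counts (cells I V) N)
          (multinomial_model V E I N (theta_cond V I z Cs)) gs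
          (prior_cond I z Cs)) \<and>
     (\<forall>bs gs. ordered_grouping {..<length Cs} (cliq_group I z Cs) bs gs \<longrightarrow>
        reference_prior_proportional_to (counts (cells I V) N)
          (multinomial_model V E I N (theta_cliq V I z Cs)) gs
          (\<lambda>\<theta>. prior_prob V I Cs (prob_of V E I (theta_cliq V I z Cs) \<theta>)) \<and>
        reference_prior_proportional_to (counts (cells I V) N)
          (multinomial_model V E I N (theta_cliq V I z Cs)) gs
          (prior_cliq I z Cs)) \<and>
     (\<forall>bs gs. ordered_grouping {..<length Cs} (mod_group I z Cs) bs gs \<and>
              compatible_order Cs bs \<longrightarrow>
        reference_prior_proportional_to (counts (cells I V) N)
          (multinomial_model V E I N (theta_mod V E I z)) gs
          (\<lambda>\<theta>. prior_prob V I Cs (prob_of V E I (theta_mod V E I z) \<theta>)) \<and>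
        reference_prior_proportional_to (counts (cells I V) N)
          (multinomial_model V E I N (theta_mod V E I z)) gs
          (\<lambda>\<theta>. prior_cliq I z Cs (theta_cliq V I z Cs (prob_of V E I (theta_mod V E I z) \<theta>))))"
proof -
  interpret clique_model V E I z Cs
    using assms(1,3,4,5,7) by unfold_locales
  show ?thesis
    using reference_prior_cond[OF assms(8)] reference_prior_cond_explicit[OF assms(8)]
      reference_prior_cliq[OF assms(8)] reference_prior_cliq_explicit[OF assms(8)]
      reference_prior_mod[OF assms(8)] reference_prior_mod_explicit[OF assms(8)]
    by blast
qed

end
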